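(* Let $Z$ be a continuous-time $(\mathcal F_t)$-Markov chain on the discrete space $\mathbb E\subset\mathbb R^d$ (in the sense fixed in the context), let $\sigma_1,\sigma_2:\mathbb E\to\mathbb R$ satisfy $(|\sigma_1|+|\sigma_2|)(z)>0$ for all $z\in\mathbb E$, and assume $$\mathsf E\int_0^t\sigma_i^2(Z_s)\,\mathrm ds<\infty\qquad\text{for all } t>0,\ i=1,2.$$ Let $\phi:\mathbb R\to\mathbb R$ be a convex function for which there are constants $a,b>0$ and $p\ge 2$ with $|\phi(x)|\le a|x|^p+b$ for all $x\in\mathbb R$. Let $T>0$ and assume that, for this $p$ and this $T$, $$\bigl(P_T(|\sigma_1|^p+|\sigma_2|^p)\bigr)(z)<\infty\qquad\text{for all } z\in\mathbb E,$$ where $P$ is the semigroup of $Z$. Let $x,y\in\mathbb R$ and, for every $V\in\mathcal V$, set $$X_t=x+\int_0^t\sigma_1(Z_s)\,\mathrm dB_s,\qquad Y_t(V)=y+\int_0^t\sigma_2(Z_s)\,\mathrm dV_s,\qquad t\ge0.$$ Define $V^I,V^{II}\in\mathcal V$ by $$V^I_t=\int_0^t\operatorname{sgn}(\sigma_1(Z_s)\sigma_2(Z_s))\,\mathrm dB_s,\qquad V^{II}_t=-V^I_t.$$ Then, for every $V\in\mathcal V$, $$\mathsf E\left[\phi(X_T-Y_T(V^{I}))\right]\le\mathsf E\left[\phi(X_T-Y_T(V))\right]\le\mathsf E\left[\phi(X_T-Y_T(V^{II}))\right].$$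
   Context: $(\Omega,(\mathcal F_t)_{t\ge0},\mathcal F,\mathsf P)$ is a filtered probability space supporting a standard $(\mathcal F_t)$-Brownian motion $B$; $\mathcal V$ is the set of all $(\mathcal F_t)$-Brownian motions $V=(V_t)_{t\ge0}$ on this space with $V_0=0$. $Z=(Z_t)_{t\ge0}$ is a non-explosive, irreducible, càdlàg $(\mathcal F_t)$-Feller process (i.e. a Feller process on this probability space that is Markov with respect to the filtration $(\mathcal F_t)$) on a discrete (hence countable) space $\mathbb E\subset\mathbb R^d$, $d\in\mathbb N$; such a process is called a continuous-time $(\mathcal F_t)$-Markov chain. For each starting point $Z$ is a semimartingale. $P=(P_t)_{t\ge0}$ is the semigroup of $Z$: $(P_tf)(z)=\mathsf E_z[f(Z_t)]$, where $\mathsf P_z,\mathsf E_z$ refer to $Z$ started at $z\in\mathbb E$. $\mathsf P,\mathsf E$ without subscript refer to an arbitrary starting point $z$ of $Z$. $\operatorname{sgn}(x)=1$ if $x>0$, $\operatorname{sgn}(x)=-1$ if $x<0$, and $\operatorname{sgn}(0)\in\{1,-1\}$ is an arbitrary fixed choice. No restriction is placed on $(\mathcal F_t)$; it need not be generated by $B$ and $Z$. *)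

theory Defs
  imports "HOL-Probability.Probability"
begin

text \<open>Processes are functions of a real time and a sample point. Only times \<open>t \<ge> 0\<close> matter:
  values of a process or of a filtration at negative times are never constrained.\<close>

type_synonym ('w, 'b) process = "real \<Rightarrow> 'w \<Rightarrow> 'b"


section \<open>Filtered probability spaces and adapted processes\<close>

text \<open>Neither completeness nor right-continuity of the filtration is assumed.\<close>

definition filtered_prob_space :: "'w measure \<Rightarrow> (real \<Rightarrow> 'w measure) \<Rightarrow> bool" where
  "filtered_prob_space M F \<longleftrightarrow>
     prob_space M \<and> (\<forall>t\<ge>0. subalgebra M (F t)) \<and>
     (\<forall>s t. 0 \<le> s \<longrightarrow> s \<le> t \<longrightarrow> sets (F s) \<subseteq> sets (F t))"

definition adapted :: "(real \<Rightarrow> 'w measure) \<Rightarrow> ('w, 'b::topological_space) process \<Rightarrow> bool" where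
  "adapted F X \<longleftrightarrow> (\<forall>t\<ge>0. X t \<in> borel_measurable (F t))"

definition progressive :: "(real \<Rightarrow> 'w measure) \<Rightarrow> ('w, 'b::topological_space) process \<Rightarrow> bool" where
  "progressive F H \<longleftrightarrow>
     (\<forall>t\<ge>0. (\<lambda>(s, w). H s w) \<in> borel_measurable (restrict_space borel {0..t} \<Otimes>\<^sub>M F t))"

text \<open>Right-continuous with left limits as a function from \<open>[0,\<infinity>)\<close> to the space \<open>E\<close>; in particular
  the left limits lie in \<open>E\<close>.\<close>

definition cadlag_in :: "'b::topological_space set \<Rightarrow> (real \<Rightarrow> 'b) \<Rightarrow> bool" where
  "cadlag_in E f \<longleftrightarrow>
     (\<forall>t\<ge>0. f t \<in> E \<and> (f \<longlongrightarrow> f t) (at_right t)) \<and>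
     (\<forall>t>0. \<exists>l\<in>E. (f \<longlongrightarrow> l) (at_left t))"


section \<open>Brownian motion and the Ito integral\<close>

text \<open>Since the filtration need not be complete, path continuity is only required almost surely.\<close>

definition brownian_motion :: "'w measure \<Rightarrow> (real \<Rightarrow> 'w measure) \<Rightarrow> ('w, real) process \<Rightarrow> bool" where
  "brownian_motion M F W \<longleftrightarrow>
     adapted F W \<and>
     (AE w in M. W 0 w = 0) \<and>
     (AE w in M. continuous_on {0..} (\<lambda>t. W t w)) \<and>
     (\<forall>s t. 0 \<le> s \<longrightarrow> s < t \<longrightarrow>
        distributed M lborel (\<lambda>w. W t w - W s w) (normal_density 0 (sqrt (t - s))) \<and>
        prob_space.indep_set M (sets (F s))
          {(\<lambda>w. W t w - W s w) -` A \<inter> space M | A. A \<in> sets borel})"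

definition brownian_motions :: "'w measure \<Rightarrow> (real \<Rightarrow> 'w measure) \<Rightarrow> ('w, real) process set" where
  "brownian_motions M F = {V. brownian_motion M F V}"

text \<open>A triple \<open>(n, u, \<xi>)\<close> encodes the simple predictable process
  \<open>\<Sum>i<n. \<xi>\<^sub>i 1\<^bsub>(u\<^sub>i, u\<^sub>i\<^sub>+\<^sub>1]\<^esub>\<close> with bounded, \<open>F (u i)\<close>-measurable coefficients.\<close>

definition simple_data ::
  "'w measure \<Rightarrow> (real \<Rightarrow> 'w measure) \<Rightarrow> nat \<Rightarrow> (nat \<Rightarrow> real) \<Rightarrow> (nat \<Rightarrow> 'w \<Rightarrow> real) \<Rightarrow> bool" where
  "simple_data M F n u \<xi> \<longleftrightarrow>
     0 \<le> u 0 \<and> (\<forall>i<n. u i \<le> u (Suc i)) \<and>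
     (\<forall>i<n. \<xi> i \<in> borel_measurable (F (u i)) \<and> (\<exists>C. \<forall>w\<in>space M. \<bar>\<xi> i w\<bar> \<le> C))"

definition simple_process ::
  "nat \<Rightarrow> (nat \<Rightarrow> real) \<Rightarrow> (nat \<Rightarrow> 'w \<Rightarrow> real) \<Rightarrow> ('w, real) process" where
  "simple_process n u \<xi> s w = (\<Sum>i<n. \<xi> i w * indicator {u i<..u (Suc i)} s)"

definition simple_integral ::
  "('w, real) process \<Rightarrow> nat \<Rightarrow> (nat \<Rightarrow> real) \<Rightarrow> (nat \<Rightarrow> 'w \<Rightarrow> real) \<Rightarrow> ('w, real) process" where
  "simple_integral W n u \<xi> t w = (\<Sum>i<n. \<xi> i w * (W (min t (u (Suc i))) w - W (min t (u i)) w))"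

definition mean_int_square :: "'w measure \<Rightarrow> ('w, real) process \<Rightarrow> real \<Rightarrow> ennreal" where
  "mean_int_square M H t = (\<integral>\<^sup>+w. (\<integral>\<^sup>+s\<in>{0..t}. ennreal ((H s w)\<^sup>2) \<partial>lborel) \<partial>M)"

text \<open>\<open>is_ito_integral M F W H I\<close>: the process \<open>I\<close> is a version of \<open>(\<integral>\<^sub>0\<^sup>t H\<^sub>s dW\<^sub>s)\<^sub>t\<^sub>\<ge>\<^sub>0\<close>, the
  \<open>L\<^sup>2\<close>-limit of integrals of simple processes. Stochastic integrals are determined only up to
  indistinguishability, hence a relation rather than a function.\<close>

definition is_ito_integral ::
  "'w measure \<Rightarrow> (real \<Rightarrow> 'w measure) \<Rightarrow> ('w, real) process \<Rightarrow> ('w, real) process \<Rightarrow>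
   ('w, real) process \<Rightarrow> bool" where
  "is_ito_integral M F W H I \<longleftrightarrow>
     progressive F H \<and> (\<forall>t\<ge>0. mean_int_square M H t < \<infinity>) \<and>
     adapted F I \<and> (AE w in M. continuous_on {0..} (\<lambda>t. I t w)) \<and>
     (\<exists>n u \<xi>. (\<forall>k. simple_data M F (n k) (u k) (\<xi> k)) \<and>
        (\<forall>t\<ge>0. (\<lambda>k. mean_int_square M
                   (\<lambda>s w. simple_process (n k) (u k) (\<xi> k) s w - H s w) t) \<longlonglongrightarrow> 0) \<and>
        (\<forall>t\<ge>0. (\<lambda>k. \<integral>\<^sup>+w. ennreal ((simple_integral W (n k) (u k) (\<xi> k) t w - I t w)\<^sup>2) \<partial>M)
                  \<longlonglongrightarrow> 0))"


section \<open>Semimartingales\<close>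

definition martingale :: "'w measure \<Rightarrow> (real \<Rightarrow> 'w measure) \<Rightarrow> ('w, real) process \<Rightarrow> bool" where
  "martingale M F N \<longleftrightarrow>
     adapted F N \<and> (\<forall>t\<ge>0. integrable M (N t)) \<and>
     (\<forall>s t. 0 \<le> s \<longrightarrow> s \<le> t \<longrightarrow> (AE w in M. real_cond_exp M (F s) (N t) w = N s w))"

text \<open>The localizing times are real-valued, which is no loss: replace the \<open>k\<close>-th one by its minimum
  with \<open>k\<close>.\<close>

definition local_martingale :: "'w measure \<Rightarrow> (real \<Rightarrow> 'w measure) \<Rightarrow> ('w, real) process \<Rightarrow> bool" where
  "local_martingale M F N \<longleftrightarrow>
     adapted F N \<and> (\<forall>w\<in>space M. cadlag_in UNIV (\<lambda>t. N t w)) \<and>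
     (\<exists>\<tau> :: nat \<Rightarrow> 'w \<Rightarrow> real.
        (\<forall>k. (\<forall>w\<in>space M. 0 \<le> \<tau> k w) \<and> (\<forall>t\<ge>0. Measurable.pred (F t) (\<lambda>w. \<tau> k w \<le> t))) \<and>
        (AE w in M. incseq (\<lambda>k. \<tau> k w) \<and> filterlim (\<lambda>k. \<tau> k w) at_top sequentially) \<and>
        (\<forall>k. martingale M F (\<lambda>t w. N (min t (\<tau> k w)) w - N 0 w)))"

definition finite_variation :: "(real \<Rightarrow> real) \<Rightarrow> bool" where
  "finite_variation f \<longleftrightarrow>
     (\<forall>t\<ge>0. \<exists>C. \<forall>n u. 0 \<le> u 0 \<longrightarrow> (\<forall>i<n. u i \<le> u (Suc i)) \<longrightarrow> u n \<le> t \<longrightarrow>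
        (\<Sum>i<n. \<bar>f (u (Suc i)) - f (u i)\<bar>) \<le> C)"

definition semimartingale :: "'w measure \<Rightarrow> (real \<Rightarrow> 'w measure) \<Rightarrow> ('w, real) process \<Rightarrow> bool" where
  "semimartingale M F X \<longleftrightarrow>
     (\<exists>N A. local_martingale M F N \<and> adapted F A \<and>
        (\<forall>w\<in>space M. cadlag_in UNIV (\<lambda>t. A t w) \<and> finite_variation (\<lambda>t. A t w)) \<and>
        (\<forall>t\<ge>0. \<forall>w\<in>space M. X t w = N t w + A t w))"


section \<open>Feller processes and continuous-time Markov chains\<close>

text \<open>A (conservative) transition function on the discrete space \<open>E\<close>: \<open>P t z\<close> is the law at time
  \<open>t\<close> of the chain started at \<open>z\<close>. The kernels are probability mass functions, so no mass
  is lost in finite time.\<close>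

definition transition_function ::
  "'e set \<Rightarrow> (real \<Rightarrow> 'e \<Rightarrow> 'e pmf) \<Rightarrow> bool" where
  "transition_function E P \<longleftrightarrow>
     (\<forall>t\<ge>0. \<forall>z\<in>E. set_pmf (P t z) \<subseteq> E) \<and>
     (\<forall>z\<in>E. P 0 z = return_pmf z) \<and>
     (\<forall>s\<ge>0. \<forall>t\<ge>0. \<forall>z\<in>E. P (s + t) z = bind_pmf (P s z) (P t))"

definition semigroup_op :: "(real \<Rightarrow> 'e \<Rightarrow> 'e pmf) \<Rightarrow> real \<Rightarrow> ('e \<Rightarrow> real) \<Rightarrow> 'e \<Rightarrow> real" where
  "semigroup_op P t f z = measure_pmf.expectation (P t z) f"

text \<open>The same operator on nonnegative, possibly unbounded functions, with values in \<open>[0,\<infinity>]\<close>.\<close>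

definition semigroup_op_nn :: "(real \<Rightarrow> 'e \<Rightarrow> 'e pmf) \<Rightarrow> real \<Rightarrow> ('e \<Rightarrow> real) \<Rightarrow> 'e \<Rightarrow> ennreal" where
  "semigroup_op_nn P t f z = (\<integral>\<^sup>+w. ennreal (f w) \<partial>measure_pmf (P t z))"

text \<open>\<open>C\<^sub>0(E)\<close>, the continuous functions on \<open>E\<close> vanishing at infinity.\<close>

definition C0_on :: "'e::topological_space set \<Rightarrow> ('e \<Rightarrow> real) set" where
  "C0_on E = {f. continuous_on E f \<and>
     (\<forall>\<epsilon>>0. \<exists>K\<subseteq>E. compact K \<and> (\<forall>z\<in>E - K. \<bar>f z\<bar> < \<epsilon>))}"

definition feller :: "'e::topological_space set \<Rightarrow> (real \<Rightarrow> 'e \<Rightarrow> 'e pmf) \<Rightarrow> bool" where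
  "feller E P \<longleftrightarrow>
     transition_function E P \<and>
     (\<forall>f\<in>C0_on E. (\<forall>t\<ge>0. semigroup_op P t f \<in> C0_on E) \<and>
        uniform_limit E (\<lambda>t. semigroup_op P t f) f (at_right 0))"

definition irreducible_on :: "'e set \<Rightarrow> (real \<Rightarrow> 'e \<Rightarrow> 'e pmf) \<Rightarrow> bool" where
  "irreducible_on E P \<longleftrightarrow> (\<forall>z\<in>E. \<forall>w\<in>E. \<exists>t>0. pmf (P t z) w > 0)"

definition markov_wrt ::
  "'w measure \<Rightarrow> (real \<Rightarrow> 'w measure) \<Rightarrow> 'e set \<Rightarrow> (real \<Rightarrow> 'e \<Rightarrow> 'e pmf) \<Rightarrow>
   ('w, 'e::topological_space) process \<Rightarrow> bool" where
  "markov_wrt M F E P Z \<longleftrightarrow>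
     adapted F Z \<and>
     (\<forall>s\<ge>0. \<forall>t\<ge>0. \<forall>f. (\<exists>C. \<forall>z\<in>E. \<bar>f z\<bar> \<le> C) \<longrightarrow>
        (AE w in M. real_cond_exp M (F s) (\<lambda>w. f (Z (s + t) w)) w = semigroup_op P t f (Z s w)))"

text \<open>\<open>Z\<close> is a non-explosive, irreducible, cadlag Feller process on the discrete space \<open>E\<close>, Markov
  with respect to \<open>F\<close>, with semigroup \<open>P\<close>, started at \<open>z\<close>. Non-explosion is the
  requirement that every path stays in \<open>E\<close>, left limits included. The given measure \<open>M\<close> plays
  the role of \<open>P\<^sub>z\<close>; expectations under other starting points enter through \<open>P\<close>.\<close>

definition markov_chain_from ::
  "'w measure \<Rightarrow> (real \<Rightarrow> 'w measure) \<Rightarrow> (real ^ 'd) set \<Rightarrow>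
   (real \<Rightarrow> real ^ 'd \<Rightarrow> (real ^ 'd) pmf) \<Rightarrow> real ^ 'd \<Rightarrow> ('w, real ^ 'd) process \<Rightarrow> bool" where
  "markov_chain_from M F E P z Z \<longleftrightarrow>
     Isolated.discrete E \<and> z \<in> E \<and> feller E P \<and> irreducible_on E P \<and>
     markov_wrt M F E P Z \<and>
     (\<forall>w\<in>space M. cadlag_in E (\<lambda>t. Z t w)) \<and>
     (AE w in M. Z 0 w = z) \<and>
     (\<forall>i. semimartingale M F (\<lambda>t w. Z t w $ i))"


section \<open>The sign function\<close>

text \<open>\<open>c\<close> is the value at \<open>0\<close>.\<close>

definition sgn_at0 :: "real \<Rightarrow> real \<Rightarrow> real" where
  "sgn_at0 c x = (if x > 0 then 1 else if x < 0 then -1 else c)"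

end

theory Submission
  imports Defs
begin

text \<open>
  Write \<open>f = \<sigma>1 (Z)\<close> and \<open>g = \<sigma>2 (Z)\<close>, and suppose first that these integrands are constant between
  the points of a grid. If the Brownian increments were independent of the whole path of the chain, one
  could condition on that path, and each step of \<open>X - Y(V)\<close> would be \<open>f N1 - g N2\<close> with two variables
  \<open>N1\<close>, \<open>N2\<close> which have the same centred Gaussian law but an arbitrary joint law. For such a step
  convexity of \<open>\<phi>\<close> alone decides the extremal couplings:

  \<^item> \<open>f N1 - g N2\<close> is a convex combination of \<open>\<plusminus>(|f| + |g|) N1\<close> and \<open>\<plusminus>(|f| + |g|) N2\<close>, hence
    \<open>E \<phi> (r + f N1 - g N2) \<le> E \<phi> (r + (|f| + |g|) N)\<close> with \<open>N\<close> of the common law;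

  \<^item> if \<open>|g| < |f|\<close>, then \<open>\<plusminus>(|f| - |g|) N1\<close> is a convex combination of \<open>f N1 - g N2\<close> and
    \<open>\<plusminus>(|f| - |g|) N2\<close>; as the two Gaussian terms have the same law, cancelling the second one gives
    \<open>E \<phi> (r + (|f| - |g|) N) \<le> E \<phi> (r + f N1 - g N2)\<close>.

  The bounds are attained when \<open>N2\<close> is \<open>- sgn (f g) N1\<close> and \<open>sgn (f g) N1\<close> respectively, which are the
  increments of \<open>V\<^sup>I\<^sup>I\<close> and \<open>V\<^sup>I\<close>. Steps are chained by replacing the part of the sum that is still to come by
  a Gaussian variable whose variance is the sum of the \<open>(|f| \<plusminus> |g|)\<^sup>2\<close> still to come; averaging over this
  variable keeps \<open>\<phi>\<close> convex (lemmas \<open>constant_upper\<close>, \<open>constant_lower\<close>, \<open>discrete_upper\<close>,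
  \<open>discrete_lower\<close>).

  The independence that makes this work is lemma \<open>bm_increment_enlarged\<close>: for every Brownian motion of the
  filtration, the increment over \<open>[s, t]\<close> is independent of \<open>F s\<close> together with the values of the chain
  from time \<open>t\<close> on. (A pair \<open>(B, V)\<close> need not be jointly independent of \<open>Z\<close>, so only single
  increments may be integrated out.) The reason is that the martingale \<open>E [h (Z t) | F r]\<close> moves essentially
  by the finitely many jumps of \<open>Z\<close> while the exponential martingale of \<open>B\<close> is continuous, so that their
  product is a martingale.

  It remains to pass to the limit. The isometry identifies the given integrals with limits in \<open>L\<^sup>2\<close> of sums
  along grids with finitely supported coefficients (\<open>walk_approx\<close>), and shows that \<open>V\<^sup>I\<close> is a Brownian motion
  (\<open>sign_integral_brownian\<close>); this settles Lipschitz \<open>\<phi>\<close> (\<open>lipschitz_comparison\<close>). A general convex \<open>\<phi>\<close>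
  is a limit of Lipschitz convex functions, dominated as soon as \<open>\<phi> (X T - Y T)\<close> is integrable. The
  latter follows from \<open>p\<close>-th moment bounds for the integrals (\<open>ito_moment\<close>), where finiteness of
  \<open>P T |\<sigma>|\<^sup>p\<close> carries over to times before \<open>T\<close> because the probability of finding the chain at its
  starting point is bounded below on \<open>[0, T]\<close>.
\<close>


section \<open>Centred Gaussian laws and Gaussian variables independent of a sigma-algebra\<close>

text \<open>The normal law with mean 0 and variance \<open>v\<close>, as an image of the standard one so that
  \<open>v = 0\<close> (the point mass at 0) is included.\<close>

definition gauss :: "real \<Rightarrow> real measure" where
  "gauss v = distr std_normal_distribution borel (\<lambda>x. sqrt v * x)"

lemma prob_std_normal: "prob_space std_normal_distribution"
  by (rule prob_space_normal_density) simp

lemma sets_gauss [simp, measurable_cong]: "sets (gauss v) = sets borel"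
  and space_gauss [simp]: "space (gauss v) = UNIV"
  by (auto simp: gauss_def)

lemma prob_space_gauss: "prob_space (gauss v)"
  unfolding gauss_def by (rule prob_space.prob_space_distr[OF prob_std_normal]) simp

lemma real_distribution_gauss: "real_distribution (gauss v)"
  unfolding real_distribution_def real_distribution_axioms_def using prob_space_gauss by auto

lemma char_gauss:
  assumes "0 \<le> v"
  shows "char (gauss v) u = complex_of_real (exp (- (v * u\<^sup>2) / 2))"
proof -
  have "char (gauss v) u = char std_normal_distribution (u * sqrt v)"
    unfolding char_def gauss_def
    by (subst integral_distr) (auto simp: mult_ac)
  also have "\<dots> = complex_of_real (exp (- (v * u\<^sup>2) / 2))"
    using assms by (simp add: char_std_normal_distribution power_mult_distrib mult.commute)
  finally show ?thesis .
qed

text \<open>Recognizing Gaussian laws by their characteristic functions turns scaling and convolution into identities between exponentials.\<close>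

lemma gauss_eqI:
  assumes "real_distribution \<mu>" "0 \<le> v"
    and "\<And>u. char \<mu> u = complex_of_real (exp (- (v * u\<^sup>2) / 2))"
  shows "\<mu> = gauss v"
  by (rule Levy_uniqueness[OF assms(1) real_distribution_gauss]) (simp add: fun_eq_iff assms char_gauss)

lemma gauss_scale:
  assumes "0 \<le> v"
  shows "distr (gauss v) borel (\<lambda>x. c * x) = gauss (c\<^sup>2 * v)"
proof (rule gauss_eqI)
  interpret prob_space "gauss v" by (rule prob_space_gauss)
  show "real_distribution (distr (gauss v) borel (\<lambda>x. c * x))"
    by (auto simp: real_distribution_def real_distribution_axioms_def intro!: prob_space_distr)
  fix u
  have "char (distr (gauss v) borel (\<lambda>x. c * x)) u = char (gauss v) (u * c)"
    unfolding char_def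
    by (subst integral_distr) (auto simp: mult_ac)
  then show "char (distr (gauss v) borel (\<lambda>x. c * x)) u = complex_of_real (exp (- (c\<^sup>2 * v * u\<^sup>2) / 2))"
    using assms by (simp add: char_gauss power_mult_distrib mult_ac)
qed (use assms in auto)

lemma gauss_convolution:
  assumes "0 \<le> v" "0 \<le> w"
  shows "distr (gauss v \<Otimes>\<^sub>M gauss w) borel (\<lambda>(x, y). x + y) = gauss (v + w)"
proof (rule gauss_eqI)
  interpret v: prob_space "gauss v" by (rule prob_space_gauss)
  interpret w: prob_space "gauss w" by (rule prob_space_gauss)
  interpret pair_prob_space "gauss v" "gauss w" ..
  show "real_distribution (distr (gauss v \<Otimes>\<^sub>M gauss w) borel (\<lambda>(x, y). x + y))"
    by (auto simp: real_distribution_def real_distribution_axioms_def intro!: P.prob_space_distr)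
  fix u
  have int: "integrable (gauss v \<Otimes>\<^sub>M gauss w) (\<lambda>z. iexp (u * (fst z + snd z)))"
    by (rule P.integrable_const_bound[of _ 1]) auto
  have "char (distr (gauss v \<Otimes>\<^sub>M gauss w) borel (\<lambda>(x, y). x + y)) u
      = (\<integral>z. iexp (u * (fst z + snd z)) \<partial>(gauss v \<Otimes>\<^sub>M gauss w))"
    unfolding char_def
    by (subst integral_distr) (auto simp: split_beta')
  also have "\<dots> = (\<integral>x. \<integral>y. iexp (u * (x + y)) \<partial>gauss w \<partial>gauss v)"
    using int by (subst integral_fst'[symmetric]) auto
  also have "\<dots> = (\<integral>x. \<integral>y. iexp (u * x) * iexp (u * y) \<partial>gauss w \<partial>gauss v)"
    by (simp add: distrib_left exp_add)
  also have "\<dots> = char (gauss v) u * char (gauss w) u"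
    unfolding char_def by simp
  also have "\<dots> = complex_of_real (exp (- ((v + w) * u\<^sup>2) / 2))"
    using assms by (simp add: char_gauss exp_add[symmetric] algebra_simps diff_divide_distrib flip: of_real_mult)
  finally show "char (distr (gauss v \<Otimes>\<^sub>M gauss w) borel (\<lambda>(x, y). x + y)) u
      = complex_of_real (exp (- ((v + w) * u\<^sup>2) / 2))" .
qed (use assms in auto)

lemma integrable_gauss_power: "integrable (gauss v) (\<lambda>x. x ^ k)"
  unfolding gauss_def
  by (subst integrable_distr_eq)
    (auto simp: power_mult_distrib intro!: integrable_mult_right integrable_std_normal_distribution_moment)

lemma integrable_gauss_ident: "integrable (gauss v) (\<lambda>x. x)"
  using integrable_gauss_power[of v 1] by simp

lemma gauss_mean: "(\<integral>x. x \<partial>gauss v) = 0"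
proof -
  have "(\<integral>x. x \<partial>gauss v) = (\<integral>x. sqrt v * x \<partial>std_normal_distribution)"
    unfolding gauss_def by (subst integral_distr) auto
  also have "\<dots> = 0"
    using integral_std_normal_distribution_moment_odd[of 1] by simp
  finally show ?thesis .
qed

lemma gauss_variance: "0 \<le> v \<Longrightarrow> (\<integral>x. x\<^sup>2 \<partial>gauss v) = v"
proof -
  assume v: "0 \<le> v"
  have "(\<integral>x. x\<^sup>2 \<partial>gauss v) = (\<integral>x. v * x\<^sup>2 \<partial>std_normal_distribution)"
    unfolding gauss_def using v by (subst integral_distr) (auto simp: power_mult_distrib)
  also have "\<dots> = v"
    using std_normal_distribution_even_moments[of 1] by simp
  finally show ?thesis .
qed

lemma gauss_zero: "gauss 0 = return borel 0"
proof -
  interpret prob_space std_normal_distribution by (rule prob_std_normal)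
  show ?thesis unfolding gauss_def using distr_const[of "0::real" borel] by (simp add: lambda_zero)
qed

text \<open>\<open>N\<close> has law \<open>gauss v\<close> and is independent of the sigma-algebra \<open>G\<close>: both are contained in
  the one product formula, as \<open>A\<close> may be the whole space.\<close>

definition indep_gauss :: "'w measure \<Rightarrow> 'w measure \<Rightarrow> ('w \<Rightarrow> real) \<Rightarrow> real \<Rightarrow> bool" where
  "indep_gauss M G N v \<longleftrightarrow> N \<in> borel_measurable M \<and>
     (\<forall>A\<in>sets G. \<forall>S\<in>sets borel.
        measure M (A \<inter> (N -` S \<inter> space M)) = measure M A * measure (gauss v) S)"

locale subalgebra_prob = prob_space M for M :: "'w measure" +
  fixes G :: "'w measure"
  assumes subalg: "subalgebra M G"
begin

lemma space_G [simp]: "space G = space M"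
  using subalg by (simp add: subalgebra_def)

lemma sets_G: "A \<in> sets G \<Longrightarrow> A \<in> sets M"
  using subalg by (auto simp: subalgebra_def)

lemma id_measurable: "(\<lambda>w. w) \<in> measurable M G"
  using subalg by (auto simp: measurable_def subalgebra_def Int_absorb2 sets.sets_into_space)

text \<open>Independence as a product law of the pair (identity, \<open>N\<close>). Taking the identity map into \<open>G\<close>
  as first component makes every \<open>G\<close>-measurable quantity a function of it, so that Fubini integrates \<open>N\<close> out
  with all of them frozen.\<close>

lemma indep_gauss_joint:
  assumes N: "indep_gauss M G N v"
  shows "distr M (G \<Otimes>\<^sub>M borel) (\<lambda>w. (w, N w)) = distr M G (\<lambda>w. w) \<Otimes>\<^sub>M gauss v"
proof (rule pair_measure_eqI[symmetric])
  have [measurable]: "N \<in> borel_measurable M" using N by (simp add: indep_gauss_def)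
  note id_measurable[measurable]
  interpret g: prob_space "gauss v" by (rule prob_space_gauss)
  interpret d: prob_space "distr M G (\<lambda>w. w)" by (rule prob_space_distr) simp
  show "sigma_finite_measure (distr M G (\<lambda>w. w))" ..
  show "sigma_finite_measure (gauss v)" ..
  show "sets (distr M G (\<lambda>w. w) \<Otimes>\<^sub>M gauss v) = sets (distr M (G \<Otimes>\<^sub>M borel) (\<lambda>w. (w, N w)))"
    by (simp cong: sets_pair_measure_cong)
  fix A S assume A: "A \<in> sets (distr M G (\<lambda>w. w))" and S: "S \<in> sets (gauss v)"
  then have A': "A \<in> sets G" "A \<in> sets M" and S': "S \<in> sets borel" by (auto intro: sets_G)
  have "(\<lambda>w. (w, N w)) -` (A \<times> S) \<inter> space M = A \<inter> (N -` S \<inter> space M)" by auto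
  moreover have "(\<lambda>w. w) -` A \<inter> space M = A" using sets.sets_into_space[OF A'(2)] by auto
  ultimately show "emeasure (distr M G (\<lambda>w. w)) A * emeasure (gauss v) S =
      emeasure (distr M (G \<Otimes>\<^sub>M borel) (\<lambda>w. (w, N w))) (A \<times> S)"
    using A' S' N
    by (simp add: emeasure_distr emeasure_eq_measure g.emeasure_eq_measure ennreal_mult indep_gauss_def)
qed

lemma indep_gauss_nn_integral:
  assumes N: "indep_gauss M G N v"
    and H: "(\<lambda>(w, x). H w x) \<in> borel_measurable (G \<Otimes>\<^sub>M borel)"
  shows "(\<integral>\<^sup>+w. H w (N w) \<partial>M) = (\<integral>\<^sup>+w. \<integral>\<^sup>+x. H w x \<partial>gauss v \<partial>M)"
proof -
  have [measurable]: "N \<in> borel_measurable M" using N by (simp add: indep_gauss_def)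
  note id_measurable[measurable] H[measurable]
  interpret g: prob_space "gauss v" by (rule prob_space_gauss)
  have H': "(\<lambda>(w, x). H w x) \<in> borel_measurable (distr M G (\<lambda>w. w) \<Otimes>\<^sub>M gauss v)"
    using H by (simp cong: measurable_cong_sets sets_pair_measure_cong)
  have "(\<integral>\<^sup>+w. H w (N w) \<partial>M) = (\<integral>\<^sup>+z. (\<lambda>(w, x). H w x) z \<partial>distr M (G \<Otimes>\<^sub>M borel) (\<lambda>w. (w, N w)))"
    by (subst nn_integral_distr) auto
  also have "\<dots> = (\<integral>\<^sup>+w. \<integral>\<^sup>+x. H w x \<partial>gauss v \<partial>distr M G (\<lambda>w. w))"
    unfolding indep_gauss_joint[OF N] using H' by (subst g.nn_integral_fst[symmetric]) auto
  also have "\<dots> = (\<integral>\<^sup>+w. \<integral>\<^sup>+x. H w x \<partial>gauss v \<partial>M)"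
    by (subst nn_integral_distr) (auto intro!: g.borel_measurable_nn_integral)
  finally show ?thesis .
qed

lemma indep_gauss_integral:
  fixes H :: "'w \<Rightarrow> real \<Rightarrow> 'b :: {banach, second_countable_topology}"
  assumes N: "indep_gauss M G N v"
    and H: "(\<lambda>(w, x). H w x) \<in> borel_measurable (G \<Otimes>\<^sub>M borel)"
    and int: "integrable M (\<lambda>w. H w (N w))"
  shows "(\<integral>w. H w (N w) \<partial>M) = (\<integral>w. \<integral>x. H w x \<partial>gauss v \<partial>M)"
    and "integrable M (\<lambda>w. \<integral>x. H w x \<partial>gauss v)"
proof -
  have [measurable]: "N \<in> borel_measurable M" using N by (simp add: indep_gauss_def)
  note id_measurable[measurable] H[measurable]
  interpret g: prob_space "gauss v" by (rule prob_space_gauss)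
  interpret d: prob_space "distr M G (\<lambda>w. w)" by (rule prob_space_distr) simp
  interpret P: pair_prob_space "distr M G (\<lambda>w. w)" "gauss v" ..
  have eq: "(\<integral>w. H w (N w) \<partial>M) = (\<integral>z. (\<lambda>(w, x). H w x) z \<partial>distr M (G \<Otimes>\<^sub>M borel) (\<lambda>w. (w, N w)))"
    by (subst integral_distr) auto
  have I: "integrable (distr M G (\<lambda>w. w) \<Otimes>\<^sub>M gauss v) (\<lambda>(w, x). H w x)"
    unfolding indep_gauss_joint[OF N, symmetric]
    by (subst integrable_distr_eq) (use int in auto)
  have m: "(\<lambda>w. \<integral>x. H w x \<partial>gauss v) \<in> borel_measurable G"
    by (rule g.borel_measurable_lebesgue_integral) (use H in \<open>simp cong: measurable_cong_sets sets_pair_measure_cong\<close>)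
  have "(\<integral>w. H w (N w) \<partial>M) = (\<integral>w. \<integral>x. H w x \<partial>gauss v \<partial>distr M G (\<lambda>w. w))"
    unfolding eq indep_gauss_joint[OF N] using I by (subst P.integral_fst'[symmetric]) auto
  also have "\<dots> = (\<integral>w. \<integral>x. H w x \<partial>gauss v \<partial>M)"
    by (subst integral_distr) (use m in auto)
  finally show "(\<integral>w. H w (N w) \<partial>M) = (\<integral>w. \<integral>x. H w x \<partial>gauss v \<partial>M)" .
  show "integrable M (\<lambda>w. \<integral>x. H w x \<partial>gauss v)"
    using P.integrable_fst'[OF I] by (subst (asm) integrable_distr_eq) (use m in auto)
qed

lemma indep_gauss_integrable:
  fixes H :: "'w \<Rightarrow> real \<Rightarrow> real"
  assumes N: "indep_gauss M G N v"
    and H: "(\<lambda>(w, x). H w x) \<in> borel_measurable (G \<Otimes>\<^sub>M borel)"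
    and bd: "(\<integral>\<^sup>+w. \<integral>\<^sup>+x. ennreal \<bar>H w x\<bar> \<partial>gauss v \<partial>M) < \<infinity>"
  shows "integrable M (\<lambda>w. H w (N w))"
proof (rule integrableI_bounded)
  have [measurable]: "N \<in> borel_measurable M" using N by (simp add: indep_gauss_def)
  note id_measurable[measurable] H[measurable]
  have "(\<lambda>w. (\<lambda>(w, x). H w x) (w, N w)) \<in> borel_measurable M"
    by (rule measurable_compose[OF _ H]) simp
  then show "(\<lambda>w. H w (N w)) \<in> borel_measurable M" by simp
  show "(\<integral>\<^sup>+w. ennreal (norm (H w (N w))) \<partial>M) < \<infinity>"
    using bd by (subst (asm) indep_gauss_nn_integral[OF N, symmetric]) auto
qed

end

text \<open>Conditionally on a generating event the characteristic function of \<open>N\<close> determines its law; a Dynkin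
  argument carries the product formula over to the generated sigma-algebra.\<close>

lemma (in prob_space) indep_gauss_char:
  assumes N[measurable]: "N \<in> borel_measurable M" and v: "0 \<le> v"
    and Gen: "Gen \<subseteq> sets M" "Int_stable Gen"
    and sG: "sets G = sigma_sets (space M) Gen"
    and top: "space M \<in> Gen"
    and ch: "\<And>A u. A \<in> Gen \<Longrightarrow>
       (\<integral>w. indicator A w *\<^sub>R iexp (u * N w) \<partial>M) = complex_of_real (prob A * exp (- (v * u\<^sup>2) / 2))"
  shows "indep_gauss M G N v"
  unfolding indep_gauss_def
proof (intro conjI ballI N)
  interpret g: prob_space "gauss v" by (rule prob_space_gauss)
  fix A and S :: "real set" assume A: "A \<in> sets G" and S[measurable]: "S \<in> sets borel"
  have gen: "prob (A \<inter> (N -` S \<inter> space M)) = prob A * measure (gauss v) S" if AP: "A \<in> Gen" for A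
  proof (cases "prob A = 0")
    case True
    have "prob (A \<inter> (N -` S \<inter> space M)) \<le> prob A"
      using AP Gen by (intro finite_measure_mono) auto
    with True show ?thesis by (simp add: measure_le_0_iff)
  next
    case False
    have [measurable]: "A \<in> sets M" using AP Gen by auto
    have eA: "emeasure M A \<noteq> 0" "emeasure M A \<noteq> \<infinity>"
      using False by (auto simp: emeasure_eq_measure)
    interpret U: prob_space "uniform_measure M A" by (rule prob_space_uniform_measure[OF eA])
    have "distr (uniform_measure M A) borel N = gauss v"
    proof (rule gauss_eqI[OF _ v])
      show "real_distribution (distr (uniform_measure M A) borel N)"
        by (auto simp: real_distribution_def real_distribution_axioms_def intro!: U.prob_space_distr)
      have um: "uniform_measure M A = density M (\<lambda>x. ennreal (indicator A x / prob A))"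
        unfolding uniform_measure_def
        by (intro density_cong) (auto simp: emeasure_eq_measure indicator_def False divide_ennreal[symmetric] zero_less_measure_iff simp flip: ennreal_1 split: if_splits)
      fix u
      have "char (distr (uniform_measure M A) borel N) u = (\<integral>w. iexp (u * N w) \<partial>uniform_measure M A)"
        unfolding char_def by (subst integral_distr) auto
      also have "\<dots> = (\<integral>w. iexp (u * N w) \<partial>density M (\<lambda>x. ennreal (indicator A x / prob A)))"
        by (subst um) simp
      also have "\<dots> = (\<integral>w. (1 / prob A) *\<^sub>R (indicator A w *\<^sub>R iexp (u * N w)) \<partial>M)"
        by (subst integral_density) (auto simp: divide_simps)
      also have "\<dots> = (1 / prob A) *\<^sub>R complex_of_real (prob A * exp (- (v * u\<^sup>2) / 2))"
        using ch[OF AP, of u] by (subst integral_scaleR_right) simp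
      also have "\<dots> = complex_of_real (exp (- (v * u\<^sup>2) / 2))"
        using False by (simp add: scaleR_conv_of_real)
      finally show "char (distr (uniform_measure M A) borel N) u = complex_of_real (exp (- (v * u\<^sup>2) / 2))" .
    qed
    then have "measure (gauss v) S = measure (distr (uniform_measure M A) borel N) S" by simp
    also have "\<dots> = prob (A \<inter> (N -` S \<inter> space M)) / prob A"
      by (subst measure_distr) (auto simp: measure_uniform_measure[OF eA])
    finally show ?thesis using False by simp
  qed
  have "Gen \<subseteq> Pow (space M)" using Gen sets.sets_into_space by auto
  have "A \<in> sigma_sets (space M) Gen" using A sG by simp
  with Gen(2) \<open>Gen \<subseteq> Pow (space M)\<close>
  show "prob (A \<inter> (N -` S \<inter> space M)) = prob A * measure (gauss v) S"
  proof (induction A rule: sigma_sets_induct_disjoint)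
    case (basic A) then show ?case by (rule gen)
  next
    case empty show ?case by simp
  next
    case (compl A)
    have [measurable]: "A \<in> sets M" using compl(1) Gen(1) sets.sigma_sets_subset by blast
    let ?B = "N -` S \<inter> space M"
    have "prob ((space M - A) \<inter> ?B) = prob (?B - A \<inter> ?B)"
      by (rule arg_cong[where f=prob]) auto
    also have "\<dots> = prob ?B - prob (A \<inter> ?B)"
      by (subst finite_measure_Diff) auto
    also have "prob ?B = measure (gauss v) S"
      using gen[OF top] by (simp add: prob_space Int_absorb1)
    finally show ?case using compl(2) by (simp add: prob_compl algebra_simps)
  next
    case (union A)
    have [measurable]: "A i \<in> sets M" for i using union(2) Gen(1) sets.sigma_sets_subset by blast
    let ?B = "N -` S \<inter> space M"
    have "(\<lambda>i. prob (A i \<inter> ?B)) sums prob (\<Union>i. A i \<inter> ?B)"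
      using union(1) by (intro finite_measure_UNION) (auto simp: disjoint_family_on_def)
    moreover have "(\<lambda>i. prob (A i) * measure (gauss v) S) sums (prob (\<Union>i. A i) * measure (gauss v) S)"
      using union(1) by (intro sums_mult2 finite_measure_UNION) auto
    moreover have "(\<Union>i. A i \<inter> ?B) = (\<Union>i. A i) \<inter> ?B" by auto
    ultimately show ?case using union(3) sums_unique2 by fastforce
  qed
qed

section \<open>Brownian motion relative to a filtration\<close>

context subalgebra_prob
begin

lemma measurable_G: "f \<in> measurable G K \<Longrightarrow> f \<in> measurable M K"
  by (rule measurable_from_subalg[OF subalg])

lemma indep_gauss_integrable_power:
  assumes N: "indep_gauss M G N v" and \<xi>[measurable]: "\<xi> \<in> borel_measurable G" and i: "integrable M \<xi>"
  shows "integrable M (\<lambda>w. \<xi> w * N w ^ k)"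
    and "(\<integral>w. \<xi> w * N w ^ k \<partial>M) = (\<integral>w. \<xi> w \<partial>M) * (\<integral>x. x ^ k \<partial>gauss v)"
proof -
  have [measurable]: "\<xi> \<in> borel_measurable M" by (rule measurable_G) simp
  have fin: "(\<integral>\<^sup>+x. ennreal \<bar>x ^ k\<bar> \<partial>gauss v) < \<infinity>"
    using integrable_gauss_power[of v k] by (simp add: integrable_iff_bounded)
  have "(\<integral>\<^sup>+w. \<integral>\<^sup>+x. ennreal \<bar>\<xi> w * x ^ k\<bar> \<partial>gauss v \<partial>M)
      = (\<integral>\<^sup>+w. ennreal \<bar>\<xi> w\<bar> * (\<integral>\<^sup>+x. ennreal \<bar>x ^ k\<bar> \<partial>gauss v) \<partial>M)"
    by (simp add: abs_mult ennreal_mult nn_integral_cmult)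
  also have "\<dots> = (\<integral>\<^sup>+w. ennreal \<bar>\<xi> w\<bar> \<partial>M) * (\<integral>\<^sup>+x. ennreal \<bar>x ^ k\<bar> \<partial>gauss v)"
    by (rule nn_integral_multc) simp
  also have "\<dots> < \<infinity>"
    using i fin by (simp add: integrable_iff_bounded ennreal_mult_less_top)
  finally show I: "integrable M (\<lambda>w. \<xi> w * N w ^ k)"
    by (intro indep_gauss_integrable[OF N]) auto
  have "(\<integral>w. \<xi> w * N w ^ k \<partial>M) = (\<integral>w. \<integral>x. \<xi> w * x ^ k \<partial>gauss v \<partial>M)"
    by (rule indep_gauss_integral(1)[where H="\<lambda>w x. \<xi> w * x ^ k", OF N _ I]) simp
  then show "(\<integral>w. \<xi> w * N w ^ k \<partial>M) = (\<integral>w. \<xi> w \<partial>M) * (\<integral>x. x ^ k \<partial>gauss v)"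
    by simp
qed

lemma indep_gauss_mean:
  assumes "indep_gauss M G N v" "\<xi> \<in> borel_measurable G" "integrable M \<xi>"
  shows "integrable M (\<lambda>w. \<xi> w * N w)" and "(\<integral>w. \<xi> w * N w \<partial>M) = 0"
  using indep_gauss_integrable_power[OF assms, of 1] by (simp_all add: gauss_mean)

lemma indep_gauss_square:
  assumes "indep_gauss M G N v" "\<xi> \<in> borel_measurable G" "integrable M \<xi>" "0 \<le> v"
  shows "integrable M (\<lambda>w. \<xi> w * (N w)\<^sup>2)" and "(\<integral>w. \<xi> w * (N w)\<^sup>2 \<partial>M) = v * (\<integral>w. \<xi> w \<partial>M)"
  using indep_gauss_integrable_power[OF assms(1-3), of 2] assms(4) by (simp_all add: gauss_variance)

lemma indep_gauss_iexp:
  fixes \<xi> :: "'w \<Rightarrow> complex"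
  assumes N: "indep_gauss M G N v" and \<xi>[measurable]: "\<xi> \<in> borel_measurable G" and i: "integrable M \<xi>"
    and v: "0 \<le> v"
  shows "(\<integral>w. \<xi> w * iexp (u * N w) \<partial>M) = (\<integral>w. \<xi> w \<partial>M) * complex_of_real (exp (- (v * u\<^sup>2) / 2))"
proof -
  have [measurable]: "\<xi> \<in> borel_measurable M" by (rule measurable_G) simp
  have [measurable]: "N \<in> borel_measurable M" using N by (simp add: indep_gauss_def)
  have I: "integrable M (\<lambda>w. \<xi> w * iexp (u * N w))"
    by (rule Bochner_Integration.integrable_bound[OF i]) (auto simp: norm_mult)
  have "(\<integral>w. \<xi> w * iexp (u * N w) \<partial>M) = (\<integral>w. \<integral>x. \<xi> w * iexp (u * x) \<partial>gauss v \<partial>M)"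
    by (rule indep_gauss_integral(1)[where H="\<lambda>w x. \<xi> w * iexp (u * x)", OF N _ I]) simp
  also have "\<dots> = (\<integral>w. \<xi> w * char (gauss v) u \<partial>M)"
    by (simp add: char_def)
  finally show ?thesis by (simp add: char_gauss[OF v])
qed

end

locale filtered_prob = prob_space M for M :: "'w measure" +
  fixes F :: "real \<Rightarrow> 'w measure"
  assumes filtered: "filtered_prob_space M F"
begin

lemma subalgebra_F: "0 \<le> t \<Longrightarrow> subalgebra M (F t)"
  using filtered by (simp add: filtered_prob_space_def)

lemma subalgebra_prob_F: "0 \<le> t \<Longrightarrow> subalgebra_prob M (F t)"
  by (simp add: subalgebra_prob_def subalgebra_prob_axioms_def subalgebra_F prob_space_axioms)

lemma space_F: "0 \<le> t \<Longrightarrow> space (F t) = space M"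
  using subalgebra_F by (simp add: subalgebra_def)

lemma F_le_M: "0 \<le> t \<Longrightarrow> f \<in> measurable (F t) K \<Longrightarrow> f \<in> measurable M K"
  by (rule measurable_from_subalg[OF subalgebra_F])

lemma sets_F_M: "0 \<le> t \<Longrightarrow> A \<in> sets (F t) \<Longrightarrow> A \<in> sets M"
  using subalgebra_F by (auto simp: subalgebra_def)

lemma sets_F_mono: "0 \<le> s \<Longrightarrow> s \<le> t \<Longrightarrow> sets (F s) \<subseteq> sets (F t)"
  using filtered by (simp add: filtered_prob_space_def)

lemma F_mono: "0 \<le> s \<Longrightarrow> s \<le> t \<Longrightarrow> f \<in> measurable (F s) K \<Longrightarrow> f \<in> measurable (F t) K"
  by (rule measurable_from_subalg) (simp_all add: subalgebra_def space_F sets_F_mono)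

lemma bm_adapted: "brownian_motion M F W \<Longrightarrow> 0 \<le> s \<Longrightarrow> s \<le> t \<Longrightarrow> W s \<in> borel_measurable (F t)"
  by (rule F_mono[of s]) (auto simp: brownian_motion_def adapted_def)

lemma bm_measurable: "brownian_motion M F W \<Longrightarrow> 0 \<le> s \<Longrightarrow> W s \<in> borel_measurable M"
  by (rule F_le_M[of s]) (auto intro: bm_adapted)

lemma distributed_normal_iff:
  assumes "0 < v" "X \<in> borel_measurable M"
  shows "distributed M lborel X (normal_density 0 (sqrt v)) \<longleftrightarrow> distr M borel X = gauss v"
proof -
  have g: "gauss v = density lborel (normal_density 0 (sqrt v))"
  proof -
    interpret s: prob_space std_normal_distribution by (rule prob_std_normal)
    have "distributed std_normal_distribution lborel (\<lambda>x. x) std_normal_density"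
      by (auto simp: distributed_def distr_id2)
    then have "distributed std_normal_distribution lborel (\<lambda>x. 0 + sqrt v * x) (normal_density (0 + sqrt v * 0) (\<bar>sqrt v\<bar> * 1))"
      by (rule s.normal_density_affine) (use assms in auto)
    then have "distr std_normal_distribution lborel (\<lambda>x. sqrt v * x) = density lborel (normal_density 0 (sqrt v))"
      using assms by (simp add: distributed_def)
    moreover have "distr std_normal_distribution lborel (\<lambda>x. sqrt v * x) = gauss v"
      unfolding gauss_def by (rule distr_cong) auto
    ultimately show ?thesis by simp
  qed
  have "distr M lborel X = distr M borel X" by (rule distr_cong) auto
  then show ?thesis unfolding g using assms by (auto simp: distributed_def)
qed

lemma bm_increment:
  assumes W: "brownian_motion M F W" and st: "0 \<le> s" "s \<le> t"
  shows "indep_gauss M (F s) (\<lambda>w. W t w - W s w) (t - s)"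
proof (cases "s = t")
  case True
  then have N: "(\<lambda>w. W t w - W s w) = (\<lambda>_. 0)" and v: "t - s = 0" by auto
  have "measure M (A \<inter> ((\<lambda>_. 0::real) -` S \<inter> space M)) = measure M A * measure (return borel 0) S"
    if "A \<in> sets (F s)" "S \<in> sets borel" for A and S :: "real set"
  proof -
    have "A \<subseteq> space M" using sets_F_M[OF st(1) that(1)] sets.sets_into_space by blast
    then show ?thesis
      using that by (cases "0 \<in> S") (auto simp: measure_return Int_absorb2)
  qed
  then show ?thesis unfolding N v indep_gauss_def gauss_zero by auto
next
  case False
  then have lt: "s < t" using st by simp
  have [measurable]: "W t \<in> borel_measurable M" "W s \<in> borel_measurable M"
    using bm_measurable[OF W] st by auto
  have D: "distributed M lborel (\<lambda>w. W t w - W s w) (normal_density 0 (sqrt (t - s)))"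
    and I: "indep_set (sets (F s)) {(\<lambda>w. W t w - W s w) -` A \<inter> space M | A. A \<in> sets borel}"
    using W st lt by (auto simp: brownian_motion_def)
  have d: "distr M borel (\<lambda>w. W t w - W s w) = gauss (t - s)"
    using D distributed_normal_iff[of "t - s" "\<lambda>w. W t w - W s w"] lt by simp
  show ?thesis
    unfolding indep_gauss_def
  proof (intro conjI ballI)
    fix A and S :: "real set" assume A: "A \<in> sets (F s)" and S[measurable]: "S \<in> sets borel"
    have "prob (A \<inter> ((\<lambda>w. W t w - W s w) -` S \<inter> space M))
        = prob A * prob ((\<lambda>w. W t w - W s w) -` S \<inter> space M)"
      by (rule indep_setD[OF I A]) auto
    also have "prob ((\<lambda>w. W t w - W s w) -` S \<inter> space M) = measure (gauss (t - s)) S"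
      by (subst d[symmetric], subst measure_distr) auto
    finally show "prob (A \<inter> ((\<lambda>w. W t w - W s w) -` S \<inter> space M)) = prob A * measure (gauss (t - s)) S" .
  qed simp
qed

text \<open>The two requirements in the definition of Brownian motion, recovered from the product formula.\<close>

lemma bm_from_indep_gauss:
  assumes st: "0 \<le> s" "s < t" and N: "indep_gauss M (F s) N (t - s)"
  shows "distributed M lborel N (normal_density 0 (sqrt (t - s)))"
    and "indep_set (sets (F s)) {N -` A \<inter> space M | A. A \<in> sets borel}"
proof -
  interpret F: subalgebra_prob M "F s" using st by (intro subalgebra_prob_F)
  have [measurable]: "N \<in> borel_measurable M" using N by (simp add: indep_gauss_def)
  have m: "prob (N -` S \<inter> space M) = measure (gauss (t - s)) S" if "S \<in> sets borel" for S
  proof -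
    have "space M \<in> sets (F s)" using F.space_G sets.top by metis
    with N that have "prob (space M \<inter> (N -` S \<inter> space M)) = prob (space M) * measure (gauss (t - s)) S"
      unfolding indep_gauss_def by blast
    then show ?thesis by (simp add: prob_space Int_absorb1)
  qed
  interpret g: prob_space "gauss (t - s)" by (rule prob_space_gauss)
  have "distr M borel N = gauss (t - s)"
    by (rule measure_eqI) (auto simp: emeasure_distr emeasure_eq_measure g.emeasure_eq_measure m)
  then show "distributed M lborel N (normal_density 0 (sqrt (t - s)))"
    using distributed_normal_iff[of "t - s" N] st by simp
  show "indep_set (sets (F s)) {N -` A \<inter> space M | A. A \<in> sets borel}"
    using N by (auto simp: indep_sets2_eq m indep_gauss_def F.sets_G)
qed

end

section \<open>The isometry for elementary integrals\<close>

lemma ennreal_square_triangle: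
  fixes x y z :: real
  shows "ennreal ((x - z)\<^sup>2) \<le> 2 * ennreal ((x - y)\<^sup>2) + 2 * ennreal ((y - z)\<^sup>2)"
proof -
  have "(x - z)\<^sup>2 \<le> 2 * (x - y)\<^sup>2 + 2 * (y - z)\<^sup>2"
    using sum_squares_bound[of "x - y" "y - z"] power2_sum[of "x - y" "y - z"] by simp
  then have "ennreal ((x - z)\<^sup>2) \<le> ennreal (2 * (x - y)\<^sup>2 + 2 * (y - z)\<^sup>2)"
    by (rule ennreal_leI)
  also have "\<dots> = 2 * ennreal ((x - y)\<^sup>2) + 2 * ennreal ((y - z)\<^sup>2)"
    by (simp add: ennreal_mult)
  finally show ?thesis .
qed

context filtered_prob
begin

text \<open>Split the longer increment at \<open>b\<close>: the part after \<open>b\<close> is centred and independent of the rest, so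
  only the square of the common part contributes.\<close>

lemma bm_products_aux:
  assumes W: "brownian_motion M F W" and t: "0 \<le> c" "c \<le> b" "b \<le> d"
    and \<kappa>: "\<kappa> \<in> borel_measurable (F c)" "\<And>w. w \<in> space M \<Longrightarrow> \<bar>\<kappa> w\<bar> \<le> C"
  shows "integrable M (\<lambda>w. \<kappa> w * (W b w - W c w) * (W d w - W c w))"
    and "(\<integral>w. \<kappa> w * (W b w - W c w) * (W d w - W c w) \<partial>M) = (\<integral>w. \<kappa> w \<partial>M) * (b - c)"
proof -
  interpret Fc: subalgebra_prob M "F c" using t by (intro subalgebra_prob_F)
  interpret Fb: subalgebra_prob M "F b" using t by (intro subalgebra_prob_F) auto
  have [measurable]: "\<kappa> \<in> borel_measurable M" by (rule Fc.measurable_G[OF \<kappa>(1)])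
  have k: "integrable M \<kappa>" using \<kappa>(2) by (intro integrable_const_bound[of _ C]) auto
  have [measurable]: "\<kappa> \<in> borel_measurable (F b)" using F_mono[OF _ _ \<kappa>(1)] t by auto
  have [measurable]: "W b \<in> borel_measurable (F b)" "W c \<in> borel_measurable (F b)"
    using bm_adapted[OF W] t by auto
  note ib = bm_increment[OF W t(1,2)] and id = bm_increment[OF W _ t(3)]
  have 1: "integrable M (\<lambda>w. \<kappa> w * (W b w - W c w)\<^sup>2)"
    "(\<integral>w. \<kappa> w * (W b w - W c w)\<^sup>2 \<partial>M) = (b - c) * (\<integral>w. \<kappa> w \<partial>M)"
    using Fc.indep_gauss_square[OF ib \<kappa>(1) k] t by auto
  have "integrable M (\<lambda>w. \<kappa> w * (W b w - W c w))" by (rule Fc.indep_gauss_mean[OF ib \<kappa>(1) k])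
  then have 2: "integrable M (\<lambda>w. \<kappa> w * (W b w - W c w) * (W d w - W b w))"
    "(\<integral>w. \<kappa> w * (W b w - W c w) * (W d w - W b w) \<partial>M) = 0"
    using t by (auto intro!: Fb.indep_gauss_mean[OF id])
  have eq: "\<kappa> w * (W b w - W c w) * (W d w - W c w)
      = \<kappa> w * (W b w - W c w)\<^sup>2 + \<kappa> w * (W b w - W c w) * (W d w - W b w)" for w
    by (simp add: algebra_simps power2_eq_square)
  show "integrable M (\<lambda>w. \<kappa> w * (W b w - W c w) * (W d w - W c w))"
    unfolding eq using 1 2 by simp
  show "(\<integral>w. \<kappa> w * (W b w - W c w) * (W d w - W c w) \<partial>M) = (\<integral>w. \<kappa> w \<partial>M) * (b - c)"
    unfolding eq using 1 2 by simp
qed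

lemma bm_products_same_start:
  assumes W: "brownian_motion M F W" and t: "0 \<le> c" "c \<le> b" "c \<le> d"
    and \<kappa>: "\<kappa> \<in> borel_measurable (F c)" "\<And>w. w \<in> space M \<Longrightarrow> \<bar>\<kappa> w\<bar> \<le> C"
  shows "integrable M (\<lambda>w. \<kappa> w * (W b w - W c w) * (W d w - W c w))
    \<and> (\<integral>w. \<kappa> w * (W b w - W c w) * (W d w - W c w) \<partial>M) = (\<integral>w. \<kappa> w \<partial>M) * (min b d - c)"
proof (cases "b \<le> d")
  case True
  then show ?thesis using bm_products_aux[OF W t(1,2) True \<kappa>] by (simp add: min_def)
next
  case False
  then have "d \<le> b" by simp
  then show ?thesis using bm_products_aux[OF W t(1,3) \<open>d \<le> b\<close> \<kappa>] by (simp add: min_def mult_ac)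
qed

lemma bm_products_ordered:
  assumes W: "brownian_motion M F W" and t: "0 \<le> a" "a \<le> b" "c \<le> d" "a \<le> c"
    and \<xi>: "\<xi> \<in> borel_measurable (F a)" "\<And>w. w \<in> space M \<Longrightarrow> \<bar>\<xi> w\<bar> \<le> C"
    and \<eta>: "\<eta> \<in> borel_measurable (F c)" "\<And>w. w \<in> space M \<Longrightarrow> \<bar>\<eta> w\<bar> \<le> C'"
  shows "integrable M (\<lambda>w. \<xi> w * \<eta> w * (W b w - W a w) * (W d w - W c w))
    \<and> (\<integral>w. \<xi> w * \<eta> w * (W b w - W a w) * (W d w - W c w) \<partial>M)
        = (\<integral>w. \<xi> w * \<eta> w \<partial>M) * max 0 (min b d - c)"
proof -
  have [simp]: "0 \<le> c" using t by simp
  interpret Fa: subalgebra_prob M "F a" using t by (intro subalgebra_prob_F)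
  interpret Fc: subalgebra_prob M "F c" using t by (intro subalgebra_prob_F) auto
  have [measurable]: "\<xi> \<in> borel_measurable M" by (rule Fa.measurable_G[OF \<xi>(1)])
  have [measurable]: "\<eta> \<in> borel_measurable M" by (rule Fc.measurable_G[OF \<eta>(1)])
  have \<xi>c[measurable]: "\<xi> \<in> borel_measurable (F c)" using F_mono[OF _ _ \<xi>(1)] t by auto
  note \<eta>(1)[measurable]
  have bd: "\<bar>\<xi> w * \<eta> w\<bar> \<le> C * C'" if "w \<in> space M" for w
    using \<xi>(2)[OF that] \<eta>(2)[OF that] by (simp add: abs_mult mult_mono')
  have z: "integrable M (\<lambda>w. \<xi> w * \<eta> w * (W e w - W a w) * (W d w - W c w))
      \<and> (\<integral>w. \<xi> w * \<eta> w * (W e w - W a w) * (W d w - W c w) \<partial>M) = 0" if e: "a \<le> e" "e \<le> c" for e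
  proof -
    have [measurable]: "W e \<in> borel_measurable (F c)" "W a \<in> borel_measurable (F c)"
      using bm_adapted[OF W] t e by auto
    have [measurable]: "W e \<in> borel_measurable M" "W a \<in> borel_measurable M"
      using bm_measurable[OF W] t e by auto
    have "integrable M (\<lambda>w. 1 * (W e w - W a w))"
      by (rule Fa.indep_gauss_mean(1)[OF bm_increment[OF W t(1) e(1)]]) auto
    then have i: "integrable M (\<lambda>w. C * C' * (1 * (W e w - W a w)))"
      by (rule integrable_mult_right)
    have "integrable M (\<lambda>w. \<xi> w * \<eta> w * (W e w - W a w))"
    proof (rule Bochner_Integration.integrable_bound[OF i])
      show "(\<lambda>w. \<xi> w * \<eta> w * (W e w - W a w)) \<in> borel_measurable M" by measurable
      show "AE w in M. norm (\<xi> w * \<eta> w * (W e w - W a w)) \<le> norm (C * C' * (1 * (W e w - W a w)))"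
      proof (rule AE_I2)
        fix w assume "w \<in> space M"
        then have "\<bar>\<xi> w * \<eta> w\<bar> \<le> \<bar>C * C'\<bar>" using bd abs_ge_self order_trans by blast
        then show "norm (\<xi> w * \<eta> w * (W e w - W a w)) \<le> norm (C * C' * (1 * (W e w - W a w)))"
          by (simp add: abs_mult mult_right_mono)
      qed
    qed
    then show ?thesis
      using Fc.indep_gauss_mean[OF bm_increment[OF W \<open>0 \<le> c\<close> t(3)], of "\<lambda>w. \<xi> w * \<eta> w * (W e w - W a w)"]
      by simp
  qed
  show ?thesis
  proof (cases "b \<le> c")
    case True
    then show ?thesis using z[OF t(2) True] t by (simp add: max_def min_def)
  next
    case False
    have 1: "integrable M (\<lambda>w. \<xi> w * \<eta> w * (W c w - W a w) * (W d w - W c w))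
      \<and> (\<integral>w. \<xi> w * \<eta> w * (W c w - W a w) * (W d w - W c w) \<partial>M) = 0"
      using z[OF t(4)] by simp
    have 2: "integrable M (\<lambda>w. (\<xi> w * \<eta> w) * (W b w - W c w) * (W d w - W c w))
    \<and> (\<integral>w. (\<xi> w * \<eta> w) * (W b w - W c w) * (W d w - W c w) \<partial>M) = (\<integral>w. \<xi> w * \<eta> w \<partial>M) * (min b d - c)"
      by (rule bm_products_same_start[OF W _ _ t(3)]) (use False bd in auto)
    have eq: "\<xi> w * \<eta> w * (W b w - W a w) * (W d w - W c w)
      = \<xi> w * \<eta> w * (W c w - W a w) * (W d w - W c w) + \<xi> w * \<eta> w * (W b w - W c w) * (W d w - W c w)" for w
      by (simp add: algebra_simps)
    have m: "max 0 (min b d - c) = min b d - c" using t False by simp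
    show ?thesis unfolding eq m
      using 1 2 by (simp only: Bochner_Integration.integrable_add Bochner_Integration.integral_add) simp
  qed
qed

lemma bm_products:
  assumes W: "brownian_motion M F W" and t: "0 \<le> a" "a \<le> b" "0 \<le> c" "c \<le> d"
    and \<xi>: "\<xi> \<in> borel_measurable (F a)" "\<And>w. w \<in> space M \<Longrightarrow> \<bar>\<xi> w\<bar> \<le> C"
    and \<eta>: "\<eta> \<in> borel_measurable (F c)" "\<And>w. w \<in> space M \<Longrightarrow> \<bar>\<eta> w\<bar> \<le> C'"
  shows "integrable M (\<lambda>w. (\<xi> w * (W b w - W a w)) * (\<eta> w * (W d w - W c w)))
    \<and> (\<integral>w. (\<xi> w * (W b w - W a w)) * (\<eta> w * (W d w - W c w)) \<partial>M)
        = (\<integral>w. \<xi> w * \<eta> w \<partial>M) * measure lborel ({a<..b} \<inter> {c<..d})"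
proof -
  have eq: "{a<..b} \<inter> {c<..d} = {max a c<..min b d}" by auto
  have m: "measure lborel ({a<..b} \<inter> {c<..d}) = max 0 (min b d - max a c)"
    unfolding eq by (cases "max a c \<le> min b d") (auto simp: max_def)
  show ?thesis
  proof (cases "a \<le> c")
    case True
    then have "max a c = c" by simp
    then show ?thesis
      using bm_products_ordered[OF W t(1,2,4) True \<xi> \<eta>] unfolding m by (simp add: mult_ac)
  next
    case False
    then have ca: "c \<le> a" and "max a c = a" by auto
    then show ?thesis
      using bm_products_ordered[OF W t(3,4,2) ca \<eta> \<xi>] unfolding m by (simp add: mult_ac min.commute)
  qed
qed

text \<open>Increments over disjoint intervals are orthogonal, and the overlap contributes its length. Allowing
  arbitrary overlaps gives the isometry for differences of simple processes over different grids without
  passing to a common refinement.\<close>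

lemma bm_products_stopped:
  assumes W: "brownian_motion M F W" and t: "0 \<le> a" "a \<le> b" "0 \<le> c" "c \<le> d" "0 \<le> T"
    and \<xi>: "\<xi> \<in> borel_measurable (F a)" "\<And>w. w \<in> space M \<Longrightarrow> \<bar>\<xi> w\<bar> \<le> C"
    and \<eta>: "\<eta> \<in> borel_measurable (F c)" "\<And>w. w \<in> space M \<Longrightarrow> \<bar>\<eta> w\<bar> \<le> C'"
  shows "integrable M (\<lambda>w. (\<xi> w * (W (min T b) w - W (min T a) w)) * (\<eta> w * (W (min T d) w - W (min T c) w)))
    \<and> (\<integral>w. (\<xi> w * (W (min T b) w - W (min T a) w)) * (\<eta> w * (W (min T d) w - W (min T c) w)) \<partial>M)
        = (\<integral>w. \<xi> w * \<eta> w \<partial>M) * measure lborel ({a<..b} \<inter> {c<..d} \<inter> {0..T})"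
proof (cases "a \<le> T \<and> c \<le> T")
  case True
  have "{a<..min T b} \<inter> {c<..min T d} = {a<..b} \<inter> {c<..d} \<inter> {0..T}" using t by auto
  moreover have "min T a = a" "min T c = c" using True by auto
  ultimately show ?thesis
    using bm_products[OF W t(1) _ t(3) _ \<xi> \<eta>, of "min T b" "min T d"] True t by simp
next
  case False
  then have "min T a = min T b \<or> min T c = min T d" using t by auto
  moreover have "{a<..b} \<inter> {c<..d} \<inter> {0..T} = {}" using False by auto
  ultimately show ?thesis by auto
qed

lemma elementary_isometry:
  fixes I :: "'i set"
  assumes W: "brownian_motion M F W" and T: "0 \<le> T" and I: "finite I"
    and ab: "\<And>i. i \<in> I \<Longrightarrow> 0 \<le> a i" "\<And>i. i \<in> I \<Longrightarrow> a i \<le> b i"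
    and \<xi>: "\<And>i. i \<in> I \<Longrightarrow> \<xi> i \<in> borel_measurable (F (a i))"
      "\<And>i w. i \<in> I \<Longrightarrow> w \<in> space M \<Longrightarrow> \<bar>\<xi> i w\<bar> \<le> C i"
  shows "(\<integral>\<^sup>+w. ennreal ((\<Sum>i\<in>I. \<xi> i w * (W (min T (b i)) w - W (min T (a i)) w))\<^sup>2) \<partial>M)
    = mean_int_square M (\<lambda>s w. \<Sum>i\<in>I. \<xi> i w * indicator {a i<..b i} s) T"
proof -
  define inc where "inc i w = W (min T (b i)) w - W (min T (a i)) w" for i w
  define l where "l i j = measure lborel ({a i<..b i} \<inter> {a j<..b j} \<inter> {0..T})" for i j
  have [measurable]: "\<xi> i \<in> borel_measurable M" if "i \<in> I" for i
    by (rule F_le_M[OF _ \<xi>(1)]) (use that ab in auto)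
  have P: "integrable M (\<lambda>w. (\<xi> i w * inc i w) * (\<xi> j w * inc j w))
    \<and> (\<integral>w. (\<xi> i w * inc i w) * (\<xi> j w * inc j w) \<partial>M) = (\<integral>w. \<xi> i w * \<xi> j w \<partial>M) * l i j"
    if "i \<in> I" "j \<in> I" for i j
    unfolding inc_def l_def by (rule bm_products_stopped[OF W]) (use that ab \<xi> T in auto)
  have X: "integrable M (\<lambda>w. \<xi> i w * \<xi> j w)" if "i \<in> I" "j \<in> I" for i j
    using that \<xi>(2) by (intro integrable_const_bound[of _ "C i * C j"]) (auto simp: abs_mult intro!: mult_mono')
  have sq: "(\<Sum>i\<in>I. \<xi> i w * inc i w)\<^sup>2 = (\<Sum>i\<in>I. \<Sum>j\<in>I. (\<xi> i w * inc i w) * (\<xi> j w * inc j w))" for w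
    by (simp add: power2_eq_square sum_product)
  have int: "integrable M (\<lambda>w. (\<Sum>i\<in>I. \<xi> i w * inc i w)\<^sup>2)"
    unfolding sq using P by (auto intro!: Bochner_Integration.integrable_sum)
  have "(\<integral>\<^sup>+w. ennreal ((\<Sum>i\<in>I. \<xi> i w * inc i w)\<^sup>2) \<partial>M) = ennreal (\<integral>w. (\<Sum>i\<in>I. \<xi> i w * inc i w)\<^sup>2 \<partial>M)"
    by (rule nn_integral_eq_integral[OF int]) simp
  also have "(\<integral>w. (\<Sum>i\<in>I. \<xi> i w * inc i w)\<^sup>2 \<partial>M) = (\<Sum>i\<in>I. \<Sum>j\<in>I. (\<integral>w. \<xi> i w * \<xi> j w \<partial>M) * l i j)"
    unfolding sq using P by (simp add: Bochner_Integration.integral_sum Bochner_Integration.integrable_sum)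
  also have "\<dots> = (\<integral>w. (\<Sum>i\<in>I. \<Sum>j\<in>I. \<xi> i w * \<xi> j w * l i j) \<partial>M)"
    using X by (simp add: Bochner_Integration.integral_sum Bochner_Integration.integrable_sum)
  finally have L: "(\<integral>\<^sup>+w. ennreal ((\<Sum>i\<in>I. \<xi> i w * inc i w)\<^sup>2) \<partial>M)
    = ennreal (\<integral>w. (\<Sum>i\<in>I. \<Sum>j\<in>I. \<xi> i w * \<xi> j w * l i j) \<partial>M)" .
  define g where "g i j s = (indicator ({a i<..b i} \<inter> {a j<..b j} \<inter> {0..T}) s :: real)" for i j s
  have gi: "has_bochner_integral lborel (g i j) (l i j)" for i j
  proof -
    have "emeasure lborel ({a i<..b i} \<inter> {a j<..b j} \<inter> {0..T}) \<le> emeasure lborel {0..T}"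
      by (rule emeasure_mono) auto
    also have "\<dots> < \<infinity>" using T by simp
    finally show ?thesis unfolding g_def l_def by (intro has_bochner_integral_real_indicator) auto
  qed
  have inner: "(\<integral>\<^sup>+s\<in>{0..T}. ennreal ((\<Sum>i\<in>I. \<xi> i w * indicator {a i<..b i} s)\<^sup>2) \<partial>lborel)
      = ennreal (\<Sum>i\<in>I. \<Sum>j\<in>I. \<xi> i w * \<xi> j w * l i j)"
    and pos: "0 \<le> (\<Sum>i\<in>I. \<Sum>j\<in>I. \<xi> i w * \<xi> j w * l i j)" for w
  proof -
    have e: "(\<Sum>i\<in>I. \<xi> i w * indicator {a i<..b i} s)\<^sup>2 * indicator {0..T} s
        = (\<Sum>i\<in>I. \<Sum>j\<in>I. \<xi> i w * \<xi> j w * g i j s)" for s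
    proof -
      have gs: "g i j s = indicator {a i<..b i} s * indicator {a j<..b j} s * indicator {0..T} s" for i j
        by (auto simp: g_def split: split_indicator)
      have "(\<Sum>i\<in>I. \<xi> i w * indicator {a i<..b i} s)\<^sup>2 * indicator {0..T} s
          = (\<Sum>i\<in>I. \<Sum>j\<in>I. (\<xi> i w * indicator {a i<..b i} s) * (\<xi> j w * indicator {a j<..b j} s)
              * indicator {0..T} s)"
        unfolding power2_eq_square sum_product by (simp only: sum_distrib_right)
      also have "\<dots> = (\<Sum>i\<in>I. \<Sum>j\<in>I. \<xi> i w * \<xi> j w * g i j s)"
        unfolding gs by (intro sum.cong refl) (simp only: mult_ac)
      finally show ?thesis .
    qed
    have h: "has_bochner_integral lborel (\<lambda>s. \<Sum>i\<in>I. \<Sum>j\<in>I. \<xi> i w * \<xi> j w * g i j s)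
        (\<Sum>i\<in>I. \<Sum>j\<in>I. \<xi> i w * \<xi> j w * l i j)"
      by (intro has_bochner_integral_sum has_bochner_integral_mult_right gi)
    have "(\<integral>\<^sup>+s\<in>{0..T}. ennreal ((\<Sum>i\<in>I. \<xi> i w * indicator {a i<..b i} s)\<^sup>2) \<partial>lborel)
      = (\<integral>\<^sup>+s. ennreal (\<Sum>i\<in>I. \<Sum>j\<in>I. \<xi> i w * \<xi> j w * g i j s) \<partial>lborel)"
      by (intro nn_integral_cong) (auto simp flip: e split: split_indicator)
    also have "\<dots> = ennreal (\<Sum>i\<in>I. \<Sum>j\<in>I. \<xi> i w * \<xi> j w * l i j)"
      using h by (subst nn_integral_eq_integral)
        (auto simp: has_bochner_integral_iff simp flip: e)
    finally show "(\<integral>\<^sup>+s\<in>{0..T}. ennreal ((\<Sum>i\<in>I. \<xi> i w * indicator {a i<..b i} s)\<^sup>2) \<partial>lborel)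
      = ennreal (\<Sum>i\<in>I. \<Sum>j\<in>I. \<xi> i w * \<xi> j w * l i j)" .
    have "(\<Sum>i\<in>I. \<Sum>j\<in>I. \<xi> i w * \<xi> j w * l i j) = (\<integral>s. (\<Sum>i\<in>I. \<xi> i w * indicator {a i<..b i} s)\<^sup>2 * indicator {0..T} s \<partial>lborel)"
      unfolding e using h by (simp add: has_bochner_integral_iff)
    then show "0 \<le> (\<Sum>i\<in>I. \<Sum>j\<in>I. \<xi> i w * \<xi> j w * l i j)" by simp
  qed
  have "mean_int_square M (\<lambda>s w. \<Sum>i\<in>I. \<xi> i w * indicator {a i<..b i} s) T
      = (\<integral>\<^sup>+w. ennreal (\<Sum>i\<in>I. \<Sum>j\<in>I. \<xi> i w * \<xi> j w * l i j) \<partial>M)"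
    unfolding mean_int_square_def inner ..
  also have "\<dots> = ennreal (\<integral>w. (\<Sum>i\<in>I. \<Sum>j\<in>I. \<xi> i w * \<xi> j w * l i j) \<partial>M)"
    by (rule nn_integral_eq_integral) (use X pos in \<open>auto intro!: Bochner_Integration.integrable_sum\<close>)
  finally show ?thesis unfolding L[unfolded inc_def] by simp
qed

lemma simple_dataD:
  assumes "simple_data M F n u \<xi>"
  shows "i \<le> n \<Longrightarrow> 0 \<le> u i" "i < n \<Longrightarrow> u i \<le> u (Suc i)"
    and "i < n \<Longrightarrow> \<xi> i \<in> borel_measurable (F (u i))" "i < n \<Longrightarrow> \<exists>C. \<forall>w\<in>space M. \<bar>\<xi> i w\<bar> \<le> C"
    and "i < n \<Longrightarrow> \<xi> i \<in> borel_measurable M"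
proof -
  show 1: "0 \<le> u i" if "i \<le> n" for i
    using that
  proof (induction i)
    case (Suc i)
    then have "0 \<le> u i" "u i \<le> u (Suc i)" using assms by (auto simp: simple_data_def)
    then show ?case by simp
  qed (use assms in \<open>auto simp: simple_data_def\<close>)
  show "i < n \<Longrightarrow> \<xi> i \<in> borel_measurable M"
    using assms 1[of i] by (intro F_le_M[of "u i"]) (auto simp: simple_data_def)
qed (use assms in \<open>auto simp: simple_data_def\<close>)

lemma simple_diff_isometry:
  assumes W: "brownian_motion M F W" and T: "0 \<le> T"
    and d1: "simple_data M F n u \<xi>" and d2: "simple_data M F m v \<eta>"
  shows "(\<integral>\<^sup>+w. ennreal ((simple_integral W n u \<xi> T w - simple_integral W m v \<eta> T w)\<^sup>2) \<partial>M)
    = mean_int_square M (\<lambda>s w. simple_process n u \<xi> s w - simple_process m v \<eta> s w) T"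
proof -
  obtain C where C: "\<And>i w. i < n \<Longrightarrow> w \<in> space M \<Longrightarrow> \<bar>\<xi> i w\<bar> \<le> C i"
    using simple_dataD(4)[OF d1] by metis
  obtain C' where C': "\<And>i w. i < m \<Longrightarrow> w \<in> space M \<Longrightarrow> \<bar>\<eta> i w\<bar> \<le> C' i"
    using simple_dataD(4)[OF d2] by metis
  define I where "I = {..<n} <+> {..<m}"
  define a where "a = case_sum u v"
  define b where "b = case_sum (\<lambda>i. u (Suc i)) (\<lambda>i. v (Suc i))"
  define \<zeta> where "\<zeta> = case_sum \<xi> (\<lambda>i w. - \<eta> i w)"
  have 1: "(\<Sum>i\<in>I. \<zeta> i w * (W (min T (b i)) w - W (min T (a i)) w))
      = simple_integral W n u \<xi> T w - simple_integral W m v \<eta> T w" for w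
    by (simp add: I_def a_def b_def \<zeta>_def sum.Plus simple_integral_def sum_negf)
  have 2: "(\<Sum>i\<in>I. \<zeta> i w * indicator {a i<..b i} s) = simple_process n u \<xi> s w - simple_process m v \<eta> s w" for s w
    unfolding I_def simple_process_def
    by (subst sum.Plus) (auto simp: a_def b_def \<zeta>_def sum_negf)
  show ?thesis
    unfolding 1[symmetric] 2[symmetric]
  proof (rule elementary_isometry[OF W T, where C="case_sum C C'"])
    show "\<And>i. i \<in> I \<Longrightarrow> \<zeta> i \<in> borel_measurable (F (a i))"
      using simple_dataD(3)[OF d1] simple_dataD(3)[OF d2] by (auto simp: I_def a_def \<zeta>_def)
    show "\<And>i w. i \<in> I \<Longrightarrow> w \<in> space M \<Longrightarrow> \<bar>\<zeta> i w\<bar> \<le> case_sum C C' i"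
      using C C' by (auto simp: I_def \<zeta>_def)
  qed (use simple_dataD(1,2)[OF d1] simple_dataD(1,2)[OF d2] in \<open>auto simp: I_def a_def b_def\<close>)
qed

text \<open>Measurability on \<open>[0, T] \<times> \<Omega>\<close>, written with an indicator so that sums and differences stay on one
  product space.\<close>

definition jointly_measurable_on :: "real \<Rightarrow> ('w, real) process \<Rightarrow> bool" where
  "jointly_measurable_on T H \<longleftrightarrow> (\<lambda>(s, w). indicator {0..T} s * H s w) \<in> borel_measurable (borel \<Otimes>\<^sub>M M)"

lemma progressive_jointly_measurable:
  assumes "progressive F H" "0 \<le> T"
  shows "jointly_measurable_on T H"
proof -
  have [measurable]: "(\<lambda>(s, w). H s w) \<in> borel_measurable (restrict_space borel {0..T} \<Otimes>\<^sub>M F T)"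
    using assms by (auto simp: progressive_def)
  interpret FT: subalgebra_prob M "F T" using assms by (intro subalgebra_prob_F)
  have [measurable]: "(\<lambda>s::real. max 0 (min T s)) \<in> measurable borel (restrict_space borel {0..T})"
    using assms by (intro measurable_restrict_space2) auto
  note FT.id_measurable[measurable]
  \<comment> \<open>Clamping the time to \<open>[0, T]\<close> maps the full product space into the one on which \<open>H\<close> is measurable.\<close>
  have "(\<lambda>z. (\<lambda>(s, w). H s w) (max 0 (min T (fst z)), snd z)) \<in> borel_measurable (borel \<Otimes>\<^sub>M M)"
    by measurable
  then have "(\<lambda>z. indicator {0..T} (fst z) * H (max 0 (min T (fst z))) (snd z)) \<in> borel_measurable (borel \<Otimes>\<^sub>M M)"
    by simp
  also have "(\<lambda>z. indicator {0..T} (fst z) * H (max 0 (min T (fst z))) (snd z))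
    = (\<lambda>(s, w). indicator {0..T} s * H s w)"
    by (auto simp: fun_eq_iff split: split_indicator)
  finally show ?thesis by (simp add: jointly_measurable_on_def)
qed

lemma simple_process_jointly_measurable:
  assumes "simple_data M F n u \<xi>"
  shows "jointly_measurable_on T (simple_process n u \<xi>)"
proof -
  have [measurable]: "i < n \<Longrightarrow> \<xi> i \<in> borel_measurable M" for i using simple_dataD(5)[OF assms] .
  show ?thesis unfolding jointly_measurable_on_def simple_process_def by measurable
qed

lemma jointly_measurable_diff:
  assumes "jointly_measurable_on T H" "jointly_measurable_on T K"
  shows "jointly_measurable_on T (\<lambda>s w. H s w - K s w)"
  using borel_measurable_diff[OF assms[unfolded jointly_measurable_on_def]]
  by (simp add: jointly_measurable_on_def split_beta' right_diff_distrib)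

lemma mean_int_square_indicator:
  "mean_int_square M H T = (\<integral>\<^sup>+w. \<integral>\<^sup>+s. ennreal ((indicator {0..T} s * H s w)\<^sup>2) \<partial>lborel \<partial>M)"
  unfolding mean_int_square_def by (intro nn_integral_cong) (auto split: split_indicator)

lemma jointly_measurable_inner:
  assumes "jointly_measurable_on T H"
  shows "(\<lambda>w. \<integral>\<^sup>+s. ennreal ((indicator {0..T} s * H s w)\<^sup>2) \<partial>lborel) \<in> borel_measurable M"
    and "w \<in> space M \<Longrightarrow> (\<lambda>s. indicator {0..T} s * H s w) \<in> borel_measurable borel"
proof -
  have "(\<lambda>(w, s). ennreal ((indicator {0..T} s * H s w)\<^sup>2)) \<in> borel_measurable (M \<Otimes>\<^sub>M lborel)"
    using measurable_compose[OF measurable_Pair[OF measurable_snd measurable_fst] assms[unfolded jointly_measurable_on_def]]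
    by (simp add: split_beta')
  then show "(\<lambda>w. \<integral>\<^sup>+s. ennreal ((indicator {0..T} s * H s w)\<^sup>2) \<partial>lborel) \<in> borel_measurable M"
    by (rule lborel.borel_measurable_nn_integral)
  assume w: "w \<in> space M"
  show "(\<lambda>s. indicator {0..T} s * H s w) \<in> borel_measurable borel"
    using measurable_compose[OF measurable_Pair2'[OF w, of borel] assms[unfolded jointly_measurable_on_def]] by simp
qed

lemma mean_int_square_triangle:
  assumes "jointly_measurable_on T (\<lambda>s w. H s w - K s w)" "jointly_measurable_on T (\<lambda>s w. K s w - L s w)"
  shows "mean_int_square M (\<lambda>s w. H s w - L s w) T
    \<le> 2 * mean_int_square M (\<lambda>s w. H s w - K s w) T + 2 * mean_int_square M (\<lambda>s w. K s w - L s w) T"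
proof -
  let ?a = "\<lambda>s w. indicator {0..T} s * (H s w - K s w)"
  let ?b = "\<lambda>s w. indicator {0..T} s * (K s w - L s w)"
  note eq = mean_int_square_indicator
  note meas = jointly_measurable_inner(1)[OF assms(1)] jointly_measurable_inner(1)[OF assms(2)]
  have ms: "(\<lambda>s. ?a s w) \<in> borel_measurable lborel" "(\<lambda>s. ?b s w) \<in> borel_measurable lborel"
    if "w \<in> space M" for w
    using jointly_measurable_inner(2)[OF assms(1) that] jointly_measurable_inner(2)[OF assms(2) that] by simp_all
  have "mean_int_square M (\<lambda>s w. H s w - L s w) T
    \<le> (\<integral>\<^sup>+w. \<integral>\<^sup>+s. 2 * ennreal ((?a s w)\<^sup>2) + 2 * ennreal ((?b s w)\<^sup>2) \<partial>lborel \<partial>M)"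
    unfolding eq
  proof (intro nn_integral_mono)
    fix w s
    show "ennreal ((indicator {0..T} s * (H s w - L s w))\<^sup>2) \<le> 2 * ennreal ((?a s w)\<^sup>2) + 2 * ennreal ((?b s w)\<^sup>2)"
      using ennreal_square_triangle[of "H s w" "L s w" "K s w"] by (cases "s \<in> {0..T}") simp_all
  qed
  also have "\<dots> = (\<integral>\<^sup>+w. 2 * (\<integral>\<^sup>+s. ennreal ((?a s w)\<^sup>2) \<partial>lborel) + 2 * (\<integral>\<^sup>+s. ennreal ((?b s w)\<^sup>2) \<partial>lborel) \<partial>M)"
    by (intro nn_integral_cong, subst nn_integral_add) (use ms in \<open>auto simp: nn_integral_cmult\<close>)
  also have "\<dots> = 2 * mean_int_square M (\<lambda>s w. H s w - K s w) T + 2 * mean_int_square M (\<lambda>s w. K s w - L s w) T"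
    unfolding eq using meas by (subst nn_integral_add) (auto simp: nn_integral_cmult)
  finally show ?thesis .
qed

text \<open>The defining approximation of \<open>I\<close> may be exchanged for any simple process: two simple integrals differ
  in \<open>L\<^sup>2\<close> exactly as their integrands do. The factor 4 comes from using \<open>(a + b)\<^sup>2 \<le> 2 a\<^sup>2 + 2 b\<^sup>2\<close> twice.\<close>

lemma ito_integral_approx:
  assumes W: "brownian_motion M F W" and T: "0 \<le> T"
    and I: "is_ito_integral M F W H I" and d: "simple_data M F n u \<xi>"
  shows "(\<integral>\<^sup>+w. ennreal ((I T w - simple_integral W n u \<xi> T w)\<^sup>2) \<partial>M)
    \<le> 4 * mean_int_square M (\<lambda>s w. H s w - simple_process n u \<xi> s w) T"
proof -
  from I obtain n' u' \<xi>' where d': "\<And>k. simple_data M F (n' k) (u' k) (\<xi>' k)"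
    and lim1: "(\<lambda>k. mean_int_square M (\<lambda>s w. simple_process (n' k) (u' k) (\<xi>' k) s w - H s w) T) \<longlonglongrightarrow> 0"
    and lim2: "(\<lambda>k. \<integral>\<^sup>+w. ennreal ((simple_integral W (n' k) (u' k) (\<xi>' k) T w - I T w)\<^sup>2) \<partial>M) \<longlonglongrightarrow> 0"
    and H: "progressive F H" and ad: "adapted F I"
    using T unfolding is_ito_integral_def by blast
  define S where "S k = simple_integral W (n' k) (u' k) (\<xi>' k) T" for k
  define S0 where "S0 = simple_integral W n u \<xi> T"
  define e where "e = mean_int_square M (\<lambda>s w. H s w - simple_process n u \<xi> s w) T"
  define a where "a k = mean_int_square M (\<lambda>s w. simple_process (n' k) (u' k) (\<xi>' k) s w - H s w) T" for k
  define c where "c k = (\<integral>\<^sup>+w. ennreal ((S k w - I T w)\<^sup>2) \<partial>M)" for k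
  have si: "simple_integral W n u \<xi> T \<in> borel_measurable M" if "simple_data M F n u \<xi>" for n u \<xi>
  proof -
    have [measurable]: "i < n \<Longrightarrow> \<xi> i \<in> borel_measurable M" for i using simple_dataD(5)[OF that] .
    have [measurable]: "W (min T (u i)) \<in> borel_measurable M" if "i \<le> n" for i
      using simple_dataD(1)[OF \<open>simple_data M F n u \<xi>\<close> that] T by (intro bm_measurable[OF W]) auto
    show ?thesis unfolding simple_integral_def by (intro borel_measurable_sum borel_measurable_times borel_measurable_diff) auto
  qed
  have [measurable]: "S k \<in> borel_measurable M" "S0 \<in> borel_measurable M" for k
    unfolding S_def S0_def using si d' d by auto
  have [measurable]: "I T \<in> borel_measurable M"
    using ad T by (intro F_le_M[of T]) (auto simp: adapted_def)
  have jm: "jointly_measurable_on T H" by (rule progressive_jointly_measurable[OF H T])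
  have "(\<integral>\<^sup>+w. ennreal ((I T w - S0 w)\<^sup>2) \<partial>M) \<le> 2 * c k + 4 * a k + 4 * e" for k
  proof -
    have "(\<integral>\<^sup>+w. ennreal ((S k w - S0 w)\<^sup>2) \<partial>M)
        = mean_int_square M (\<lambda>s w. simple_process (n' k) (u' k) (\<xi>' k) s w - simple_process n u \<xi> s w) T"
      unfolding S_def S0_def by (rule simple_diff_isometry[OF W T d' d])
    also have "\<dots> \<le> 2 * a k + 2 * e"
      unfolding a_def e_def
      by (intro mean_int_square_triangle jointly_measurable_diff simple_process_jointly_measurable d' d jm)
    finally have le: "(\<integral>\<^sup>+w. ennreal ((S k w - S0 w)\<^sup>2) \<partial>M) \<le> 2 * a k + 2 * e" .
    have "(\<integral>\<^sup>+w. ennreal ((I T w - S0 w)\<^sup>2) \<partial>M)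
      \<le> (\<integral>\<^sup>+w. 2 * ennreal ((S k w - I T w)\<^sup>2) + 2 * ennreal ((S k w - S0 w)\<^sup>2) \<partial>M)"
      using ennreal_square_triangle[of "I T _" "S0 _" "S k _"]
      by (intro nn_integral_mono) (simp add: power2_commute[of "I T _"])
    also have "\<dots> = 2 * c k + 2 * (\<integral>\<^sup>+w. ennreal ((S k w - S0 w)\<^sup>2) \<partial>M)"
      by (simp add: nn_integral_add nn_integral_cmult c_def)
    also have "\<dots> \<le> 2 * c k + 2 * (2 * a k + 2 * e)"
      by (intro add_left_mono mult_left_mono le) simp
    also have "2 * c k + 2 * (2 * a k + 2 * e) = 2 * c k + 4 * a k + 4 * e"
      by (simp add: distrib_left mult.assoc[symmetric] add.assoc)
    finally show ?thesis .
  qed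
  moreover have "(\<lambda>k. 2 * c k + 4 * a k + 4 * e) \<longlonglongrightarrow> 2 * 0 + 4 * 0 + 4 * e"
    using lim1 lim2 unfolding a_def c_def S_def
    by (intro tendsto_add tendsto_const ennreal_tendsto_cmult) auto
  ultimately have "(\<integral>\<^sup>+w. ennreal ((I T w - S0 w)\<^sup>2) \<partial>M) \<le> 2 * 0 + 4 * 0 + 4 * e"
    by (intro LIMSEQ_le_const[of _ _ "\<integral>\<^sup>+w. ennreal ((I T w - S0 w)\<^sup>2) \<partial>M"]) blast+
  then show ?thesis by (simp add: S0_def e_def)
qed

end

section \<open>Paths and Markov property of the chain\<close>

lemma discrete_isolating_open:
  assumes "Isolated.discrete E" "x \<in> E"
  obtains U where "open U" "U \<inter> E = {x}"
proof -
  have "x isolated_in E" using assms by (simp add: discrete_def)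
  then show ?thesis unfolding isolated_in_def using that by blast
qed

lemma discrete_countable:
  fixes E :: "'a::second_countable_topology set"
  assumes "Isolated.discrete E"
  shows "countable E"
proof -
  obtain B :: "'a set set" where B: "countable B" "topological_basis B"
    using ex_countable_basis by (elim exE conjE)
  have "\<forall>x\<in>E. \<exists>b\<in>B. b \<inter> E = {x}"
  proof
    fix x assume x: "x \<in> E"
    obtain U where U: "open U" "U \<inter> E = {x}" by (rule discrete_isolating_open[OF assms x])
    have "x \<in> U" using U(2) by blast
    with B(2) U(1) obtain b where "b \<in> B" "x \<in> b" "b \<subseteq> U"
      by (rule topological_basisE)
    then have "b \<inter> E = {x}" using U(2) x by blast
    with \<open>b \<in> B\<close> show "\<exists>b\<in>B. b \<inter> E = {x}" by blast
  qed
  then have "\<forall>x\<in>E. \<exists>b. b \<in> B \<and> b \<inter> E = {x}" by blast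
  from bchoice[OF this] obtain g where g: "\<And>x. x \<in> E \<Longrightarrow> g x \<in> B" "\<And>x. x \<in> E \<Longrightarrow> g x \<inter> E = {x}"
    by blast
  have "inj_on g E"
  proof (rule inj_onI)
    fix x y assume xy: "x \<in> E" "y \<in> E" "g x = g y"
    have "{x} = g x \<inter> E" using g(2)[OF xy(1)] by simp
    also have "\<dots> = {y}" unfolding xy(3) by (rule g(2)[OF xy(2)])
    finally show "x = y" by simp
  qed
  moreover have "countable (g ` E)" by (rule countable_subset[OF _ B(1)]) (use g(1) in blast)
  ultimately show ?thesis by (rule countable_image_inj_on[rotated])
qed

lemma cadlag_discrete_right:
  assumes "Isolated.discrete E" "cadlag_in E f" "0 \<le> t"
  obtains d where "0 < d" "\<And>s. t \<le> s \<Longrightarrow> s < t + d \<Longrightarrow> f s = f t"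
proof -
  have ft: "f t \<in> E" "(f \<longlongrightarrow> f t) (at_right t)" using assms by (auto simp: cadlag_in_def)
  obtain U where U: "open U" "U \<inter> E = {f t}" by (rule discrete_isolating_open[OF assms(1) ft(1)])
  have "eventually (\<lambda>s. f s \<in> U) (at_right t)"
    using U ft(2) by (intro topological_tendstoD) auto
  then obtain b where b: "b > t" "\<And>y. y > t \<Longrightarrow> y < b \<Longrightarrow> f y \<in> U"
    by (auto simp: eventually_at_right_field)
  have *: "f s = f t" if "t \<le> s" "s < t + (b - t)" for s
  proof (cases "s = t")
    case False
    then have "f s \<in> U" using b(2)[of s] that by simp
    moreover have "f s \<in> E" using that assms(2,3) by (simp add: cadlag_in_def)
    ultimately have "f s \<in> {f t}" unfolding U(2)[symmetric] by (rule IntI)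
    then show ?thesis by (rule singletonD)
  qed simp
  show ?thesis by (rule that[of "b - t", OF _ *]) (use b(1) in simp)
qed

lemma cadlag_discrete_left:
  assumes "Isolated.discrete E" "cadlag_in E f" "0 < t"
  obtains d where "0 < d" "d \<le> t" "\<And>r s. t - d < r \<Longrightarrow> r < t \<Longrightarrow> t - d < s \<Longrightarrow> s < t \<Longrightarrow> f r = f s"
proof -
  obtain l where l: "l \<in> E" "(f \<longlongrightarrow> l) (at_left t)" using assms by (auto simp: cadlag_in_def)
  obtain U where U: "open U" "U \<inter> E = {l}" by (rule discrete_isolating_open[OF assms(1) l(1)])
  have "eventually (\<lambda>s. f s \<in> U) (at_left t)"
    using U l(2) by (intro topological_tendstoD) auto
  then obtain b where b: "b < t" "\<And>y. b < y \<Longrightarrow> y < t \<Longrightarrow> f y \<in> U"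
    by (auto simp: eventually_at_left_field)
  have *: "f s = l" if "t - min t (t - b) < s" "s < t" for s
  proof -
    have "b < s" "0 \<le> s" using that by (simp_all add: min_def split: if_splits)
    then have "f s \<in> U" "f s \<in> E" using b(2)[of s] that(2) assms(2) by (simp_all add: cadlag_in_def)
    then have "f s \<in> {l}" unfolding U(2)[symmetric] by (rule IntI)
    then show ?thesis by (rule singletonD)
  qed
  show ?thesis
  proof (rule that[of "min t (t - b)"])
    show "0 < min t (t - b)" using b(1) assms(3) by simp
    show "f r = f s" if "t - min t (t - b) < r" "r < t" "t - min t (t - b) < s" "s < t" for r s
      using *[OF that(1,2)] *[OF that(3,4)] by simp
  qed simp
qed

text \<open>Around each time a path in a discrete space is constant on the left and constant on the right, so one
  jump time per neighbourhood suffices; compactness, in the form of the Bolzano induction principle, leaves finitely many.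
  Stating that every change over \<open>(r, s]\<close> meets \<open>D\<close> makes the property additive over adjacent intervals.\<close>

lemma cadlag_discrete_finitely_many_jumps:
  assumes E: "Isolated.discrete E" and f: "cadlag_in E f" and T: "0 \<le> (T::real)"
  shows "\<exists>D. finite D \<and> (\<forall>r s. 0 \<le> r \<longrightarrow> r < s \<longrightarrow> s \<le> T \<longrightarrow> f r \<noteq> f s \<longrightarrow> D \<inter> {r<..s} \<noteq> {})"
proof -
  define Q where "Q a b \<longleftrightarrow> (\<exists>D. finite D \<and> (\<forall>r s. a \<le> r \<longrightarrow> 0 \<le> r \<longrightarrow> r < s \<longrightarrow> s \<le> b \<longrightarrow> f r \<noteq> f s \<longrightarrow> D \<inter> {r<..s} \<noteq> {}))"
    for a b
  have "Q 0 T"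
  proof (rule Bolzano[OF T])
    fix a b c assume "Q a b" "Q b c" and ord: "a \<le> b" "b \<le> c"
    then obtain D1 D2 where D: "finite D1" "finite D2"
      and D1: "\<And>r s. a \<le> r \<Longrightarrow> 0 \<le> r \<Longrightarrow> r < s \<Longrightarrow> s \<le> b \<Longrightarrow> f r \<noteq> f s \<Longrightarrow> D1 \<inter> {r<..s} \<noteq> {}"
      and D2: "\<And>r s. b \<le> r \<Longrightarrow> 0 \<le> r \<Longrightarrow> r < s \<Longrightarrow> s \<le> c \<Longrightarrow> f r \<noteq> f s \<Longrightarrow> D2 \<inter> {r<..s} \<noteq> {}"
      unfolding Q_def by blast
    have "(D1 \<union> D2) \<inter> {r<..s} \<noteq> {}" if rs: "a \<le> r" "0 \<le> r" "r < s" "s \<le> c" "f r \<noteq> f s" for r s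
    proof -
      consider "s \<le> b" | "b \<le> r" | "r < b" "b < s" "f r \<noteq> f b" | "r < b" "b < s" "f b \<noteq> f s"
        by (metis rs(5) linorder_not_le)
      then show ?thesis
      proof cases
        case 1 then show ?thesis using D1[of r s] rs by blast
      next
        case 2 then show ?thesis using D2[of r s] rs by blast
      next
        case 3
        then have "D1 \<inter> {r<..b} \<noteq> {}" using D1[of r b] rs by auto
        moreover have "{r<..b} \<subseteq> {r<..s}" using 3 by auto
        ultimately show ?thesis by blast
      next
        case 4
        then have "D2 \<inter> {b<..s} \<noteq> {}" using D2[of b s] rs by auto
        moreover have "{b<..s} \<subseteq> {r<..s}" using 4 by auto
        ultimately show ?thesis by blast
      qed
    qed
    then show "Q a c" unfolding Q_def using D by (intro exI[of _ "D1 \<union> D2"]) auto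
  next
    fix x assume x: "0 \<le> x" "x \<le> T"
    obtain d1 where d1: "0 < d1" "\<And>s. x \<le> s \<Longrightarrow> s < x + d1 \<Longrightarrow> f s = f x"
      by (rule cadlag_discrete_right[OF E f x(1)]) blast
    obtain d2 where d2: "0 < d2" "\<And>r s. x - d2 < r \<Longrightarrow> r < x \<Longrightarrow> x - d2 < s \<Longrightarrow> s < x \<Longrightarrow> 0 \<le> r \<Longrightarrow> 0 \<le> s \<Longrightarrow> f r = f s"
    proof (cases "x = 0")
      case True then show ?thesis by (intro that[of 1]) auto
    next
      case False
      then have "0 < x" using x by simp
      then obtain d where "0 < d" "\<And>r s. x - d < r \<Longrightarrow> r < x \<Longrightarrow> x - d < s \<Longrightarrow> s < x \<Longrightarrow> f r = f s"
        by (rule cadlag_discrete_left[OF E f]) blast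
      then show ?thesis by (intro that[of d])
    qed
    have "Q a b" if ab: "a \<le> x" "x \<le> b" "b - a < min d1 d2" for a b
      unfolding Q_def
    proof (intro exI[of _ "{x}"] conjI allI impI)
      fix r s assume rs: "a \<le> r" "0 \<le> r" "r < s" "s \<le> b" "f r \<noteq> f s"
      have "\<not> x \<le> r"
      proof
        assume "x \<le> r"
        then have "f r = f x" "f s = f x" using d1(2)[of r] d1(2)[of s] rs ab by auto
        with rs show False by simp
      qed
      moreover have "\<not> s < x"
      proof
        assume "s < x"
        then have "f r = f s" using d2(2)[of r s] rs ab by auto
        with rs show False by simp
      qed
      ultimately show "{x} \<inter> {r<..s} \<noteq> {}" by auto
    qed simp
    then show "\<exists>d>0. \<forall>a b. a \<le> x \<and> x \<le> b \<and> b - a < d \<longrightarrow> Q a b"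
      using d1(1) d2(1) by (intro exI[of _ "min d1 d2"]) auto
  qed
  then show ?thesis unfolding Q_def by blast
qed

locale markov_chain = filtered_prob M F for M :: "'w measure" and F +
  fixes E :: "(real ^ 'd) set" and P :: "real \<Rightarrow> real ^ 'd \<Rightarrow> (real ^ 'd) pmf"
    and z0 :: "real ^ 'd" and Z :: "('w, real ^ 'd) process"
  assumes chain: "markov_chain_from M F E P z0 Z"
begin

lemma discrete_E: "Isolated.discrete E" and z0_E: "z0 \<in> E" and feller: "feller E P"
  and markov: "markov_wrt M F E P Z" and cadlag: "w \<in> space M \<Longrightarrow> cadlag_in E (\<lambda>t. Z t w)"
  and start: "AE w in M. Z 0 w = z0"
  using chain by (auto simp: markov_chain_from_def)

lemma transition: "transition_function E P"
  using feller by (simp add: feller_def)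

lemma countable_E: "countable E"
  by (rule discrete_countable[OF discrete_E])

lemma Z_in_E: "w \<in> space M \<Longrightarrow> 0 \<le> t \<Longrightarrow> Z t w \<in> E"
  using cadlag by (auto simp: cadlag_in_def)

text \<open>The state space is countable, so the chain is measurable for the discrete sigma-algebra, and every
  function of it, Borel or not, is a random variable.\<close>

lemma Z_count_space: "0 \<le> s \<Longrightarrow> s \<le> t \<Longrightarrow> Z s \<in> measurable (F t) (count_space E)"
proof -
  assume st: "0 \<le> s" "s \<le> t"
  have "Z s \<in> borel_measurable (F s)" using markov st by (auto simp: markov_wrt_def adapted_def)
  then have "Z s \<in> borel_measurable (F t)" using F_mono st by blast
  then have "Z s -` {z} \<inter> space (F t) \<in> sets (F t)" for z
    by (rule measurable_sets) simp
  then show ?thesis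
    using Z_in_E st space_F[of t]
    by (simp add: measurable_count_space_eq_countable[OF countable_E] Pi_iff)
qed

lemma Z_measurable:
  assumes "0 \<le> s" "s \<le> t" "h \<in> E \<rightarrow> space K"
  shows "(\<lambda>w. h (Z s w)) \<in> measurable (F t) K"
  using assms by (intro measurable_compose[OF Z_count_space]) auto

lemma Z_measurable_M:
  assumes "0 \<le> s" "h \<in> E \<rightarrow> space K"
  shows "(\<lambda>w. h (Z s w)) \<in> measurable M K"
  using assms by (intro F_le_M[OF _ Z_measurable]) auto

text \<open>Right-continuous paths in a discrete space are eventually equal to their right-hand discretizations, whose
  joint measurability is a matter of countably many times. The maximum with 0 discards negative times, where
  nothing is known about the path.\<close>

lemma Z_jointly_measurable:
  fixes h :: "real ^ 'd \<Rightarrow> real"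
  shows "(\<lambda>(s, w). h (Z (max 0 s) w)) \<in> borel_measurable (borel \<Otimes>\<^sub>M M)"
proof -
  \<comment> \<open>the first point of the grid of mesh \<open>1 / Suc n\<close> strictly after \<open>s\<close>\<close>
  define d where "d n s = (real_of_int \<lfloor>max 0 s * real (Suc n)\<rfloor> + 1) / real (Suc n)" for n :: nat and s :: real
  have d: "max 0 s < d n s" "d n s \<le> max 0 s + 1 / real (Suc n)" for n s
  proof -
    have "max 0 s * real (Suc n) < real_of_int \<lfloor>max 0 s * real (Suc n)\<rfloor> + 1" by linarith
    then show "max 0 s < d n s" unfolding d_def by (simp only: pos_less_divide_eq of_nat_0_less_iff zero_less_Suc)
    have "real_of_int \<lfloor>max 0 s * real (Suc n)\<rfloor> + 1 \<le> max 0 s * real (Suc n) + 1" by linarith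
    then have "d n s \<le> (max 0 s * real (Suc n) + 1) / real (Suc n)"
      unfolding d_def by (intro divide_right_mono) auto
    then show "d n s \<le> max 0 s + 1 / real (Suc n)" by (simp add: add_divide_distrib)
  qed
  have "(\<lambda>z. h (Z (d n (fst z)) (snd z))) \<in> borel_measurable (borel \<Otimes>\<^sub>M M)" for n
  proof -
    have 1: "(\<lambda>z. h (Z (max 0 ((real_of_int i + 1) / real (Suc n))) (snd z))) \<in> borel_measurable ((borel :: real measure) \<Otimes>\<^sub>M M)" for i
      by (rule measurable_compose[OF measurable_snd Z_measurable_M]) auto
    have "(\<lambda>z. \<lfloor>max 0 (fst z) * real (Suc n)\<rfloor>) \<in> measurable ((borel :: real measure) \<Otimes>\<^sub>M M) (count_space UNIV)"
      by measurable
    then have "(\<lambda>z. (\<lambda>i z. h (Z (max 0 ((real_of_int i + 1) / real (Suc n))) (snd z)))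
        \<lfloor>max 0 (fst z) * real (Suc n)\<rfloor> z) \<in> borel_measurable ((borel :: real measure) \<Otimes>\<^sub>M M)"
      by (rule measurable_compose_countable[rotated]) (rule 1)
    then have "(\<lambda>z. h (Z (max 0 (d n (fst z))) (snd z))) \<in> borel_measurable (borel \<Otimes>\<^sub>M M)"
      by (simp only: d_def)
    moreover have "max 0 (d n s) = d n s" for s using d(1)[of s n] by simp
    ultimately show ?thesis by simp
  qed
  then show ?thesis
  proof (rule borel_measurable_LIMSEQ_real[rotated])
    fix z assume "z \<in> space ((borel :: real measure) \<Otimes>\<^sub>M M)"
    then obtain s w where z: "z = (s, w)" "w \<in> space M" by (auto simp: space_pair_measure)
    obtain e where e: "0 < e" "\<And>r. max 0 s \<le> r \<Longrightarrow> r < max 0 s + e \<Longrightarrow> Z r w = Z (max 0 s) w"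
      by (rule cadlag_discrete_right[OF discrete_E cadlag[OF z(2)], of "max 0 s"]) (simp, blast)
    have "eventually (\<lambda>n. 1 / real (Suc n) < e) sequentially"
      using order_tendstoD(2)[OF LIMSEQ_inverse_real_of_nat e(1)] by (simp add: inverse_eq_divide)
    then have "eventually (\<lambda>n. h (Z (d n (fst z)) (snd z)) = (case z of (s, w) \<Rightarrow> h (Z (max 0 s) w))) sequentially"
    proof eventually_elim
      case (elim n)
      have "Z (d n s) w = Z (max 0 s) w"
        using d(1)[of s n] d(2)[of n s] elim by (intro e(2)) auto
      then show ?case using z by simp
    qed
    then show "(\<lambda>n. h (Z (d n (fst z)) (snd z))) \<longlonglongrightarrow> (case z of (s, w) \<Rightarrow> h (Z (max 0 s) w))"
      by (rule tendsto_eventually)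
  qed
qed

lemma Z_jointly_measurable_on: "jointly_measurable_on T (\<lambda>s w. h (Z s w))"
proof -
  have [measurable]: "(\<lambda>z. h (Z (max 0 (fst z)) (snd z))) \<in> borel_measurable (borel \<Otimes>\<^sub>M M)"
    using Z_jointly_measurable[of h] by (simp add: split_beta')
  have "(\<lambda>z. indicator {0..T} (fst z) * h (Z (max 0 (fst z)) (snd z))) \<in> borel_measurable (borel \<Otimes>\<^sub>M M)"
    by measurable
  also have "(\<lambda>z. indicator {0..T} (fst z) * h (Z (max 0 (fst z)) (snd z))) = (\<lambda>(s, w). indicator {0..T} s * h (Z s w))"
    by (auto simp: fun_eq_iff split: split_indicator)
  finally show ?thesis by (simp add: jointly_measurable_on_def)
qed

lemma semigroup_bounded:
  assumes "\<And>z. \<bar>f z\<bar> \<le> C"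
  shows "\<bar>semigroup_op P t f z\<bar> \<le> C"
proof -
  have "\<bar>semigroup_op P t f z\<bar> \<le> measure_pmf.expectation (P t z) (\<lambda>x. \<bar>f x\<bar>)"
    unfolding semigroup_op_def using integral_norm_bound[of "measure_pmf (P t z)" f] by simp
  also have "\<dots> \<le> C"
    using assms by (intro measure_pmf.integral_le_const measure_pmf.integrable_const_bound[of _ C]) auto
  finally show ?thesis .
qed

lemma markov_real:
  assumes st: "0 \<le> s" "0 \<le> t" and f: "\<And>z. \<bar>f z\<bar> \<le> C"
    and \<xi>: "\<xi> \<in> borel_measurable (F s)" and i: "integrable M \<xi>"
  shows "(\<integral>w. \<xi> w * f (Z (s + t) w) \<partial>M) = (\<integral>w. \<xi> w * semigroup_op P t f (Z s w) \<partial>M)"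
proof -
  interpret Fs: subalgebra_prob M "F s" by (rule subalgebra_prob_F[OF st(1)])
  interpret fm: finite_measure_subalgebra M "F s"
    by unfold_locales (rule Fs.subalg)
  have [measurable]: "(\<lambda>w. f (Z (s + t) w)) \<in> borel_measurable M" by (rule Z_measurable_M) (use st in auto)
  have [measurable]: "(\<lambda>w. semigroup_op P t f (Z s w)) \<in> borel_measurable M" by (rule Z_measurable_M) (use st in auto)
  have [measurable]: "\<xi> \<in> borel_measurable M" by (rule Fs.measurable_G[OF \<xi>])
  have I: "integrable M (\<lambda>w. \<xi> w * f (Z (s + t) w))"
  proof (rule Bochner_Integration.integrable_bound[OF integrable_mult_left[OF i, of C]])
    show "AE w in M. norm (\<xi> w * f (Z (s + t) w)) \<le> norm (\<xi> w * C)"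
      using f by (intro AE_I2) (auto simp: abs_mult intro!: mult_left_mono order_trans[OF f])
  qed simp
  have "(\<integral>w. \<xi> w * f (Z (s + t) w) \<partial>M) = (\<integral>w. \<xi> w * real_cond_exp M (F s) (\<lambda>w. f (Z (s + t) w)) w \<partial>M)"
    by (rule fm.real_cond_exp_intg(2)[symmetric]) (use I \<xi> in auto)
  also have "\<dots> = (\<integral>w. \<xi> w * semigroup_op P t f (Z s w) \<partial>M)"
  proof (rule integral_cong_AE)
    have "AE w in M. real_cond_exp M (F s) (\<lambda>w. f (Z (s + t) w)) w = semigroup_op P t f (Z s w)"
      using markov st f unfolding markov_wrt_def by blast
    then show "AE w in M. \<xi> w * real_cond_exp M (F s) (\<lambda>w. f (Z (s + t) w)) w = \<xi> w * semigroup_op P t f (Z s w)"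
      by eventually_elim simp
  qed simp_all
  finally show ?thesis .
qed

lemma markov_complex:
  fixes \<xi> :: "'w \<Rightarrow> complex"
  assumes st: "0 \<le> s" "0 \<le> t" and f: "\<And>z. \<bar>f z\<bar> \<le> C"
    and \<xi>[measurable]: "\<xi> \<in> borel_measurable (F s)" and i: "integrable M \<xi>"
  shows "(\<integral>w. \<xi> w * complex_of_real (f (Z (s + t) w)) \<partial>M)
    = (\<integral>w. \<xi> w * complex_of_real (semigroup_op P t f (Z s w)) \<partial>M)"
proof -
  have [measurable]: "\<xi> \<in> borel_measurable M" by (rule F_le_M[OF st(1) \<xi>])
  have 1: "integrable M (\<lambda>w. \<xi> w * complex_of_real (g w))"
    if [measurable]: "g \<in> borel_measurable M" and "\<And>w. \<bar>g w\<bar> \<le> C" for g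
  proof (rule Bochner_Integration.integrable_bound[OF integrable_mult_left[OF i, of "complex_of_real C"]])
    show "AE w in M. norm (\<xi> w * complex_of_real (g w)) \<le> norm (\<xi> w * complex_of_real C)"
      using that(2) by (intro AE_I2) (auto simp: norm_mult intro!: mult_left_mono order_trans[OF that(2)])
  qed simp
  have I1: "integrable M (\<lambda>w. \<xi> w * complex_of_real (f (Z (s + t) w)))"
    by (intro 1 f Z_measurable_M) (use st in auto)
  have I2: "integrable M (\<lambda>w. \<xi> w * complex_of_real (semigroup_op P t f (Z s w)))"
    by (intro 1 semigroup_bounded f Z_measurable_M) (use st in auto)
  show ?thesis
  proof (rule complex_eqI)
    have "(\<integral>w. Re (\<xi> w) * f (Z (s + t) w) \<partial>M) = (\<integral>w. Re (\<xi> w) * semigroup_op P t f (Z s w) \<partial>M)"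
      by (intro markov_real[OF st f]) (use i in auto)
    then show "Re (\<integral>w. \<xi> w * complex_of_real (f (Z (s + t) w)) \<partial>M)
      = Re (\<integral>w. \<xi> w * complex_of_real (semigroup_op P t f (Z s w)) \<partial>M)"
      using I1 I2 by (simp add: integral_Re[symmetric])
    have "(\<integral>w. Im (\<xi> w) * f (Z (s + t) w) \<partial>M) = (\<integral>w. Im (\<xi> w) * semigroup_op P t f (Z s w) \<partial>M)"
      by (intro markov_real[OF st f]) (use i in auto)
    then show "Im (\<integral>w. \<xi> w * complex_of_real (f (Z (s + t) w)) \<partial>M)
      = Im (\<integral>w. \<xi> w * complex_of_real (semigroup_op P t f (Z s w)) \<partial>M)"
      using I1 I2 by (simp add: integral_Im[symmetric])
  qed
qed

lemma Z_law:
  assumes t: "0 \<le> t"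
  shows "distr M (count_space UNIV) (Z t) = measure_pmf (P t z0)"
proof (rule measure_eqI)
  have m: "Z t \<in> measurable M (count_space UNIV)" using Z_measurable_M[OF t, of "\<lambda>z. z"] by simp
  fix S :: "(real ^ 'd) set" assume "S \<in> sets (distr M (count_space UNIV) (Z t))"
  have "prob (Z t -` S \<inter> space M) = (\<integral>w. 1 * indicator S (Z (0 + t) w) \<partial>M)"
  proof -
    have "prob (Z t -` S \<inter> space M) = (\<integral>w. indicator (Z t -` S \<inter> space M) w \<partial>M)"
      using measurable_sets[OF m, of S] by simp
    also have "\<dots> = (\<integral>w. 1 * indicator S (Z (0 + t) w) \<partial>M)"
      by (intro Bochner_Integration.integral_cong) (auto split: split_indicator)
    finally show ?thesis .
  qed
  also have "\<dots> = (\<integral>w. 1 * semigroup_op P t (indicator S) (Z 0 w) \<partial>M)"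
    by (rule markov_real[where C=1]) (use t in \<open>auto split: split_indicator\<close>)
  also have "\<dots> = (\<integral>w. semigroup_op P t (indicator S) z0 \<partial>M)"
    using start by (intro integral_cong_AE Z_measurable_M) (auto intro: Z_measurable_M)
  also have "\<dots> = measure_pmf.prob (P t z0) S"
    by (simp add: semigroup_op_def prob_space)
  finally show "emeasure (distr M (count_space UNIV) (Z t)) S = emeasure (measure_pmf (P t z0)) S"
    using m by (simp add: emeasure_distr emeasure_eq_measure measure_pmf.emeasure_eq_measure)
qed simp

lemma Z_nn_integral:
  assumes t: "0 \<le> t"
  shows "(\<integral>\<^sup>+w. ennreal (g (Z t w)) \<partial>M) = semigroup_op_nn P t g z0"
  unfolding semigroup_op_nn_def Z_law[OF t, symmetric]
  using Z_measurable_M[OF t, of "\<lambda>z. z" "count_space UNIV"] by (subst nn_integral_distr) auto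

end

section \<open>Brownian increments are independent of the future of the chain\<close>

text \<open>The indicators of \<open>S k < K\<close> decrease in \<open>k\<close>, so truncating a telescoping sum by them amounts to
  stopping it.\<close>

lemma telescope_truncated:
  fixes X :: "nat \<Rightarrow> 'a::ab_group_add" and c :: "nat \<Rightarrow> nat"
  defines "S \<equiv> \<lambda>k. \<Sum>i<k. c i"
  shows "\<exists>m\<le>n. (\<Sum>k<n. if S k < K then X (Suc k) - X k else 0) = X m - X 0"
    and "S n < K \<Longrightarrow> (\<Sum>k<n. if S k < K then X (Suc k) - X k else 0) = X n - X 0"
proof -
  have S_mono: "S i \<le> S j" if "i \<le> j" for i j
    unfolding S_def using that by (intro sum_mono2) auto
  show *: "(\<Sum>k<n. if S k < K then X (Suc k) - X k else 0) = X n - X 0" if "S n < K" for n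
  proof -
    have "S k < K" if "k < n" for k using S_mono[of k n] that \<open>S n < K\<close> by simp
    then have "(\<Sum>k<n. if S k < K then X (Suc k) - X k else 0) = (\<Sum>k<n. X (Suc k) - X k)"
      by (intro sum.cong) auto
    then show ?thesis by (simp add: sum_lessThan_telescope)
  qed
  show "\<exists>m\<le>n. (\<Sum>k<n. if S k < K then X (Suc k) - X k else 0) = X m - X 0"
  proof (induction n)
    case (Suc n)
    show ?case
    proof (cases "S n < K")
      case True
      then have "(\<Sum>k<Suc n. if S k < K then X (Suc k) - X k else 0) = X (Suc n) - X 0"
        using *[OF True] by simp
      then show ?thesis by blast
    next
      case False
      with Suc show ?thesis by (auto intro: le_SucI)
    qed
  qed simp
qed

text \<open>Truncating just before the count exceeds \<open>K\<close> leaves at most \<open>K\<close> counted terms.\<close>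

lemma count_truncated:
  fixes c :: "nat \<Rightarrow> nat"
  assumes "\<And>i. c i \<le> 1"
  shows "(\<Sum>k<n. if (\<Sum>i<k. c i) < K then c k else 0) \<le> K"
proof -
  have "(\<Sum>k<n. if (\<Sum>i<k. c i) < K then c k else 0) = min K (\<Sum>i<n. c i)"
  proof (induction n)
    case (Suc n)
    then show ?case using assms[of n] by (auto simp: min_def)
  qed simp
  then show ?thesis by simp
qed

lemma (in prob_space) integrable_bounded_complex:
  fixes h :: "'a \<Rightarrow> complex"
  assumes "h \<in> borel_measurable M" "\<And>w. w \<in> space M \<Longrightarrow> norm (h w) \<le> B"
  shows "integrable M h"
  using assms by (intro integrable_const_bound[of _ B]) auto

lemma pmf_expectation_bind_bounded:
  fixes f :: "'b \<Rightarrow> real"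
  assumes f: "\<And>x. \<bar>f x\<bar> \<le> C"
  shows "measure_pmf.expectation (bind_pmf p q) f
    = measure_pmf.expectation p (\<lambda>x. measure_pmf.expectation (q x) f)"
proof -
  have nn: "(\<integral>\<^sup>+x. ennreal (g x + C) \<partial>measure_pmf r) = ennreal (measure_pmf.expectation r g + C)"
    if "\<And>x. \<bar>g x\<bar> \<le> C" for g :: "'c \<Rightarrow> real" and r
  proof -
    have i: "integrable (measure_pmf r) g" by (rule measure_pmf.integrable_const_bound[of _ C]) (use that in auto)
    have "0 \<le> g x + C" for x using that[of x] by linarith
    then show ?thesis using i by (subst nn_integral_eq_integral) auto
  qed
  have b: "\<bar>measure_pmf.expectation r g\<bar> \<le> C" if "\<And>x. \<bar>g x\<bar> \<le> C" for g :: "'c \<Rightarrow> real" and r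
  proof -
    have "\<bar>measure_pmf.expectation r g\<bar> \<le> measure_pmf.expectation r (\<lambda>x. \<bar>g x\<bar>)"
      using integral_norm_bound[of "measure_pmf r" g] by simp
    also have "\<dots> \<le> C"
      using that by (intro measure_pmf.integral_le_const measure_pmf.integrable_const_bound[of _ C]) auto
    finally show ?thesis .
  qed
  have bf: "\<bar>measure_pmf.expectation r f\<bar> \<le> C" for r by (rule b) (rule f)
  have bf2: "\<bar>measure_pmf.expectation p (\<lambda>x. measure_pmf.expectation (q x) f)\<bar> \<le> C" by (rule b) (rule bf)
  have "ennreal (measure_pmf.expectation (bind_pmf p q) f + C) = (\<integral>\<^sup>+x. \<integral>\<^sup>+y. ennreal (f y + C) \<partial>q x \<partial>p)"
    by (simp add: nn[OF f, symmetric])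
  also have "\<dots> = (\<integral>\<^sup>+x. ennreal (measure_pmf.expectation (q x) f + C) \<partial>p)"
    by (simp add: nn[OF f])
  also have "\<dots> = ennreal (measure_pmf.expectation p (\<lambda>x. measure_pmf.expectation (q x) f) + C)"
    by (rule nn) (rule bf)
  finally show ?thesis
    using bf[of "bind_pmf p q"] bf2 by simp
qed

context markov_chain
begin

lemma semigroup_zero: "z \<in> E \<Longrightarrow> semigroup_op P 0 f z = f z"
  using transition by (simp add: semigroup_op_def transition_function_def)

lemma semigroup_add:
  assumes "0 \<le> s" "0 \<le> t" "z \<in> E" "\<And>z. \<bar>f z\<bar> \<le> C"
  shows "semigroup_op P (s + t) f z = semigroup_op P s (semigroup_op P t f) z"
proof -
  have "P (s + t) z = bind_pmf (P s z) (P t)"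
    using transition assms by (simp add: transition_function_def)
  then show ?thesis
    unfolding semigroup_op_def using assms(4)
    by (simp add: pmf_expectation_bind_bounded[of f C])
qed

text \<open>The setting for the independence of one Brownian increment over \<open>[s, t]\<close> and the state \<open>Z t\<close>. Along a
  grid of \<open>[s, t]\<close> the martingales \<open>predict x (Z x) = E [f (Z t) | F x]\<close> and \<open>exp_mart x\<close> are multiplied; the
  product turns out to have constant expectation on every event \<open>C\<close> of \<open>F s\<close>.\<close>

context
  fixes W :: "('w, real) process" and s t :: real and f :: "real ^ 'd \<Rightarrow> real" and u :: real and C :: "'w set"
  assumes W: "brownian_motion M F W" and st: "0 \<le> s" "s < t" and f: "\<And>z. \<bar>f z\<bar> \<le> 1" and C: "C \<in> sets (F s)"
begin

definition mesh :: "nat \<Rightarrow> nat \<Rightarrow> real" where "mesh n k = s + real k * ((t - s) / real n)"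

definition predict :: "real \<Rightarrow> real ^ 'd \<Rightarrow> real" where "predict x = semigroup_op P (t - x) f"

definition exp_mart :: "real \<Rightarrow> 'w \<Rightarrow> complex" where
  "exp_mart x w = iexp (u * (W x w - W s w)) * complex_of_real (exp (u\<^sup>2 * (x - s) / 2))"

definition jumped :: "nat \<Rightarrow> nat \<Rightarrow> 'w \<Rightarrow> nat" where
  "jumped n k w = of_bool (Z (mesh n (Suc k)) w \<noteq> Z (mesh n k) w)"

definition jump_count :: "nat \<Rightarrow> nat \<Rightarrow> 'w \<Rightarrow> nat" where
  "jump_count n k w = (\<Sum>i<k. jumped n i w)"

definition exp_bound :: real where "exp_bound = exp (u\<^sup>2 * (t - s) / 2)"

lemma mesh_bounds: "k \<le> n \<Longrightarrow> s \<le> mesh n k" "0 < n \<Longrightarrow> k \<le> n \<Longrightarrow> mesh n k \<le> t" "0 < n \<Longrightarrow> mesh n n = t" "mesh n 0 = s"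
  "mesh n k \<le> mesh n (Suc k)" "mesh n (Suc k) - mesh n k = (t - s) / real n"
proof -
  show "k \<le> n \<Longrightarrow> s \<le> mesh n k" using st by (auto simp: mesh_def)
  show "0 < n \<Longrightarrow> mesh n n = t" "mesh n 0 = s" by (auto simp: mesh_def)
  show *: "mesh n (Suc k) - mesh n k = (t - s) / real n" by (simp only: mesh_def of_nat_Suc distrib_right mult_1_left)
  show "mesh n k \<le> mesh n (Suc k)" using * st by (smt (verit) divide_nonneg_nonneg of_nat_0_le_iff)
  show "0 < n \<Longrightarrow> k \<le> n \<Longrightarrow> mesh n k \<le> t"
  proof -
    assume "0 < n" "k \<le> n"
    then have "real k * ((t - s) / real n) \<le> real n * ((t - s) / real n)"
      using st by (intro mult_right_mono) auto
    then show "mesh n k \<le> t" using \<open>0 < n\<close> by (simp add: mesh_def)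
  qed
qed

lemma predict_bounded: "\<bar>predict x z\<bar> \<le> 1"
  unfolding predict_def by (rule semigroup_bounded[OF f])

lemma exp_mart_bounded: "x \<le> t \<Longrightarrow> norm (exp_mart x w) \<le> exp_bound"
  unfolding exp_mart_def exp_bound_def by (auto simp: norm_mult intro!: mult_left_mono divide_right_mono)

lemma exp_mart_measurable: "s \<le> x \<Longrightarrow> x \<le> y \<Longrightarrow> exp_mart x \<in> borel_measurable (F y)"
proof -
  assume "s \<le> x" "x \<le> y"
  then have [measurable]: "W x \<in> borel_measurable (F y)" "W s \<in> borel_measurable (F y)"
    using bm_adapted[OF W] st by auto
  show ?thesis unfolding exp_mart_def by measurable
qed

lemma jumped_measurable: "k < n \<Longrightarrow> mesh n (Suc k) \<le> y \<Longrightarrow> jumped n k \<in> measurable (F y) (count_space UNIV)"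
proof -
  assume k: "k < n" "mesh n (Suc k) \<le> y"
  then have "0 \<le> mesh n k" "0 \<le> mesh n (Suc k)" "mesh n k \<le> y" using mesh_bounds(1)[of k n] mesh_bounds(1)[of "Suc k" n] mesh_bounds(5)[of n k] st by auto
  then have [measurable]: "Z (mesh n k) \<in> borel_measurable (F y)" "Z (mesh n (Suc k)) \<in> borel_measurable (F y)"
    using Z_measurable[of _ y "\<lambda>z. z" borel] k by auto
  show ?thesis unfolding jumped_def by measurable
qed

lemma mesh_mono: "i \<le> j \<Longrightarrow> mesh n i \<le> mesh n j"
  using st unfolding mesh_def by (intro add_left_mono mult_right_mono) auto

lemma jump_count_measurable: "k \<le> n \<Longrightarrow> mesh n k \<le> y \<Longrightarrow> jump_count n k \<in> measurable (F y) (count_space UNIV)"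
proof -
  assume k: "k \<le> n" "mesh n k \<le> y"
  have [measurable]: "jumped n i \<in> measurable (F y) (count_space UNIV)" if "i < k" for i
    using that k mesh_mono[of "Suc i" k n] by (intro jumped_measurable) auto
  have "(\<lambda>w. \<Sum>i<j. jumped n i w) \<in> measurable (F y) (count_space UNIV)" if "j \<le> k" for j
    using that
  proof (induction j)
    case (Suc j)
    then have [measurable]: "(\<lambda>w. \<Sum>i<j. jumped n i w) \<in> measurable (F y) (count_space UNIV)" by simp
    have [measurable]: "jumped n j \<in> measurable (F y) (count_space UNIV)" using Suc by simp
    show ?case by simp
  qed simp
  then show ?thesis unfolding jump_count_def by simp
qed

text \<open>The sum over the grid is stopped once the chain has changed \<open>K\<close> times: the number of jumps is finite but
  need not have an expectation.\<close>

definition cutoff :: "nat \<Rightarrow> nat \<Rightarrow> nat \<Rightarrow> 'w \<Rightarrow> complex" where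
  "cutoff K n k w = complex_of_real (indicator C w * of_bool (jump_count n k w < K))"

lemma cutoff_measurable: "k \<le> n \<Longrightarrow> cutoff K n k \<in> borel_measurable (F (mesh n k))"
proof -
  assume k: "k \<le> n"
  have [measurable]: "jump_count n k \<in> measurable (F (mesh n k)) (count_space UNIV)" using jump_count_measurable k by blast
  have [measurable]: "C \<in> sets (F (mesh n k))" using C sets_F_mono[of s "mesh n k"] st mesh_bounds(1)[OF k] by auto
  show ?thesis unfolding cutoff_def by measurable
qed

lemma cutoff_le: "norm (cutoff K n k w) \<le> 1"
  by (auto simp: cutoff_def indicator_def)

text \<open>The increment of a product of martingales has the expectation of the product of their increments.
  In the latter, \<open>predict\<close> at the new time may be evaluated at the old state instead of the martingale's old
  value, since both are known at the old time. The new first factor vanishes unless the chain has changed.\<close>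

lemma decoupling_step:
  assumes n: "0 < n" "k < n"
  shows "(\<integral>w. cutoff K n k w * (complex_of_real (predict (mesh n (Suc k)) (Z (mesh n (Suc k)) w)) * exp_mart (mesh n (Suc k)) w
        - complex_of_real (predict (mesh n k) (Z (mesh n k) w)) * exp_mart (mesh n k) w) \<partial>M)
    = (\<integral>w. cutoff K n k w * ((complex_of_real (predict (mesh n (Suc k)) (Z (mesh n (Suc k)) w) - predict (mesh n (Suc k)) (Z (mesh n k) w)))
        * (exp_mart (mesh n (Suc k)) w - exp_mart (mesh n k) w)) \<partial>M)"
proof -
  define x y where "x = mesh n k" and "y = mesh n (Suc k)"
  have xy: "s \<le> x" "x \<le> y" "y \<le> t" "0 \<le> x" "0 \<le> y" "s \<le> y" "x \<le> t"
    using mesh_bounds(1)[of k n] mesh_bounds(5)[of n k] mesh_bounds(2)[of n "Suc k"] n st by (auto simp: x_def y_def)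
  interpret Fx: subalgebra_prob M "F x" by (rule subalgebra_prob_F) (rule xy)
  define A where "A = cutoff K n k"
  have A[measurable]: "A \<in> borel_measurable (F x)" unfolding A_def x_def using n by (intro cutoff_measurable) auto
  have A1: "norm (A w) \<le> 1" for w by (simp add: A_def cutoff_le)
  have [measurable]: "A \<in> borel_measurable M" by (rule Fx.measurable_G) simp
  have wx[measurable]: "exp_mart x \<in> borel_measurable (F x)" using exp_mart_measurable xy by auto
  have [measurable]: "exp_mart x \<in> borel_measurable M" by (rule Fx.measurable_G) simp
  have [measurable]: "exp_mart y \<in> borel_measurable M" using F_le_M[OF _ exp_mart_measurable[of y y]] xy by auto
  have ex[measurable]: "(\<lambda>w. predict a (Z x w)) \<in> borel_measurable (F x)" for a by (rule Z_measurable) (use xy in auto)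
  have [measurable]: "(\<lambda>w. predict a (Z x w)) \<in> borel_measurable M" for a by (rule Fx.measurable_G) simp
  have [measurable]: "(\<lambda>w. predict a (Z y w)) \<in> borel_measurable M" for a by (rule Z_measurable_M) (use xy in auto)
  have bx: "norm (exp_mart x w) \<le> exp_bound" and "by": "norm (exp_mart y w) \<le> exp_bound" for w using exp_mart_bounded xy by auto
  have bd0: "0 \<le> exp_bound" by (simp add: exp_bound_def)
  have prod_le: "norm (A w * complex_of_real e * v) \<le> exp_bound" if "\<bar>e\<bar> \<le> 1" "norm v \<le> exp_bound" for w e v
  proof -
    have "norm (A w) * \<bar>e\<bar> * norm v \<le> 1 * 1 * exp_bound"
      using that A1 bd0 by (intro mult_mono) auto
    then show ?thesis by (simp add: norm_mult)
  qed
  have I: "integrable M (\<lambda>w. A w * complex_of_real (predict a (Z z w)) * exp_mart v w)" if "z \<in> {x, y}" "v \<in> {x, y}" for a z v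
  proof (rule integrable_bounded_complex[where B=exp_bound])
    show "norm (A w * complex_of_real (predict a (Z z w)) * exp_mart v w) \<le> exp_bound" for w
      using that bx "by" by (intro prod_le predict_bounded) auto
  qed (use that in auto)
  have mart: "(\<integral>w. A w * complex_of_real (predict y (Z y w)) * exp_mart x w \<partial>M) = (\<integral>w. A w * complex_of_real (predict x (Z x w)) * exp_mart x w \<partial>M)"
  proof -
    have i: "integrable M (\<lambda>w. A w * exp_mart x w)"
      by (rule integrable_bounded_complex[where B=exp_bound]) (use prod_le[of 1] bx in auto)
    have "(\<integral>w. (A w * exp_mart x w) * complex_of_real (predict y (Z (x + (y - x)) w)) \<partial>M)
        = (\<integral>w. (A w * exp_mart x w) * complex_of_real (semigroup_op P (y - x) (predict y) (Z x w)) \<partial>M)"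
      by (rule markov_complex[OF _ _ predict_bounded _ i]) (use xy in auto)
    also have "\<dots> = (\<integral>w. (A w * exp_mart x w) * complex_of_real (predict x (Z x w)) \<partial>M)"
    proof (intro Bochner_Integration.integral_cong refl)
      fix w assume "w \<in> space M"
      then have "semigroup_op P ((y - x) + (t - y)) f (Z x w) = semigroup_op P (y - x) (semigroup_op P (t - y) f) (Z x w)"
        using xy Z_in_E by (intro semigroup_add[OF _ _ _ f]) auto
      then show "(A w * exp_mart x w) * complex_of_real (semigroup_op P (y - x) (predict y) (Z x w)) = (A w * exp_mart x w) * complex_of_real (predict x (Z x w))"
        by (simp add: predict_def)
    qed
    finally show ?thesis by (simp add: mult_ac)
  qed
  have wmart: "(\<integral>w. A w * complex_of_real (predict y (Z x w)) * exp_mart y w \<partial>M) = (\<integral>w. A w * complex_of_real (predict y (Z x w)) * exp_mart x w \<partial>M)"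
  proof -
    have N: "indep_gauss M (F x) (\<lambda>w. W y w - W x w) (y - x)" by (rule bm_increment[OF W]) (use xy in auto)
    have eq: "exp_mart y w = exp_mart x w * iexp (u * (W y w - W x w)) * complex_of_real (exp (u\<^sup>2 * (y - x) / 2))" for w
    proof -
      have "iexp (u * (W y w - W s w)) = iexp (u * (W x w - W s w)) * iexp (u * (W y w - W x w))"
        by (simp add: exp_add[symmetric] algebra_simps)
      moreover have "exp (u\<^sup>2 * (y - s) / 2) = exp (u\<^sup>2 * (x - s) / 2) * exp (u\<^sup>2 * (y - x) / 2)"
        by (simp add: exp_add[symmetric] field_simps)
      ultimately show ?thesis unfolding exp_mart_def by (simp only: of_real_mult mult_ac)
    qed
    have "(\<integral>w. A w * complex_of_real (predict y (Z x w)) * exp_mart y w \<partial>M)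
      = (\<integral>w. (A w * complex_of_real (predict y (Z x w)) * exp_mart x w) * iexp (u * (W y w - W x w)) * complex_of_real (exp (u\<^sup>2 * (y - x) / 2)) \<partial>M)"
      unfolding eq by (simp only: mult.assoc)
    also have "\<dots> = (\<integral>w. (A w * complex_of_real (predict y (Z x w)) * exp_mart x w) * iexp (u * (W y w - W x w)) \<partial>M)
        * complex_of_real (exp (u\<^sup>2 * (y - x) / 2))"
      by (rule integral_mult_left_zero)
    also have "(\<integral>w. (A w * complex_of_real (predict y (Z x w)) * exp_mart x w) * iexp (u * (W y w - W x w)) \<partial>M)
      = (\<integral>w. A w * complex_of_real (predict y (Z x w)) * exp_mart x w \<partial>M) * complex_of_real (exp (- ((y - x) * u\<^sup>2) / 2))"
      by (rule Fx.indep_gauss_iexp[OF N]) (use xy I[of x x y] in auto)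
    also have "\<dots> * complex_of_real (exp (u\<^sup>2 * (y - x) / 2)) = (\<integral>w. A w * complex_of_real (predict y (Z x w)) * exp_mart x w \<partial>M)"
      by (simp add: mult.assoc exp_add[symmetric] mult.commute flip: of_real_mult)
    finally show ?thesis .
  qed
  have "(\<integral>w. A w * (complex_of_real (predict y (Z y w)) * exp_mart y w - complex_of_real (predict x (Z x w)) * exp_mart x w) \<partial>M)
    = (\<integral>w. A w * complex_of_real (predict y (Z y w)) * exp_mart y w \<partial>M) - (\<integral>w. A w * complex_of_real (predict x (Z x w)) * exp_mart x w \<partial>M)"
    using I by (subst Bochner_Integration.integral_diff[symmetric]) (auto simp: algebra_simps)
  also have "\<dots> = ((\<integral>w. A w * complex_of_real (predict y (Z y w)) * exp_mart y w \<partial>M) - (\<integral>w. A w * complex_of_real (predict y (Z y w)) * exp_mart x w \<partial>M))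
     - ((\<integral>w. A w * complex_of_real (predict y (Z x w)) * exp_mart y w \<partial>M) - (\<integral>w. A w * complex_of_real (predict y (Z x w)) * exp_mart x w \<partial>M))"
    using mart wmart by simp
  also have "\<dots> = (\<integral>w. (A w * complex_of_real (predict y (Z y w)) * exp_mart y w - A w * complex_of_real (predict y (Z y w)) * exp_mart x w)
      - (A w * complex_of_real (predict y (Z x w)) * exp_mart y w - A w * complex_of_real (predict y (Z x w)) * exp_mart x w) \<partial>M)"
    using I by (simp add: Bochner_Integration.integral_diff)
  also have "\<dots> = (\<integral>w. A w * (complex_of_real (predict y (Z y w) - predict y (Z x w)) * (exp_mart y w - exp_mart x w)) \<partial>M)"
    by (simp add: algebra_simps)
  finally show ?thesis unfolding A_def x_def y_def .
qed

text \<open>The increments of \<open>exp_mart\<close> over the first \<open>K\<close> grid cells in which the chain changes: up to a factor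
  this bounds what the stopped product of the two martingales gains on \<open>[s, t]\<close>.\<close>

definition jump_error :: "nat \<Rightarrow> nat \<Rightarrow> 'w \<Rightarrow> real" where
  "jump_error K n w = (\<Sum>k<n. of_bool (jump_count n k w < K) * real (jumped n k w) * norm (exp_mart (mesh n (Suc k)) w - exp_mart (mesh n k) w))"

lemma mesh_measurable:
  assumes "0 < n" "k \<le> n"
  shows "exp_mart (mesh n k) \<in> borel_measurable M" "jump_count n k \<in> measurable M (count_space UNIV)"
    "(\<lambda>w. predict a (Z (mesh n k) w)) \<in> borel_measurable M" "cutoff K n k \<in> borel_measurable M"
    "k < n \<Longrightarrow> jumped n k \<in> measurable M (count_space UNIV)"
proof -
  have s: "s \<le> mesh n k" "mesh n k \<le> t" using mesh_bounds assms by auto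
  then have p: "0 \<le> mesh n k" using st by simp
  show "exp_mart (mesh n k) \<in> borel_measurable M" using F_le_M[OF p exp_mart_measurable[OF s(1)]] by simp
  show "jump_count n k \<in> measurable M (count_space UNIV)" using F_le_M[OF p jump_count_measurable[OF assms(2)]] by simp
  show "(\<lambda>w. predict a (Z (mesh n k) w)) \<in> borel_measurable M" by (rule Z_measurable_M[OF p]) auto
  show "cutoff K n k \<in> borel_measurable M" using F_le_M[OF p cutoff_measurable[OF assms(2)]] .
  assume "k < n"
  then have "mesh n (Suc k) \<le> t" using mesh_bounds(2)[of n "Suc k"] by simp
  then show "jumped n k \<in> measurable M (count_space UNIV)" using F_le_M[OF _ jumped_measurable[OF \<open>k < n\<close>], of t] st by simp
qed

lemma jump_error_measurable: "0 < n \<Longrightarrow> jump_error K n \<in> borel_measurable M"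
  unfolding jump_error_def
proof (rule borel_measurable_sum)
  fix k assume n: "0 < n" "k \<in> {..<n}"
  have [measurable]: "exp_mart (mesh n k) \<in> borel_measurable M" "exp_mart (mesh n (Suc k)) \<in> borel_measurable M"
     "jump_count n k \<in> measurable M (count_space UNIV)" "jumped n k \<in> measurable M (count_space UNIV)"
    using mesh_measurable[of n k] mesh_measurable[of n "Suc k"] n by auto
  show "(\<lambda>w. of_bool (jump_count n k w < K) * real (jumped n k w) * norm (exp_mart (mesh n (Suc k)) w - exp_mart (mesh n k) w)) \<in> borel_measurable M"
    by measurable
qed

lemma jump_error_le:
  assumes "\<And>k. k < n \<Longrightarrow> norm (exp_mart (mesh n (Suc k)) w - exp_mart (mesh n k) w) \<le> e" and e: "0 \<le> e"
  shows "0 \<le> jump_error K n w" "jump_error K n w \<le> real K * e"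
proof -
  show "0 \<le> jump_error K n w" unfolding jump_error_def by (intro sum_nonneg) simp
  show "jump_error K n w \<le> real K * e"
  proof -
    have "jump_error K n w \<le> (\<Sum>k<n. of_bool (jump_count n k w < K) * real (jumped n k w) * e)"
      unfolding jump_error_def using assms by (intro sum_mono mult_left_mono) auto
    also have "\<dots> = real (\<Sum>k<n. if (\<Sum>i<k. jumped n i w) < K then jumped n k w else 0) * e"
      unfolding of_nat_sum sum_distrib_right by (intro sum.cong) (auto simp: jump_count_def)
    also have "\<dots> \<le> real K * e"
      using e by (intro mult_right_mono of_nat_mono count_truncated) (auto simp: jumped_def)
    finally show ?thesis .
  qed
qed

text \<open>Only steps at which the chain changes contribute, at most \<open>K\<close> of them; the last term pays for
  stopping the sum.\<close>

lemma decoupling_mesh: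
  assumes n: "0 < n"
  shows "norm (\<integral>w. complex_of_real (indicator C w) * (complex_of_real (f (Z t w)) * exp_mart t w
       - complex_of_real (predict s (Z s w))) \<partial>M)
    \<le> 2 * (\<integral>w. jump_error K n w \<partial>M) + 4 * exp_bound * prob {w \<in> space M. K \<le> jump_count n n w}"
proof -
  define X where "X k w = complex_of_real (predict (mesh n k) (Z (mesh n k) w)) * exp_mart (mesh n k) w" for k w
  define A where "A = cutoff K n"
  define \<Theta> where "\<Theta> w = (\<Sum>k<n. A k w * (X (Suc k) w - X k w))" for w
  have [measurable]: "X k \<in> borel_measurable M" "A k \<in> borel_measurable M" if "k \<le> n" for k
    unfolding X_def A_def using mesh_measurable[OF n that] by measurable
  have Xb: "norm (X k w) \<le> exp_bound" if "k \<le> n" for k w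
  proof -
    have "\<bar>predict (mesh n k) (Z (mesh n k) w)\<bar> * norm (exp_mart (mesh n k) w) \<le> 1 * exp_bound"
      using predict_bounded exp_mart_bounded mesh_bounds(2)[OF n that] by (intro mult_mono) auto
    then show ?thesis by (simp add: X_def norm_mult)
  qed
  have [measurable]: "C \<in> sets M" using sets_F_M[OF st(1) C] .
  have [measurable]: "jump_count n n \<in> measurable M (count_space UNIV)" using mesh_measurable(2)[OF n, of n] by simp
  have bd0: "0 \<le> exp_bound" by (simp add: exp_bound_def)
  have \<Theta>: "\<Theta> w = complex_of_real (indicator C w) * (\<Sum>k<n. if (\<Sum>i<k. jumped n i w) < K then X (Suc k) w - X k w else 0)" for w
    unfolding \<Theta>_def A_def cutoff_def sum_distrib_left by (intro sum.cong) (auto simp: jump_count_def)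
  have [measurable]: "\<Theta> \<in> borel_measurable M" unfolding \<Theta>_def by (intro borel_measurable_sum) auto
  have diff2: "norm (X m w - X 0 w) \<le> 2 * exp_bound" if "m \<le> n" for m w
    using norm_triangle_ineq4[of "X m w" "X 0 w"] Xb[OF that, of w] Xb[of 0 w] by simp
  have \<Theta>b: "norm (\<Theta> w) \<le> 2 * exp_bound" for w
  proof -
    obtain m where m: "m \<le> n" "(\<Sum>k<n. if (\<Sum>i<k. jumped n i w) < K then X (Suc k) w - X k w else 0) = X m w - X 0 w"
      using telescope_truncated(1)[of n "\<lambda>i. jumped n i w" K "\<lambda>k. X k w"] by blast
    have "norm (indicator C w :: real) * norm (X m w - X 0 w) \<le> 1 * (2 * exp_bound)"
      using diff2[OF m(1), of w] by (intro mult_mono) (auto split: split_indicator)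
    then show ?thesis unfolding \<Theta> m(2) by (simp add: norm_mult)
  qed
  have \<Theta>d: "norm (complex_of_real (indicator C w) * (X n w - X 0 w) - \<Theta> w) \<le> 4 * exp_bound * indicator {w \<in> space M. K \<le> jump_count n n w} w"
    if "w \<in> space M" for w
  proof (cases "jump_count n n w < K")
    case True
    then have "(\<Sum>k<n. if (\<Sum>i<k. jumped n i w) < K then X (Suc k) w - X k w else 0) = X n w - X 0 w"
      using telescope_truncated(2)[of "\<lambda>i. jumped n i w" n K "\<lambda>k. X k w"] by (simp add: jump_count_def)
    then show ?thesis using True bd0 by (simp add: \<Theta>)
  next
    case False
    have "norm (complex_of_real (indicator C w) * (X n w - X 0 w)) \<le> 1 * (2 * exp_bound)"
      unfolding norm_mult using diff2[of n w] by (intro mult_mono) (auto split: split_indicator)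
    then show ?thesis using False that \<Theta>b[of w] norm_triangle_ineq4[of "complex_of_real (indicator C w) * (X n w - X 0 w)" "\<Theta> w"] by simp
  qed
  have I\<Theta>: "integrable M \<Theta>" by (rule integrable_bounded_complex[where B="2 * exp_bound"]) (use \<Theta>b in auto)
  have IX: "integrable M (\<lambda>w. complex_of_real (indicator C w) * (X n w - X 0 w))"
  proof (rule integrable_bounded_complex[where B="2 * exp_bound"])
    show "norm (complex_of_real (indicator C w) * (X n w - X 0 w)) \<le> 2 * exp_bound" for w
      using diff2[of n w] bd0 by (auto simp: norm_mult split: split_indicator)
  qed measurable
  have E\<Theta>: "norm (\<integral>w. \<Theta> w \<partial>M) \<le> 2 * (\<integral>w. jump_error K n w \<partial>M)"
  proof -
    define Y where "Y k w = A k w * ((complex_of_real (predict (mesh n (Suc k)) (Z (mesh n (Suc k)) w) - predict (mesh n (Suc k)) (Z (mesh n k) w)))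
        * (exp_mart (mesh n (Suc k)) w - exp_mart (mesh n k) w))" for k w
    have Ym: "Y k \<in> borel_measurable M" if "k < n" for k
    proof -
      note g = mesh_measurable[OF n less_imp_le[OF that]] mesh_measurable(1,3)[OF n Suc_leI[OF that]]
      note [measurable] = g(1) g(3) g(4) g(6) g(7)
      show ?thesis unfolding Y_def A_def by measurable
    qed
    have Y: "norm (Y k w) \<le> 2 * (of_bool (jump_count n k w < K) * real (jumped n k w) * norm (exp_mart (mesh n (Suc k)) w - exp_mart (mesh n k) w))" for k w
    proof -
      have a: "norm (A k w) \<le> of_bool (jump_count n k w < K)" by (auto simp: A_def cutoff_def indicator_def)
      have "\<bar>predict (mesh n (Suc k)) (Z (mesh n (Suc k)) w) - predict (mesh n (Suc k)) (Z (mesh n k) w)\<bar> \<le> 2"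
        using predict_bounded[of "mesh n (Suc k)" "Z (mesh n (Suc k)) w"] predict_bounded[of "mesh n (Suc k)" "Z (mesh n k) w"] by linarith
      then have b: "\<bar>predict (mesh n (Suc k)) (Z (mesh n (Suc k)) w) - predict (mesh n (Suc k)) (Z (mesh n k) w)\<bar> \<le> 2 * real (jumped n k w)"
        by (auto simp: jumped_def)
      have "norm (Y k w) = norm (A k w) * (\<bar>predict (mesh n (Suc k)) (Z (mesh n (Suc k)) w) - predict (mesh n (Suc k)) (Z (mesh n k) w)\<bar>
          * norm (exp_mart (mesh n (Suc k)) w - exp_mart (mesh n k) w))"
        by (simp only: Y_def norm_mult norm_of_real)
      also have "\<dots> \<le> of_bool (jump_count n k w < K) * ((2 * real (jumped n k w)) * norm (exp_mart (mesh n (Suc k)) w - exp_mart (mesh n k) w))"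
        using a b by (intro mult_mono) auto
      finally show ?thesis by (simp add: mult_ac)
    qed
    have wmd: "norm (exp_mart (mesh n (Suc k)) w - exp_mart (mesh n k) w) \<le> 2 * exp_bound" if "k < n" for k w
      using norm_triangle_ineq4[of "exp_mart (mesh n (Suc k)) w" "exp_mart (mesh n k) w"] exp_mart_bounded mesh_bounds(2)[OF n, of k] mesh_bounds(2)[OF n, of "Suc k"] that
      by (smt (verit) Suc_leI less_imp_le_nat)
    have Yi: "integrable M (Y k)" if "k < n" for k
    proof (rule integrable_bounded_complex[where B="4 * exp_bound", OF Ym[OF that]])
      fix w
      have "of_bool (jump_count n k w < K) * real (jumped n k w) * norm (exp_mart (mesh n (Suc k)) w - exp_mart (mesh n k) w) \<le> 1 * 1 * (2 * exp_bound)"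
        using wmd[OF that, of w] by (intro mult_mono) (auto simp: jumped_def)
      then show "norm (Y k w) \<le> 4 * exp_bound" using Y[of k w] by simp
    qed
    have iA: "integrable M (\<lambda>w. A k w * (X (Suc k) w - X k w))" if "k < n" for k
    proof (rule integrable_bounded_complex[where B="2 * exp_bound"])
      fix w
      have "norm (X (Suc k) w - X k w) \<le> 2 * exp_bound"
        using norm_triangle_ineq4[of "X (Suc k) w" "X k w"] Xb[of "Suc k" w] Xb[of k w] that by simp
      then have "norm (A k w) * norm (X (Suc k) w - X k w) \<le> 1 * (2 * exp_bound)"
        unfolding A_def by (intro mult_mono cutoff_le) auto
      then show "norm (A k w * (X (Suc k) w - X k w)) \<le> 2 * exp_bound" by (simp add: norm_mult)
    qed (use that in auto)
    have "(\<integral>w. \<Theta> w \<partial>M) = (\<Sum>k<n. \<integral>w. A k w * (X (Suc k) w - X k w) \<partial>M)"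
      unfolding \<Theta>_def using iA by (intro Bochner_Integration.integral_sum) auto
    also have "\<dots> = (\<Sum>k<n. \<integral>w. Y k w \<partial>M)"
      unfolding X_def Y_def A_def using decoupling_step[OF n] by (intro sum.cong) auto
    also have "\<dots> = (\<integral>w. (\<Sum>k<n. Y k w) \<partial>M)"
      using Yi by (intro Bochner_Integration.integral_sum[symmetric]) auto
    finally have e: "(\<integral>w. \<Theta> w \<partial>M) = (\<integral>w. (\<Sum>k<n. Y k w) \<partial>M)" .
    have "norm (\<integral>w. \<Theta> w \<partial>M) \<le> (\<integral>w. norm (\<Sum>k<n. Y k w) \<partial>M)"
      unfolding e by (rule integral_norm_bound)
    also have "\<dots> \<le> (\<integral>w. 2 * jump_error K n w \<partial>M)"
    proof (rule integral_mono)
      show "integrable M (\<lambda>w. norm (\<Sum>k<n. Y k w))"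
        using Yi by (intro integrable_norm Bochner_Integration.integrable_sum) auto
      show "integrable M (\<lambda>w. 2 * jump_error K n w)"
        by (intro integrable_mult_right integrable_const_bound[of _ "real K * (2 * exp_bound)"] AE_I2)
          (use jump_error_le[OF wmd] jump_error_measurable[OF n] bd0 in auto)
      show "norm (\<Sum>k<n. Y k w) \<le> 2 * jump_error K n w" for w
        unfolding jump_error_def sum_distrib_left by (intro order_trans[OF norm_sum] sum_mono Y)
    qed
    finally show ?thesis by simp
  qed
  have "norm (\<integral>w. complex_of_real (indicator C w) * (X n w - X 0 w) \<partial>M)
     \<le> norm (\<integral>w. \<Theta> w \<partial>M) + norm (\<integral>w. complex_of_real (indicator C w) * (X n w - X 0 w) - \<Theta> w \<partial>M)"
    using IX I\<Theta> by (subst Bochner_Integration.integral_diff) (auto intro: norm_triangle_sub)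
  also have "norm (\<integral>w. complex_of_real (indicator C w) * (X n w - X 0 w) - \<Theta> w \<partial>M)
      \<le> (\<integral>w. norm (complex_of_real (indicator C w) * (X n w - X 0 w) - \<Theta> w) \<partial>M)"
    by (rule integral_norm_bound)
  also have "\<dots> \<le> (\<integral>w. 4 * exp_bound * indicator {w \<in> space M. K \<le> jump_count n n w} w \<partial>M)"
  proof (rule integral_mono)
    show "integrable M (\<lambda>w. 4 * exp_bound * indicator {w \<in> space M. K \<le> jump_count n n w} w)"
      by (intro integrable_mult_right integrable_real_indicator) (auto simp: emeasure_eq_measure)
  qed (use IX I\<Theta> \<Theta>d in auto)
  also have "\<dots> = 4 * exp_bound * prob {w \<in> space M. K \<le> jump_count n n w}" by simp
  finally have "norm (\<integral>w. complex_of_real (indicator C w) * (X n w - X 0 w) \<partial>M)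
    \<le> 2 * (\<integral>w. jump_error K n w \<partial>M) + 4 * exp_bound * prob {w \<in> space M. K \<le> jump_count n n w}" using E\<Theta> by simp
  moreover have "(\<integral>w. complex_of_real (indicator C w) * (X n w - X 0 w) \<partial>M)
     = (\<integral>w. complex_of_real (indicator C w) * (complex_of_real (f (Z t w)) * exp_mart t w - complex_of_real (predict s (Z s w))) \<partial>M)"
    using n Z_in_E st by (intro Bochner_Integration.integral_cong) (auto simp: X_def mesh_bounds predict_def semigroup_zero exp_mart_def)
  ultimately show ?thesis by simp
qed

lemma jump_count_event: "0 < n \<Longrightarrow> {w \<in> space M. K \<le> jump_count n n w} \<in> sets M"
proof -
  assume "0 < n"
  then have [measurable]: "jump_count n n \<in> measurable M (count_space UNIV)" using mesh_measurable(2)[of n n] by simp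
  show ?thesis by measurable
qed

text \<open>Every change along a grid uses up its own jump time of the path, for all grids at once.\<close>

lemma jump_count_bounded:
  assumes w: "w \<in> space M"
  shows "\<exists>J. \<forall>n>0. jump_count n n w \<le> J"
proof -
  obtain D where D: "finite D"
    and J: "\<And>x y. 0 \<le> x \<Longrightarrow> x < y \<Longrightarrow> y \<le> t \<Longrightarrow> Z x w \<noteq> Z y w \<Longrightarrow> D \<inter> {x<..y} \<noteq> {}"
    using cadlag_discrete_finitely_many_jumps[OF discrete_E cadlag[OF w], of t] st by auto
  have "jump_count n n w \<le> card D" if n: "0 < n" for n
  proof -
    define I where "I = {k. k < n \<and> Z (mesh n (Suc k)) w \<noteq> Z (mesh n k) w}"
    have "\<exists>x. x \<in> D \<and> x \<in> {mesh n k<..mesh n (Suc k)}" if "k \<in> I" for k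
    proof -
      have k: "k < n" "Z (mesh n (Suc k)) w \<noteq> Z (mesh n k) w" using that by (auto simp: I_def)
      then have "mesh n k < mesh n (Suc k)" using mesh_bounds(5)[of n k] by (cases "mesh n k = mesh n (Suc k)") auto
      moreover have "0 \<le> mesh n k" using mesh_bounds(1)[of k n] k st by simp
      moreover have "mesh n (Suc k) \<le> t" using mesh_bounds(2)[OF n, of "Suc k"] k by simp
      ultimately have "D \<inter> {mesh n k<..mesh n (Suc k)} \<noteq> {}" using k(2) by (intro J) auto
      then show ?thesis by blast
    qed
    then obtain h where h: "\<And>k. k \<in> I \<Longrightarrow> h k \<in> D" "\<And>k. k \<in> I \<Longrightarrow> mesh n k < h k \<and> h k \<le> mesh n (Suc k)"
      by (metis greaterThanAtMost_iff)
    have "inj_on h I"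
    proof (rule linorder_inj_onI)
      fix i j assume ij: "i < j" "i \<in> I" "j \<in> I"
      have "h i \<le> mesh n (Suc i)" using h(2)[OF ij(2)] by simp
      also have "\<dots> \<le> mesh n j" using ij(1) by (intro mesh_mono) simp
      also have "\<dots> < h j" using h(2)[OF ij(3)] by simp
      finally show "h i \<noteq> h j" by simp
    qed auto
    then have "card I \<le> card D" using h(1) D by (intro card_inj_on_le[of h]) auto
    moreover have "jump_count n n w = card I"
    proof -
      have "I = {..<n} \<inter> {k. Z (mesh n (Suc k)) w \<noteq> Z (mesh n k) w}" by (auto simp: I_def)
      then show ?thesis unfolding jump_count_def jumped_def by (simp add: sum_of_bool_eq)
    qed
    ultimately show ?thesis by simp
  qed
  then show ?thesis by blast
qed

text \<open>At most \<open>K\<close> increments of a path that is uniformly continuous on \<open>[s, t]\<close> are summed, so the sum tends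
  to 0 with the mesh. Grids are indexed by \<open>Suc n\<close> to avoid the empty one.\<close>

lemma jump_error_tendsto: "(\<lambda>n. \<integral>w. jump_error K (Suc n) w \<partial>M) \<longlonglongrightarrow> 0"
proof -
  have bd0: "0 \<le> exp_bound" by (simp add: exp_bound_def)
  have wmd: "norm (exp_mart (mesh n (Suc k)) w - exp_mart (mesh n k) w) \<le> 2 * exp_bound" if "0 < n" "k < n" for n k w
    using norm_triangle_ineq4[of "exp_mart (mesh n (Suc k)) w" "exp_mart (mesh n k) w"]
      exp_mart_bounded[of "mesh n (Suc k)" w] exp_mart_bounded[of "mesh n k" w]
      mesh_bounds(2)[of n k] mesh_bounds(2)[of n "Suc k"] that by simp
  have "(\<lambda>n. \<integral>w. jump_error K (Suc n) w \<partial>M) \<longlonglongrightarrow> (\<integral>w. 0 \<partial>M)"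
  proof (rule integral_dominated_convergence[where w="\<lambda>_. real K * (2 * exp_bound)"])
    show "AE w in M. (\<lambda>n. jump_error K (Suc n) w) \<longlonglongrightarrow> 0"
    proof -
      have "AE w in M. continuous_on {0..} (\<lambda>x. W x w)" using W by (simp add: brownian_motion_def)
      then show ?thesis
      proof eventually_elim
        case (elim w)
        have "continuous_on {s..t} (\<lambda>x. W x w)" by (rule continuous_on_subset[OF elim]) (use st in auto)
        then have "continuous_on {s..t} (\<lambda>x. exp_mart x w)" unfolding exp_mart_def by (intro continuous_intros) auto
        then have uc: "uniformly_continuous_on {s..t} (\<lambda>x. exp_mart x w)"
          by (intro compact_uniformly_continuous) auto
        show ?case
        proof (rule LIMSEQ_I)
          fix r :: real assume r: "0 < r"
          \<comment> \<open>chosen so that \<open>K e < r\<close>, also for \<open>K = 0\<close>\<close>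
          define e where "e = r / (2 * (real K + 1))"
          have e: "0 < e" using r by (simp add: e_def)
          obtain d where d: "0 < d" "\<And>x y. x \<in> {s..t} \<Longrightarrow> y \<in> {s..t} \<Longrightarrow> dist y x < d \<Longrightarrow> dist (exp_mart y w) (exp_mart x w) < e"
            using uc e unfolding uniformly_continuous_on_def by metis
          obtain N where N: "(t - s) / d < real N" using reals_Archimedean2 by blast
          have "norm (jump_error K (Suc n) w - 0) < r" if n: "N \<le> n" for n
          proof -
            have "(t - s) / d < real (Suc n)" using N n by simp
            then have small: "(t - s) / real (Suc n) < d"
              using d(1) by (simp add: divide_simps mult.commute)
            have v: "norm (exp_mart (mesh (Suc n) (Suc k)) w - exp_mart (mesh (Suc n) k) w) \<le> e" if k: "k < Suc n" for k
            proof -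
              have "dist (exp_mart (mesh (Suc n) (Suc k)) w) (exp_mart (mesh (Suc n) k) w) < e"
              proof (rule d(2))
                show "mesh (Suc n) k \<in> {s..t}" "mesh (Suc n) (Suc k) \<in> {s..t}"
                  using mesh_bounds(1,2)[of k "Suc n"] mesh_bounds(1,2)[of "Suc k" "Suc n"] mesh_bounds(2)[of "Suc n" k] mesh_bounds(2)[of "Suc n" "Suc k"] k by auto
                show "dist (mesh (Suc n) (Suc k)) (mesh (Suc n) k) < d"
                  using small mesh_bounds(5)[of "Suc n" k] mesh_bounds(6)[of "Suc n" k] by (simp add: dist_real_def)
              qed
              then show ?thesis by (simp add: dist_norm)
            qed
            have "jump_error K (Suc n) w \<le> real K * e" "0 \<le> jump_error K (Suc n) w" using jump_error_le[OF v] e by auto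
            moreover have "real K * e < r"
            proof -
              have "real K * e < (2 * (real K + 1)) * e" using e by (intro mult_strict_right_mono) auto
              then show ?thesis by (simp add: e_def)
            qed
            ultimately show ?thesis by simp
          qed
          then show "\<exists>no. \<forall>n\<ge>no. norm (jump_error K (Suc n) w - 0) < r" by blast
        qed
      qed
    qed
    show "AE w in M. norm (jump_error K (Suc n) w) \<le> real K * (2 * exp_bound)" for n
      using jump_error_le[OF wmd] bd0 by (intro AE_I2) (simp add: abs_of_nonneg)
  qed (use jump_error_measurable in auto)
  then show ?thesis by simp
qed

text \<open>First the mesh tends to 0 for fixed \<open>K\<close>, then \<open>K\<close> to infinity; the second limit uses that paths have finitely many jumps.\<close>

lemma decoupling_null:
  "(\<integral>w. complex_of_real (indicator C w) * (complex_of_real (f (Z t w)) * exp_mart t w - complex_of_real (predict s (Z s w))) \<partial>M) = 0"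
  (is "?I = 0")
proof -
  define B where "B K = (\<Union>n. {w \<in> space M. K \<le> jump_count (Suc n) (Suc n) w})" for K
  have Bm: "range B \<subseteq> sets M" unfolding B_def using jump_count_event by auto
  have "(\<lambda>K. prob (B K)) \<longlonglongrightarrow> prob (\<Inter>K. B K)"
    using Bm by (intro finite_Lim_measure_decseq) (auto simp: B_def decseq_def)
  moreover have "(\<Inter>K. B K) = {}"
  proof -
    have "w \<notin> (\<Inter>K. B K)" for w
    proof
      assume "w \<in> (\<Inter>K. B K)"
      then have *: "\<And>K. \<exists>n. w \<in> space M \<and> K \<le> jump_count (Suc n) (Suc n) w" by (auto simp: B_def)
      then obtain J where J: "\<And>n. jump_count (Suc n) (Suc n) w \<le> J" using jump_count_bounded[of w] by auto
      obtain n where "Suc J \<le> jump_count (Suc n) (Suc n) w" using * by blast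
      with J[of n] show False by simp
    qed
    then show ?thesis by blast
  qed
  ultimately have B0: "(\<lambda>K. prob (B K)) \<longlonglongrightarrow> 0" by simp
  have "norm ?I \<le> 4 * exp_bound * prob (B K)" for K
  proof -
    have "norm ?I \<le> 2 * (\<integral>w. jump_error K (Suc n) w \<partial>M) + 4 * exp_bound * prob (B K)" for n
    proof -
      have "norm ?I \<le> 2 * (\<integral>w. jump_error K (Suc n) w \<partial>M) + 4 * exp_bound * prob {w \<in> space M. K \<le> jump_count (Suc n) (Suc n) w}"
        by (rule decoupling_mesh) simp
      also have "prob {w \<in> space M. K \<le> jump_count (Suc n) (Suc n) w} \<le> prob (B K)"
        using Bm by (intro finite_measure_mono) (auto simp: B_def)
      finally show ?thesis by (simp add: exp_bound_def mult_left_mono)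
    qed
    moreover have "(\<lambda>n. 2 * (\<integral>w. jump_error K (Suc n) w \<partial>M) + 4 * exp_bound * prob (B K)) \<longlonglongrightarrow> 2 * 0 + 4 * exp_bound * prob (B K)"
      by (intro tendsto_intros jump_error_tendsto)
    ultimately have "norm ?I \<le> 2 * 0 + 4 * exp_bound * prob (B K)"
      by (intro LIMSEQ_le_const[of _ _ "norm ?I"]) blast+
    then show ?thesis by simp
  qed
  moreover have "(\<lambda>K. 4 * exp_bound * prob (B K)) \<longlonglongrightarrow> 4 * exp_bound * 0"
    by (intro tendsto_intros B0)
  ultimately have "norm ?I \<le> 4 * exp_bound * 0"
    by (intro LIMSEQ_le_const[of _ _ "norm ?I"]) blast+
  then show ?thesis by simp
qed

lemma decoupled_iexp:
  "(\<integral>w. complex_of_real (indicator C w) * complex_of_real (f (Z t w)) * iexp (u * (W t w - W s w)) \<partial>M)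
    = (\<integral>w. complex_of_real (indicator C w) * complex_of_real (f (Z t w)) \<partial>M) * complex_of_real (exp (- ((t - s) * u\<^sup>2) / 2))"
proof -
  have [measurable]: "C \<in> sets M" using sets_F_M[OF st(1) C] .
  have [measurable]: "(\<lambda>w. f (Z t w)) \<in> borel_measurable M" by (rule Z_measurable_M) (use st in auto)
  have [measurable]: "(\<lambda>w. predict s (Z s w)) \<in> borel_measurable M" by (rule Z_measurable_M) (use st in auto)
  have [measurable]: "exp_mart t \<in> borel_measurable M" using F_le_M[OF _ exp_mart_measurable[of t t]] st by auto
  have bd1: "1 \<le> exp_bound" using st by (simp add: exp_bound_def)
  have b: "norm (complex_of_real (indicator C w) * complex_of_real (g x) * v) \<le> exp_bound" if "\<bar>g x\<bar> \<le> 1" "norm v \<le> exp_bound" for g :: "real ^ 'd \<Rightarrow> real" and x v w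
  proof -
    have "\<bar>indicator C w\<bar> * \<bar>g x\<bar> * norm v \<le> 1 * 1 * exp_bound" using that bd1 by (intro mult_mono) (auto split: split_indicator)
    then show ?thesis by (simp add: norm_mult)
  qed
  have I1: "integrable M (\<lambda>w. complex_of_real (indicator C w) * complex_of_real (f (Z t w)) * exp_mart t w)"
    by (rule integrable_bounded_complex[where B=exp_bound]) (use b f exp_mart_bounded in auto)
  have I2: "integrable M (\<lambda>w. complex_of_real (indicator C w) * complex_of_real (predict s (Z s w)))"
    by (rule integrable_bounded_complex[where B=exp_bound]) (use b[of "predict s" _ 1] predict_bounded bd1 in auto)
  have ind: "(\<lambda>w. complex_of_real (indicator C w)) \<in> borel_measurable (F s)" using C by measurable
  have eq: "(\<integral>w. complex_of_real (indicator C w) * complex_of_real (f (Z t w)) * exp_mart t w \<partial>M)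
     = (\<integral>w. complex_of_real (indicator C w) * complex_of_real (predict s (Z s w)) \<partial>M)"
    using decoupling_null I1 I2 by (simp add: right_diff_distrib mult.assoc)
  also have "\<dots> = (\<integral>w. complex_of_real (indicator C w) * complex_of_real (f (Z (s + (t - s)) w)) \<partial>M)"
    unfolding predict_def
    by (rule markov_complex[symmetric, OF _ _ f ind])
      (use st in \<open>auto intro!: integrable_bounded_complex[where B=1] split: split_indicator\<close>)
  finally have eq: "(\<integral>w. complex_of_real (indicator C w) * complex_of_real (f (Z t w)) * exp_mart t w \<partial>M)
      = (\<integral>w. complex_of_real (indicator C w) * complex_of_real (f (Z t w)) \<partial>M)" by simp
  have "complex_of_real (indicator C w) * complex_of_real (f (Z t w)) * iexp (u * (W t w - W s w))
     = complex_of_real (indicator C w) * complex_of_real (f (Z t w)) * exp_mart t w * complex_of_real (exp (- ((t - s) * u\<^sup>2) / 2))" for w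
  proof -
    have "exp (u\<^sup>2 * (t - s) / 2) * exp (- ((t - s) * u\<^sup>2) / 2) = 1"
      by (simp add: exp_add[symmetric] mult.commute)
    then have "complex_of_real (exp (u\<^sup>2 * (t - s) / 2)) * complex_of_real (exp (- ((t - s) * u\<^sup>2) / 2)) = 1"
      by (simp only: of_real_mult[symmetric] of_real_1)
    then show ?thesis unfolding exp_mart_def by (simp only: mult.assoc mult_1_right)
  qed
  then show ?thesis by (simp only: integral_mult_left_zero eq)
qed

end

text \<open>Events of \<open>F s\<close> intersected with finitely many conditions on the chain at the times \<open>\<tau> 0, \<tau> 1, \<dots>\<close>:
  an intersection-stable generator of \<open>F s\<close> enlarged by these values of the chain.\<close>

definition future_gen :: "real \<Rightarrow> (nat \<Rightarrow> real) \<Rightarrow> nat \<Rightarrow> 'w set set" where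
  "future_gen s \<tau> m = {C \<inter> {w \<in> space M. \<forall>j<m. Z (\<tau> j) w \<in> S j} | C S. C \<in> sets (F s)}"

definition enlarged :: "real \<Rightarrow> (nat \<Rightarrow> real) \<Rightarrow> nat \<Rightarrow> 'w measure" where
  "enlarged s \<tau> m = sigma (space M) (future_gen s \<tau> m)"

text \<open>By repeated use of the Markov property, a condition on the chain after time \<open>t\<close> acts on \<open>F t\<close> through
  a function of \<open>Z t\<close> alone.\<close>

lemma future_value:
  assumes "0 \<le> t" "t \<le> \<tau> 0" "\<And>i. \<tau> i \<le> \<tau> (Suc i)"
  shows "\<exists>g. (\<forall>z. \<bar>g z\<bar> \<le> 1) \<and> (\<forall>\<xi> :: 'w \<Rightarrow> complex. \<xi> \<in> borel_measurable (F t) \<longrightarrow> integrable M \<xi> \<longrightarrow>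
     (\<integral>w. \<xi> w * complex_of_real (of_bool (\<forall>j<m. Z (\<tau> j) w \<in> S j)) \<partial>M) = (\<integral>w. \<xi> w * complex_of_real (g (Z t w)) \<partial>M))"
  using assms
proof (induction m arbitrary: t \<tau> S)
  case 0
  show ?case by (rule exI[of _ "\<lambda>_. 1"]) simp
next
  case (Suc m)
  have t0: "0 \<le> \<tau> 0" using Suc.prems by simp
  obtain g where g: "\<And>z. \<bar>g z\<bar> \<le> 1"
    and G: "\<And>\<xi> :: 'w \<Rightarrow> complex. \<xi> \<in> borel_measurable (F (\<tau> 0)) \<Longrightarrow> integrable M \<xi> \<Longrightarrow>
     (\<integral>w. \<xi> w * complex_of_real (of_bool (\<forall>j<m. Z (\<tau> (Suc j)) w \<in> S (Suc j))) \<partial>M) = (\<integral>w. \<xi> w * complex_of_real (g (Z (\<tau> 0) w)) \<partial>M)"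
    using Suc.IH[of "\<tau> 0" "\<lambda>j. \<tau> (Suc j)" "\<lambda>j. S (Suc j)"] Suc.prems t0 by auto
  define h where "h z = indicator (S 0) z * g z" for z
  have h: "\<bar>h z\<bar> \<le> 1" for z using g[of z] by (simp add: h_def split: split_indicator)
  show ?case
  proof (intro exI[of _ "semigroup_op P (\<tau> 0 - t) h"] conjI allI impI)
    show "\<bar>semigroup_op P (\<tau> 0 - t) h z\<bar> \<le> 1" for z by (rule semigroup_bounded[OF h])
    fix \<xi> :: "'w \<Rightarrow> complex" assume \<xi>: "\<xi> \<in> borel_measurable (F t)" and i: "integrable M \<xi>"
    have [measurable]: "\<xi> \<in> borel_measurable (F (\<tau> 0))" using F_mono[OF _ _ \<xi>] Suc.prems by blast
    have [measurable]: "(\<lambda>w. indicator (S 0) (Z (\<tau> 0) w) :: real) \<in> borel_measurable (F (\<tau> 0))"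
      by (rule Z_measurable) (use t0 in auto)
    have "integrable M (\<lambda>w. \<xi> w * complex_of_real (indicator (S 0) (Z (\<tau> 0) w)))"
    proof (rule Bochner_Integration.integrable_bound[OF i])
      show "(\<lambda>w. \<xi> w * complex_of_real (indicator (S 0) (Z (\<tau> 0) w))) \<in> borel_measurable M"
        by (rule F_le_M[OF t0]) measurable
    qed (auto simp: norm_mult split: split_indicator)
    then have "(\<integral>w. (\<xi> w * complex_of_real (indicator (S 0) (Z (\<tau> 0) w))) * complex_of_real (of_bool (\<forall>j<m. Z (\<tau> (Suc j)) w \<in> S (Suc j))) \<partial>M)
       = (\<integral>w. (\<xi> w * complex_of_real (indicator (S 0) (Z (\<tau> 0) w))) * complex_of_real (g (Z (\<tau> 0) w)) \<partial>M)"
      by (intro G) measurable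
    also have "\<dots> = (\<integral>w. \<xi> w * complex_of_real (h (Z (t + (\<tau> 0 - t)) w)) \<partial>M)"
      by (simp add: h_def mult.assoc)
    also have "\<dots> = (\<integral>w. \<xi> w * complex_of_real (semigroup_op P (\<tau> 0 - t) h (Z t w)) \<partial>M)"
      by (rule markov_complex[OF _ _ h \<xi> i]) (use Suc.prems in auto)
    also have "(\<lambda>w. (\<xi> w * complex_of_real (indicator (S 0) (Z (\<tau> 0) w))) * complex_of_real (of_bool (\<forall>j<m. Z (\<tau> (Suc j)) w \<in> S (Suc j))))
      = (\<lambda>w. \<xi> w * complex_of_real (of_bool (\<forall>j<Suc m. Z (\<tau> j) w \<in> S j)))"
    proof
      fix w
      have "(\<forall>j<Suc m. Z (\<tau> j) w \<in> S j) \<longleftrightarrow> Z (\<tau> 0) w \<in> S 0 \<and> (\<forall>j<m. Z (\<tau> (Suc j)) w \<in> S (Suc j))"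
        by (rule All_less_Suc2)
      then show "(\<xi> w * complex_of_real (indicator (S 0) (Z (\<tau> 0) w))) * complex_of_real (of_bool (\<forall>j<m. Z (\<tau> (Suc j)) w \<in> S (Suc j)))
         = \<xi> w * complex_of_real (of_bool (\<forall>j<Suc m. Z (\<tau> j) w \<in> S j))"
        by (cases "Z (\<tau> 0) w \<in> S 0") simp_all
    qed
    finally show "(\<integral>w. \<xi> w * complex_of_real (of_bool (\<forall>j<Suc m. Z (\<tau> j) w \<in> S j)) \<partial>M)
      = (\<integral>w. \<xi> w * complex_of_real (semigroup_op P (\<tau> 0 - t) h (Z t w)) \<partial>M)" .
  qed
qed

lemma future_genI:
  "C \<in> sets (F s) \<Longrightarrow> C \<inter> {w \<in> space M. \<forall>j<m. Z (\<tau> j) w \<in> S j} \<in> future_gen s \<tau> m"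
  unfolding future_gen_def by blast

lemma future_gen_measurable:
  assumes "0 \<le> s" "\<And>j. 0 \<le> \<tau> j"
  shows "future_gen s \<tau> m \<subseteq> sets M"
proof -
  have "{w \<in> space M. Z (\<tau> j) w \<in> S j} \<in> sets M" for j and S :: "nat \<Rightarrow> (real ^ 'd) set"
    using measurable_sets[OF Z_measurable_M[OF assms(2), of "\<lambda>z. z" "count_space UNIV"], of "S j" j]
    by (simp add: vimage_def Int_def conj_commute)
  then have "{w \<in> space M. \<forall>j<m. Z (\<tau> j) w \<in> S j} \<in> sets M" for S :: "nat \<Rightarrow> (real ^ 'd) set"
    by (intro sets.sets_Collect_countable_All sets.sets_Collect) auto
  then have "C \<inter> {w \<in> space M. \<forall>j<m. Z (\<tau> j) w \<in> S j} \<in> sets M" if "C \<in> sets (F s)" for C S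
    using sets_F_M[OF assms(1) that] by (intro sets.Int)
  then show ?thesis unfolding future_gen_def by blast
qed

lemma subalgebra_enlarged:
  assumes "0 \<le> s" "\<And>j. 0 \<le> \<tau> j"
  shows "subalgebra_prob M (enlarged s \<tau> m)"
proof unfold_locales
  have "future_gen s \<tau> m \<subseteq> sets M" by (rule future_gen_measurable[OF assms])
  then show "subalgebra M (enlarged s \<tau> m)"
    unfolding subalgebra_def enlarged_def
    by (simp add: sets_measure_of_conv space_measure_of_conv sets.sigma_sets_subset)
qed

lemma sets_enlarged:
  assumes "0 \<le> s" "\<And>j. 0 \<le> \<tau> j"
  shows "sets (enlarged s \<tau> m) = sigma_sets (space M) (future_gen s \<tau> m)"
proof -
  have "future_gen s \<tau> m \<subseteq> Pow (space M)" by (rule order_trans[OF future_gen_measurable[OF assms] sets.space_closed])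
  then show ?thesis by (simp add: enlarged_def)
qed

lemma F_le_enlarged:
  assumes "0 \<le> s" "\<And>j. 0 \<le> \<tau> j" "f \<in> measurable (F s) K"
  shows "f \<in> measurable (enlarged s \<tau> m) K"
proof -
  have "C \<in> sets (enlarged s \<tau> m)" if C: "C \<in> sets (F s)" for C
  proof -
    have "C \<inter> {w \<in> space M. \<forall>j<m. Z (\<tau> j) w \<in> UNIV} \<in> future_gen s \<tau> m"
      using C by (rule future_genI)
    moreover have "C \<inter> {w \<in> space M. \<forall>j<m. Z (\<tau> j) w \<in> UNIV} = C"
      using sets.sets_into_space[OF C] space_F[OF assms(1)] by auto
    ultimately have "C \<in> future_gen s \<tau> m" by simp
    then show ?thesis unfolding sets_enlarged[OF assms(1,2)] by (rule sigma_sets.Basic)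
  qed
  moreover interpret subalgebra_prob M "enlarged s \<tau> m" by (rule subalgebra_enlarged[OF assms(1,2)])
  have "space (enlarged s \<tau> m) = space (F s)" using space_F[OF assms(1)] by simp
  ultimately show ?thesis
    by (intro measurable_from_subalg[OF _ assms(3)]) (auto simp: subalgebra_def)
qed

lemma Z_measurable_enlarged:
  assumes s: "0 \<le> s" "\<And>j. 0 \<le> \<tau> j" and j: "j < m" and h: "h \<in> E \<rightarrow> space K"
  shows "(\<lambda>w. h (Z (\<tau> j) w)) \<in> measurable (enlarged s \<tau> m) K"
proof -
  interpret subalgebra_prob M "enlarged s \<tau> m" by (rule subalgebra_enlarged[OF s])
  have "Z (\<tau> j) -` {z} \<inter> space M \<in> sets (enlarged s \<tau> m)" for z
  proof -
    have "space M \<in> sets (F s)" using sets.top[of "F s"] space_F[OF s(1)] by simp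
    then have "space M \<inter> {w \<in> space M. \<forall>i<m. Z (\<tau> i) w \<in> (if i = j then {z} else UNIV)} \<in> future_gen s \<tau> m"
      by (rule future_genI)
    moreover have "space M \<inter> {w \<in> space M. \<forall>i<m. Z (\<tau> i) w \<in> (if i = j then {z} else UNIV)} = Z (\<tau> j) -` {z} \<inter> space M"
    proof -
      have "(\<forall>i<m. Z (\<tau> i) w \<in> (if i = j then {z} else UNIV)) \<longleftrightarrow> Z (\<tau> j) w = z" for w
        using j by (metis UNIV_I singletonD singletonI)
      then show ?thesis by blast
    qed
    ultimately have "Z (\<tau> j) -` {z} \<inter> space M \<in> future_gen s \<tau> m" by (simp only:)
    then show ?thesis unfolding sets_enlarged[OF s] by (rule sigma_sets.Basic)
  qed
  then have "Z (\<tau> j) \<in> measurable (enlarged s \<tau> m) (count_space E)"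
    using Z_in_E s by (simp add: measurable_count_space_eq_countable[OF countable_E] Pi_iff)
  then show ?thesis by (rule measurable_compose) (use h in auto)
qed

text \<open>An increment over \<open>[s, t]\<close> stays independent Gaussian when \<open>F s\<close> is enlarged by the chain after time
  \<open>t\<close>: the later chain enters through a function of \<open>Z t\<close>, and \<open>Z t\<close> is decoupled from the increment.\<close>

lemma bm_increment_enlarged:
  assumes W: "brownian_motion M F W" and st: "0 \<le> s" "s < t" and \<tau>: "t \<le> \<tau> 0" "\<And>i. \<tau> i \<le> \<tau> (Suc i)"
  shows "indep_gauss M (enlarged s \<tau> m) (\<lambda>w. W t w - W s w) (t - s)"
proof (rule indep_gauss_char)
  have \<tau>0: "0 \<le> \<tau> j" for j
  proof (induction j)
    case (Suc j) then show ?case using \<tau>(2)[of j] by simp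
  qed (use st \<tau> in simp)
  have [measurable]: "W t \<in> borel_measurable M" "W s \<in> borel_measurable M" using bm_measurable[OF W] st by auto
  show "(\<lambda>w. W t w - W s w) \<in> borel_measurable M" by measurable
  show "future_gen s \<tau> m \<subseteq> sets M" using future_gen_measurable[OF st(1) \<tau>0] .
  show "sets (enlarged s \<tau> m) = sigma_sets (space M) (future_gen s \<tau> m)" using sets_enlarged[OF st(1) \<tau>0] .
  show "Int_stable (future_gen s \<tau> m)"
  proof (rule Int_stableI)
    fix A B assume "A \<in> future_gen s \<tau> m" "B \<in> future_gen s \<tau> m"
    then obtain C S C' S' where "C \<in> sets (F s)" "C' \<in> sets (F s)"
      and A: "A = C \<inter> {w \<in> space M. \<forall>j<m. Z (\<tau> j) w \<in> S j}" and B: "B = C' \<inter> {w \<in> space M. \<forall>j<m. Z (\<tau> j) w \<in> S' j}"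
      unfolding future_gen_def by blast
    moreover have "A \<inter> B = (C \<inter> C') \<inter> {w \<in> space M. \<forall>j<m. Z (\<tau> j) w \<in> S j \<inter> S' j}"
      unfolding A B by auto
    ultimately show "A \<inter> B \<in> future_gen s \<tau> m"
      by (simp only: sets.Int future_genI)
  qed
  show "space M \<in> future_gen s \<tau> m"
    using future_genI[of "space M" s m \<tau> "\<lambda>_. UNIV"] sets.top[of "F s"] space_F[OF st(1)] by simp
  fix A u assume "A \<in> future_gen s \<tau> m"
  then obtain C S where C: "C \<in> sets (F s)" and A: "A = C \<inter> {w \<in> space M. \<forall>j<m. Z (\<tau> j) w \<in> S j}"
    unfolding future_gen_def by blast
  obtain g where g: "\<And>z. \<bar>g z\<bar> \<le> 1"
    and G: "\<And>\<xi> :: 'w \<Rightarrow> complex. \<xi> \<in> borel_measurable (F t) \<Longrightarrow> integrable M \<xi> \<Longrightarrow>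
     (\<integral>w. \<xi> w * complex_of_real (of_bool (\<forall>j<m. Z (\<tau> j) w \<in> S j)) \<partial>M) = (\<integral>w. \<xi> w * complex_of_real (g (Z t w)) \<partial>M)"
    using future_value[of t \<tau> m S] st \<tau> by auto
  have [measurable]: "C \<in> sets (F t)" using C sets_F_mono[of s t] st by auto
  have [measurable]: "C \<in> sets M" using sets_F_M[OF st(1) C] .
  have [measurable]: "W t \<in> borel_measurable (F t)" "W s \<in> borel_measurable (F t)" using bm_adapted[OF W] st by auto
  have ind: "(\<integral>w. complex_of_real (indicator C w) * complex_of_real (of_bool (\<forall>j<m. Z (\<tau> j) w \<in> S j)) \<partial>M)
      = complex_of_real (prob A)"
  proof -
    have "A \<in> sets M" using \<open>A \<in> future_gen s \<tau> m\<close> future_gen_measurable[where m=m and \<tau>=\<tau>, OF st(1) \<tau>0] by blast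
    have "(\<integral>w. complex_of_real (indicator C w) * complex_of_real (of_bool (\<forall>j<m. Z (\<tau> j) w \<in> S j)) \<partial>M)
      = (\<integral>w. complex_of_real (indicator A w) \<partial>M)"
      by (intro Bochner_Integration.integral_cong) (auto simp: A indicator_def)
    then show ?thesis using \<open>A \<in> sets M\<close> by simp
  qed
  have i1: "integrable M (\<lambda>w. complex_of_real (indicator C w) * iexp (u * (W t w - W s w)))"
    by (rule integrable_bounded_complex[where B=1]) (auto simp: norm_mult split: split_indicator)
  have i2: "integrable M (\<lambda>w. complex_of_real (indicator C w))"
    by (rule integrable_bounded_complex[where B=1]) (auto split: split_indicator)
  have "(\<integral>w. indicator A w *\<^sub>R iexp (u * (W t w - W s w)) \<partial>M)
    = (\<integral>w. (complex_of_real (indicator C w) * iexp (u * (W t w - W s w))) * complex_of_real (of_bool (\<forall>j<m. Z (\<tau> j) w \<in> S j)) \<partial>M)"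
    by (intro Bochner_Integration.integral_cong) (auto simp: A indicator_def)
  also have "\<dots> = (\<integral>w. (complex_of_real (indicator C w) * iexp (u * (W t w - W s w))) * complex_of_real (g (Z t w)) \<partial>M)"
    by (rule G[OF _ i1]) measurable
  also have "\<dots> = (\<integral>w. complex_of_real (indicator C w) * complex_of_real (g (Z t w)) * iexp (u * (W t w - W s w)) \<partial>M)"
    by (simp only: mult_ac)
  also have "\<dots> = (\<integral>w. complex_of_real (indicator C w) * complex_of_real (g (Z t w)) \<partial>M) * complex_of_real (exp (- ((t - s) * u\<^sup>2) / 2))"
    by (rule decoupled_iexp[OF W st g C])
  also have "(\<integral>w. complex_of_real (indicator C w) * complex_of_real (g (Z t w)) \<partial>M) = complex_of_real (prob A)"
    unfolding ind[symmetric] by (rule G[OF _ i2, symmetric]) measurable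
  finally show "(\<integral>w. indicator A w *\<^sub>R iexp (u * (W t w - W s w)) \<partial>M) = complex_of_real (prob A * exp (- ((t - s) * u\<^sup>2) / 2))"
    by simp
qed (use st in simp)

end

section \<open>Gaussian smoothing of Lipschitz convex functions\<close>

lemma measure_gauss_UNIV [simp]: "measure (gauss v) UNIV = 1"
  using prob_space.prob_space[OF prob_space_gauss[of v]] by simp

locale lipschitz_convex =
  fixes \<phi> :: "real \<Rightarrow> real" and L :: real
  assumes convex: "convex_on UNIV \<phi>" and lipschitz: "\<And>x y. \<bar>\<phi> x - \<phi> y\<bar> \<le> L * \<bar>x - y\<bar>"
begin

lemma L_nonneg: "0 \<le> L"
  using lipschitz[of 1 0] by simp

lemma measurable_\<phi>[measurable]: "\<phi> \<in> borel_measurable borel"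
proof (rule borel_measurable_continuous_onI)
  have "L-lipschitz_on UNIV \<phi>"
    by (rule lipschitz_onI) (auto simp: dist_real_def lipschitz L_nonneg)
  then show "continuous_on UNIV \<phi>" by (rule lipschitz_on_continuous_on)
qed

lemma convexD: "0 \<le> a \<Longrightarrow> a \<le> 1 \<Longrightarrow> \<phi> (a * x + (1 - a) * y) \<le> a * \<phi> x + (1 - a) * \<phi> y"
  using convex_onD[OF convex, of "1 - a" x y] by simp

lemma \<phi>_bound: "\<bar>\<phi> x\<bar> \<le> \<bar>\<phi> 0\<bar> + L * \<bar>x\<bar>"
  using lipschitz[of x 0] by simp

text \<open>The function \<open>\<phi>\<close> averaged over an independent Gaussian displacement of variance \<open>v\<close>, i.e. the heat
  semigroup. It stands for the part of a sum that has not been revealed yet.\<close>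

definition smooth :: "real \<Rightarrow> real \<Rightarrow> real" where
  "smooth v r = (\<integral>x. \<phi> (r + x) \<partial>gauss v)"

lemma integrable_shift: "integrable (gauss v) (\<lambda>x. \<phi> (r + c * x))"
proof -
  interpret g: prob_space "gauss v" by (rule prob_space_gauss)
  have "integrable (gauss v) (\<lambda>x. \<bar>\<phi> r\<bar> + L * \<bar>c * x\<bar>)"
    using integrable_gauss_ident[of v] by (auto intro!: integrable_mult_right)
  then show ?thesis
  proof (rule Bochner_Integration.integrable_bound)
    show "AE x in gauss v. norm (\<phi> (r + c * x)) \<le> norm (\<bar>\<phi> r\<bar> + L * \<bar>c * x\<bar>)"
    proof (rule AE_I2)
      fix x
      have "\<bar>\<phi> (r + c * x)\<bar> \<le> \<bar>\<phi> r\<bar> + L * \<bar>c * x\<bar>"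
        using lipschitz[of "r + c * x" r] by simp
      then show "norm (\<phi> (r + c * x)) \<le> norm (\<bar>\<phi> r\<bar> + L * \<bar>c * x\<bar>)" by simp
    qed
  qed measurable
qed

lemma integrable_shift': "integrable (gauss v) (\<lambda>x. \<phi> (r + x))"
  using integrable_shift[of v r 1] by simp

lemma smooth_zero: "smooth 0 r = \<phi> r"
  unfolding smooth_def gauss_zero by (subst integral_return) auto

lemma smooth_std: "smooth v r = (\<integral>x. \<phi> (r + sqrt v * x) \<partial>std_normal_distribution)"
  unfolding smooth_def gauss_def by (subst integral_distr) auto

lemma smooth_measurable: "(\<lambda>(v, r). smooth v r) \<in> borel_measurable (borel \<Otimes>\<^sub>M borel)"
proof -
  interpret s: prob_space std_normal_distribution by (rule prob_std_normal)
  have "(\<lambda>p. \<integral>x. \<phi> (snd p + sqrt (fst p) * x) \<partial>std_normal_distribution) \<in> borel_measurable (borel \<Otimes>\<^sub>M borel)"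
    by (rule s.borel_measurable_lebesgue_integral) measurable
  then show ?thesis by (simp add: smooth_std split_beta')
qed

lemma smooth_lipschitz: "\<bar>smooth v r - smooth v s\<bar> \<le> L * \<bar>r - s\<bar>"
proof -
  interpret g: prob_space "gauss v" by (rule prob_space_gauss)
  have "\<bar>smooth v r - smooth v s\<bar> = \<bar>\<integral>x. \<phi> (r + x) - \<phi> (s + x) \<partial>gauss v\<bar>"
    unfolding smooth_def by (simp add: integrable_shift')
  also have "\<dots> \<le> (\<integral>x. \<bar>\<phi> (r + x) - \<phi> (s + x)\<bar> \<partial>gauss v)"
    using integral_norm_bound[of "gauss v" "\<lambda>x. \<phi> (r + x) - \<phi> (s + x)"] by simp
  also have "\<dots> \<le> L * \<bar>r - s\<bar>"
  proof (rule g.integral_le_const)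
    show "AE x in gauss v. \<bar>\<phi> (r + x) - \<phi> (s + x)\<bar> \<le> L * \<bar>r - s\<bar>"
    proof (rule AE_I2)
      fix x show "\<bar>\<phi> (r + x) - \<phi> (s + x)\<bar> \<le> L * \<bar>r - s\<bar>" using lipschitz[of "r + x" "s + x"] by simp
    qed
  qed (intro integrable_abs Bochner_Integration.integrable_diff integrable_shift')
  finally show ?thesis .
qed

lemma smooth_convex:
  assumes "0 \<le> a" "a \<le> 1"
  shows "smooth v (a * x + (1 - a) * y) \<le> a * smooth v x + (1 - a) * smooth v y"
proof -
  have "smooth v (a * x + (1 - a) * y) \<le> (\<integral>z. a * \<phi> (x + z) + (1 - a) * \<phi> (y + z) \<partial>gauss v)"
    unfolding smooth_def
  proof (rule integral_mono)
    show "\<phi> (a * x + (1 - a) * y + z) \<le> a * \<phi> (x + z) + (1 - a) * \<phi> (y + z)" for z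
      using convexD[OF assms, of "x + z" "y + z"] by (simp add: algebra_simps)
  qed (auto intro!: integrable_shift' integrable_mult_right)
  also have "\<dots> = a * smooth v x + (1 - a) * smooth v y"
    unfolding smooth_def by (subst Bochner_Integration.integral_add) (auto intro!: integrable_shift' integrable_mult_right)
  finally show ?thesis .
qed

text \<open>A bound that is linear in \<open>r\<close> and in \<open>v\<close>, from \<open>|x| \<le> 1 + x\<^sup>2\<close>, is all that integrability needs.\<close>

lemma smooth_bound:
  assumes "0 \<le> v"
  shows "\<bar>smooth v r\<bar> \<le> \<bar>\<phi> 0\<bar> + L * \<bar>r\<bar> + L * (1 + v)"
proof -
  interpret g: prob_space "gauss v" by (rule prob_space_gauss)
  have i: "integrable (gauss v) (\<lambda>x. x\<^sup>2)" by (rule integrable_gauss_power)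
  have "\<bar>smooth v r\<bar> \<le> (\<integral>x. \<bar>\<phi> (r + x)\<bar> \<partial>gauss v)"
    unfolding smooth_def using integral_norm_bound[of "gauss v" "\<lambda>x. \<phi> (r + x)"] by simp
  also have "\<dots> \<le> (\<integral>x. \<bar>\<phi> 0\<bar> + L * \<bar>r\<bar> + L * (1 + x\<^sup>2) \<partial>gauss v)"
  proof (rule integral_mono)
    show "integrable (gauss v) (\<lambda>x. \<bar>\<phi> (r + x)\<bar>)" by (intro integrable_abs integrable_shift')
    show "integrable (gauss v) (\<lambda>x. \<bar>\<phi> 0\<bar> + L * \<bar>r\<bar> + L * (1 + x\<^sup>2))" using i by simp
    fix x :: real
    have "\<bar>x\<bar> \<le> 1 + x\<^sup>2"
    proof -
      have "0 \<le> (\<bar>x\<bar> - 1)\<^sup>2" by simp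
      then have "2 * \<bar>x\<bar> \<le> 1 + x\<^sup>2" by (simp add: power2_diff)
      then show ?thesis by simp
    qed
    then have "\<bar>r + x\<bar> \<le> \<bar>r\<bar> + (1 + x\<^sup>2)" by linarith
    then have "L * \<bar>r + x\<bar> \<le> L * (\<bar>r\<bar> + (1 + x\<^sup>2))" by (rule mult_left_mono[OF _ L_nonneg])
    then show "\<bar>\<phi> (r + x)\<bar> \<le> \<bar>\<phi> 0\<bar> + L * \<bar>r\<bar> + L * (1 + x\<^sup>2)"
      using \<phi>_bound[of "r + x"] by (simp add: distrib_left)
  qed
  also have "\<dots> = \<bar>\<phi> 0\<bar> + L * \<bar>r\<bar> + L * (1 + v)"
    using i gauss_variance[OF assms] by simp
  finally show ?thesis .
qed

lemma smooth_convolution: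
  assumes "0 \<le> v" "0 \<le> \<delta>"
  shows "(\<integral>x. smooth v (r + e * x) \<partial>gauss \<delta>) = smooth (v + e\<^sup>2 * \<delta>) r"
proof -
  interpret v: prob_space "gauss v" by (rule prob_space_gauss)
  interpret w: prob_space "gauss (e\<^sup>2 * \<delta>)" by (rule prob_space_gauss)
  interpret P: pair_prob_space "gauss (e\<^sup>2 * \<delta>)" "gauss v" ..
  have m: "smooth v \<in> borel_measurable borel"
    using measurable_compose[OF measurable_Pair1'[of v borel] smooth_measurable] by simp
  have "smooth (v + e\<^sup>2 * \<delta>) r = (\<integral>x. \<phi> (r + x) \<partial>distr (gauss (e\<^sup>2 * \<delta>) \<Otimes>\<^sub>M gauss v) borel (\<lambda>(x, y). x + y))"
    unfolding smooth_def using assms by (subst gauss_convolution) (auto simp: add.commute)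
  also have "\<dots> = (\<integral>z. \<phi> (r + (fst z + snd z)) \<partial>(gauss (e\<^sup>2 * \<delta>) \<Otimes>\<^sub>M gauss v))"
    by (subst integral_distr) (auto simp: split_beta')
  also have "\<dots> = (\<integral>x. \<integral>y. \<phi> (r + (x + y)) \<partial>gauss v \<partial>gauss (e\<^sup>2 * \<delta>))"
  proof -
    have "integrable (gauss (e\<^sup>2 * \<delta>) \<Otimes>\<^sub>M gauss v) (\<lambda>z. \<phi> (r + (fst z + snd z)))"
    proof -
      have "integrable (gauss (v + e\<^sup>2 * \<delta>)) (\<lambda>x. \<phi> (r + x))" by (rule integrable_shift')
      also have "gauss (v + e\<^sup>2 * \<delta>) = distr (gauss (e\<^sup>2 * \<delta>) \<Otimes>\<^sub>M gauss v) borel (\<lambda>(x, y). x + y)"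
        using assms by (subst gauss_convolution) (auto simp: add.commute)
      finally show ?thesis by (subst (asm) integrable_distr_eq) (auto simp: split_beta')
    qed
    then show ?thesis by (subst P.integral_fst'[symmetric]) auto
  qed
  also have "\<dots> = (\<integral>x. smooth v (r + x) \<partial>gauss (e\<^sup>2 * \<delta>))"
    unfolding smooth_def by (simp add: add.assoc)
  also have "\<dots> = (\<integral>x. smooth v (r + e * x) \<partial>gauss \<delta>)"
    unfolding gauss_scale[OF assms(2), of e, symmetric] using m by (subst integral_distr) auto
  finally show ?thesis by simp
qed

text \<open>More variance increases the average of a convex function: add an independent Gaussian and compare with its
  reflection.\<close>

lemma smooth_mono:
  assumes "0 \<le> v" "v \<le> w"
  shows "smooth v r \<le> smooth w r"
proof -
  define \<delta> where "\<delta> = w - v"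
  have \<delta>: "0 \<le> \<delta>" using assms by (simp add: \<delta>_def)
  interpret g: prob_space "gauss \<delta>" by (rule prob_space_gauss)
  have m: "smooth v \<in> borel_measurable borel"
    using measurable_compose[OF measurable_Pair1'[of v borel] smooth_measurable] by simp
  have i: "integrable (gauss \<delta>) (\<lambda>x. smooth v (r + e * x))" for e
  proof (rule Bochner_Integration.integrable_bound[where f="\<lambda>x. \<bar>\<phi> 0\<bar> + L * (\<bar>r\<bar> + \<bar>e * x\<bar>) + L * (1 + v)"])
    show "integrable (gauss \<delta>) (\<lambda>x. \<bar>\<phi> 0\<bar> + L * (\<bar>r\<bar> + \<bar>e * x\<bar>) + L * (1 + v))"
      using integrable_gauss_ident[of \<delta>] by (auto intro!: integrable_mult_right)
    show "AE x in gauss \<delta>. norm (smooth v (r + e * x)) \<le> norm (\<bar>\<phi> 0\<bar> + L * (\<bar>r\<bar> + \<bar>e * x\<bar>) + L * (1 + v))"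
    proof (rule AE_I2)
      fix x
      have "L * \<bar>r + e * x\<bar> \<le> L * (\<bar>r\<bar> + \<bar>e * x\<bar>)" by (intro mult_left_mono L_nonneg abs_triangle_ineq)
      then show "norm (smooth v (r + e * x)) \<le> norm (\<bar>\<phi> 0\<bar> + L * (\<bar>r\<bar> + \<bar>e * x\<bar>) + L * (1 + v))"
        using smooth_bound[OF assms(1), of "r + e * x"] by simp
    qed
  qed (use m in measurable)
  have c: "(\<integral>x. smooth v (r + e * x) \<partial>gauss \<delta>) = smooth w r" if "e\<^sup>2 = 1" for e
    using smooth_convolution[OF assms(1) \<delta>, of r e] that by (simp add: \<delta>_def)
  have "smooth v r = (\<integral>x. smooth v r \<partial>gauss \<delta>)" by simp
  also have "\<dots> \<le> (\<integral>x. 1/2 * smooth v (r + 1 * x) + 1/2 * smooth v (r + (- 1) * x) \<partial>gauss \<delta>)"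
  proof (rule integral_mono)
    show "smooth v r \<le> 1/2 * smooth v (r + 1 * x) + 1/2 * smooth v (r + (- 1) * x)" for x
      using smooth_convex[of "1/2" v "r + x" "r - x"] by (simp add: field_simps)
  qed (intro Bochner_Integration.integrable_add integrable_mult_right i g.integrable_const)+
  also have "\<dots> = 1/2 * (\<integral>x. smooth v (r + 1 * x) \<partial>gauss \<delta>) + 1/2 * (\<integral>x. smooth v (r + (- 1) * x) \<partial>gauss \<delta>)"
    using i[of 1] i[of "- 1"] by simp
  also have "\<dots> = 1/2 * smooth w r + 1/2 * smooth w r"
    unfolding c[of 1, simplified power_one, OF refl] c[of "- 1", simplified power2_minus power_one, OF refl] ..
  finally show ?thesis by simp
qed

end

section \<open>One step of the comparison\<close>

lemma finite_support_bounded: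
  fixes f g :: "'s \<Rightarrow> real"
  assumes S: "finite S" and off: "\<And>z. z \<notin> S \<Longrightarrow> f z = 0" "\<And>z. z \<notin> S \<Longrightarrow> g z = 0"
  shows "\<exists>K. \<forall>z. \<bar>f z\<bar> \<le> K \<and> \<bar>g z\<bar> \<le> K"
proof -
  define K where "K = (\<Sum>z\<in>S. \<bar>f z\<bar> + \<bar>g z\<bar>)"
  have *: "\<bar>f z\<bar> + \<bar>g z\<bar> \<le> K" for z
    using S off member_le_sum[of z S "\<lambda>z. \<bar>f z\<bar> + \<bar>g z\<bar>"]
    by (cases "z \<in> S") (auto simp: K_def sum_nonneg)
  have "\<bar>f z\<bar> \<le> K \<and> \<bar>g z\<bar> \<le> K" for z using *[of z] by linarith
  then show ?thesis by blast
qed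

text \<open>Everything known before the step is \<open>G\<close>-measurable: the current value \<open>U\<close> and, thanks to the
  enlargement, even the variance \<open>R\<close> of all later steps. The variance of the step itself is \<open>\<delta>\<close> times the
  square of its coefficient.\<close>

locale comparison_step = subalgebra_prob M G + lipschitz_convex \<phi> L for M G :: "'w measure" and \<phi> L +
  fixes R U :: "'w \<Rightarrow> real" and C \<delta> :: real
  assumes R: "R \<in> borel_measurable G" "\<And>w. w \<in> space M \<Longrightarrow> 0 \<le> R w" "\<And>w. w \<in> space M \<Longrightarrow> R w \<le> C"
    and U: "U \<in> borel_measurable G" "integrable M U" and \<delta>: "0 \<le> \<delta>"
begin

lemma integrable_smooth:
  assumes V: "integrable M V" and Q: "Q \<in> borel_measurable M" "\<And>w. w \<in> space M \<Longrightarrow> 0 \<le> Q w" "\<And>w. w \<in> space M \<Longrightarrow> Q w \<le> K"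
  shows "integrable M (\<lambda>w. smooth (Q w) (V w))"
proof (rule Bochner_Integration.integrable_bound[where f="\<lambda>w. \<bar>\<phi> 0\<bar> + L * \<bar>V w\<bar> + L * (1 + K)"])
  show "integrable M (\<lambda>w. \<bar>\<phi> 0\<bar> + L * \<bar>V w\<bar> + L * (1 + K))" using V by auto
  have [measurable]: "V \<in> borel_measurable M" using V by auto
  note Q(1)[measurable]
  have "(\<lambda>w. (\<lambda>(v, r). smooth v r) (Q w, V w)) \<in> borel_measurable M"
    by (rule measurable_compose[OF _ smooth_measurable]) measurable
  then show "(\<lambda>w. smooth (Q w) (V w)) \<in> borel_measurable M" by simp
  show "AE w in M. norm (smooth (Q w) (V w)) \<le> norm (\<bar>\<phi> 0\<bar> + L * \<bar>V w\<bar> + L * (1 + K))"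
  proof (rule AE_I2)
    fix w assume w: "w \<in> space M"
    have "L * (1 + Q w) \<le> L * (1 + K)" using Q(3)[OF w] by (intro mult_left_mono L_nonneg) simp
    then show "norm (smooth (Q w) (V w)) \<le> norm (\<bar>\<phi> 0\<bar> + L * \<bar>V w\<bar> + L * (1 + K))"
      using smooth_bound[OF Q(2)[OF w], of "V w"] by simp
  qed
qed

lemma RM: "R \<in> borel_measurable M"
  by (rule measurable_G[OF R(1)])

lemma integrable_normal: "indep_gauss M G N \<delta> \<Longrightarrow> integrable M N"
proof -
  assume N: "indep_gauss M G N \<delta>"
  have "integrable M (\<lambda>w. 1 * N w)" by (rule indep_gauss_mean(1)[OF N]) auto
  then show ?thesis by simp
qed

lemma integrable_smooth_indicator:
  assumes "A \<in> sets G" "integrable M V"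
  shows "integrable M (\<lambda>w. indicator A w * smooth (R w) (V w))"
  using integrable_mult_indicator[OF sets_G[OF assms(1)] integrable_smooth[OF assms(2) RM R(2,3)]] by simp

text \<open>A step with a single Gaussian variable adds its variance to \<open>R\<close>; the sign of the coefficient does not matter.\<close>

lemma indep_gauss_smooth:
  assumes N: "indep_gauss M G N \<delta>" and A: "A \<in> sets G" and e: "e\<^sup>2 = h\<^sup>2"
  shows "(\<integral>w. indicator A w * smooth (R w) (U w + e * N w) \<partial>M) = (\<integral>w. indicator A w * smooth (R w + h\<^sup>2 * \<delta>) (U w) \<partial>M)"
proof -
  note [measurable] = R(1) U(1) A
  have "(\<integral>w. indicator A w * smooth (R w) (U w + e * N w) \<partial>M)
    = (\<integral>w. \<integral>x. indicator A w * smooth (R w) (U w + e * x) \<partial>gauss \<delta> \<partial>M)"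
  proof (rule indep_gauss_integral(1)[where H="\<lambda>w x. indicator A w * smooth (R w) (U w + e * x)", OF N])
    have "(\<lambda>z. (\<lambda>(v, r). smooth v r) (R (fst z), U (fst z) + e * snd z)) \<in> borel_measurable (G \<Otimes>\<^sub>M borel)"
      by (rule measurable_compose[OF _ smooth_measurable]) measurable
    then have [measurable]: "(\<lambda>z. smooth (R (fst z)) (U (fst z) + e * snd z)) \<in> borel_measurable (G \<Otimes>\<^sub>M borel)" by simp
    have "(\<lambda>z. indicator A (fst z) * smooth (R (fst z)) (U (fst z) + e * snd z)) \<in> borel_measurable (G \<Otimes>\<^sub>M borel)"
      by measurable
    then show "(\<lambda>(w, x). indicator A w * smooth (R w) (U w + e * x)) \<in> borel_measurable (G \<Otimes>\<^sub>M borel)"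
      by (simp add: split_beta')
    show "integrable M (\<lambda>w. indicator A w * smooth (R w) (U w + e * N w))"
      using integrable_normal[OF N] U(2) by (intro integrable_smooth_indicator A) auto
  qed
  also have "\<dots> = (\<integral>w. indicator A w * smooth (R w + h\<^sup>2 * \<delta>) (U w) \<partial>M)"
    using R(2) \<delta> e by (intro Bochner_Integration.integral_cong) (auto simp: smooth_convolution)
  finally show ?thesis .
qed

text \<open>The step is a convex combination of two steps of size \<open>|f| + |g|\<close>, one driven by \<open>N1\<close> and one by
  \<open>N2\<close>. Each involves one variable only, so the joint law of \<open>(N1, N2)\<close> drops out.\<close>

lemma constant_upper:
  assumes N1: "indep_gauss M G N1 \<delta>" and N2: "indep_gauss M G N2 \<delta>" and A: "A \<in> sets G"
  shows "(\<integral>w. indicator A w * smooth (R w) (U w + (f * N1 w - g * N2 w)) \<partial>M)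
    \<le> (\<integral>w. indicator A w * smooth (R w + (\<bar>f\<bar> + \<bar>g\<bar>)\<^sup>2 * \<delta>) (U w) \<partial>M)"
proof (cases "f = 0 \<and> g = 0")
  case True
  then show ?thesis by simp
next
  case False
  define h where "h = \<bar>f\<bar> + \<bar>g\<bar>"
  have h: "0 < h" using False by (auto simp: h_def)
  define a where "a = \<bar>f\<bar> / h"
  have a: "0 \<le> a" "a \<le> 1" "1 - a = \<bar>g\<bar> / h" using h by (auto simp: a_def h_def field_simps)
  define e1 where "e1 = (if 0 \<le> f then h else - h)"
  define e2 where "e2 = (if 0 \<le> g then - h else h)"
  have ae: "a * e1 = f" "(1 - a) * e2 = - g" unfolding a(3) using h by (auto simp: a_def e1_def e2_def)
  have sq: "e1\<^sup>2 = h\<^sup>2" "e2\<^sup>2 = h\<^sup>2" by (auto simp: e1_def e2_def)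
  have i: "integrable M (\<lambda>w. indicator A w * smooth (R w) (U w + (x * N1 w - y * N2 w)))" for x y
    using integrable_normal[OF N1] integrable_normal[OF N2] U(2) by (intro integrable_smooth_indicator A) auto
  have i1: "integrable M (\<lambda>w. indicator A w * smooth (R w) (U w + x * N1 w))" for x using i[of x 0] by simp
  have i2: "integrable M (\<lambda>w. indicator A w * smooth (R w) (U w + x * N2 w))" for x using i[of 0 "- x"] by simp
  have "(\<integral>w. indicator A w * smooth (R w) (U w + (f * N1 w - g * N2 w)) \<partial>M)
     \<le> (\<integral>w. a * (indicator A w * smooth (R w) (U w + e1 * N1 w)) + (1 - a) * (indicator A w * smooth (R w) (U w + e2 * N2 w)) \<partial>M)"
  proof (rule integral_mono)
    fix w
    have "U w + (f * N1 w - g * N2 w) = a * (U w + e1 * N1 w) + (1 - a) * (U w + e2 * N2 w)"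
    proof -
      have "a * (U w + e1 * N1 w) + (1 - a) * (U w + e2 * N2 w) = U w + (a * e1) * N1 w + ((1 - a) * e2) * N2 w"
        by (simp add: algebra_simps)
      then show ?thesis unfolding ae by simp
    qed
    then have "smooth (R w) (U w + (f * N1 w - g * N2 w)) \<le> a * smooth (R w) (U w + e1 * N1 w) + (1 - a) * smooth (R w) (U w + e2 * N2 w)"
      using smooth_convex[OF a(1,2), of "R w"] by simp
    then show "indicator A w * smooth (R w) (U w + (f * N1 w - g * N2 w))
      \<le> a * (indicator A w * smooth (R w) (U w + e1 * N1 w)) + (1 - a) * (indicator A w * smooth (R w) (U w + e2 * N2 w))"
      by (auto split: split_indicator)
  qed (intro i i1 i2 Bochner_Integration.integrable_add integrable_mult_right)+
  also have "\<dots> = a * (\<integral>w. indicator A w * smooth (R w) (U w + e1 * N1 w) \<partial>M) + (1 - a) * (\<integral>w. indicator A w * smooth (R w) (U w + e2 * N2 w) \<partial>M)"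
    using i1 i2 by (subst Bochner_Integration.integral_add) auto
  also have "\<dots> = (\<integral>w. indicator A w * smooth (R w + h\<^sup>2 * \<delta>) (U w) \<partial>M)"
    unfolding indep_gauss_smooth[OF N1 A sq(1)] indep_gauss_smooth[OF N2 A sq(2)] by (simp add: algebra_simps)
  finally show ?thesis by (simp add: h_def)
qed

text \<open>Now the step \<open>e1 N1\<close> of size \<open>|f| - |g|\<close> is a convex combination of the given step, with weight \<open>a\<close>, and
  of \<open>e2 N2\<close>. Both outer terms have the expectation \<open>S\<close>, so \<open>S \<le> a X + (1 - a) S\<close>, which can be divided by
  \<open>a > 0\<close>.\<close>

lemma lower_strict:
  assumes N1: "indep_gauss M G N1 \<delta>" and N2: "indep_gauss M G N2 \<delta>" and A: "A \<in> sets G" and fg: "\<bar>g\<bar> < \<bar>f\<bar>"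
  shows "(\<integral>w. indicator A w * smooth (R w + (\<bar>f\<bar> - \<bar>g\<bar>)\<^sup>2 * \<delta>) (U w) \<partial>M)
    \<le> (\<integral>w. indicator A w * smooth (R w) (U w + (f * N1 w - g * N2 w)) \<partial>M)"
proof -
  define h where "h = \<bar>f\<bar> - \<bar>g\<bar>"
  have h: "0 < h" using fg by (auto simp: h_def)
  define a where "a = h / \<bar>f\<bar>"
  have a: "0 < a" "a \<le> 1" "1 - a = \<bar>g\<bar> / \<bar>f\<bar>" using h fg by (auto simp: a_def h_def field_simps)
  define e1 where "e1 = (if 0 \<le> f then h else - h)"
  define e2 where "e2 = (if 0 \<le> g then h else - h)"
  have ae: "a * f = e1" "(1 - a) * e2 = a * g" unfolding a(3) using h fg by (auto simp: a_def e1_def e2_def)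
  have sq: "e1\<^sup>2 = h\<^sup>2" "e2\<^sup>2 = h\<^sup>2" by (auto simp: e1_def e2_def)
  have i: "integrable M (\<lambda>w. indicator A w * smooth (R w) (U w + (x * N1 w - y * N2 w)))" for x y
    using integrable_normal[OF N1] integrable_normal[OF N2] U(2) by (intro integrable_smooth_indicator A) auto
  have i1: "integrable M (\<lambda>w. indicator A w * smooth (R w) (U w + x * N1 w))" for x using i[of x 0] by simp
  have i2: "integrable M (\<lambda>w. indicator A w * smooth (R w) (U w + x * N2 w))" for x using i[of 0 "- x"] by simp
  let ?S = "\<integral>w. indicator A w * smooth (R w + h\<^sup>2 * \<delta>) (U w) \<partial>M"
  let ?X = "\<integral>w. indicator A w * smooth (R w) (U w + (f * N1 w - g * N2 w)) \<partial>M"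
  have "?S = (\<integral>w. indicator A w * smooth (R w) (U w + e1 * N1 w) \<partial>M)" by (rule indep_gauss_smooth[OF N1 A sq(1), symmetric])
  also have "\<dots> \<le> (\<integral>w. a * (indicator A w * smooth (R w) (U w + (f * N1 w - g * N2 w)))
      + (1 - a) * (indicator A w * smooth (R w) (U w + e2 * N2 w)) \<partial>M)"
  proof (rule integral_mono)
    fix w
    have "U w + e1 * N1 w = a * (U w + (f * N1 w - g * N2 w)) + (1 - a) * (U w + e2 * N2 w)"
    proof -
      have "a * (U w + (f * N1 w - g * N2 w)) + (1 - a) * (U w + e2 * N2 w) = U w + (a * f) * N1 w - (a * g) * N2 w + ((1 - a) * e2) * N2 w"
        by (simp add: algebra_simps)
      then show ?thesis unfolding ae by simp
    qed
    then have "smooth (R w) (U w + e1 * N1 w) \<le> a * smooth (R w) (U w + (f * N1 w - g * N2 w)) + (1 - a) * smooth (R w) (U w + e2 * N2 w)"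
      using smooth_convex[OF less_imp_le[OF a(1)] a(2), of "R w"] by simp
    then show "indicator A w * smooth (R w) (U w + e1 * N1 w)
      \<le> a * (indicator A w * smooth (R w) (U w + (f * N1 w - g * N2 w))) + (1 - a) * (indicator A w * smooth (R w) (U w + e2 * N2 w))"
      by (auto split: split_indicator)
  qed (intro i i1 i2 Bochner_Integration.integrable_add integrable_mult_right)+
  also have "\<dots> = a * ?X + (1 - a) * (\<integral>w. indicator A w * smooth (R w) (U w + e2 * N2 w) \<partial>M)"
    using i i2 by (subst Bochner_Integration.integral_add) auto
  also have "(\<integral>w. indicator A w * smooth (R w) (U w + e2 * N2 w) \<partial>M) = ?S" by (rule indep_gauss_smooth[OF N2 A sq(2)])
  finally have "a * ?S \<le> a * ?X" by (simp add: algebra_simps)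
  then show ?thesis using a(1) by (simp add: h_def)
qed

text \<open>In the case of equality the weight degenerates to 0. Enlarging \<open>f\<close> by a factor \<open>1 + \<epsilon>\<close> reduces it to
  the strict case, and by Lipschitz continuity the error vanishes with \<open>\<epsilon>\<close>.\<close>

lemma lower_ordered:
  assumes N1: "indep_gauss M G N1 \<delta>" and N2: "indep_gauss M G N2 \<delta>" and A: "A \<in> sets G" and fg: "\<bar>g\<bar> \<le> \<bar>f\<bar>"
  shows "(\<integral>w. indicator A w * smooth (R w + (\<bar>f\<bar> - \<bar>g\<bar>)\<^sup>2 * \<delta>) (U w) \<partial>M)
    \<le> (\<integral>w. indicator A w * smooth (R w) (U w + (f * N1 w - g * N2 w)) \<partial>M)"
proof (cases "f = 0")
  case True
  with fg show ?thesis by simp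
next
  case False
  let ?S = "\<lambda>f. \<integral>w. indicator A w * smooth (R w + (\<bar>f\<bar> - \<bar>g\<bar>)\<^sup>2 * \<delta>) (U w) \<partial>M"
  let ?X = "\<lambda>f. \<integral>w. indicator A w * smooth (R w) (U w + (f * N1 w - g * N2 w)) \<partial>M"
  have i: "integrable M (\<lambda>w. indicator A w * smooth (R w) (U w + (x * N1 w - g * N2 w)))" for x
    using integrable_normal[OF N1] integrable_normal[OF N2] U(2) by (intro integrable_smooth_indicator A) auto
  have iS: "integrable M (\<lambda>w. indicator A w * smooth (R w + x\<^sup>2 * \<delta>) (U w))" for x
  proof -
    have "integrable M (\<lambda>w. smooth (R w + x\<^sup>2 * \<delta>) (U w))"
      by (rule integrable_smooth[OF U(2), of _ "C + x\<^sup>2 * \<delta>"]) (use RM R \<delta> in auto)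
    from integrable_mult_indicator[OF sets_G[OF A] this] show ?thesis by simp
  qed
  have bd: "?S f \<le> ?X f + L * (\<epsilon> * \<bar>f\<bar>) * (\<integral>w. \<bar>N1 w\<bar> \<partial>M)" if \<epsilon>: "0 < \<epsilon>" for \<epsilon>
  proof -
    define f' where "f' = (1 + \<epsilon>) * f"
    have "\<bar>f'\<bar> = (1 + \<epsilon>) * \<bar>f\<bar>" using \<epsilon> by (simp add: f'_def abs_mult)
    then have f': "\<bar>f'\<bar> = \<bar>f\<bar> + \<epsilon> * \<bar>f\<bar>" by (simp add: distrib_right)
    then have f2: "\<bar>f\<bar> < \<bar>f'\<bar>" using False \<epsilon> by simp
    have "?S f \<le> ?S f'"
    proof (rule integral_mono[OF iS iS])
      fix w assume w: "w \<in> space M"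
      have "(\<bar>f\<bar> - \<bar>g\<bar>)\<^sup>2 \<le> (\<bar>f'\<bar> - \<bar>g\<bar>)\<^sup>2" using fg f2 by (intro power_mono) auto
      then have "(\<bar>f\<bar> - \<bar>g\<bar>)\<^sup>2 * \<delta> \<le> (\<bar>f'\<bar> - \<bar>g\<bar>)\<^sup>2 * \<delta>" using \<delta> by (rule mult_right_mono)
      then have "smooth (R w + (\<bar>f\<bar> - \<bar>g\<bar>)\<^sup>2 * \<delta>) (U w) \<le> smooth (R w + (\<bar>f'\<bar> - \<bar>g\<bar>)\<^sup>2 * \<delta>) (U w)"
        using R(2)[OF w] \<delta> by (intro smooth_mono) auto
      then show "indicator A w * smooth (R w + (\<bar>f\<bar> - \<bar>g\<bar>)\<^sup>2 * \<delta>) (U w) \<le> indicator A w * smooth (R w + (\<bar>f'\<bar> - \<bar>g\<bar>)\<^sup>2 * \<delta>) (U w)"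
        by (rule mult_left_mono) simp
    qed
    also have "\<dots> \<le> ?X f'" using fg f2 by (intro lower_strict N1 N2 A) auto
    also have "\<dots> \<le> (\<integral>w. indicator A w * smooth (R w) (U w + (f * N1 w - g * N2 w)) + L * (\<epsilon> * \<bar>f\<bar>) * \<bar>N1 w\<bar> \<partial>M)"
    proof (rule integral_mono)
      show "integrable M (\<lambda>w. indicator A w * smooth (R w) (U w + (f * N1 w - g * N2 w)) + L * (\<epsilon> * \<bar>f\<bar>) * \<bar>N1 w\<bar>)"
        using i integrable_normal[OF N1] by auto
      fix w
      have "smooth (R w) (U w + (f' * N1 w - g * N2 w)) - smooth (R w) (U w + (f * N1 w - g * N2 w)) \<le> L * \<bar>(f' - f) * N1 w\<bar>"
        using smooth_lipschitz[of "R w" "U w + (f' * N1 w - g * N2 w)" "U w + (f * N1 w - g * N2 w)"] by (simp add: algebra_simps)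
      also have "\<dots> = L * (\<epsilon> * \<bar>f\<bar>) * \<bar>N1 w\<bar>" using \<epsilon> by (simp add: f'_def abs_mult algebra_simps)
      finally have *: "smooth (R w) (U w + (f' * N1 w - g * N2 w)) \<le> smooth (R w) (U w + (f * N1 w - g * N2 w)) + L * (\<epsilon> * \<bar>f\<bar>) * \<bar>N1 w\<bar>" by simp
      have "0 \<le> L * (\<epsilon> * \<bar>f\<bar>) * \<bar>N1 w\<bar>" using L_nonneg \<epsilon> by simp
      with * show "indicator A w * smooth (R w) (U w + (f' * N1 w - g * N2 w))
        \<le> indicator A w * smooth (R w) (U w + (f * N1 w - g * N2 w)) + L * (\<epsilon> * \<bar>f\<bar>) * \<bar>N1 w\<bar>"
        by (auto split: split_indicator)
    qed (rule i)
    also have "\<dots> = ?X f + L * (\<epsilon> * \<bar>f\<bar>) * (\<integral>w. \<bar>N1 w\<bar> \<partial>M)"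
      using i integrable_normal[OF N1] by simp
    finally show ?thesis .
  qed
  show ?thesis
  proof (rule field_le_epsilon)
    fix e :: real assume e: "0 < e"
    define K where "K = L * \<bar>f\<bar> * (\<integral>w. \<bar>N1 w\<bar> \<partial>M)"
    have K: "0 \<le> K" unfolding K_def using L_nonneg by simp
    have "?S f \<le> ?X f + (e / (K + 1)) * K" using bd[of "e / (K + 1)"] e K by (simp add: K_def mult_ac)
    also have "(e / (K + 1)) * K \<le> e" using e K by (simp add: field_simps)
    finally show "?S f \<le> ?X f + e" by simp
  qed
qed

lemma constant_lower:
  assumes N1: "indep_gauss M G N1 \<delta>" and N2: "indep_gauss M G N2 \<delta>" and A: "A \<in> sets G"
  shows "(\<integral>w. indicator A w * smooth (R w + (\<bar>f\<bar> - \<bar>g\<bar>)\<^sup>2 * \<delta>) (U w) \<partial>M)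
    \<le> (\<integral>w. indicator A w * smooth (R w) (U w + (f * N1 w - g * N2 w)) \<partial>M)"
proof (cases "\<bar>g\<bar> \<le> \<bar>f\<bar>")
  case True
  then show ?thesis by (rule lower_ordered[OF N1 N2 A])
next
  case False
  have "(\<bar>- g\<bar> - \<bar>- f\<bar>)\<^sup>2 = (\<bar>f\<bar> - \<bar>g\<bar>)\<^sup>2" by (simp add: power2_commute)
  moreover have "- g * N2 w - - f * N1 w = f * N1 w - g * N2 w" for w by simp
  ultimately show ?thesis using lower_ordered[OF N2 N1 A, of "- f" "- g"] False by simp
qed

lemma integral_partition:
  fixes X :: "'w \<Rightarrow> 's" and Y :: "'w \<Rightarrow> real"
  assumes X: "\<And>z. z \<in> S \<Longrightarrow> {w \<in> space M. X w = z} \<in> sets M" and S: "finite S" and Y: "integrable M Y"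
  shows "(\<integral>w. Y w \<partial>M) = (\<Sum>z\<in>S. \<integral>w. indicator {w \<in> space M. X w = z} w * Y w \<partial>M)
     + (\<integral>w. indicator {w \<in> space M. X w \<notin> S} w * Y w \<partial>M)"
proof -
  have m: "{w \<in> space M. X w \<notin> S} \<in> sets M"
  proof -
    have "{w \<in> space M. X w \<notin> S} = space M - (\<Union>z\<in>S. {w \<in> space M. X w = z})" by auto
    moreover have "(\<Union>z\<in>S. {w \<in> space M. X w = z}) \<in> sets M" using S X by auto
    ultimately show ?thesis by simp
  qed
  have i: "integrable M (\<lambda>w. indicator A w * Y w)" if "A \<in> sets M" for A
    using integrable_mult_indicator[OF that Y] by simp
  have "(\<integral>w. Y w \<partial>M) = (\<integral>w. (\<Sum>z\<in>S. indicator {w \<in> space M. X w = z} w * Y w) + indicator {w \<in> space M. X w \<notin> S} w * Y w \<partial>M)"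
  proof (rule Bochner_Integration.integral_cong[OF refl])
    fix w assume w: "w \<in> space M"
    have "(\<Sum>z\<in>S. indicator {w \<in> space M. X w = z} w * Y w) = (\<Sum>z\<in>S. if z = X w then Y w else 0)"
      using w by (intro sum.cong) (auto split: split_indicator)
    also have "\<dots> = (if X w \<in> S then Y w else 0)" using S by simp
    finally show "Y w = (\<Sum>z\<in>S. indicator {w \<in> space M. X w = z} w * Y w) + indicator {w \<in> space M. X w \<notin> S} w * Y w"
      using w by (auto split: split_indicator)
  qed
  also have "\<dots> = (\<Sum>z\<in>S. \<integral>w. indicator {w \<in> space M. X w = z} w * Y w \<partial>M)
     + (\<integral>w. indicator {w \<in> space M. X w \<notin> S} w * Y w \<partial>M)"
    using i X m by (subst Bochner_Integration.integral_add) (auto intro!: Bochner_Integration.integral_sum Bochner_Integration.integrable_sum)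
  finally show ?thesis .
qed

text \<open>Random coefficients \<open>f (X)\<close>, \<open>g (X)\<close> with finitely many nonzero values are constant on the events
  \<open>X = z\<close>, which belong to \<open>G\<close>; the constant case applies on each of them.\<close>

context
  fixes X :: "'w \<Rightarrow> 's" and S :: "'s set" and f g :: "'s \<Rightarrow> real" and N1 N2
  assumes N1: "indep_gauss M G N1 \<delta>" and N2: "indep_gauss M G N2 \<delta>"
    and S: "finite S" and X: "\<And>z. {w \<in> space M. X w = z} \<in> sets G"
    and off: "\<And>z. z \<notin> S \<Longrightarrow> f z = 0" "\<And>z. z \<notin> S \<Longrightarrow> g z = 0"
    and fX: "(\<lambda>w. f (X w)) \<in> borel_measurable G" and gX: "(\<lambda>w. g (X w)) \<in> borel_measurable G"
begin

lemma coefficients_bounded: "\<exists>K. \<forall>z. \<bar>f z\<bar> \<le> K \<and> \<bar>g z\<bar> \<le> K"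
  by (rule finite_support_bounded[OF S off])

lemma integrable_increment: "integrable M (\<lambda>w. f (X w) * N1 w - g (X w) * N2 w)"
proof -
  obtain K where K: "\<And>z. \<bar>f z\<bar> \<le> K" "\<And>z. \<bar>g z\<bar> \<le> K" using coefficients_bounded by blast
  have "integrable M (\<lambda>w. f (X w))" "integrable M (\<lambda>w. g (X w))"
    using measurable_G[OF fX] measurable_G[OF gX] K by (auto intro!: integrable_const_bound[of _ K])
  then show ?thesis
    using indep_gauss_mean(1)[OF N1 fX] indep_gauss_mean(1)[OF N2 gX] by auto
qed

lemma integrable_smooth_increment:
  "integrable M (\<lambda>w. smooth (R w) (U w + (f (X w) * N1 w - g (X w) * N2 w)))"
  by (intro integrable_smooth[OF _ RM R(2,3)] Bochner_Integration.integrable_add U(2) integrable_increment)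

lemma integrable_smooth_variance:
  assumes h: "\<And>z. h z \<in> {(\<bar>f z\<bar> + \<bar>g z\<bar>)\<^sup>2, (\<bar>f z\<bar> - \<bar>g z\<bar>)\<^sup>2}" and hX: "(\<lambda>w. h (X w)) \<in> borel_measurable G"
  shows "integrable M (\<lambda>w. smooth (R w + h (X w) * \<delta>) (U w))"
proof -
  obtain K where K: "\<And>z. \<bar>f z\<bar> \<le> K" "\<And>z. \<bar>g z\<bar> \<le> K" using coefficients_bounded by blast
  have hb: "0 \<le> h z \<and> h z \<le> (2 * K)\<^sup>2" for z
  proof -
    have "(\<bar>f z\<bar> + \<bar>g z\<bar>)\<^sup>2 \<le> (2 * K)\<^sup>2" using K[of z] by (intro power_mono) auto
    moreover have "(\<bar>f z\<bar> - \<bar>g z\<bar>)\<^sup>2 \<le> (\<bar>f z\<bar> + \<bar>g z\<bar>)\<^sup>2" by (simp add: power2_sum power2_diff)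
    ultimately show ?thesis using h[of z] by auto
  qed
  show ?thesis
  proof (rule integrable_smooth[OF U(2), of _ "C + (2 * K)\<^sup>2 * \<delta>"])
    show "(\<lambda>w. R w + h (X w) * \<delta>) \<in> borel_measurable M"
      using RM measurable_G[OF hX] by measurable
    show "0 \<le> R w + h (X w) * \<delta>" if "w \<in> space M" for w using R(2)[OF that] hb \<delta> by simp
    show "R w + h (X w) * \<delta> \<le> C + (2 * K)\<^sup>2 * \<delta>" if "w \<in> space M" for w
      using R(3)[OF that] hb \<delta> by (intro add_mono mult_right_mono) auto
  qed
qed

lemma state_upper:
  assumes hX: "(\<lambda>w. (\<bar>f (X w)\<bar> + \<bar>g (X w)\<bar>)\<^sup>2) \<in> borel_measurable G"
  shows "(\<integral>w. smooth (R w) (U w + (f (X w) * N1 w - g (X w) * N2 w)) \<partial>M)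
    \<le> (\<integral>w. smooth (R w + (\<bar>f (X w)\<bar> + \<bar>g (X w)\<bar>)\<^sup>2 * \<delta>) (U w) \<partial>M)"
proof -
  note XM = sets_G[OF X]
  have 1: "(\<integral>w. indicator {w \<in> space M. X w = z} w * smooth (R w) (U w + (f (X w) * N1 w - g (X w) * N2 w)) \<partial>M)
     \<le> (\<integral>w. indicator {w \<in> space M. X w = z} w * smooth (R w + (\<bar>f (X w)\<bar> + \<bar>g (X w)\<bar>)\<^sup>2 * \<delta>) (U w) \<partial>M)" for z
  proof -
    have "(\<integral>w. indicator {w \<in> space M. X w = z} w * smooth (R w) (U w + (f (X w) * N1 w - g (X w) * N2 w)) \<partial>M)
      = (\<integral>w. indicator {w \<in> space M. X w = z} w * smooth (R w) (U w + (f z * N1 w - g z * N2 w)) \<partial>M)"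
      by (intro Bochner_Integration.integral_cong) (auto split: split_indicator)
    also have "\<dots> \<le> (\<integral>w. indicator {w \<in> space M. X w = z} w * smooth (R w + (\<bar>f z\<bar> + \<bar>g z\<bar>)\<^sup>2 * \<delta>) (U w) \<partial>M)"
      by (rule constant_upper[OF N1 N2 X])
    also have "\<dots> = (\<integral>w. indicator {w \<in> space M. X w = z} w * smooth (R w + (\<bar>f (X w)\<bar> + \<bar>g (X w)\<bar>)\<^sup>2 * \<delta>) (U w) \<partial>M)"
      by (intro Bochner_Integration.integral_cong) (auto split: split_indicator)
    finally show ?thesis .
  qed
  have 2: "(\<integral>w. indicator {w \<in> space M. X w \<notin> S} w * smooth (R w) (U w + (f (X w) * N1 w - g (X w) * N2 w)) \<partial>M)
     = (\<integral>w. indicator {w \<in> space M. X w \<notin> S} w * smooth (R w + (\<bar>f (X w)\<bar> + \<bar>g (X w)\<bar>)\<^sup>2 * \<delta>) (U w) \<partial>M)"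
    by (intro Bochner_Integration.integral_cong) (auto simp: off split: split_indicator)
  show ?thesis
    unfolding integral_partition[where X=X, OF XM S integrable_smooth_increment]
      integral_partition[where X=X, OF XM S integrable_smooth_variance[where h="\<lambda>z. (\<bar>f z\<bar> + \<bar>g z\<bar>)\<^sup>2", simplified, OF hX]] 2
    by (intro add_right_mono sum_mono 1)
qed

lemma state_lower:
  assumes hX: "(\<lambda>w. (\<bar>f (X w)\<bar> - \<bar>g (X w)\<bar>)\<^sup>2) \<in> borel_measurable G"
  shows "(\<integral>w. smooth (R w + (\<bar>f (X w)\<bar> - \<bar>g (X w)\<bar>)\<^sup>2 * \<delta>) (U w) \<partial>M)
    \<le> (\<integral>w. smooth (R w) (U w + (f (X w) * N1 w - g (X w) * N2 w)) \<partial>M)"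
proof -
  note XM = sets_G[OF X]
  have 1: "(\<integral>w. indicator {w \<in> space M. X w = z} w * smooth (R w + (\<bar>f (X w)\<bar> - \<bar>g (X w)\<bar>)\<^sup>2 * \<delta>) (U w) \<partial>M)
     \<le> (\<integral>w. indicator {w \<in> space M. X w = z} w * smooth (R w) (U w + (f (X w) * N1 w - g (X w) * N2 w)) \<partial>M)" for z
  proof -
    have "(\<integral>w. indicator {w \<in> space M. X w = z} w * smooth (R w + (\<bar>f (X w)\<bar> - \<bar>g (X w)\<bar>)\<^sup>2 * \<delta>) (U w) \<partial>M)
      = (\<integral>w. indicator {w \<in> space M. X w = z} w * smooth (R w + (\<bar>f z\<bar> - \<bar>g z\<bar>)\<^sup>2 * \<delta>) (U w) \<partial>M)"
      by (intro Bochner_Integration.integral_cong) (auto split: split_indicator)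
    also have "\<dots> \<le> (\<integral>w. indicator {w \<in> space M. X w = z} w * smooth (R w) (U w + (f z * N1 w - g z * N2 w)) \<partial>M)"
      by (rule constant_lower[OF N1 N2 X])
    also have "\<dots> = (\<integral>w. indicator {w \<in> space M. X w = z} w * smooth (R w) (U w + (f (X w) * N1 w - g (X w) * N2 w)) \<partial>M)"
      by (intro Bochner_Integration.integral_cong) (auto split: split_indicator)
    finally show ?thesis .
  qed
  have 2: "(\<integral>w. indicator {w \<in> space M. X w \<notin> S} w * smooth (R w) (U w + (f (X w) * N1 w - g (X w) * N2 w)) \<partial>M)
     = (\<integral>w. indicator {w \<in> space M. X w \<notin> S} w * smooth (R w + (\<bar>f (X w)\<bar> - \<bar>g (X w)\<bar>)\<^sup>2 * \<delta>) (U w) \<partial>M)"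
    by (intro Bochner_Integration.integral_cong) (auto simp: off split: split_indicator)
  show ?thesis
    unfolding integral_partition[where X=X, OF XM S integrable_smooth_increment]
      integral_partition[where X=X, OF XM S integrable_smooth_variance[where h="\<lambda>z. (\<bar>f z\<bar> - \<bar>g z\<bar>)\<^sup>2", simplified, OF hX]] 2
    by (intro add_right_mono sum_mono 1)
qed

end

end

section \<open>Comparison of discretized integrals\<close>

context markov_chain
begin

text \<open>The integral of \<open>f (Z)\<close>, frozen on the cells of the grid with mesh \<open>\<delta>\<close>, up to the time \<open>n \<delta>\<close>.\<close>

definition walk :: "('w, real) process \<Rightarrow> real \<Rightarrow> (real ^ 'd \<Rightarrow> real) \<Rightarrow> nat \<Rightarrow> 'w \<Rightarrow> real" where
  "walk W \<delta> f n w = (\<Sum>i<n. f (Z (real i * \<delta>) w) * (W (real (Suc i) * \<delta>) w - W (real i * \<delta>) w))"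

lemma walk_measurable:
  assumes W: "brownian_motion M F W" and \<delta>: "0 \<le> \<delta>" and k: "real k * \<delta> \<le> t"
  shows "walk W \<delta> f k \<in> borel_measurable (F t)"
  unfolding walk_def
proof (rule borel_measurable_sum)
  fix i assume "i \<in> {..<k}"
  then have i: "real i * \<delta> \<le> real k * \<delta>" "real (Suc i) * \<delta> \<le> real k * \<delta>"
    using \<delta> by (auto intro!: mult_right_mono simp del: of_nat_Suc)
  have p: "0 \<le> real i * \<delta>" "0 \<le> real (Suc i) * \<delta>" using \<delta> by auto
  have [measurable]: "(\<lambda>w. f (Z (real i * \<delta>) w)) \<in> borel_measurable (F t)"
    by (rule Z_measurable) (use p i k in auto)
  have [measurable]: "W (real i * \<delta>) \<in> borel_measurable (F t)" "W (real (Suc i) * \<delta>) \<in> borel_measurable (F t)"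
    using bm_adapted[OF W p(1)] bm_adapted[OF W p(2)] i k by auto
  show "(\<lambda>w. f (Z (real i * \<delta>) w) * (W (real (Suc i) * \<delta>) w - W (real i * \<delta>) w)) \<in> borel_measurable (F t)"
    by measurable
qed

lemma walk_integrable:
  assumes W: "brownian_motion M F W" and \<delta>: "0 \<le> \<delta>" and f: "\<And>z. \<bar>f z\<bar> \<le> K"
  shows "integrable M (walk W \<delta> f k)"
  unfolding walk_def
proof (rule Bochner_Integration.integrable_sum)
  fix i
  have p: "0 \<le> real i * \<delta>" "real i * \<delta> \<le> real (Suc i) * \<delta>" using \<delta> by (auto intro!: mult_right_mono)
  interpret Fi: subalgebra_prob M "F (real i * \<delta>)" by (rule subalgebra_prob_F[OF p(1)])
  have m: "(\<lambda>w. f (Z (real i * \<delta>) w)) \<in> borel_measurable (F (real i * \<delta>))" by (rule Z_measurable) (use p in auto)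
  show "integrable M (\<lambda>w. f (Z (real i * \<delta>) w) * (W (real (Suc i) * \<delta>) w - W (real i * \<delta>) w))"
    by (rule Fi.indep_gauss_mean(1)[OF bm_increment[OF W p] m])
      (use Fi.measurable_G[OF m] f in \<open>auto intro!: integrable_const_bound[of _ K]\<close>)
qed

context
  fixes \<phi> :: "real \<Rightarrow> real" and L :: real and B V :: "('w, real) process" and f g :: "real ^ 'd \<Rightarrow> real"
    and S :: "(real ^ 'd) set" and \<delta> r0 :: real and n :: nat
  assumes lc: "lipschitz_convex \<phi> L" and B: "brownian_motion M F B" and V: "brownian_motion M F V"
    and S: "finite S" and off: "\<And>z. z \<notin> S \<Longrightarrow> f z = 0" "\<And>z. z \<notin> S \<Longrightarrow> g z = 0" and \<delta>: "0 < \<delta>"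
begin

interpretation lipschitz_convex \<phi> L by (rule lc)

text \<open>Conditional variance of the steps from \<open>k\<close> to \<open>n\<close> when the step from the state \<open>z\<close> has coefficient of square \<open>h z\<close>.\<close>

definition remaining_variance :: "(real ^ 'd \<Rightarrow> real) \<Rightarrow> nat \<Rightarrow> 'w \<Rightarrow> real" where
  "remaining_variance h k w = (\<Sum>i=k..<n. h (Z (real i * \<delta>) w) * \<delta>)"

definition running_gap :: "nat \<Rightarrow> 'w \<Rightarrow> real" where
  "running_gap k w = r0 + walk B \<delta> f k w - walk V \<delta> g k w"

lemma support_bound: "\<exists>K. \<forall>z. \<bar>f z\<bar> \<le> K \<and> \<bar>g z\<bar> \<le> K"
  by (rule finite_support_bounded[OF S off])

lemma running_gap_integrable: "integrable M (running_gap k)"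
proof -
  obtain K where "\<And>z. \<bar>f z\<bar> \<le> K" "\<And>z. \<bar>g z\<bar> \<le> K" using support_bound by blast
  then show ?thesis
    unfolding running_gap_def using walk_integrable[OF B, of \<delta> f K k] walk_integrable[OF V, of \<delta> g K k] \<delta> by simp
qed

text \<open>The variance of the later steps is a function of the chain at later grid times, hence measurable for
  the enlarged sigma-algebra, from which the increments at step \<open>k\<close> are still independent.\<close>

lemma comparison_step_at:
  assumes k: "k < n" and h: "\<And>z. 0 \<le> h z" "\<And>z. h z \<le> H"
  shows "comparison_step M (enlarged (real k * \<delta>) (\<lambda>j. real (Suc k + j) * \<delta>) n) \<phi> L (remaining_variance h (Suc k)) (running_gap k) (real n * (H * \<delta>)) \<delta>"
proof -
  have s: "0 \<le> real k * \<delta>" "\<And>j. 0 \<le> real (Suc k + j) * \<delta>" using \<delta> by auto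
  interpret subalgebra_prob M "enlarged (real k * \<delta>) (\<lambda>j. real (Suc k + j) * \<delta>) n"
    by (rule subalgebra_enlarged[OF s])
  show ?thesis
  proof unfold_locales
    show "remaining_variance h (Suc k) \<in> borel_measurable (enlarged (real k * \<delta>) (\<lambda>j. real (Suc k + j) * \<delta>) n)"
      unfolding remaining_variance_def
    proof (intro borel_measurable_sum borel_measurable_times borel_measurable_const)
      fix i assume i: "i \<in> {Suc k..<n}"
      then have e: "Suc k + (i - Suc k) = i" "i - Suc k < n" by auto
      show "(\<lambda>w. h (Z (real i * \<delta>) w)) \<in> borel_measurable (enlarged (real k * \<delta>) (\<lambda>j. real (Suc k + j) * \<delta>) n)"
        using Z_measurable_enlarged[of "real k * \<delta>" "\<lambda>j. real (Suc k + j) * \<delta>" "i - Suc k" n h borel, OF s e(2)]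
        unfolding e(1) by simp
    qed
    show "0 \<le> remaining_variance h (Suc k) w" for w unfolding remaining_variance_def using h \<delta> by (intro sum_nonneg mult_nonneg_nonneg) auto
    show "remaining_variance h (Suc k) w \<le> real n * (H * \<delta>)" for w
    proof -
      have H0: "0 \<le> H" using h[of undefined] by linarith
      have "remaining_variance h (Suc k) w \<le> (\<Sum>i=Suc k..<n. H * \<delta>)" unfolding remaining_variance_def using h \<delta> by (intro sum_mono mult_right_mono) auto
      also have "\<dots> = real (n - Suc k) * (H * \<delta>)" by simp
      also have "\<dots> \<le> real n * (H * \<delta>)" using H0 \<delta> by (intro mult_right_mono) auto
      finally show ?thesis .
    qed
    have "running_gap k \<in> borel_measurable (F (real k * \<delta>))"
      unfolding running_gap_def using walk_measurable[OF B, of \<delta> k "real k * \<delta>" f] walk_measurable[OF V, of \<delta> k "real k * \<delta>" g] \<delta>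
      by simp
    then show "running_gap k \<in> borel_measurable (enlarged (real k * \<delta>) (\<lambda>j. real (Suc k + j) * \<delta>) n)"
      by (rule F_le_enlarged[OF s])
    show "integrable M (running_gap k)" by (rule running_gap_integrable)
    show "0 \<le> \<delta>" using \<delta> by simp
  qed
qed

lemma increment_indep_gauss:
  assumes k: "k < n" and W: "brownian_motion M F W"
  shows "indep_gauss M (enlarged (real k * \<delta>) (\<lambda>j. real (Suc k + j) * \<delta>) n) (\<lambda>w. W (real (Suc k) * \<delta>) w - W (real k * \<delta>) w) \<delta>"
proof -
  have "indep_gauss M (enlarged (real k * \<delta>) (\<lambda>j. real (Suc k + j) * \<delta>) n) (\<lambda>w. W (real (Suc k) * \<delta>) w - W (real k * \<delta>) w)
     (real (Suc k) * \<delta> - real k * \<delta>)"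
    by (rule bm_increment_enlarged[OF W]) (use \<delta> in \<open>auto intro!: mult_right_mono simp: distrib_right\<close>)
  then show ?thesis by (simp add: distrib_right)
qed

lemma state_enlarged:
  shows "{w \<in> space M. Z (real k * \<delta>) w = z} \<in> sets (enlarged (real k * \<delta>) (\<lambda>j. real (Suc k + j) * \<delta>) n)"
    and "(\<lambda>w. h (Z (real k * \<delta>) w)) \<in> borel_measurable (enlarged (real k * \<delta>) (\<lambda>j. real (Suc k + j) * \<delta>) n)"
proof -
  have s: "0 \<le> real k * \<delta>" "\<And>j. 0 \<le> real (Suc k + j) * \<delta>" using \<delta> by auto
  interpret subalgebra_prob M "enlarged (real k * \<delta>) (\<lambda>j. real (Suc k + j) * \<delta>) n"
    by (rule subalgebra_enlarged[OF s])
  show "(\<lambda>w. h (Z (real k * \<delta>) w)) \<in> borel_measurable (enlarged (real k * \<delta>) (\<lambda>j. real (Suc k + j) * \<delta>) n)"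
    by (rule F_le_enlarged[OF s Z_measurable]) (use s in auto)
  have "(\<lambda>w. Z (real k * \<delta>) w = z) \<in> measurable (enlarged (real k * \<delta>) (\<lambda>j. real (Suc k + j) * \<delta>) n) (count_space UNIV)"
    by (rule F_le_enlarged[OF s Z_measurable[where h="\<lambda>x. x = z"]]) (use s in auto)
  moreover have "(\<lambda>w. Z (real k * \<delta>) w = z) -` {True} \<inter> space (enlarged (real k * \<delta>) (\<lambda>j. real (Suc k + j) * \<delta>) n)
      = {w \<in> space M. Z (real k * \<delta>) w = z}"
    unfolding space_G by auto
  ultimately
  show "{w \<in> space M. Z (real k * \<delta>) w = z} \<in> sets (enlarged (real k * \<delta>) (\<lambda>j. real (Suc k + j) * \<delta>) n)"
    using measurable_sets[of "\<lambda>w. Z (real k * \<delta>) w = z" "enlarged (real k * \<delta>) (\<lambda>j. real (Suc k + j) * \<delta>) n" "count_space UNIV" "{True}"]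
    by (simp only: sets_count_space) blast
qed

lemma running_gap_Suc: "running_gap (Suc k) w = running_gap k w
    + (f (Z (real k * \<delta>) w) * (B (real (Suc k) * \<delta>) w - B (real k * \<delta>) w) - g (Z (real k * \<delta>) w) * (V (real (Suc k) * \<delta>) w - V (real k * \<delta>) w))"
  by (simp add: running_gap_def walk_def)

lemma remaining_variance_Suc: "k < n \<Longrightarrow> remaining_variance h (Suc k) w + h (Z (real k * \<delta>) w) * \<delta> = remaining_variance h k w"
  unfolding remaining_variance_def by (simp add: sum.atLeast_Suc_lessThan)

lemma remaining_variance_end: "remaining_variance h n w = 0"
  by (simp add: remaining_variance_def)

text \<open>With \<open>Q k\<close> the expectation of \<open>smooth\<close> at the current gap and the remaining variance, one step
  shows that \<open>Q\<close> decreases; \<open>Q n\<close> is the left-hand side and \<open>Q 0\<close> the right-hand side.\<close>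

lemma discrete_upper:
  "(\<integral>w. \<phi> (r0 + walk B \<delta> f n w - walk V \<delta> g n w) \<partial>M) \<le> (\<integral>w. smooth (remaining_variance (\<lambda>z. (\<bar>f z\<bar> + \<bar>g z\<bar>)\<^sup>2) 0 w) r0 \<partial>M)"
proof -
  define h where "h z = (\<bar>f z\<bar> + \<bar>g z\<bar>)\<^sup>2" for z
  obtain K where K: "\<And>z. \<bar>f z\<bar> \<le> K" "\<And>z. \<bar>g z\<bar> \<le> K" using support_bound by blast
  have h: "0 \<le> h z" "h z \<le> (2 * K)\<^sup>2" for z
    unfolding h_def by (simp, rule power_mono) (use K[of z] in auto)
  define Q where "Q k = (\<integral>w. smooth (remaining_variance h k w) (running_gap k w) \<partial>M)" for k
  have "Q (Suc k) \<le> Q k" if k: "k < n" for k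
  proof -
    interpret st: comparison_step M "enlarged (real k * \<delta>) (\<lambda>j. real (Suc k + j) * \<delta>) n" \<phi> L
      "remaining_variance h (Suc k)" "running_gap k" "real n * ((2 * K)\<^sup>2 * \<delta>)" \<delta>
      by (rule comparison_step_at[OF k h])
    show ?thesis
      using st.state_upper[where f=f and g=g and X="\<lambda>w. Z (real k * \<delta>) w",
          OF increment_indep_gauss[OF k B] increment_indep_gauss[OF k V] S state_enlarged(1) off state_enlarged(2) state_enlarged(2) state_enlarged(2)[of "\<lambda>z. (\<bar>f z\<bar> + \<bar>g z\<bar>)\<^sup>2" k]]
      by (simp add: Q_def running_gap_Suc remaining_variance_Suc[OF k, symmetric] h_def)
  qed
  note st = this
  have "Q k \<le> Q 0" if "k \<le> n" for k
    using that
  proof (induction k)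
    case (Suc k) then show ?case using st[of k] by simp
  qed simp
  then have "Q n \<le> Q 0" by simp
  then show ?thesis by (simp add: Q_def remaining_variance_end smooth_zero running_gap_def walk_def h_def[abs_def])
qed

lemma discrete_lower:
  "(\<integral>w. smooth (remaining_variance (\<lambda>z. (\<bar>f z\<bar> - \<bar>g z\<bar>)\<^sup>2) 0 w) r0 \<partial>M) \<le> (\<integral>w. \<phi> (r0 + walk B \<delta> f n w - walk V \<delta> g n w) \<partial>M)"
proof -
  define h where "h z = (\<bar>f z\<bar> - \<bar>g z\<bar>)\<^sup>2" for z
  obtain K where K: "\<And>z. \<bar>f z\<bar> \<le> K" "\<And>z. \<bar>g z\<bar> \<le> K" using support_bound by blast
  have h: "0 \<le> h z" "h z \<le> (2 * K)\<^sup>2" for z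
  proof -
    have "\<bar>\<bar>f z\<bar> - \<bar>g z\<bar>\<bar>\<^sup>2 \<le> (2 * K)\<^sup>2" using K[of z] by (intro power_mono) auto
    then show "0 \<le> h z" "h z \<le> (2 * K)\<^sup>2" by (auto simp: h_def)
  qed
  define Q where "Q k = (\<integral>w. smooth (remaining_variance h k w) (running_gap k w) \<partial>M)" for k
  have "Q k \<le> Q (Suc k)" if k: "k < n" for k
  proof -
    interpret st: comparison_step M "enlarged (real k * \<delta>) (\<lambda>j. real (Suc k + j) * \<delta>) n" \<phi> L
      "remaining_variance h (Suc k)" "running_gap k" "real n * ((2 * K)\<^sup>2 * \<delta>)" \<delta>
      by (rule comparison_step_at[OF k h])
    show ?thesis
      using st.state_lower[where f=f and g=g and X="\<lambda>w. Z (real k * \<delta>) w",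
          OF increment_indep_gauss[OF k B] increment_indep_gauss[OF k V] S state_enlarged(1) off state_enlarged(2) state_enlarged(2) state_enlarged(2)[of "\<lambda>z. (\<bar>f z\<bar> - \<bar>g z\<bar>)\<^sup>2" k]]
      by (simp add: Q_def running_gap_Suc remaining_variance_Suc[OF k, symmetric] h_def)
  qed
  note st = this
  have "Q 0 \<le> Q k" if "k \<le> n" for k
    using that
  proof (induction k)
    case (Suc k) then show ?case using st[of k] by simp
  qed simp
  then have "Q 0 \<le> Q n" by simp
  then show ?thesis by (simp add: Q_def remaining_variance_end smooth_zero running_gap_def walk_def h_def[abs_def])
qed

end

end

section \<open>Approximation of Ito integrals along grids\<close>

lemma cmod_iexp_diff_le: "cmod (iexp a - iexp b) \<le> \<bar>a - b\<bar>"
proof -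
  have "iexp a - iexp b = iexp b * (iexp (a - b) - 1)"
    by (simp add: algebra_simps exp_add[symmetric])
  then have "cmod (iexp a - iexp b) = cmod (iexp (a - b) - 1)" by (simp add: norm_mult)
  also have "\<dots> \<le> \<bar>a - b\<bar>" using iexp_approx1[of "a - b" 0] by simp
  finally show ?thesis .
qed

context prob_space
begin

lemma L1_from_L2:
  fixes U :: "'a \<Rightarrow> real"
  assumes U: "U \<in> borel_measurable M" and le: "(\<integral>\<^sup>+w. ennreal ((U w)\<^sup>2) \<partial>M) \<le> ennreal \<eta>" and \<eta>: "0 \<le> \<eta>"
  shows "integrable M U" and "(\<integral>w. \<bar>U w\<bar> \<partial>M) \<le> sqrt \<eta>"
proof -
  have "(\<integral>\<^sup>+w. ennreal ((U w)\<^sup>2) \<partial>M) < \<infinity>" using le by (rule le_less_trans) simp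
  then have i2: "integrable M (\<lambda>w. (U w)\<^sup>2)" using U by (intro integrableI_bounded) auto
  then show i: "integrable M U" by (rule square_integrable_imp_integrable[OF U])
  have "ennreal (\<integral>w. (U w)\<^sup>2 \<partial>M) \<le> ennreal \<eta>" using le i2 by (simp add: nn_integral_eq_integral)
  then have E2: "(\<integral>w. (U w)\<^sup>2 \<partial>M) \<le> \<eta>" using \<eta> by simp
  define m where "m = (\<integral>w. \<bar>U w\<bar> \<partial>M)"
  have "0 \<le> (\<integral>w. (\<bar>U w\<bar> - m)\<^sup>2 \<partial>M)" by simp
  also have "\<dots> = (\<integral>w. (U w)\<^sup>2 - 2 * m * \<bar>U w\<bar> + m\<^sup>2 \<partial>M)"
    by (simp add: power2_diff algebra_simps)
  also have "\<dots> = (\<integral>w. (U w)\<^sup>2 \<partial>M) - m\<^sup>2"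
    using i i2 by (simp add: m_def[symmetric] prob_space power2_eq_square)
  finally have "m\<^sup>2 \<le> \<eta>" using E2 by simp
  then show "(\<integral>w. \<bar>U w\<bar> \<partial>M) \<le> sqrt \<eta>" unfolding m_def[symmetric] by (rule real_le_rsqrt)
qed

end

context filtered_prob
begin

lemma mean_int_square_mono: "s \<le> t \<Longrightarrow> mean_int_square M H s \<le> mean_int_square M H t"
  unfolding mean_int_square_def by (intro nn_integral_mono) (auto split: split_indicator)

text \<open>Dominated convergence, first in time for almost every path and then over the paths.\<close>

lemma mean_int_square_tendsto_0:
  assumes jm: "\<And>m. jointly_measurable_on T (H m)" "jointly_measurable_on T K"
    and bound: "\<And>m s w. w \<in> space M \<Longrightarrow> 0 \<le> s \<Longrightarrow> s \<le> T \<Longrightarrow> \<bar>H m s w\<bar> \<le> \<bar>K s w\<bar>"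
    and fin: "mean_int_square M K T < \<infinity>"
    and lim: "\<And>w. w \<in> space M \<Longrightarrow> AE s in lborel. 0 < s \<longrightarrow> s \<le> T \<longrightarrow> (\<lambda>m. H m s w) \<longlonglongrightarrow> 0"
  shows "(\<lambda>m. mean_int_square M (H m) T) \<longlonglongrightarrow> 0"
proof -
  let ?q = "\<lambda>J w s. ennreal ((indicator {0..T} s * J s w)\<^sup>2)"
  have le: "?q (H m) w s \<le> ?q K w s" if "w \<in> space M" for m w s
    using bound[OF that, of s m] by (auto intro!: ennreal_leI power2_mono simp: abs_le_square_iff split: split_indicator)
  have "(\<lambda>m. \<integral>\<^sup>+w. \<integral>\<^sup>+s. ?q (H m) w s \<partial>lborel \<partial>M) \<longlonglongrightarrow> (\<integral>\<^sup>+w. 0 \<partial>M)"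
  proof (rule nn_integral_dominated_convergence[where w="\<lambda>w. \<integral>\<^sup>+s. ?q K w s \<partial>lborel"])
    show "AE w in M. (\<integral>\<^sup>+s. ?q (H m) w s \<partial>lborel) \<le> (\<integral>\<^sup>+s. ?q K w s \<partial>lborel)" for m
      by (intro AE_I2 nn_integral_mono le)
    show fin': "(\<integral>\<^sup>+w. \<integral>\<^sup>+s. ?q K w s \<partial>lborel \<partial>M) < \<infinity>" using fin by (simp add: mean_int_square_indicator)
    have "AE w in M. (\<integral>\<^sup>+s. ?q K w s \<partial>lborel) \<noteq> \<infinity>"
      using fin' by (intro nn_integral_PInf_AE jointly_measurable_inner(1)[OF jm(2)]) auto
    then show "AE w in M. (\<lambda>m. \<integral>\<^sup>+s. ?q (H m) w s \<partial>lborel) \<longlonglongrightarrow> 0"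
      using AE_space
    proof eventually_elim
      case (elim w)
      have ms: "(\<lambda>s. ?q J w s) \<in> borel_measurable lborel" if "jointly_measurable_on T J" for J
        using jointly_measurable_inner(2)[OF that elim(2)] by simp
      have "(\<lambda>m. \<integral>\<^sup>+s. ?q (H m) w s \<partial>lborel) \<longlonglongrightarrow> (\<integral>\<^sup>+s. 0 \<partial>(lborel :: real measure))"
      proof (rule nn_integral_dominated_convergence[where w="\<lambda>s. ?q K w s"])
        have "AE s in lborel. s \<noteq> (0::real)" by (rule AE_lborel_singleton)
        with lim[OF elim(2)] show "AE s in lborel. (\<lambda>m. ?q (H m) w s) \<longlonglongrightarrow> 0"
        proof eventually_elim
          case (elim s)
          show ?case
          proof (cases "s \<in> {0..T}")
            case True
            then have "(\<lambda>m. H m s w) \<longlonglongrightarrow> 0" using elim by auto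
            then have "(\<lambda>m. ennreal ((indicator {0..T} s * H m s w)\<^sup>2)) \<longlonglongrightarrow> ennreal ((indicator {0..T} s * 0)\<^sup>2)"
              by (intro tendsto_ennrealI tendsto_power tendsto_mult tendsto_const)
            then show ?thesis by simp
          qed simp
        qed
        show "AE s in lborel. ?q (H m) w s \<le> ?q K w s" for m using le[OF elim(2)] by (intro AE_I2)
        show "(\<integral>\<^sup>+s. ?q K w s \<partial>lborel) < \<infinity>" using elim(1) by (simp add: less_top)
      qed (use ms jm in auto)
      then show ?case by simp
    qed
  qed (use jointly_measurable_inner(1) jm in auto)
  then show ?thesis by (simp add: mean_int_square_indicator)
qed

lemma mean_int_square_const: "mean_int_square M (\<lambda>s w. k) T < \<infinity>"
proof -
  have "mean_int_square M (\<lambda>s w. k) T = (\<integral>\<^sup>+w. ennreal (k\<^sup>2) * emeasure lborel {0..T} \<partial>M)"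
    unfolding mean_int_square_def by (subst nn_integral_cmult_indicator) auto
  also have "\<dots> = ennreal (k\<^sup>2) * emeasure lborel {0..T}" by (simp add: emeasure_space_1)
  also have "\<dots> < \<infinity>" by (simp add: ennreal_mult_less_top emeasure_lborel_Icc_eq)
  finally show ?thesis .
qed

end

context markov_chain
begin

definition grid :: "real \<Rightarrow> nat \<Rightarrow> nat \<Rightarrow> real" where
  "grid T m i = real i * (T / real (Suc m))"

abbreviation on_grid :: "(real ^ 'd \<Rightarrow> real) \<Rightarrow> real \<Rightarrow> nat \<Rightarrow> nat \<Rightarrow> 'w \<Rightarrow> real" where
  "on_grid f T m \<equiv> \<lambda>i w. f (Z (grid T m i) w)"

lemma grid_mono: "0 \<le> T \<Longrightarrow> i \<le> j \<Longrightarrow> grid T m i \<le> grid T m j"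
  unfolding grid_def by (intro mult_right_mono) auto

lemma grid_top: "grid T m (Suc m) = T"
  unfolding grid_def by simp

lemma grid_nonneg: "0 \<le> T \<Longrightarrow> 0 \<le> grid T m i"
  unfolding grid_def by simp

lemma simple_data_grid:
  assumes "0 \<le> T" "\<And>z. \<bar>f z\<bar> \<le> C"
  shows "simple_data M F (Suc m) (grid T m) (on_grid f T m)"
  unfolding simple_data_def
proof (intro conjI allI impI)
  show "0 \<le> grid T m 0" by (simp add: grid_def)
  fix i
  show "grid T m i \<le> grid T m (Suc i)" using assms(1) by (rule grid_mono) simp
  show "on_grid f T m i \<in> borel_measurable (F (grid T m i))" by (rule Z_measurable) (use grid_nonneg assms in auto)
  show "\<exists>C. \<forall>w\<in>space M. \<bar>on_grid f T m i w\<bar> \<le> C" using assms(2) by blast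
qed

lemma simple_integral_grid:
  assumes T: "0 \<le> T"
  shows "simple_integral W (Suc m) (grid T m) (on_grid f T m) T w = walk W (T / real (Suc m)) f (Suc m) w"
  unfolding simple_integral_def walk_def
proof (rule sum.cong[OF refl])
  fix i assume "i \<in> {..<Suc m}"
  then have "grid T m i \<le> T" "grid T m (Suc i) \<le> T"
    using grid_mono[OF T, of i "Suc m" m] grid_mono[OF T, of "Suc i" "Suc m" m] grid_top[of T m] by auto
  then have "min T (grid T m i) = grid T m i" "min T (grid T m (Suc i)) = grid T m (Suc i)" by auto
  then show "on_grid f T m i w * (W (min T (grid T m (Suc i))) w - W (min T (grid T m i)) w)
    = f (Z (real i * (T / real (Suc m))) w) * (W (real (Suc i) * (T / real (Suc m))) w - W (real i * (T / real (Suc m))) w)"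
    by (simp only: grid_def)
qed

lemma simple_process_grid:
  assumes s: "0 < s" "s \<le> T"
  obtains i where "i < Suc m" "grid T m i < s" "s \<le> grid T m (Suc i)"
    "\<And>f w. simple_process (Suc m) (grid T m) (on_grid f T m) s w = f (Z (grid T m i) w)"
proof -
  have T: "0 < T" using s by simp
  define \<delta> where "\<delta> = T / real (Suc m)"
  have \<delta>: "0 < \<delta>" using T by (simp add: \<delta>_def)
  have g: "grid T m i = real i * \<delta>" for i by (simp add: grid_def \<delta>_def)
  define i where "i = nat (\<lceil>s / \<delta>\<rceil> - 1)"
  have pos: "0 < s / \<delta>" using s \<delta> by simp
  then have "1 \<le> \<lceil>s / \<delta>\<rceil>" by (simp add: one_le_ceiling)
  then have ri: "real i = real_of_int \<lceil>s / \<delta>\<rceil> - 1" by (simp add: i_def)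
  have 1: "real i < s / \<delta>" "s / \<delta> \<le> real (Suc i)" using ri ceiling_correct[of "s / \<delta>"] by auto
  then have 2: "grid T m i < s" "s \<le> grid T m (Suc i)" unfolding g using \<delta> by (auto simp: pos_less_divide_eq pos_divide_le_eq)
  have im: "i < Suc m"
  proof (rule ccontr)
    assume "\<not> i < Suc m"
    then have "grid T m (Suc m) \<le> grid T m i" using T by (intro grid_mono) auto
    then show False using 2 s grid_top[of T m] by simp
  qed
  have "simple_process (Suc m) (grid T m) (on_grid f T m) s w = f (Z (grid T m i) w)" for f w
  proof -
    have "indicator {grid T m j<..grid T m (Suc j)} s = (if j = i then 1 else 0 :: real)" for j
    proof -
      have "s \<le> grid T m j" if "i < j" using 2 grid_mono[of T "Suc i" j m] T that by simp
      moreover have "grid T m (Suc j) < s" if "j < i" using 2 grid_mono[of T "Suc j" i m] T that by simp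
      ultimately show ?thesis using 2 by (cases j i rule: linorder_cases) (auto split: split_indicator)
    qed
    then have "simple_process (Suc m) (grid T m) (on_grid f T m) s w = (\<Sum>j<Suc m. if j = i then f (Z (grid T m j) w) else 0)"
      unfolding simple_process_def by (intro sum.cong) auto
    also have "\<dots> = f (Z (grid T m i) w)" using im by (subst sum.delta) auto
    finally show ?thesis .
  qed
  with im 2 show ?thesis by (rule that)
qed

lemma simple_process_grid_bound:
  assumes s: "0 < s" "s \<le> T" and f: "\<And>z. \<bar>f z\<bar> \<le> C"
  shows "\<bar>simple_process (Suc m) (grid T m) (on_grid f T m) s w\<bar> \<le> C"
proof -
  obtain i where "i < Suc m" "grid T m i < s" "s \<le> grid T m (Suc i)"
    and v: "\<And>f w. simple_process (Suc m) (grid T m) (on_grid f T m) s w = f (Z (grid T m i) w)"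
    using s by (rule simple_process_grid[where m=m]) blast
  then show ?thesis using f by simp
qed

text \<open>Away from its finitely many jump times a path is constant on a left neighbourhood, so the value at the
  last grid point before \<open>s\<close> is eventually the value at \<open>s\<close>.\<close>

lemma discretize_tendsto:
  assumes T: "0 < T" and f: "\<And>z. \<bar>f z\<bar> \<le> C"
  shows "(\<lambda>m. mean_int_square M (\<lambda>s w. f (Z s w) - simple_process (Suc m) (grid T m) (on_grid f T m) s w) T) \<longlonglongrightarrow> 0"
proof (rule mean_int_square_tendsto_0[where K="\<lambda>s w. 2 * C"])
  have C0: "0 \<le> C" using f[of undefined] by linarith
  show "jointly_measurable_on T (\<lambda>s w. f (Z s w) - simple_process (Suc m) (grid T m) (on_grid f T m) s w)" for m
    by (intro jointly_measurable_diff Z_jointly_measurable_on simple_process_jointly_measurable simple_data_grid[OF _ f]) (use T in simp)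
  show "jointly_measurable_on T (\<lambda>s w. 2 * C)" unfolding jointly_measurable_on_def by measurable
  show "mean_int_square M (\<lambda>s w. 2 * C) T < \<infinity>" by (rule mean_int_square_const)
  show "\<bar>f (Z s w) - simple_process (Suc m) (grid T m) (on_grid f T m) s w\<bar> \<le> \<bar>2 * C\<bar>"
    if sT: "0 \<le> s" "s \<le> T" for m s w
  proof (cases "s = 0")
    case True
    have "simple_process (Suc m) (grid T m) (on_grid f T m) s w = 0"
      unfolding simple_process_def True using grid_nonneg[of T m] T by (auto simp: not_less intro!: sum.neutral split: split_indicator)
    then show ?thesis using f[of "Z s w"] C0 by simp
  next
    case False
    then have "0 < s" using sT by simp
    then have "\<bar>simple_process (Suc m) (grid T m) (on_grid f T m) s w\<bar> \<le> C"
      by (rule simple_process_grid_bound[OF _ sT(2) f])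
    then show ?thesis using f[of "Z s w"] by linarith
  qed
  fix w assume w: "w \<in> space M"
  obtain D where D: "finite D"
    and J: "\<And>x y. 0 \<le> x \<Longrightarrow> x < y \<Longrightarrow> y \<le> T \<Longrightarrow> Z x w \<noteq> Z y w \<Longrightarrow> D \<inter> {x<..y} \<noteq> {}"
    using cadlag_discrete_finitely_many_jumps[OF discrete_E cadlag[OF w], of T] T by auto
  have "AE s in lborel. s \<notin> D" using finite_imp_null_set_lborel[OF D] by (rule AE_not_in)
  then show "AE s in lborel. 0 < s \<longrightarrow> s \<le> T \<longrightarrow> (\<lambda>m. f (Z s w) - simple_process (Suc m) (grid T m) (on_grid f T m) s w) \<longlonglongrightarrow> 0"
  proof eventually_elim
    case (elim s)
    show ?case
    proof (intro impI)
      assume s: "0 < s" "s \<le> T"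
      obtain d where d: "0 < d" "\<And>x. x \<in> D \<Longrightarrow> x \<noteq> s \<Longrightarrow> d \<le> dist s x" using finite_set_avoid[OF D, of s] by blast
      obtain N where N: "T / d < real N" using reals_Archimedean2 by blast
      have "f (Z s w) - simple_process (Suc m) (grid T m) (on_grid f T m) s w = 0" if m: "N \<le> m" for m
      proof -
        have "T / d < real (Suc m)" using N m by simp
        then have small: "T / real (Suc m) < d" using d(1) by (simp add: divide_simps mult.commute)
        obtain i where "i < Suc m" and i: "grid T m i < s" "s \<le> grid T m (Suc i)"
          and v: "\<And>f w. simple_process (Suc m) (grid T m) (on_grid f T m) s w = f (Z (grid T m i) w)"
          using s by (rule simple_process_grid[where m=m]) blast
        have "grid T m (Suc i) = grid T m i + T / real (Suc m)" by (simp add: grid_def distrib_right add_divide_distrib)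
        then have near: "s - d < grid T m i" using i(2) small by simp
        have "D \<inter> {grid T m i<..s} = {}"
        proof (rule ccontr)
          assume "D \<inter> {grid T m i<..s} \<noteq> {}"
          then obtain x where x: "x \<in> D" "grid T m i < x" "x \<le> s" by auto
          then have "x \<noteq> s" using elim by auto
          then have "d \<le> s - x" using d(2)[OF x(1)] x(3) by (simp add: dist_real_def)
          then show False using near x(2) by simp
        qed
        then have "Z (grid T m i) w = Z s w" using J[of "grid T m i" s] i(1) s(2) grid_nonneg[of T m i] T by fastforce
        then show ?thesis by (simp add: v)
      qed
      then show "(\<lambda>m. f (Z s w) - simple_process (Suc m) (grid T m) (on_grid f T m) s w) \<longlonglongrightarrow> 0"
        by (intro tendsto_eventually) (auto simp: eventually_sequentially)
    qed
  qed
qed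

text \<open>The isometry combined with the triangle inequality: \<open>4 (2 \<eta> + 2 \<eta>) = 16 \<eta>\<close>, one \<open>\<eta>\<close> for replacing \<open>\<sigma>\<close>
  by \<open>f\<close> and one for discretizing \<open>f\<close>.\<close>

lemma walk_approx:
  assumes T: "0 < T" and W: "brownian_motion M F W" and I: "is_ito_integral M F W (\<lambda>s w. \<sigma> (Z s w)) I"
    and f: "\<And>z. \<bar>f z\<bar> \<le> C" and \<eta>: "0 < \<eta>"
    and close: "mean_int_square M (\<lambda>s w. \<sigma> (Z s w) - f (Z s w)) T \<le> ennreal \<eta>"
  shows "\<forall>\<^sub>F m in sequentially. (\<integral>\<^sup>+w. ennreal ((I T w - walk W (T / real (Suc m)) f (Suc m) w)\<^sup>2) \<partial>M) \<le> ennreal (16 * \<eta>)"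
proof -
  let ?d = "\<lambda>m. mean_int_square M (\<lambda>s w. f (Z s w) - simple_process (Suc m) (grid T m) (on_grid f T m) s w) T"
  have "\<forall>\<^sub>F m in sequentially. ?d m < ennreal \<eta>"
    using order_tendstoD(2)[OF discretize_tendsto[OF T f], of "ennreal \<eta>"] \<eta> by simp
  then show ?thesis
  proof eventually_elim
    case (elim m)
    have sd: "simple_data M F (Suc m) (grid T m) (on_grid f T m)" using simple_data_grid[where f=f, OF _ f] T by simp
    have "(\<integral>\<^sup>+w. ennreal ((I T w - walk W (T / real (Suc m)) f (Suc m) w)\<^sup>2) \<partial>M)
      \<le> 4 * mean_int_square M (\<lambda>s w. \<sigma> (Z s w) - simple_process (Suc m) (grid T m) (on_grid f T m) s w) T"
      using ito_integral_approx[OF W _ I sd, of T] T by (simp add: simple_integral_grid)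
    also have "\<dots> \<le> 4 * (2 * mean_int_square M (\<lambda>s w. \<sigma> (Z s w) - f (Z s w)) T + 2 * ?d m)"
      by (intro mult_left_mono mean_int_square_triangle jointly_measurable_diff Z_jointly_measurable_on
          simple_process_jointly_measurable sd) simp
    also have "\<dots> \<le> 4 * (2 * ennreal \<eta> + 2 * ennreal \<eta>)"
      using close elim by (intro mult_left_mono add_mono) auto
    also have "\<dots> = ennreal (16 * \<eta>)"
      using \<eta> by (simp add: ennreal_mult' flip: ennreal_plus distrib_right mult.assoc)
    finally show ?case .
  qed
qed

text \<open>An exhaustion of the countable state space by finite sets.\<close>

definition initial_states :: "nat \<Rightarrow> (real ^ 'd) set" where
  "initial_states m = from_nat_into E ` {..m}"

lemma finite_initial_states: "finite (initial_states m)"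
  by (simp add: initial_states_def)

lemma truncation_tendsto:
  assumes "mean_int_square M (\<lambda>s w. \<sigma> (Z s w)) T < \<infinity>"
  shows "(\<lambda>m. mean_int_square M (\<lambda>s w. \<sigma> (Z s w) - \<sigma> (Z s w) * indicator (initial_states m) (Z s w)) T) \<longlonglongrightarrow> 0"
proof (rule mean_int_square_tendsto_0[where K="\<lambda>s w. \<sigma> (Z s w)"])
  show "jointly_measurable_on T (\<lambda>s w. \<sigma> (Z s w) - \<sigma> (Z s w) * indicator (initial_states m) (Z s w))" for m
    by (rule Z_jointly_measurable_on[where h="\<lambda>z. \<sigma> z - \<sigma> z * indicator (initial_states m) z"])
  show "jointly_measurable_on T (\<lambda>s w. \<sigma> (Z s w))" by (rule Z_jointly_measurable_on)
  show "\<bar>\<sigma> (Z s w) - \<sigma> (Z s w) * indicator (initial_states m) (Z s w)\<bar> \<le> \<bar>\<sigma> (Z s w)\<bar>" for m s w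
    by (auto split: split_indicator)
  fix w assume w: "w \<in> space M"
  show "AE s in lborel. 0 < s \<longrightarrow> s \<le> T \<longrightarrow> (\<lambda>m. \<sigma> (Z s w) - \<sigma> (Z s w) * indicator (initial_states m) (Z s w)) \<longlonglongrightarrow> 0"
  proof (intro AE_I2 impI)
    fix s :: real assume "0 < s"
    then have "Z s w \<in> E" using Z_in_E[OF w] by simp
    then obtain k where k: "from_nat_into E k = Z s w" using from_nat_into_surj[OF countable_E] by blast
    have "Z s w \<in> initial_states m" if "k \<le> m" for m
      using that k unfolding initial_states_def by (metis atMost_iff imageI)
    then have "\<sigma> (Z s w) - \<sigma> (Z s w) * indicator (initial_states m) (Z s w) = 0" if "k \<le> m" for m
      using that by simp
    then show "(\<lambda>m. \<sigma> (Z s w) - \<sigma> (Z s w) * indicator (initial_states m) (Z s w)) \<longlonglongrightarrow> 0"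
      by (intro tendsto_eventually) (auto simp: eventually_sequentially)
  qed
qed (rule assms)

end

section \<open>The integral of a sign process is a Brownian motion\<close>

lemma (in subalgebra_prob) indep_gauss_iexp_sign:
  fixes \<xi> :: "'w \<Rightarrow> complex" and \<kappa> :: "'w \<Rightarrow> real"
  assumes N: "indep_gauss M G N v" and \<xi>[measurable]: "\<xi> \<in> borel_measurable G" and i: "integrable M \<xi>"
    and \<kappa>[measurable]: "\<kappa> \<in> borel_measurable G" and sq: "\<And>w. w \<in> space M \<Longrightarrow> (\<kappa> w)\<^sup>2 = 1" and v: "0 \<le> v"
  shows "(\<integral>w. \<xi> w * iexp (u * (\<kappa> w * N w)) \<partial>M) = (\<integral>w. \<xi> w \<partial>M) * complex_of_real (exp (- (v * u\<^sup>2) / 2))"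
proof -
  have [measurable]: "\<xi> \<in> borel_measurable M" "\<kappa> \<in> borel_measurable M" by (auto intro: measurable_G)
  have [measurable]: "N \<in> borel_measurable M" using N by (simp add: indep_gauss_def)
  have I: "integrable M (\<lambda>w. \<xi> w * iexp (u * (\<kappa> w * N w)))"
    by (rule Bochner_Integration.integrable_bound[OF i]) (auto simp: norm_mult)
  have "(\<integral>w. \<xi> w * iexp (u * (\<kappa> w * N w)) \<partial>M) = (\<integral>w. \<integral>x. \<xi> w * iexp (u * (\<kappa> w * x)) \<partial>gauss v \<partial>M)"
    by (rule indep_gauss_integral(1)[where H="\<lambda>w x. \<xi> w * iexp (u * (\<kappa> w * x))", OF N _ I]) simp
  also have "\<dots> = (\<integral>w. \<xi> w * complex_of_real (exp (- (v * u\<^sup>2) / 2)) \<partial>M)"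
  proof (rule Bochner_Integration.integral_cong[OF refl])
    fix w assume w: "w \<in> space M"
    have "(\<integral>x. \<xi> w * iexp (u * (\<kappa> w * x)) \<partial>gauss v) = \<xi> w * char (gauss v) (u * \<kappa> w)"
      by (simp add: char_def mult.assoc)
    then show "(\<integral>x. \<xi> w * iexp (u * (\<kappa> w * x)) \<partial>gauss v) = \<xi> w * complex_of_real (exp (- (v * u\<^sup>2) / 2))"
      using sq[OF w] v by (simp add: char_gauss power_mult_distrib)
  qed
  finally show ?thesis by simp
qed

context markov_chain
begin

text \<open>A coefficient of modulus 1 that is known at the start of a cell does not change the conditional law of
  the increment over that cell, so the characteristic function factorizes cell by cell.\<close>

lemma sign_simple_iexp:
  assumes W: "brownian_motion M F W" and st: "0 \<le> s" "s \<le> t" and \<kappa>: "\<And>z. (\<kappa> z)\<^sup>2 = 1" and A: "A \<in> sets (F s)"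
    and J: "J = simple_integral W (Suc m) (grid t m) (on_grid \<kappa> t m)"
  shows "(\<integral>w. complex_of_real (indicator A w) * iexp (u * (J t w - J s w)) \<partial>M) = complex_of_real (prob A * exp (- ((t - s) * u\<^sup>2) / 2))"
proof -
  have t0: "0 \<le> t" using st by simp
  \<comment> \<open>the grid clamped to \<open>[s, t]\<close>; cells outside collapse to a point\<close>
  define c where "c i = max s (min t (grid t m i))" for i
  have c0: "c 0 = s" and cn: "c (Suc m) = t" using st by (auto simp: c_def grid_top) (auto simp: grid_def)
  have c_mono: "c i \<le> c (Suc i)" for i using grid_mono[OF t0, of i "Suc i" m] by (auto simp: c_def)
  have c_ge: "s \<le> c i" for i by (simp add: c_def)
  have AM: "A \<in> sets M" using sets_F_M[OF st(1) A] .
  define Y where "Y j w = (\<Sum>i<j. on_grid \<kappa> t m i w * (W (c (Suc i)) w - W (c i) w))" for j w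
  have JY: "J t w - J s w = Y (Suc m) w" for w
  proof -
    have "W (min t (grid t m (Suc i))) w - W (min t (grid t m i)) w - (W (min s (grid t m (Suc i))) w - W (min s (grid t m i)) w)
      = W (c (Suc i)) w - W (c i) w" for i
    proof -
      have le: "grid t m i \<le> grid t m (Suc i)" using grid_mono[OF t0, of i "Suc i" m] by simp
      consider "grid t m (Suc i) \<le> s" | "grid t m i \<le> s" "s < grid t m (Suc i)" | "s < grid t m i" by linarith
      then show ?thesis
        by cases (use le st in \<open>simp_all add: c_def min_def max_def\<close>)
    qed
    then show ?thesis
      unfolding J simple_integral_def Y_def by (simp add: sum_subtractf[symmetric] right_diff_distrib[symmetric] del: sum.lessThan_Suc)
  qed
  have Ym: "Y j \<in> borel_measurable (F (c j))" for j
  proof (induction j)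
    case (Suc j)
    have "Y j \<in> borel_measurable (F (c (Suc j)))" using F_mono[OF _ c_mono Suc] c_ge[of j] st by simp
    moreover have "W (c (Suc j)) \<in> borel_measurable (F (c (Suc j)))" "W (c j) \<in> borel_measurable (F (c (Suc j)))"
      using bm_adapted[OF W] c_mono[of j] c_ge[of j] c_ge[of "Suc j"] st by auto
    moreover have "(\<lambda>w. on_grid \<kappa> t m j w * (W (c (Suc j)) w - W (c j) w)) \<in> borel_measurable (F (c (Suc j)))"
    proof (cases "c j = c (Suc j)")
      case False
      then have "grid t m j \<le> c (Suc j)" using c_mono[of j] by (auto simp: c_def max_def min_def split: if_splits)
      then have "on_grid \<kappa> t m j \<in> borel_measurable (F (c (Suc j)))" using grid_nonneg[OF t0] by (intro Z_measurable) auto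
      with calculation show ?thesis by measurable
    qed simp
    ultimately show ?case unfolding Y_def by simp
  qed (simp add: Y_def)
  have ind: "(\<lambda>w. complex_of_real (indicator A w)) \<in> borel_measurable (F (c j))" for j
  proof -
    have "A \<in> sets (F (c j))" using A sets_F_mono[OF st(1) c_ge] by blast
    then show ?thesis by measurable
  qed
  have "(\<integral>w. complex_of_real (indicator A w) * iexp (u * Y j w) \<partial>M) = complex_of_real (prob A * exp (- ((c j - s) * u\<^sup>2) / 2))" for j
  proof (induction j)
    case 0
    then show ?case using AM by (simp add: Y_def c0)
  next
    case (Suc j)
    show ?case
    proof (cases "c j = c (Suc j)")
      case True
      then have "Y (Suc j) w = Y j w" for w by (simp add: Y_def)
      then show ?thesis using Suc True by simp
    next
      case False
      have cj: "0 \<le> c j" using c_ge[of j] st by simp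
      interpret Fj: subalgebra_prob M "F (c j)" by (rule subalgebra_prob_F[OF cj])
      have g: "grid t m j \<le> c j" using False c_mono[of j] grid_mono[OF t0, of j "Suc j" m] by (auto simp: c_def max_def min_def split: if_splits)
      have \<kappa>m: "on_grid \<kappa> t m j \<in> borel_measurable (F (c j))" by (rule Z_measurable) (use g grid_nonneg[OF t0] in auto)
      note Ym[of j, measurable] ind[of j, measurable]
      have xm: "(\<lambda>w. complex_of_real (indicator A w) * iexp (u * Y j w)) \<in> borel_measurable (F (c j))" by measurable
      have "integrable M (\<lambda>w. complex_of_real (indicator A w) * iexp (u * Y j w))"
        using Fj.measurable_G[OF xm] by (intro integrable_bounded_complex[where B=1]) (auto simp: norm_mult split: split_indicator)
      then have "(\<integral>w. (complex_of_real (indicator A w) * iexp (u * Y j w)) * iexp (u * (on_grid \<kappa> t m j w * (W (c (Suc j)) w - W (c j) w))) \<partial>M)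
        = (\<integral>w. complex_of_real (indicator A w) * iexp (u * Y j w) \<partial>M) * complex_of_real (exp (- ((c (Suc j) - c j) * u\<^sup>2) / 2))"
        by (intro Fj.indep_gauss_iexp_sign[OF bm_increment[OF W cj c_mono] xm _ \<kappa>m]) (use \<kappa> c_mono in auto)
      also have "\<dots> = complex_of_real (prob A * (exp (- ((c j - s) * u\<^sup>2) / 2) * exp (- ((c (Suc j) - c j) * u\<^sup>2) / 2)))"
        unfolding Suc by simp
      also have "exp (- ((c j - s) * u\<^sup>2) / 2) * exp (- ((c (Suc j) - c j) * u\<^sup>2) / 2) = exp (- ((c (Suc j) - s) * u\<^sup>2) / 2)"
        by (simp add: exp_add[symmetric] field_simps)
      finally show ?thesis
        by (simp add: Y_def distrib_left exp_add mult.assoc)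
    qed
  qed
  from this[of "Suc m"] show ?thesis by (simp add: JY cn)
qed

text \<open>The case of Levy's characterization needed here: the increments of simple sign integrals are exactly Gaussian and
  independent of the past, and this survives limits in \<open>L\<^sup>2\<close> because \<open>iexp\<close> is Lipschitz.\<close>

lemma sign_integral_brownian:
  assumes B: "brownian_motion M F B" and \<kappa>: "\<And>z. (\<kappa> z)\<^sup>2 = 1"
    and I: "is_ito_integral M F B (\<lambda>s w. \<kappa> (Z s w)) I"
  shows "brownian_motion M F I"
proof -
  have \<kappa>b: "\<bar>\<kappa> z\<bar> \<le> 1" for z using \<kappa>[of z] by (auto simp: power2_eq_1_iff)
  have ad: "adapted F I" and cont: "AE w in M. continuous_on {0..} (\<lambda>t. I t w)" using I by (auto simp: is_ito_integral_def)
  have Im: "I x \<in> borel_measurable M" if "0 \<le> x" for x using ad that F_le_M[OF that] by (auto simp: adapted_def)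
  have zero: "AE w in M. I 0 w = 0"
  proof -
    have sd: "simple_data M F (Suc 0) (grid 0 0) (on_grid \<kappa> 0 0)" by (rule simple_data_grid[OF _ \<kappa>b]) simp
    have "mean_int_square M H 0 = 0" for H :: "real \<Rightarrow> 'w \<Rightarrow> real"
    proof -
      have "(\<integral>\<^sup>+s\<in>{0..0}. ennreal ((H s w)\<^sup>2) \<partial>lborel) = 0" for w
        by (rule nn_integral_null_set) (simp add: finite_imp_null_set_lborel)
      then show ?thesis by (simp add: mean_int_square_def)
    qed
    then have "(\<integral>\<^sup>+w. ennreal ((I 0 w - simple_integral B (Suc 0) (grid 0 0) (on_grid \<kappa> 0 0) 0 w)\<^sup>2) \<partial>M) = 0"
      using ito_integral_approx[OF B _ I sd, of 0] by simp
    then have "(\<integral>\<^sup>+w. ennreal ((I 0 w)\<^sup>2) \<partial>M) = 0" by (simp add: simple_integral_def grid_def)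
    then have "AE w in M. ennreal ((I 0 w)\<^sup>2) = 0" using Im[of 0] by (subst (asm) nn_integral_0_iff_AE) auto
    then show ?thesis by eventually_elim simp
  qed
  have gauss: "indep_gauss M (F s) (\<lambda>w. I t w - I s w) (t - s)" if st: "0 \<le> s" "s < t" for s t
  proof (rule indep_gauss_char)
    have t0: "0 < t" "0 \<le> t" using st by auto
    have [measurable]: "I s \<in> borel_measurable M" "I t \<in> borel_measurable M" using Im st t0 by auto
    show "(\<lambda>w. I t w - I s w) \<in> borel_measurable M" by measurable
    show "sets (F s) \<subseteq> sets M" using sets_F_M[OF st(1)] by auto
    show "Int_stable (sets (F s))" by (auto simp: Int_stable_def)
    show "sets (F s) = sigma_sets (space M) (sets (F s))" using sets.sigma_sets_eq[of "F s"] space_F[OF st(1)] by simp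
    show "space M \<in> sets (F s)" using sets.top[of "F s"] space_F[OF st(1)] by simp
    fix A u assume A: "A \<in> sets (F s)"
    have [measurable]: "A \<in> sets M" using sets_F_M[OF st(1) A] .
    let ?J = "\<lambda>m. simple_integral B (Suc m) (grid t m) (on_grid \<kappa> t m)"
    let ?v = "complex_of_real (prob A * exp (- ((t - s) * u\<^sup>2) / 2))"
    let ?E = "\<integral>w. complex_of_real (indicator A w) * iexp (u * (I t w - I s w)) \<partial>M"
    have bnd: "cmod (?E - ?v) \<le> \<bar>u\<bar> * (2 * sqrt \<eta>)" if \<eta>: "0 < \<eta>" for \<eta>
    proof -
      let ?d = "\<lambda>m. mean_int_square M (\<lambda>s w. \<kappa> (Z s w) - simple_process (Suc m) (grid t m) (on_grid \<kappa> t m) s w) t"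
      have "\<forall>\<^sub>F m in sequentially. ?d m < ennreal (\<eta> / 4)"
        using order_tendstoD(2)[OF discretize_tendsto[OF t0(1) \<kappa>b], of "ennreal (\<eta> / 4)"] \<eta> by simp
      then obtain m where m: "?d m < ennreal (\<eta> / 4)" by (meson eventually_happens sequentially_bot)
      have sd: "simple_data M F (Suc m) (grid t m) (on_grid \<kappa> t m)" using simple_data_grid[where f=\<kappa>, OF t0(2) \<kappa>b] .
      have Jm: "?J m x \<in> borel_measurable M" if "0 \<le> x" for x
      proof -
        have "on_grid \<kappa> t m i \<in> borel_measurable M" for i by (rule Z_measurable_M) (use grid_nonneg[OF t0(2)] in auto)
        moreover have "B (min x (grid t m i)) \<in> borel_measurable M" for i
          using grid_nonneg[OF t0(2), of m i] that by (intro bm_measurable[OF B]) auto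
        ultimately show ?thesis unfolding simple_integral_def by (intro borel_measurable_sum borel_measurable_times borel_measurable_diff)
      qed
      have close: "integrable M (\<lambda>w. I x w - ?J m x w)" "(\<integral>w. \<bar>I x w - ?J m x w\<bar> \<partial>M) \<le> sqrt \<eta>" if x: "0 \<le> x" "x \<le> t" for x
      proof -
        have "(\<integral>\<^sup>+w. ennreal ((I x w - ?J m x w)\<^sup>2) \<partial>M) \<le> 4 * mean_int_square M (\<lambda>s w. \<kappa> (Z s w) - simple_process (Suc m) (grid t m) (on_grid \<kappa> t m) s w) x"
          by (rule ito_integral_approx[OF B x(1) I sd])
        also have "\<dots> \<le> 4 * ?d m" by (intro mult_left_mono mean_int_square_mono x) simp
        also have "\<dots> \<le> 4 * ennreal (\<eta> / 4)" using m by (intro mult_left_mono) auto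
        also have "\<dots> = ennreal \<eta>" using \<eta> by (simp add: ennreal_mult'[symmetric] flip: ennreal_numeral)
        finally have *: "(\<integral>\<^sup>+w. ennreal ((I x w - ?J m x w)\<^sup>2) \<partial>M) \<le> ennreal \<eta>" .
        have mm: "(\<lambda>w. I x w - ?J m x w) \<in> borel_measurable M" using Im[OF x(1)] Jm[OF x(1)] by measurable
        show "integrable M (\<lambda>w. I x w - ?J m x w)" "(\<integral>w. \<bar>I x w - ?J m x w\<bar> \<partial>M) \<le> sqrt \<eta>"
          using L1_from_L2[OF mm *] \<eta> by auto
      qed
      have [measurable]: "?J m s \<in> borel_measurable M" "?J m t \<in> borel_measurable M" using Jm st t0 by auto
      have i: "integrable M (\<lambda>w. complex_of_real (indicator A w) * iexp (u * Q w))" if [measurable]: "Q \<in> borel_measurable M" for Q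
        by (rule integrable_bounded_complex[where B=1]) (auto simp: norm_mult split: split_indicator)
      have "?v = (\<integral>w. complex_of_real (indicator A w) * iexp (u * (?J m t w - ?J m s w)) \<partial>M)"
        by (rule sign_simple_iexp[symmetric, OF B st(1) less_imp_le[OF st(2)] \<kappa> A refl])
      then have "?E - ?v = (\<integral>w. complex_of_real (indicator A w) * iexp (u * (I t w - I s w))
          - complex_of_real (indicator A w) * iexp (u * (?J m t w - ?J m s w)) \<partial>M)"
        by (simp only:) (intro Bochner_Integration.integral_diff[symmetric] i; measurable)
      then have "cmod (?E - ?v) \<le> (\<integral>w. cmod (complex_of_real (indicator A w) * iexp (u * (I t w - I s w))
          - complex_of_real (indicator A w) * iexp (u * (?J m t w - ?J m s w))) \<partial>M)"
        by (simp only: integral_norm_bound)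
      also have "\<dots> \<le> (\<integral>w. \<bar>u\<bar> * (\<bar>I t w - ?J m t w\<bar> + \<bar>I s w - ?J m s w\<bar>) \<partial>M)"
      proof (rule integral_mono)
        show "integrable M (\<lambda>w. cmod (complex_of_real (indicator A w) * iexp (u * (I t w - I s w))
          - complex_of_real (indicator A w) * iexp (u * (?J m t w - ?J m s w))))"
          by (intro integrable_norm Bochner_Integration.integrable_diff i; measurable)
        show "integrable M (\<lambda>w. \<bar>u\<bar> * (\<bar>I t w - ?J m t w\<bar> + \<bar>I s w - ?J m s w\<bar>))"
          using close(1)[of t] close(1)[of s] st t0 by auto
        fix w
        have "cmod (complex_of_real (indicator A w) * iexp (u * (I t w - I s w)) - complex_of_real (indicator A w) * iexp (u * (?J m t w - ?J m s w)))
          \<le> cmod (iexp (u * (I t w - I s w)) - iexp (u * (?J m t w - ?J m s w)))"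
          by (cases "w \<in> A") auto
        also have "\<dots> \<le> \<bar>u * (I t w - I s w) - u * (?J m t w - ?J m s w)\<bar>" by (rule cmod_iexp_diff_le)
        also have "\<dots> = \<bar>u\<bar> * \<bar>(I t w - ?J m t w) - (I s w - ?J m s w)\<bar>"
          by (simp add: abs_mult[symmetric] algebra_simps)
        also have "\<dots> \<le> \<bar>u\<bar> * (\<bar>I t w - ?J m t w\<bar> + \<bar>I s w - ?J m s w\<bar>)"
          by (intro mult_left_mono abs_triangle_ineq4) simp
        finally show "cmod (complex_of_real (indicator A w) * iexp (u * (I t w - I s w)) - complex_of_real (indicator A w) * iexp (u * (?J m t w - ?J m s w)))
          \<le> \<bar>u\<bar> * (\<bar>I t w - ?J m t w\<bar> + \<bar>I s w - ?J m s w\<bar>)" .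
      qed
      also have "\<dots> = \<bar>u\<bar> * ((\<integral>w. \<bar>I t w - ?J m t w\<bar> \<partial>M) + (\<integral>w. \<bar>I s w - ?J m s w\<bar> \<partial>M))"
        using close(1)[of t] close(1)[of s] st t0 by simp
      also have "\<dots> \<le> \<bar>u\<bar> * (sqrt \<eta> + sqrt \<eta>)"
        using close(2)[of t] close(2)[of s] st t0 by (intro mult_left_mono add_mono) auto
      finally show ?thesis by simp
    qed
    have "cmod (?E - ?v) \<le> 0"
    proof (rule field_le_epsilon)
      fix e :: real assume e: "0 < e"
      \<comment> \<open>the bound applied with \<open>\<eta> = k\<^sup>2\<close> is below \<open>e\<close>\<close>
      define k where "k = e / (2 * (\<bar>u\<bar> + 1))"
      have k: "0 < k" using e by (simp add: k_def)
      have "cmod (?E - ?v) \<le> \<bar>u\<bar> * (2 * sqrt (k\<^sup>2))" using bnd[of "k\<^sup>2"] k by simp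
      also have "\<dots> = 2 * \<bar>u\<bar> * k" using k by simp
      also have "\<dots> \<le> 2 * (\<bar>u\<bar> + 1) * k" using k by (intro mult_right_mono) auto
      also have "\<dots> = e" by (simp add: k_def)
      finally show "cmod (?E - ?v) \<le> 0 + e" by simp
    qed
    then show "(\<integral>w. indicator A w *\<^sub>R iexp (u * (I t w - I s w)) \<partial>M) = complex_of_real (prob A * exp (- ((t - s) * u\<^sup>2) / 2))"
      by (simp add: scaleR_conv_of_real)
  qed (use st in simp)
  show ?thesis
    unfolding brownian_motion_def using ad zero cont bm_from_indep_gauss[OF _ _ gauss] by blast
qed

lemma brownian_minus:
  assumes W: "brownian_motion M F W"
  shows "brownian_motion M F (\<lambda>t w. - W t w)"
proof -
  have gauss: "indep_gauss M (F s) (\<lambda>w. - W t w - - W s w) (t - s)" if st: "0 \<le> s" "s < t" for s t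
  proof -
    have N: "indep_gauss M (F s) (\<lambda>w. W t w - W s w) (t - s)" by (rule bm_increment[OF W]) (use st in auto)
    have sym: "measure (gauss (t - s)) (uminus -` S) = measure (gauss (t - s)) S" if "S \<in> sets borel" for S :: "real set"
    proof -
      have "gauss (t - s) = distr (gauss (t - s)) borel (\<lambda>x. - 1 * x)"
        using gauss_scale[of "t - s" "- 1"] st by simp
      then have "measure (gauss (t - s)) S = measure (distr (gauss (t - s)) borel (\<lambda>x. - 1 * x)) S" by simp
      also have "\<dots> = measure (gauss (t - s)) (uminus -` S)" using that by (subst measure_distr) (auto simp: vimage_def)
      finally show ?thesis by simp
    qed
    show ?thesis
      unfolding indep_gauss_def
    proof (intro conjI ballI)
      have [measurable]: "W t \<in> borel_measurable M" "W s \<in> borel_measurable M" using bm_measurable[OF W] st by auto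
      show "(\<lambda>w. - W t w - - W s w) \<in> borel_measurable M" by measurable
      fix A and S :: "real set" assume A: "A \<in> sets (F s)" and S: "S \<in> sets borel"
      have S': "uminus -` S \<in> sets borel" using measurable_sets[OF borel_measurable_uminus[OF measurable_ident] S] by simp
      have "(\<lambda>w. - W t w - - W s w) -` S \<inter> space M = (\<lambda>w. W t w - W s w) -` (uminus -` S) \<inter> space M" by auto
      then show "prob (A \<inter> ((\<lambda>w. - W t w - - W s w) -` S \<inter> space M)) = prob A * measure (gauss (t - s)) S"
        using N A S' sym[OF S] unfolding indep_gauss_def by simp
    qed
  qed
  have "adapted F (\<lambda>t w. - W t w)" using W by (auto simp: brownian_motion_def adapted_def)
  moreover have "AE w in M. - W 0 w = 0" using W by (simp add: brownian_motion_def)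
  moreover have "AE w in M. continuous_on {0..} (\<lambda>t. - W t w)"
  proof -
    have "AE w in M. continuous_on {0..} (\<lambda>t. W t w)" using W by (simp add: brownian_motion_def)
    then show ?thesis by eventually_elim (intro continuous_intros)
  qed
  ultimately show ?thesis
    unfolding brownian_motion_def using bm_from_indep_gauss[OF _ _ gauss] by blast
qed

end

section \<open>Comparison for Lipschitz convex functions\<close>

context markov_chain
begin

text \<open>When \<open>V\<close> is the integral of \<open>\<kappa> (Z)\<close> against \<open>B\<close>, its increment over a cell is close to \<open>\<kappa> (Z)\<close> times the
  increment of \<open>B\<close>. The differences are orthogonal over the cells, even when multiplied by bounded
  coefficients known at the start of the cell.\<close>

context
  fixes B V :: "('w, real) process" and \<kappa> :: "real ^ 'd \<Rightarrow> real" and \<delta> :: real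
  assumes B: "brownian_motion M F B" and V: "brownian_motion M F V" and \<kappa>: "\<And>z. (\<kappa> z)\<^sup>2 = 1" and \<delta>: "0 \<le> \<delta>"
begin

definition resid :: "nat \<Rightarrow> 'w \<Rightarrow> real" where
  "resid i w = (V (real (Suc i) * \<delta>) w - V (real i * \<delta>) w)
     - \<kappa> (Z (real i * \<delta>) w) * (B (real (Suc i) * \<delta>) w - B (real i * \<delta>) w)"

lemma walk_diff_resid:
  "walk V \<delta> g k w - walk B \<delta> (\<lambda>z. g z * \<kappa> z) k w = (\<Sum>i<k. g (Z (real i * \<delta>) w) * resid i w)"
  unfolding walk_def resid_def by (simp add: sum_subtractf[symmetric] right_diff_distrib mult.assoc)

lemma resid_moments:
  fixes \<zeta> :: "'w \<Rightarrow> real"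
  assumes \<zeta>: "\<zeta> \<in> borel_measurable (F (real i * \<delta>))" and i: "integrable M \<zeta>"
  shows "integrable M (\<lambda>w. \<zeta> w * resid i w)" "(\<integral>w. \<zeta> w * resid i w \<partial>M) = 0" "integrable M (\<lambda>w. (resid i w)\<^sup>2)"
proof -
  have p: "0 \<le> real i * \<delta>" "real i * \<delta> \<le> real (Suc i) * \<delta>" using \<delta> by (auto intro!: mult_right_mono)
  interpret Fi: subalgebra_prob M "F (real i * \<delta>)" by (rule subalgebra_prob_F[OF p(1)])
  have \<kappa>b: "\<bar>\<kappa> z\<bar> = 1" for z using \<kappa>[of z] by (auto simp: power2_eq_1_iff)
  have \<kappa>m: "(\<lambda>w. \<kappa> (Z (real i * \<delta>) w)) \<in> borel_measurable (F (real i * \<delta>))" by (rule Z_measurable) (use p in auto)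
  note iB = bm_increment[OF B p] and iV = bm_increment[OF V p]
  have \<zeta>\<kappa>: "(\<lambda>w. \<zeta> w * \<kappa> (Z (real i * \<delta>) w)) \<in> borel_measurable (F (real i * \<delta>))" using \<zeta> \<kappa>m by measurable
  have i\<zeta>\<kappa>: "integrable M (\<lambda>w. \<zeta> w * \<kappa> (Z (real i * \<delta>) w))"
    by (rule Bochner_Integration.integrable_bound[OF i]) (use Fi.measurable_G[OF \<zeta>\<kappa>] \<kappa>b in \<open>auto simp: abs_mult\<close>)
  have eq: "\<zeta> w * resid i w = \<zeta> w * (V (real (Suc i) * \<delta>) w - V (real i * \<delta>) w)
      - (\<zeta> w * \<kappa> (Z (real i * \<delta>) w)) * (B (real (Suc i) * \<delta>) w - B (real i * \<delta>) w)" for w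
    by (simp add: resid_def right_diff_distrib)
  show "integrable M (\<lambda>w. \<zeta> w * resid i w)" "(\<integral>w. \<zeta> w * resid i w \<partial>M) = 0"
    unfolding eq using Fi.indep_gauss_mean[OF iV \<zeta> i] Fi.indep_gauss_mean[OF iB \<zeta>\<kappa> i\<zeta>\<kappa>] by simp_all
  have sq: "integrable M (\<lambda>w. (V (real (Suc i) * \<delta>) w - V (real i * \<delta>) w)\<^sup>2)" "integrable M (\<lambda>w. (B (real (Suc i) * \<delta>) w - B (real i * \<delta>) w)\<^sup>2)"
  proof -
    have "integrable M (\<lambda>w. 1 * (V (real (Suc i) * \<delta>) w - V (real i * \<delta>) w)\<^sup>2)"
      by (rule Fi.indep_gauss_square(1)[OF iV]) (use p in auto)
    then show "integrable M (\<lambda>w. (V (real (Suc i) * \<delta>) w - V (real i * \<delta>) w)\<^sup>2)" by simp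
    have "integrable M (\<lambda>w. 1 * (B (real (Suc i) * \<delta>) w - B (real i * \<delta>) w)\<^sup>2)"
      by (rule Fi.indep_gauss_square(1)[OF iB]) (use p in auto)
    then show "integrable M (\<lambda>w. (B (real (Suc i) * \<delta>) w - B (real i * \<delta>) w)\<^sup>2)" by simp
  qed
  show "integrable M (\<lambda>w. (resid i w)\<^sup>2)"
  proof (rule Bochner_Integration.integrable_bound)
    show "integrable M (\<lambda>w. 2 * (V (real (Suc i) * \<delta>) w - V (real i * \<delta>) w)\<^sup>2 + 2 * (B (real (Suc i) * \<delta>) w - B (real i * \<delta>) w)\<^sup>2)"
      using sq by auto
    have [measurable]: "V (real (Suc i) * \<delta>) \<in> borel_measurable M" "V (real i * \<delta>) \<in> borel_measurable M"
      "B (real (Suc i) * \<delta>) \<in> borel_measurable M" "B (real i * \<delta>) \<in> borel_measurable M"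
      using bm_measurable[OF V] bm_measurable[OF B] p \<delta> by auto
    have [measurable]: "(\<lambda>w. \<kappa> (Z (real i * \<delta>) w)) \<in> borel_measurable M" by (rule Fi.measurable_G[OF \<kappa>m])
    show "(\<lambda>w. (resid i w)\<^sup>2) \<in> borel_measurable M" unfolding resid_def by measurable
    show "AE w in M. norm ((resid i w)\<^sup>2) \<le> norm (2 * (V (real (Suc i) * \<delta>) w - V (real i * \<delta>) w)\<^sup>2 + 2 * (B (real (Suc i) * \<delta>) w - B (real i * \<delta>) w)\<^sup>2)"
    proof (rule AE_I2)
      fix w
      define x y k where "x = V (real (Suc i) * \<delta>) w - V (real i * \<delta>) w" and "y = B (real (Suc i) * \<delta>) w - B (real i * \<delta>) w" and "k = \<kappa> (Z (real i * \<delta>) w)"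
      have "(x - k * y)\<^sup>2 \<le> 2 * x\<^sup>2 + 2 * (k * y)\<^sup>2"
        using sum_squares_bound[of x "- (k * y)"] by (simp add: power2_diff)
      also have "(k * y)\<^sup>2 = y\<^sup>2" using \<kappa> by (simp add: k_def power_mult_distrib)
      finally show "norm ((resid i w)\<^sup>2) \<le> norm (2 * (V (real (Suc i) * \<delta>) w - V (real i * \<delta>) w)\<^sup>2 + 2 * (B (real (Suc i) * \<delta>) w - B (real i * \<delta>) w)\<^sup>2)"
        unfolding resid_def x_def y_def k_def by simp
    qed
  qed
qed

lemma resid_orthogonal:
  assumes g: "\<And>z. \<bar>g z\<bar> \<le> C"
  shows "integrable M (\<lambda>w. (\<Sum>i<k. g (Z (real i * \<delta>) w) * resid i w)\<^sup>2)
    \<and> (\<integral>w. (\<Sum>i<k. g (Z (real i * \<delta>) w) * resid i w)\<^sup>2 \<partial>M) = (\<Sum>i<k. \<integral>w. (g (Z (real i * \<delta>) w))\<^sup>2 * (resid i w)\<^sup>2 \<partial>M)"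
proof (induction k)
  case (Suc k)
  let ?P = "\<lambda>w. \<Sum>i<k. g (Z (real i * \<delta>) w) * resid i w"
  have p: "0 \<le> real k * \<delta>" using \<delta> by simp
  have gm: "(\<lambda>w. g (Z (real k * \<delta>) w)) \<in> borel_measurable (F (real k * \<delta>))" by (rule Z_measurable) (use p in auto)
  have gM[measurable]: "(\<lambda>w. g (Z (real k * \<delta>) w)) \<in> borel_measurable M" by (rule F_le_M[OF p gm])
  have gk: "\<bar>g z * \<kappa> z\<bar> \<le> C" for z
  proof -
    have "\<bar>\<kappa> z\<bar> = 1" using \<kappa>[of z] by (auto simp: power2_eq_1_iff)
    then show ?thesis using g[of z] by (simp add: abs_mult)
  qed
  have Pm: "?P \<in> borel_measurable (F (real k * \<delta>))"
    unfolding walk_diff_resid[symmetric]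
    by (intro borel_measurable_diff walk_measurable[OF V \<delta>] walk_measurable[OF B \<delta>]) auto
  have Pi: "integrable M ?P"
    unfolding walk_diff_resid[symmetric]
    by (intro Bochner_Integration.integrable_diff walk_integrable[OF V \<delta> g] walk_integrable[OF B \<delta> gk])
  have zm: "(\<lambda>w. 2 * ?P w * g (Z (real k * \<delta>) w)) \<in> borel_measurable (F (real k * \<delta>))" using Pm gm by measurable
  have zi: "integrable M (\<lambda>w. 2 * ?P w * g (Z (real k * \<delta>) w))"
  proof (rule Bochner_Integration.integrable_bound)
    show "integrable M (\<lambda>w. 2 * C * ?P w)" using Pi by auto
    show "(\<lambda>w. 2 * ?P w * g (Z (real k * \<delta>) w)) \<in> borel_measurable M" by (rule F_le_M[OF p zm])
    show "AE w in M. norm (2 * ?P w * g (Z (real k * \<delta>) w)) \<le> norm (2 * C * ?P w)"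
    proof (rule AE_I2)
      fix w
      have "\<bar>?P w\<bar> * \<bar>g (Z (real k * \<delta>) w)\<bar> \<le> \<bar>?P w\<bar> * \<bar>C\<bar>" using g[of "Z (real k * \<delta>) w"] by (intro mult_left_mono) auto
      then show "norm (2 * ?P w * g (Z (real k * \<delta>) w)) \<le> norm (2 * C * ?P w)" by (simp add: abs_mult mult_ac)
    qed
  qed
  note rm = resid_moments[OF zm zi]
  have sq: "integrable M (\<lambda>w. (g (Z (real k * \<delta>) w))\<^sup>2 * (resid k w)\<^sup>2)"
  proof (rule Bochner_Integration.integrable_bound)
    show "integrable M (\<lambda>w. C\<^sup>2 * (resid k w)\<^sup>2)" using rm(3) by auto
    have "(\<lambda>w. (resid k w)\<^sup>2) \<in> borel_measurable M" using rm(3) by auto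
    then show "(\<lambda>w. (g (Z (real k * \<delta>) w))\<^sup>2 * (resid k w)\<^sup>2) \<in> borel_measurable M" using gM by measurable
    show "AE w in M. norm ((g (Z (real k * \<delta>) w))\<^sup>2 * (resid k w)\<^sup>2) \<le> norm (C\<^sup>2 * (resid k w)\<^sup>2)"
    proof (rule AE_I2)
      fix w
      have "\<bar>g (Z (real k * \<delta>) w)\<bar>\<^sup>2 \<le> C\<^sup>2" using g by (rule power_mono) simp
      then have "(g (Z (real k * \<delta>) w))\<^sup>2 * (resid k w)\<^sup>2 \<le> C\<^sup>2 * (resid k w)\<^sup>2" by (intro mult_right_mono) auto
      then show "norm ((g (Z (real k * \<delta>) w))\<^sup>2 * (resid k w)\<^sup>2) \<le> norm (C\<^sup>2 * (resid k w)\<^sup>2)" by simp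
    qed
  qed
  have eq: "(\<Sum>i<Suc k. g (Z (real i * \<delta>) w) * resid i w)\<^sup>2
     = (?P w)\<^sup>2 + 2 * ?P w * g (Z (real k * \<delta>) w) * resid k w + (g (Z (real k * \<delta>) w))\<^sup>2 * (resid k w)\<^sup>2" for w
    by (simp add: power2_sum power_mult_distrib algebra_simps)
  show ?case
    unfolding eq using Suc rm(1,2) sq by simp
qed simp

end

text \<open>By orthogonality, the coefficients \<open>g\<close> enlarge the square error at most by \<open>C\<^sup>2\<close>, and without them the
  differences add up to the error of approximating \<open>I T\<close>.\<close>

lemma sign_walk_approx:
  assumes T: "0 < T" and B: "brownian_motion M F B" and \<kappa>: "\<And>z. (\<kappa> z)\<^sup>2 = 1"
    and I: "is_ito_integral M F B (\<lambda>s w. \<kappa> (Z s w)) I" and g: "\<And>z. \<bar>g z\<bar> \<le> C" and \<eta>: "0 < \<eta>"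
  shows "\<forall>\<^sub>F m in sequentially. (\<integral>\<^sup>+w. ennreal ((walk I (T / real (Suc m)) g (Suc m) w
      - walk B (T / real (Suc m)) (\<lambda>z. g z * \<kappa> z) (Suc m) w)\<^sup>2) \<partial>M) \<le> ennreal \<eta>"
proof -
  have V: "brownian_motion M F I" by (rule sign_integral_brownian[OF B \<kappa> I])
  have \<kappa>b: "\<bar>\<kappa> z\<bar> \<le> 1" for z using \<kappa>[of z] by (auto simp: power2_eq_1_iff)
  \<comment> \<open>so that \<open>16 C\<^sup>2 \<eta>' \<le> \<eta>\<close>, also for \<open>C = 0\<close>\<close>
  define \<eta>' where "\<eta>' = \<eta> / (16 * (C\<^sup>2 + 1))"
  have cpos: "0 < C\<^sup>2 + 1" by (simp add: add_nonneg_pos)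
  then have \<eta>': "0 < \<eta>'" using \<eta> by (simp add: \<eta>'_def)
  have "mean_int_square M (\<lambda>s w. \<kappa> (Z s w) - \<kappa> (Z s w)) T \<le> ennreal \<eta>'" by (simp add: mean_int_square_def)
  from walk_approx[OF T B I \<kappa>b \<eta>' this] show ?thesis
  proof eventually_elim
    case (elim m)
    define \<delta> where "\<delta> = T / real (Suc m)"
    define n where "n = Suc m"
    have \<delta>: "0 \<le> \<delta>" using T by (simp add: \<delta>_def)
    have n\<delta>: "real n * \<delta> = T" by (simp add: n_def \<delta>_def)
    let ?r = "resid B I \<kappa> \<delta>"
    note ro = resid_orthogonal[where \<kappa>=\<kappa>, OF B V \<kappa> \<delta>]
    note rg = ro[where g=g and C=C and k=n, OF g]
    have r1: "integrable M (\<lambda>w. (\<Sum>i<n. ?r i w)\<^sup>2)" "(\<integral>w. (\<Sum>i<n. ?r i w)\<^sup>2 \<partial>M) = (\<Sum>i<n. \<integral>w. (?r i w)\<^sup>2 \<partial>M)"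
      using ro[where g="\<lambda>_. 1" and C=1 and k=n] by simp_all
    have ri: "integrable M (\<lambda>w. (?r i w)\<^sup>2)" for i
      by (rule resid_moments(3)[where \<kappa>=\<kappa> and \<zeta>="\<lambda>_. 0", OF B V \<kappa> \<delta>]) auto
    have "(\<integral>w. (\<Sum>i<n. g (Z (real i * \<delta>) w) * ?r i w)\<^sup>2 \<partial>M) = (\<Sum>i<n. \<integral>w. (g (Z (real i * \<delta>) w))\<^sup>2 * (?r i w)\<^sup>2 \<partial>M)"
      using rg by simp
    also have "\<dots> \<le> (\<Sum>i<n. \<integral>w. C\<^sup>2 * (?r i w)\<^sup>2 \<partial>M)"
    proof (rule sum_mono)
      fix i
      show "(\<integral>w. (g (Z (real i * \<delta>) w))\<^sup>2 * (?r i w)\<^sup>2 \<partial>M) \<le> (\<integral>w. C\<^sup>2 * (?r i w)\<^sup>2 \<partial>M)"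
      proof (rule integral_mono')
        show "integrable M (\<lambda>w. C\<^sup>2 * (?r i w)\<^sup>2)" using ri by auto
        show "(g (Z (real i * \<delta>) w))\<^sup>2 * (?r i w)\<^sup>2 \<le> C\<^sup>2 * (?r i w)\<^sup>2" for w
          using power_mono[OF g[of "Z (real i * \<delta>) w"] abs_ge_zero, of 2] by (intro mult_right_mono) auto
      qed auto
    qed
    also have "\<dots> = C\<^sup>2 * (\<integral>w. (\<Sum>i<n. ?r i w)\<^sup>2 \<partial>M)" using r1 by (simp add: sum_distrib_left)
    finally have le: "(\<integral>w. (\<Sum>i<n. g (Z (real i * \<delta>) w) * ?r i w)\<^sup>2 \<partial>M) \<le> C\<^sup>2 * (\<integral>w. (\<Sum>i<n. ?r i w)\<^sup>2 \<partial>M)" .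
    have one: "(\<integral>\<^sup>+w. ennreal ((\<Sum>i<n. ?r i w)\<^sup>2) \<partial>M) = (\<integral>\<^sup>+w. ennreal ((I T w - walk B \<delta> \<kappa> n w)\<^sup>2) \<partial>M)"
    proof (rule nn_integral_cong_AE)
      have "AE w in M. I 0 w = 0" using V by (simp add: brownian_motion_def)
      then show "AE w in M. ennreal ((\<Sum>i<n. ?r i w)\<^sup>2) = ennreal ((I T w - walk B \<delta> \<kappa> n w)\<^sup>2)"
      proof eventually_elim
        case (elim w)
        have "(\<Sum>i<n. ?r i w) = walk I \<delta> (\<lambda>_. 1) n w - walk B \<delta> \<kappa> n w"
          using walk_diff_resid[where \<kappa>=\<kappa> and g="\<lambda>_. 1" and k=n and w=w, OF B V \<kappa> \<delta>] by simp
        also have "walk I \<delta> (\<lambda>_. 1) n w = I T w"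
          using sum_lessThan_telescope[of "\<lambda>i. I (real i * \<delta>) w" n] elim n\<delta> by (simp add: walk_def)
        finally show ?case by simp
      qed
    qed
    have "(\<integral>\<^sup>+w. ennreal ((walk I \<delta> g n w - walk B \<delta> (\<lambda>z. g z * \<kappa> z) n w)\<^sup>2) \<partial>M)
       = ennreal (\<integral>w. (\<Sum>i<n. g (Z (real i * \<delta>) w) * ?r i w)\<^sup>2 \<partial>M)"
      unfolding walk_diff_resid[where \<kappa>=\<kappa>, OF B V \<kappa> \<delta>] using rg by (intro nn_integral_eq_integral) auto
    also have "\<dots> \<le> ennreal (C\<^sup>2 * (\<integral>w. (\<Sum>i<n. ?r i w)\<^sup>2 \<partial>M))" using le by (rule ennreal_leI)
    also have "\<dots> = ennreal (C\<^sup>2) * (\<integral>\<^sup>+w. ennreal ((\<Sum>i<n. ?r i w)\<^sup>2) \<partial>M)"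
      using r1 by (subst nn_integral_eq_integral) (auto simp: ennreal_mult')
    also have "\<dots> \<le> ennreal (C\<^sup>2) * ennreal (16 * \<eta>')"
      unfolding one using elim by (intro mult_left_mono) (auto simp: \<delta>_def n_def)
    also have "\<dots> = ennreal (C\<^sup>2 * (16 * \<eta>'))" using \<eta>' by (simp add: ennreal_mult')
    also have "\<dots> \<le> ennreal \<eta>"
    proof (rule ennreal_leI)
      have "C\<^sup>2 * (16 * \<eta>') \<le> (C\<^sup>2 + 1) * (16 * \<eta>')" using \<eta>' by (intro mult_right_mono) auto
      also have "\<dots> = \<eta>" using cpos by (simp add: \<eta>'_def field_simps)
      finally show "C\<^sup>2 * (16 * \<eta>') \<le> \<eta>" .
    qed
    finally show ?case by (simp add: \<delta>_def n_def)
  qed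
qed

lemma lipschitz_expectation_close:
  assumes lc: "lipschitz_convex \<phi> L" and U: "integrable M U" and U': "integrable M U'"
  shows "integrable M (\<lambda>w. \<phi> (U w))" and "\<bar>(\<integral>w. \<phi> (U w) \<partial>M) - (\<integral>w. \<phi> (U' w) \<partial>M)\<bar> \<le> L * (\<integral>w. \<bar>U w - U' w\<bar> \<partial>M)"
proof -
  interpret lipschitz_convex \<phi> L by (rule lc)
  have i: "integrable M (\<lambda>w. \<phi> (V w))" if V: "integrable M V" for V
  proof (rule Bochner_Integration.integrable_bound)
    show "integrable M (\<lambda>w. \<bar>\<phi> 0\<bar> + L * \<bar>V w\<bar>)" using V by auto
    have [measurable]: "V \<in> borel_measurable M" using V by auto
    show "(\<lambda>w. \<phi> (V w)) \<in> borel_measurable M" by measurable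
    show "AE w in M. norm (\<phi> (V w)) \<le> norm (\<bar>\<phi> 0\<bar> + L * \<bar>V w\<bar>)"
    proof (rule AE_I2)
      fix w show "norm (\<phi> (V w)) \<le> norm (\<bar>\<phi> 0\<bar> + L * \<bar>V w\<bar>)" using \<phi>_bound[of "V w"] by simp
    qed
  qed
  show "integrable M (\<lambda>w. \<phi> (U w))" by (rule i[OF U])
  have "\<bar>(\<integral>w. \<phi> (U w) \<partial>M) - (\<integral>w. \<phi> (U' w) \<partial>M)\<bar> = \<bar>\<integral>w. \<phi> (U w) - \<phi> (U' w) \<partial>M\<bar>"
    using i[OF U] i[OF U'] by simp
  also have "\<dots> \<le> (\<integral>w. \<bar>\<phi> (U w) - \<phi> (U' w)\<bar> \<partial>M)"
    using integral_norm_bound[of M "\<lambda>w. \<phi> (U w) - \<phi> (U' w)"] by simp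
  also have "\<dots> \<le> (\<integral>w. L * \<bar>U w - U' w\<bar> \<partial>M)"
    using i[OF U] i[OF U'] U U' lipschitz by (intro integral_mono) auto
  finally show "\<bar>(\<integral>w. \<phi> (U w) \<partial>M) - (\<integral>w. \<phi> (U' w) \<partial>M)\<bar> \<le> L * (\<integral>w. \<bar>U w - U' w\<bar> \<partial>M)" by simp
qed

lemma ito_measurable: "is_ito_integral M F W H I \<Longrightarrow> 0 \<le> t \<Longrightarrow> I t \<in> borel_measurable M"
  by (rule F_le_M[of t]) (auto simp: is_ito_integral_def adapted_def)

text \<open>All integrals are replaced by walks on one grid with finitely supported coefficients \<open>f\<close>, \<open>g\<close>. For the
  extremal integrators the walk is driven by \<open>B\<close> alone, with the coefficient \<open>f - g \<kappa>\<close> or \<open>f + g \<kappa>\<close>, whose modulus is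
  \<open>| |f| - |g| |\<close> or \<open>|f| + |g|\<close>; the discrete inequalities applied to it, with second coefficient 0, show
  that the bounds are attained. In \<open>L\<^sup>1\<close> each integral is off by \<open>4 \<surd>\<eta>\<close> and the sign
  replacement by \<open>\<surd>\<eta>\<close>, which makes \<open>8 + 9 = 17\<close>.\<close>

lemma lipschitz_comparison_error:
  assumes lc: "lipschitz_convex \<phi> L" and T: "0 < T" and B: "brownian_motion M F B" and V: "brownian_motion M F V"
    and \<kappa>: "\<And>z. (\<kappa> z)\<^sup>2 = 1" "\<And>z. \<kappa> z * (\<sigma>1 z * \<sigma>2 z) = \<bar>\<sigma>1 z * \<sigma>2 z\<bar>"
    and K: "is_ito_integral M F B (\<lambda>s w. \<kappa> (Z s w)) K"
    and I1: "is_ito_integral M F B (\<lambda>s w. \<sigma>1 (Z s w)) I1"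
    and I2: "is_ito_integral M F V (\<lambda>s w. \<sigma>2 (Z s w)) I2"
    and J: "is_ito_integral M F K (\<lambda>s w. \<sigma>2 (Z s w)) J"
    and J': "is_ito_integral M F (\<lambda>t w. - K t w) (\<lambda>s w. \<sigma>2 (Z s w)) J'"
    and \<eta>: "0 < \<eta>"
  shows "(\<integral>w. \<phi> (r0 + I1 T w - J T w) \<partial>M) \<le> (\<integral>w. \<phi> (r0 + I1 T w - I2 T w) \<partial>M) + L * (17 * sqrt \<eta>)"
    and "(\<integral>w. \<phi> (r0 + I1 T w - I2 T w) \<partial>M) \<le> (\<integral>w. \<phi> (r0 + I1 T w - J' T w) \<partial>M) + L * (17 * sqrt \<eta>)"
proof -
  interpret lipschitz_convex \<phi> L by (rule lc)
  have K': "brownian_motion M F K" by (rule sign_integral_brownian[OF B \<kappa>(1) K])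
  have K'': "brownian_motion M F (\<lambda>t w. - K t w)" by (rule brownian_minus[OF K'])
  have fin: "mean_int_square M (\<lambda>s w. \<sigma>1 (Z s w)) T < \<infinity>" "mean_int_square M (\<lambda>s w. \<sigma>2 (Z s w)) T < \<infinity>"
    using I1 I2 T by (auto simp: is_ito_integral_def)
  have "\<forall>\<^sub>F m in sequentially. mean_int_square M (\<lambda>s w. \<sigma>1 (Z s w) - \<sigma>1 (Z s w) * indicator (initial_states m) (Z s w)) T < ennreal \<eta>
    \<and> mean_int_square M (\<lambda>s w. \<sigma>2 (Z s w) - \<sigma>2 (Z s w) * indicator (initial_states m) (Z s w)) T < ennreal \<eta>"
    using order_tendstoD(2)[OF truncation_tendsto[OF fin(1)], of "ennreal \<eta>"] order_tendstoD(2)[OF truncation_tendsto[OF fin(2)], of "ennreal \<eta>"] \<eta>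
    by (intro eventually_conj) auto
  then obtain j where j: "mean_int_square M (\<lambda>s w. \<sigma>1 (Z s w) - \<sigma>1 (Z s w) * indicator (initial_states j) (Z s w)) T < ennreal \<eta>"
    "mean_int_square M (\<lambda>s w. \<sigma>2 (Z s w) - \<sigma>2 (Z s w) * indicator (initial_states j) (Z s w)) T < ennreal \<eta>"
    by (auto simp: eventually_sequentially)
  define S where "S = initial_states j"
  have S: "finite S" unfolding S_def by (rule finite_initial_states)
  define f where "f z = \<sigma>1 z * indicator S z" for z
  define g where "g z = \<sigma>2 z * indicator S z" for z
  obtain C1 where f: "\<And>z. \<bar>f z\<bar> \<le> C1" using finite_support_bounded[OF S, of f f] by (auto simp: f_def)
  obtain C2 where g: "\<And>z. \<bar>g z\<bar> \<le> C2" using finite_support_bounded[OF S, of g g] by (auto simp: g_def)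
  have cf: "mean_int_square M (\<lambda>s w. \<sigma>1 (Z s w) - f (Z s w)) T \<le> ennreal \<eta>" using j(1) by (simp add: f_def S_def)
  have cg: "mean_int_square M (\<lambda>s w. \<sigma>2 (Z s w) - g (Z s w)) T \<le> ennreal \<eta>" using j(2) by (simp add: g_def S_def)
  have "\<forall>\<^sub>F m in sequentially.
      (\<integral>\<^sup>+w. ennreal ((I1 T w - walk B (T / real (Suc m)) f (Suc m) w)\<^sup>2) \<partial>M) \<le> ennreal (16 * \<eta>)
    \<and> (\<integral>\<^sup>+w. ennreal ((I2 T w - walk V (T / real (Suc m)) g (Suc m) w)\<^sup>2) \<partial>M) \<le> ennreal (16 * \<eta>)
    \<and> (\<integral>\<^sup>+w. ennreal ((J T w - walk K (T / real (Suc m)) g (Suc m) w)\<^sup>2) \<partial>M) \<le> ennreal (16 * \<eta>)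
    \<and> (\<integral>\<^sup>+w. ennreal ((J' T w - walk (\<lambda>t w. - K t w) (T / real (Suc m)) g (Suc m) w)\<^sup>2) \<partial>M) \<le> ennreal (16 * \<eta>)
    \<and> (\<integral>\<^sup>+w. ennreal ((walk K (T / real (Suc m)) g (Suc m) w - walk B (T / real (Suc m)) (\<lambda>z. g z * \<kappa> z) (Suc m) w)\<^sup>2) \<partial>M) \<le> ennreal \<eta>"
    by (intro eventually_conj walk_approx[OF T B I1 f \<eta> cf] walk_approx[OF T V I2 g \<eta> cg] walk_approx[OF T K' J g \<eta> cg]
        walk_approx[OF T K'' J' g \<eta> cg] sign_walk_approx[OF T B \<kappa>(1) K g \<eta>])
  then obtain m where m: "(\<integral>\<^sup>+w. ennreal ((I1 T w - walk B (T / real (Suc m)) f (Suc m) w)\<^sup>2) \<partial>M) \<le> ennreal (16 * \<eta>)"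
    "(\<integral>\<^sup>+w. ennreal ((I2 T w - walk V (T / real (Suc m)) g (Suc m) w)\<^sup>2) \<partial>M) \<le> ennreal (16 * \<eta>)"
    "(\<integral>\<^sup>+w. ennreal ((J T w - walk K (T / real (Suc m)) g (Suc m) w)\<^sup>2) \<partial>M) \<le> ennreal (16 * \<eta>)"
    "(\<integral>\<^sup>+w. ennreal ((J' T w - walk (\<lambda>t w. - K t w) (T / real (Suc m)) g (Suc m) w)\<^sup>2) \<partial>M) \<le> ennreal (16 * \<eta>)"
    "(\<integral>\<^sup>+w. ennreal ((walk K (T / real (Suc m)) g (Suc m) w - walk B (T / real (Suc m)) (\<lambda>z. g z * \<kappa> z) (Suc m) w)\<^sup>2) \<partial>M) \<le> ennreal \<eta>"
    by (auto simp only: eventually_sequentially)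
  define n where "n = Suc m"
  define \<delta> where "\<delta> = T / real (Suc m)"
  have \<delta>: "0 < \<delta>" "0 \<le> \<delta>" using T by (auto simp: \<delta>_def)
  note m = m[folded \<delta>_def, folded n_def]
  define g\<kappa> where "g\<kappa> z = g z * \<kappa> z" for z
  have \<kappa>a: "\<bar>\<kappa> z\<bar> = 1" for z using \<kappa>(1)[of z] by (auto simp: power2_eq_1_iff)
  have g\<kappa>: "\<bar>g\<kappa> z\<bar> \<le> C2" for z using g[of z] \<kappa>a[of z] by (simp add: g\<kappa>_def abs_mult)
  define a1 where "a1 = walk B \<delta> f n"
  define a2 where "a2 = walk V \<delta> g n"
  define a3 where "a3 = walk K \<delta> g n"
  define a4 where "a4 = walk (\<lambda>t w. - K t w) \<delta> g n"
  define a5 where "a5 = walk B \<delta> g\<kappa> n"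
  have neg: "a4 w = - a3 w" for w by (simp add: a3_def a4_def walk_def sum_negf[symmetric] algebra_simps)
  have ai: "integrable M a1" "integrable M a2" "integrable M a3" "integrable M a4" "integrable M a5"
    unfolding a1_def a2_def a3_def a4_def a5_def
    by (intro walk_integrable[OF B \<delta>(2) f] walk_integrable[OF V \<delta>(2) g] walk_integrable[OF K' \<delta>(2) g]
        walk_integrable[OF K'' \<delta>(2) g] walk_integrable[OF B \<delta>(2) g\<kappa>])+
  have T0: "0 \<le> T" using T by simp
  have s16: "sqrt (16 * \<eta>) = 4 * sqrt \<eta>" by (simp add: real_sqrt_mult)
  have close: "integrable M (\<lambda>w. X w - Y w)" "(\<integral>w. \<bar>X w - Y w\<bar> \<partial>M) \<le> 4 * sqrt \<eta>" "integrable M X"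
    if le: "(\<integral>\<^sup>+w. ennreal ((X w - Y w)\<^sup>2) \<partial>M) \<le> ennreal (16 * \<eta>)" and X: "X \<in> borel_measurable M" and Y: "integrable M Y" for X Y
  proof -
    have meas: "(\<lambda>w. X w - Y w) \<in> borel_measurable M" using X Y by auto
    show i: "integrable M (\<lambda>w. X w - Y w)" using L1_from_L2(1)[OF meas le] \<eta> by simp
    show "(\<integral>w. \<bar>X w - Y w\<bar> \<partial>M) \<le> 4 * sqrt \<eta>" using L1_from_L2(2)[OF meas le] \<eta> unfolding s16 by simp
    have "integrable M (\<lambda>w. (X w - Y w) + Y w)" using i Y by (rule Bochner_Integration.integrable_add)
    then show "integrable M X" by simp
  qed
  note c1 = close[OF m(1)[folded a1_def] ito_measurable[OF I1 T0] ai(1)]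
  note c2 = close[OF m(2)[folded a2_def] ito_measurable[OF I2 T0] ai(2)]
  note c3 = close[OF m(3)[folded a3_def] ito_measurable[OF J T0] ai(3)]
  note c4 = close[OF m(4)[folded a4_def] ito_measurable[OF J' T0] ai(4)]
  have c5: "(\<integral>w. \<bar>a3 w - a5 w\<bar> \<partial>M) \<le> sqrt \<eta>"
  proof (rule L1_from_L2(2))
    show "(\<lambda>w. a3 w - a5 w) \<in> borel_measurable M" using ai by auto
    show "(\<integral>\<^sup>+w. ennreal ((a3 w - a5 w)\<^sup>2) \<partial>M) \<le> ennreal \<eta>" using m(5) by (simp add: a3_def a5_def g\<kappa>_def[abs_def])
  qed (use \<eta> in simp)
  have dV: "\<bar>(\<integral>w. \<phi> (r0 + I1 T w - I2 T w) \<partial>M) - (\<integral>w. \<phi> (r0 + a1 w - a2 w) \<partial>M)\<bar> \<le> L * (8 * sqrt \<eta>)"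
  proof -
    have "\<bar>(\<integral>w. \<phi> (r0 + I1 T w - I2 T w) \<partial>M) - (\<integral>w. \<phi> (r0 + a1 w - a2 w) \<partial>M)\<bar>
       \<le> L * (\<integral>w. \<bar>(r0 + I1 T w - I2 T w) - (r0 + a1 w - a2 w)\<bar> \<partial>M)"
      using c1 c2 ai by (intro lipschitz_expectation_close[OF lc]) auto
    also have "(\<integral>w. \<bar>(r0 + I1 T w - I2 T w) - (r0 + a1 w - a2 w)\<bar> \<partial>M) \<le> (\<integral>w. \<bar>I1 T w - a1 w\<bar> + \<bar>I2 T w - a2 w\<bar> \<partial>M)"
      using c1 c2 ai by (intro integral_mono) auto
    also have "\<dots> \<le> 8 * sqrt \<eta>" using c1 c2 by simp
    finally show ?thesis using L_nonneg by (simp add: mult_left_mono)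
  qed
  have dJ: "\<bar>(\<integral>w. \<phi> (r0 + I1 T w - J T w) \<partial>M) - (\<integral>w. \<phi> (r0 + a1 w - a5 w) \<partial>M)\<bar> \<le> L * (9 * sqrt \<eta>)"
  proof -
    have "\<bar>(\<integral>w. \<phi> (r0 + I1 T w - J T w) \<partial>M) - (\<integral>w. \<phi> (r0 + a1 w - a5 w) \<partial>M)\<bar>
       \<le> L * (\<integral>w. \<bar>(r0 + I1 T w - J T w) - (r0 + a1 w - a5 w)\<bar> \<partial>M)"
      using c1 c3 ai by (intro lipschitz_expectation_close[OF lc]) auto
    also have "(\<integral>w. \<bar>(r0 + I1 T w - J T w) - (r0 + a1 w - a5 w)\<bar> \<partial>M) \<le> (\<integral>w. \<bar>I1 T w - a1 w\<bar> + \<bar>J T w - a3 w\<bar> + \<bar>a3 w - a5 w\<bar> \<partial>M)"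
      using c1 c3 ai by (intro integral_mono) auto
    also have "\<dots> = (\<integral>w. \<bar>I1 T w - a1 w\<bar> \<partial>M) + (\<integral>w. \<bar>J T w - a3 w\<bar> \<partial>M) + (\<integral>w. \<bar>a3 w - a5 w\<bar> \<partial>M)"
      using c1 c3 ai by simp
    also have "\<dots> \<le> 9 * sqrt \<eta>" using c1 c3 c5 by simp
    finally show ?thesis using L_nonneg by (simp add: mult_left_mono)
  qed
  have dJ': "\<bar>(\<integral>w. \<phi> (r0 + I1 T w - J' T w) \<partial>M) - (\<integral>w. \<phi> (r0 + a1 w + a5 w) \<partial>M)\<bar> \<le> L * (9 * sqrt \<eta>)"
  proof -
    have "\<bar>(\<integral>w. \<phi> (r0 + I1 T w - J' T w) \<partial>M) - (\<integral>w. \<phi> (r0 + a1 w + a5 w) \<partial>M)\<bar>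
       \<le> L * (\<integral>w. \<bar>(r0 + I1 T w - J' T w) - (r0 + a1 w + a5 w)\<bar> \<partial>M)"
      using c1 c4 ai by (intro lipschitz_expectation_close[OF lc]) auto
    also have "(\<integral>w. \<bar>(r0 + I1 T w - J' T w) - (r0 + a1 w + a5 w)\<bar> \<partial>M) \<le> (\<integral>w. \<bar>I1 T w - a1 w\<bar> + \<bar>J' T w - a4 w\<bar> + \<bar>a3 w - a5 w\<bar> \<partial>M)"
      using c1 c4 ai neg by (intro integral_mono) auto
    also have "\<dots> = (\<integral>w. \<bar>I1 T w - a1 w\<bar> \<partial>M) + (\<integral>w. \<bar>J' T w - a4 w\<bar> \<partial>M) + (\<integral>w. \<bar>a3 w - a5 w\<bar> \<partial>M)"
      using c1 c4 ai by simp
    also have "\<dots> \<le> 9 * sqrt \<eta>" using c1 c4 c5 by simp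
    finally show ?thesis using L_nonneg by (simp add: mult_left_mono)
  qed
  have off: "z \<notin> S \<Longrightarrow> f z = 0" "z \<notin> S \<Longrightarrow> g z = 0" "z \<notin> S \<Longrightarrow> f z - g\<kappa> z = 0" "z \<notin> S \<Longrightarrow> f z + g\<kappa> z = 0" "z \<notin> S \<Longrightarrow> (0::real) = 0" for z
    by (auto simp: f_def g_def g\<kappa>_def)
  have sgn: "\<kappa> z * (f z * g z) = \<bar>f z\<bar> * \<bar>g z\<bar>" for z
    using \<kappa>(2)[of z] by (simp add: f_def g_def abs_mult split: split_indicator)
  have gsq: "(g\<kappa> z)\<^sup>2 = (g z)\<^sup>2" for z by (simp add: g\<kappa>_def power_mult_distrib \<kappa>)
  have fgk: "f z * g\<kappa> z = \<bar>f z\<bar> * \<bar>g z\<bar>" for z using sgn[of z] by (simp add: g\<kappa>_def mult_ac)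
  have sq_minus: "(\<bar>f z - g\<kappa> z\<bar> + \<bar>0\<bar>)\<^sup>2 = (\<bar>f z\<bar> - \<bar>g z\<bar>)\<^sup>2" for z
  proof -
    have "(\<bar>f z - g\<kappa> z\<bar> + \<bar>0\<bar>)\<^sup>2 = (f z)\<^sup>2 + (g\<kappa> z)\<^sup>2 - 2 * (f z * g\<kappa> z)" by (simp add: power2_diff)
    also have "\<dots> = (\<bar>f z\<bar> - \<bar>g z\<bar>)\<^sup>2" by (simp add: power2_diff gsq fgk)
    finally show ?thesis .
  qed
  have sq_plus: "(\<bar>f z + g\<kappa> z\<bar> - \<bar>0\<bar>)\<^sup>2 = (\<bar>f z\<bar> + \<bar>g z\<bar>)\<^sup>2" for z
  proof -
    have "(\<bar>f z + g\<kappa> z\<bar> - \<bar>0\<bar>)\<^sup>2 = (f z)\<^sup>2 + (g\<kappa> z)\<^sup>2 + 2 * (f z * g\<kappa> z)" by (simp add: power2_sum)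
    also have "\<dots> = (\<bar>f z\<bar> + \<bar>g z\<bar>)\<^sup>2" by (simp add: power2_sum gsq fgk)
    finally show ?thesis .
  qed
  have wm: "walk B \<delta> (\<lambda>z. f z - g\<kappa> z) n w = a1 w - a5 w" "walk B \<delta> (\<lambda>z. f z + g\<kappa> z) n w = a1 w + a5 w" "walk V \<delta> (\<lambda>_. 0) n w = 0" for w
    by (simp_all add: a1_def a5_def walk_def sum_subtractf[symmetric] sum.distrib[symmetric] left_diff_distrib distrib_right)
  have "(\<integral>w. \<phi> (r0 + a1 w - a5 w) \<partial>M) \<le> (\<integral>w. smooth (remaining_variance \<delta> n (\<lambda>z. (\<bar>f z\<bar> - \<bar>g z\<bar>)\<^sup>2) 0 w) r0 \<partial>M)"
    using discrete_upper[where f="\<lambda>z. f z - g\<kappa> z" and g="\<lambda>_. 0" and ?r0.0=r0 and n=n, OF lc B V S off(3) off(5) \<delta>(1)] by (simp add: wm sq_minus[simplified] add_diff_eq)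
  also have "\<dots> \<le> (\<integral>w. \<phi> (r0 + a1 w - a2 w) \<partial>M)"
    using discrete_lower[where f=f and g=g and ?r0.0=r0 and n=n, OF lc B V S off(1,2) \<delta>(1)] by (simp add: a1_def a2_def)
  finally show "(\<integral>w. \<phi> (r0 + I1 T w - J T w) \<partial>M) \<le> (\<integral>w. \<phi> (r0 + I1 T w - I2 T w) \<partial>M) + L * (17 * sqrt \<eta>)"
    using dV dJ by (simp add: distrib_left abs_le_iff)
  have "(\<integral>w. \<phi> (r0 + a1 w - a2 w) \<partial>M) \<le> (\<integral>w. smooth (remaining_variance \<delta> n (\<lambda>z. (\<bar>f z\<bar> + \<bar>g z\<bar>)\<^sup>2) 0 w) r0 \<partial>M)"
    using discrete_upper[where f=f and g=g and ?r0.0=r0 and n=n, OF lc B V S off(1,2) \<delta>(1)] by (simp add: a1_def a2_def)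
  also have "\<dots> \<le> (\<integral>w. \<phi> (r0 + a1 w + a5 w) \<partial>M)"
    using discrete_lower[where f="\<lambda>z. f z + g\<kappa> z" and g="\<lambda>_. 0" and ?r0.0=r0 and n=n, OF lc B V S off(4) off(5) \<delta>(1)] by (simp add: wm sq_plus[simplified] add.assoc)
  finally show "(\<integral>w. \<phi> (r0 + I1 T w - I2 T w) \<partial>M) \<le> (\<integral>w. \<phi> (r0 + I1 T w - J' T w) \<partial>M) + L * (17 * sqrt \<eta>)"
    using dV dJ' by (simp add: distrib_left abs_le_iff)
qed

lemma lipschitz_comparison:
  assumes lc: "lipschitz_convex \<phi> L" and T: "0 < T" and B: "brownian_motion M F B" and V: "brownian_motion M F V"
    and \<kappa>: "\<And>z. (\<kappa> z)\<^sup>2 = 1" "\<And>z. \<kappa> z * (\<sigma>1 z * \<sigma>2 z) = \<bar>\<sigma>1 z * \<sigma>2 z\<bar>"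
    and K: "is_ito_integral M F B (\<lambda>s w. \<kappa> (Z s w)) K"
    and I1: "is_ito_integral M F B (\<lambda>s w. \<sigma>1 (Z s w)) I1"
    and I2: "is_ito_integral M F V (\<lambda>s w. \<sigma>2 (Z s w)) I2"
    and J: "is_ito_integral M F K (\<lambda>s w. \<sigma>2 (Z s w)) J"
    and J': "is_ito_integral M F (\<lambda>t w. - K t w) (\<lambda>s w. \<sigma>2 (Z s w)) J'"
  shows "(\<integral>w. \<phi> (r0 + I1 T w - J T w) \<partial>M) \<le> (\<integral>w. \<phi> (r0 + I1 T w - I2 T w) \<partial>M)"
    and "(\<integral>w. \<phi> (r0 + I1 T w - I2 T w) \<partial>M) \<le> (\<integral>w. \<phi> (r0 + I1 T w - J' T w) \<partial>M)"
proof -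
  interpret lipschitz_convex \<phi> L by (rule lc)
  have le: "x \<le> y" if "\<And>\<eta>. 0 < \<eta> \<Longrightarrow> x \<le> y + L * (17 * sqrt \<eta>)" for x y
  proof (rule field_le_epsilon)
    fix e :: real assume e: "0 < e"
    \<comment> \<open>the error term at \<open>\<eta> = k\<^sup>2\<close> is at most \<open>e\<close>, also for \<open>L = 0\<close>\<close>
    define k where "k = e / (17 * (L + 1))"
    have k: "0 < k" using e L_nonneg by (simp add: k_def)
    have "x \<le> y + L * (17 * sqrt (k\<^sup>2))" using k by (intro that) simp
    also have "L * (17 * sqrt (k\<^sup>2)) \<le> (L + 1) * (17 * k)" using k by (intro mult_mono) (use L_nonneg in auto)
    also have "(L + 1) * (17 * k) = e" using L_nonneg by (simp add: k_def field_simps)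
    finally show "x \<le> y + e" by simp
  qed
  show "(\<integral>w. \<phi> (r0 + I1 T w - J T w) \<partial>M) \<le> (\<integral>w. \<phi> (r0 + I1 T w - I2 T w) \<partial>M)"
    by (rule le, rule lipschitz_comparison_error(1)[OF assms])
  show "(\<integral>w. \<phi> (r0 + I1 T w - I2 T w) \<partial>M) \<le> (\<integral>w. \<phi> (r0 + I1 T w - J' T w) \<partial>M)"
    by (rule le, rule lipschitz_comparison_error(2)[OF assms])
qed

end

section \<open>Moments\<close>

lemma abs_powr_split:
  fixes x p :: real
  assumes "x \<noteq> 0"
  shows "\<bar>x\<bar> powr p = \<bar>x\<bar> powr (p - 2) * x\<^sup>2"
proof -
  have "\<bar>x\<bar> powr 2 = x\<^sup>2" using assms by (simp add: powr_numeral)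
  moreover have "\<bar>x\<bar> powr (p - 2) * \<bar>x\<bar> powr 2 = \<bar>x\<bar> powr p" by (simp only: powr_add[symmetric]) simp
  ultimately show ?thesis by simp
qed

text \<open>A second-order Taylor bound without derivatives: averaging over \<open>\<plusminus>u\<close> removes the first-order term. For
  \<open>|u| < |s|\<close> divide by \<open>|s|\<^sup>p\<close> and use \<open>(1 + t)\<^sup>p \<le> exp (p t)\<close> and \<open>cosh y \<le> exp (y\<^sup>2)\<close>; otherwise \<open>|u|\<^sup>p\<close>
  dominates.\<close>

lemma powr_symmetric_bound:
  fixes s u p :: real
  assumes p: "2 \<le> p"
  shows "(\<bar>s + u\<bar> powr p + \<bar>s - u\<bar> powr p) / 2
    \<le> \<bar>s\<bar> powr p + (exp (p\<^sup>2) + 2 powr p) * (\<bar>s\<bar> powr (p - 2) * u\<^sup>2 + \<bar>u\<bar> powr p)"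
proof -
  define A where "A = exp (p\<^sup>2) + 2 powr p"
  have A: "exp (p\<^sup>2) \<le> A" "2 powr p \<le> A" "0 \<le> A" by (auto simp: A_def)
  show ?thesis
  proof (cases "\<bar>u\<bar> < \<bar>s\<bar>")
    case False
    have "\<bar>s + u\<bar> powr p \<le> (2 * \<bar>u\<bar>) powr p" "\<bar>s - u\<bar> powr p \<le> (2 * \<bar>u\<bar>) powr p"
      using False p by (auto intro!: powr_mono2)
    then have "(\<bar>s + u\<bar> powr p + \<bar>s - u\<bar> powr p) / 2 \<le> 2 powr p * \<bar>u\<bar> powr p" by (simp add: powr_mult)
    also have "\<dots> \<le> A * \<bar>u\<bar> powr p" using A by (intro mult_right_mono) auto
    also have "\<dots> \<le> \<bar>s\<bar> powr p + A * (\<bar>s\<bar> powr (p - 2) * u\<^sup>2 + \<bar>u\<bar> powr p)"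
      using A by (simp add: distrib_left)
    finally show ?thesis by (simp add: A_def)
  next
    case True
    then have s: "0 < \<bar>s\<bar>" by simp
    define t where "t = u / s"
    have t: "\<bar>t\<bar> < 1" using True s by (simp add: t_def abs_divide)
    have u: "u = s * t" using s by (simp add: t_def)
    have pw: "(1 + x) powr p \<le> exp (p * x)" if "\<bar>x\<bar> < 1" for x :: real
    proof -
      have "(1 + x) powr p = exp (p * ln (1 + x))" using that by (simp add: powr_def)
      also have "\<dots> \<le> exp (p * x)" using that p ln_add_one_self_le_self2[of x] by (simp add: mult_left_mono)
      finally show ?thesis .
    qed
    have ch: "(exp y + exp (- y)) / 2 \<le> exp (y\<^sup>2)" for y :: real
    proof -
      have e: "exp x \<le> x + exp (x\<^sup>2)" for x :: real
      proof (cases "\<bar>x\<bar> \<le> 1")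
        case True
        then have "exp x \<le> 1 + x + x\<^sup>2" 
        proof (cases "0 \<le> x")
          case True2: True
          then show ?thesis using exp_bound[of x] True by simp
        next
          case False
          define z where "z = - x"
          have z: "0 \<le> z" "z \<le> 1" using False True by (auto simp: z_def)
          have "exp (- z) \<le> 1 / (1 + z)" using exp_ge_add_one_self[of z] z by (simp add: exp_minus field_simps)
          also have "\<dots> \<le> 1 - z + z\<^sup>2"
          proof -
            have "1 \<le> (1 - z + z\<^sup>2) * (1 + z)" using z by (simp add: power2_eq_square algebra_simps)
            then show ?thesis using z by (simp add: pos_divide_le_eq)
          qed
          finally show ?thesis by (simp add: z_def)
        qed
        also have "\<dots> \<le> x + exp (x\<^sup>2)" using exp_ge_add_one_self[of "x\<^sup>2"] by simp
        finally show ?thesis .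
      next
        case False
        show ?thesis
        proof (cases "0 \<le> x")
          case True
          then have "x \<le> x\<^sup>2" using False by (simp add: power2_eq_square mult_le_cancel_right1)
          then have "exp x \<le> exp (x\<^sup>2)" by simp
          then show ?thesis using True by linarith
        next
          case F2: False
          have "exp x \<le> 1" using F2 by simp
          moreover have "1 - x \<le> exp (x\<^sup>2)"
          proof -
            have "(- x) * 1 \<le> (- x) * (- x)" using F2 False by (intro mult_left_mono) auto
            then have "- x \<le> x\<^sup>2" by (simp add: power2_eq_square)
            then show ?thesis using exp_ge_add_one_self[of "x\<^sup>2"] by linarith
          qed
          ultimately show ?thesis by linarith
        qed
      qed
      from e[of y] e[of "- y"] show ?thesis by simp
    qed
    have "((1 + t) powr p + (1 - t) powr p) / 2 \<le> (exp (p * t) + exp (- (p * t))) / 2"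
      using pw[of t] pw[of "- t"] t by simp
    also have "\<dots> \<le> exp ((p * t)\<^sup>2)" by (rule ch)
    also have "\<dots> \<le> 1 + t\<^sup>2 * exp (p\<^sup>2)"
    proof -
      have t2: "0 \<le> t\<^sup>2" "t\<^sup>2 \<le> 1" using t by (auto simp: abs_square_le_1)
      have "exp ((1 - t\<^sup>2) *\<^sub>R 0 + t\<^sup>2 *\<^sub>R (p\<^sup>2)) \<le> (1 - t\<^sup>2) * exp 0 + t\<^sup>2 * exp (p\<^sup>2)"
        using t2 by (intro convex_onD[OF exp_convex]) auto
      then have "exp ((p * t)\<^sup>2) \<le> (1 - t\<^sup>2) + t\<^sup>2 * exp (p\<^sup>2)" by (simp add: power_mult_distrib mult.commute)
      then show ?thesis using t2 by linarith
    qed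
    finally have key: "((1 + t) powr p + (1 - t) powr p) / 2 \<le> 1 + t\<^sup>2 * exp (p\<^sup>2)" .
    have sp: "\<bar>s\<bar> powr p = \<bar>s\<bar> powr (p - 2) * s\<^sup>2" using s by (intro abs_powr_split) simp
    have "\<bar>s + u\<bar> = \<bar>s\<bar> * (1 + t)" "\<bar>s - u\<bar> = \<bar>s\<bar> * (1 - t)"
    proof -
      have "s + u = s * (1 + t)" "s - u = s * (1 - t)" unfolding u by (simp_all add: algebra_simps)
      then show "\<bar>s + u\<bar> = \<bar>s\<bar> * (1 + t)" "\<bar>s - u\<bar> = \<bar>s\<bar> * (1 - t)" using t by (simp_all add: abs_mult)
    qed
    then have "\<bar>s + u\<bar> powr p = \<bar>s\<bar> powr p * (1 + t) powr p" "\<bar>s - u\<bar> powr p = \<bar>s\<bar> powr p * (1 - t) powr p"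
      using t by (simp_all only: powr_mult)
    then have "(\<bar>s + u\<bar> powr p + \<bar>s - u\<bar> powr p) / 2 = \<bar>s\<bar> powr p * (((1 + t) powr p + (1 - t) powr p) / 2)"
      by (simp add: distrib_left add_divide_distrib)
    also have "\<dots> \<le> \<bar>s\<bar> powr p * (1 + t\<^sup>2 * exp (p\<^sup>2))" using key by (intro mult_left_mono) auto
    also have "\<dots> = \<bar>s\<bar> powr p + exp (p\<^sup>2) * (\<bar>s\<bar> powr (p - 2) * u\<^sup>2)"
      unfolding sp u by (simp add: algebra_simps power_mult_distrib)
    also have "\<dots> \<le> \<bar>s\<bar> powr p + A * (\<bar>s\<bar> powr (p - 2) * u\<^sup>2 + \<bar>u\<bar> powr p)"
      using A by (intro add_left_mono mult_mono) auto
    finally show ?thesis by (simp add: A_def)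
  qed
qed

lemma powr_mixed_le:
  fixes s h p :: real
  assumes "2 \<le> p"
  shows "\<bar>s\<bar> powr (p - 2) * h\<^sup>2 \<le> \<bar>s\<bar> powr p + \<bar>h\<bar> powr p"
proof -
  have eq: "\<bar>x\<bar> powr (p - 2) * x\<^sup>2 = \<bar>x\<bar> powr p" for x :: real
    by (cases "x = 0") (simp_all add: abs_powr_split[of x p])
  show ?thesis
  proof (cases "\<bar>h\<bar> \<le> \<bar>s\<bar>")
    case True
    then have "\<bar>s\<bar> powr (p - 2) * h\<^sup>2 \<le> \<bar>s\<bar> powr (p - 2) * s\<^sup>2" by (intro mult_left_mono) (auto simp: abs_le_square_iff)
    then show ?thesis unfolding eq by (simp add: add_increasing add_increasing2)
  next
    case False
    then have "\<bar>s\<bar> powr (p - 2) * h\<^sup>2 \<le> \<bar>h\<bar> powr (p - 2) * h\<^sup>2" using assms by (intro mult_right_mono powr_mono2) auto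
    then show ?thesis unfolding eq by (simp add: add_increasing add_increasing2)
  qed
qed

definition gauss_moment :: "real \<Rightarrow> real" where
  "gauss_moment p = enn2real (\<integral>\<^sup>+x. ennreal (\<bar>x\<bar> powr p) \<partial>gauss 1)"

lemma gauss_moment:
  assumes "0 \<le> p"
  shows "(\<integral>\<^sup>+x. ennreal (\<bar>x\<bar> powr p) \<partial>gauss 1) = ennreal (gauss_moment p)"
proof -
  interpret g: prob_space "gauss 1" by (rule prob_space_gauss)
  obtain k :: nat where k: "p \<le> real k" using real_arch_simple by blast
  have "\<bar>x\<bar> powr p \<le> 1 + x ^ (2 * k)" for x :: real
  proof (cases "\<bar>x\<bar> \<le> 1")
    case True
    then have "\<bar>x\<bar> powr p \<le> 1" using powr_mono2[of p "\<bar>x\<bar>" 1] assms by simp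
    then show ?thesis by (simp add: add_increasing2)
  next
    case False
    then have "\<bar>x\<bar> powr p \<le> \<bar>x\<bar> powr real (2 * k)" using k by (intro powr_mono) auto
    also have "\<dots> = x ^ (2 * k)" using False by (subst powr_realpow) (auto simp: power_even_abs)
    finally show ?thesis by simp
  qed
  then have "(\<integral>\<^sup>+x. ennreal (\<bar>x\<bar> powr p) \<partial>gauss 1) \<le> (\<integral>\<^sup>+x. ennreal (1 + x ^ (2 * k)) \<partial>gauss 1)"
    by (intro nn_integral_mono ennreal_leI)
  also have "\<dots> = ennreal (\<integral>x. 1 + x ^ (2 * k) \<partial>gauss 1)"
    using integrable_gauss_power[of 1 "2 * k"] by (intro nn_integral_eq_integral) auto
  also have "\<dots> < \<infinity>" by simp
  finally show ?thesis unfolding gauss_moment_def by (simp add: less_top)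
qed

lemma gauss_moment_scale:
  assumes p: "2 \<le> p" and \<delta>: "0 \<le> \<delta>" "\<delta> \<le> 1"
  shows "(\<integral>\<^sup>+x. ennreal (\<bar>x\<bar> powr p) \<partial>gauss \<delta>) \<le> ennreal (\<delta> * gauss_moment p)"
proof -
  have "(\<integral>\<^sup>+x. ennreal (\<bar>x\<bar> powr p) \<partial>gauss \<delta>) = (\<integral>\<^sup>+x. ennreal (\<bar>x\<bar> powr p) \<partial>distr (gauss 1) borel (\<lambda>x. sqrt \<delta> * x))"
    using gauss_scale[of 1 "sqrt \<delta>"] \<delta> by simp
  also have "\<dots> = (\<integral>\<^sup>+x. ennreal (sqrt \<delta> powr p) * ennreal (\<bar>x\<bar> powr p) \<partial>gauss 1)"
    using \<delta> by (subst nn_integral_distr) (auto simp: abs_mult powr_mult ennreal_mult')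
  also have "\<dots> = ennreal (sqrt \<delta> powr p) * ennreal (gauss_moment p)"
    using p by (subst nn_integral_cmult) (auto simp: gauss_moment)
  also have "\<dots> \<le> ennreal \<delta> * ennreal (gauss_moment p)"
  proof (intro mult_right_mono ennreal_leI)
    show "sqrt \<delta> powr p \<le> \<delta>"
    proof (cases "\<delta> = 0")
      case False
      have "sqrt \<delta> powr p \<le> sqrt \<delta> powr 2" using p \<delta> False by (intro powr_mono') (auto simp: real_sqrt_le_1_iff)
      also have "\<dots> = \<delta>" using \<delta> False by (simp add: powr_numeral)
      finally show ?thesis .
    qed simp
  qed simp
  also have "\<dots> = ennreal (\<delta> * gauss_moment p)" using \<delta> by (simp add: ennreal_mult')
  finally show ?thesis .
qed

text \<open>One step of a discrete Gronwall argument. The bounds \<open>\<delta> \<le> 1\<close> and \<open>p \<ge> 2\<close> make the \<open>p\<close>-th moment of the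
  increment of order \<open>\<delta>\<close>.\<close>

lemma gauss_power_step:
  assumes p: "2 \<le> p" and \<delta>: "0 \<le> \<delta>" "\<delta> \<le> 1"
  defines "A \<equiv> exp (p\<^sup>2) + 2 powr p"
  shows "(\<integral>\<^sup>+x. ennreal (\<bar>s + h * x\<bar> powr p) \<partial>gauss \<delta>)
    \<le> ennreal (1 + A * \<delta>) * ennreal (\<bar>s\<bar> powr p) + ennreal (A * (1 + gauss_moment p) * \<delta>) * ennreal (\<bar>h\<bar> powr p)"
proof -
  interpret g: prob_space "gauss \<delta>" by (rule prob_space_gauss)
  have A0: "0 \<le> A" by (simp add: A_def)
  have gm: "0 \<le> gauss_moment p" by (simp add: gauss_moment_def)
  have sym: "(\<integral>\<^sup>+x. ennreal (\<bar>s - h * x\<bar> powr p) \<partial>gauss \<delta>) = (\<integral>\<^sup>+x. ennreal (\<bar>s + h * x\<bar> powr p) \<partial>gauss \<delta>)"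
  proof -
    have "gauss \<delta> = distr (gauss \<delta>) borel (\<lambda>x. - 1 * x)" using gauss_scale[OF \<delta>(1), of "- 1"] by simp
    then have "(\<integral>\<^sup>+x. ennreal (\<bar>s + h * x\<bar> powr p) \<partial>gauss \<delta>) = (\<integral>\<^sup>+x. ennreal (\<bar>s + h * x\<bar> powr p) \<partial>distr (gauss \<delta>) borel (\<lambda>x. - 1 * x))" by simp
    also have "\<dots> = (\<integral>\<^sup>+x. ennreal (\<bar>s - h * x\<bar> powr p) \<partial>gauss \<delta>)" by (subst nn_integral_distr) auto
    finally show ?thesis by simp
  qed
  let ?X = "\<integral>\<^sup>+x. ennreal (\<bar>s + h * x\<bar> powr p) \<partial>gauss \<delta>"
  have "2 * ?X = ?X + (\<integral>\<^sup>+x. ennreal (\<bar>s - h * x\<bar> powr p) \<partial>gauss \<delta>)" unfolding sym by (simp add: mult_2)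
  also have "\<dots> = (\<integral>\<^sup>+x. ennreal (\<bar>s + h * x\<bar> powr p + \<bar>s - h * x\<bar> powr p) \<partial>gauss \<delta>)"
    by (subst nn_integral_add[symmetric]) auto
  also have "\<dots> \<le> (\<integral>\<^sup>+x. 2 * (ennreal (\<bar>s\<bar> powr p) + ennreal (A * (\<bar>s\<bar> powr p + \<bar>h\<bar> powr p)) * ennreal (x\<^sup>2) + ennreal (A * \<bar>h\<bar> powr p) * ennreal (\<bar>x\<bar> powr p)) \<partial>gauss \<delta>)"
  proof (rule nn_integral_mono)
    fix x
    have arith: "l \<le> 2 * (q + c + d)" if "l / 2 \<le> q + y" "y \<le> y'" "y' = c + d" for l q y y' c d :: real
      using that by simp
    have "(\<bar>s + h * x\<bar> powr p + \<bar>s - h * x\<bar> powr p) / 2 \<le> \<bar>s\<bar> powr p + A * (\<bar>s\<bar> powr (p - 2) * (h * x)\<^sup>2 + \<bar>h * x\<bar> powr p)"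
      unfolding A_def by (rule powr_symmetric_bound[OF p])
    moreover have "\<bar>s\<bar> powr (p - 2) * (h * x)\<^sup>2 \<le> (\<bar>s\<bar> powr p + \<bar>h\<bar> powr p) * x\<^sup>2"
      using mult_right_mono[OF powr_mixed_le[OF p, of s h], of "x\<^sup>2"] by (simp add: power_mult_distrib mult.assoc)
    then have "A * (\<bar>s\<bar> powr (p - 2) * (h * x)\<^sup>2 + \<bar>h * x\<bar> powr p)
      \<le> A * ((\<bar>s\<bar> powr p + \<bar>h\<bar> powr p) * x\<^sup>2 + \<bar>h\<bar> powr p * \<bar>x\<bar> powr p)"
      using A0 by (intro mult_left_mono add_mono) (auto simp: abs_mult powr_mult)
    moreover have "A * ((\<bar>s\<bar> powr p + \<bar>h\<bar> powr p) * x\<^sup>2 + \<bar>h\<bar> powr p * \<bar>x\<bar> powr p)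
      = (A * (\<bar>s\<bar> powr p + \<bar>h\<bar> powr p)) * x\<^sup>2 + (A * \<bar>h\<bar> powr p) * \<bar>x\<bar> powr p" by (simp add: distrib_left mult.assoc)
    ultimately have "\<bar>s + h * x\<bar> powr p + \<bar>s - h * x\<bar> powr p
      \<le> 2 * (\<bar>s\<bar> powr p + (A * (\<bar>s\<bar> powr p + \<bar>h\<bar> powr p)) * x\<^sup>2 + (A * \<bar>h\<bar> powr p) * \<bar>x\<bar> powr p)"
      by (rule arith)
    then have "ennreal (\<bar>s + h * x\<bar> powr p + \<bar>s - h * x\<bar> powr p)
      \<le> ennreal (2 * (\<bar>s\<bar> powr p + (A * (\<bar>s\<bar> powr p + \<bar>h\<bar> powr p)) * x\<^sup>2 + (A * \<bar>h\<bar> powr p) * \<bar>x\<bar> powr p))"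
      by (rule ennreal_leI)
    also have "\<dots> = 2 * (ennreal (\<bar>s\<bar> powr p) + ennreal (A * (\<bar>s\<bar> powr p + \<bar>h\<bar> powr p)) * ennreal (x\<^sup>2) + ennreal (A * \<bar>h\<bar> powr p) * ennreal (\<bar>x\<bar> powr p))"
      using A0 by (simp add: ennreal_mult)
    finally show "ennreal (\<bar>s + h * x\<bar> powr p + \<bar>s - h * x\<bar> powr p)
      \<le> 2 * (ennreal (\<bar>s\<bar> powr p) + ennreal (A * (\<bar>s\<bar> powr p + \<bar>h\<bar> powr p)) * ennreal (x\<^sup>2) + ennreal (A * \<bar>h\<bar> powr p) * ennreal (\<bar>x\<bar> powr p))" .
  qed
  also have "\<dots> = 2 * (ennreal (\<bar>s\<bar> powr p) + ennreal (A * (\<bar>s\<bar> powr p + \<bar>h\<bar> powr p)) * (\<integral>\<^sup>+x. ennreal (x\<^sup>2) \<partial>gauss \<delta>)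
      + ennreal (A * \<bar>h\<bar> powr p) * (\<integral>\<^sup>+x. ennreal (\<bar>x\<bar> powr p) \<partial>gauss \<delta>))"
    by (simp add: nn_integral_add nn_integral_cmult g.emeasure_space_1[simplified])
  also have "(\<integral>\<^sup>+x. ennreal (x\<^sup>2) \<partial>gauss \<delta>) = ennreal \<delta>"
    using integrable_gauss_power[of \<delta> 2] gauss_variance[OF \<delta>(1)] by (subst nn_integral_eq_integral) auto
  also have "2 * (ennreal (\<bar>s\<bar> powr p) + ennreal (A * (\<bar>s\<bar> powr p + \<bar>h\<bar> powr p)) * ennreal \<delta>
      + ennreal (A * \<bar>h\<bar> powr p) * (\<integral>\<^sup>+x. ennreal (\<bar>x\<bar> powr p) \<partial>gauss \<delta>))
     \<le> 2 * (ennreal (\<bar>s\<bar> powr p) + ennreal (A * (\<bar>s\<bar> powr p + \<bar>h\<bar> powr p)) * ennreal \<delta>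
      + ennreal (A * \<bar>h\<bar> powr p) * ennreal (\<delta> * gauss_moment p))"
    by (intro mult_left_mono add_left_mono gauss_moment_scale[OF p \<delta>]) auto
  also have "\<dots> = 2 * (ennreal (1 + A * \<delta>) * ennreal (\<bar>s\<bar> powr p) + ennreal (A * (1 + gauss_moment p) * \<delta>) * ennreal (\<bar>h\<bar> powr p))"
  proof -
    have "\<bar>s\<bar> powr p + A * (\<bar>s\<bar> powr p + \<bar>h\<bar> powr p) * \<delta> + A * \<bar>h\<bar> powr p * (\<delta> * gauss_moment p)
      = (1 + A * \<delta>) * \<bar>s\<bar> powr p + A * (1 + gauss_moment p) * \<delta> * \<bar>h\<bar> powr p" by (simp add: algebra_simps)
    moreover have "ennreal (\<bar>s\<bar> powr p) + ennreal (A * (\<bar>s\<bar> powr p + \<bar>h\<bar> powr p)) * ennreal \<delta> + ennreal (A * \<bar>h\<bar> powr p) * ennreal (\<delta> * gauss_moment p)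
      = ennreal (\<bar>s\<bar> powr p + A * (\<bar>s\<bar> powr p + \<bar>h\<bar> powr p) * \<delta> + A * \<bar>h\<bar> powr p * (\<delta> * gauss_moment p))"
      using A0 \<delta> gm by (simp add: ennreal_mult)
    moreover have "ennreal (1 + A * \<delta>) * ennreal (\<bar>s\<bar> powr p) + ennreal (A * (1 + gauss_moment p) * \<delta>) * ennreal (\<bar>h\<bar> powr p)
      = ennreal ((1 + A * \<delta>) * \<bar>s\<bar> powr p + A * (1 + gauss_moment p) * \<delta> * \<bar>h\<bar> powr p)"
      using A0 \<delta> gm by (simp add: ennreal_mult)
    ultimately show ?thesis by simp
  qed
  finally show ?thesis by (subst (asm) ennreal_mult_le_mult_iff) auto
qed

context markov_chain
begin

lemma walk_moment:
  assumes W: "brownian_motion M F W" and p: "2 \<le> p" and \<delta>: "0 \<le> \<delta>" "\<delta> \<le> 1" and \<beta>: "0 \<le> \<beta>"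
    and f: "\<And>k. k < n \<Longrightarrow> (\<integral>\<^sup>+w. ennreal (\<bar>f (Z (real k * \<delta>) w)\<bar> powr p) \<partial>M) \<le> ennreal \<beta>"
  defines "A \<equiv> exp (p\<^sup>2) + 2 powr p"
  shows "(\<integral>\<^sup>+w. ennreal (\<bar>walk W \<delta> f n w\<bar> powr p) \<partial>M)
    \<le> ennreal (exp (A * (real n * \<delta>)) * (A * (1 + gauss_moment p) * \<beta> * (real n * \<delta>)))"
proof -
  define K where "K = A * (1 + gauss_moment p) * \<beta>"
  have A0: "0 \<le> A" by (simp add: A_def)
  have gm: "0 \<le> gauss_moment p" by (simp add: gauss_moment_def)
  have K0: "0 \<le> K" using A0 gm \<beta> by (simp add: K_def)
  have "(\<integral>\<^sup>+w. ennreal (\<bar>walk W \<delta> f k w\<bar> powr p) \<partial>M) \<le> ennreal (exp (A * (real k * \<delta>)) * (K * (real k * \<delta>)))" if "k \<le> n" for k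
    using that
  proof (induction k)
    case 0 then show ?case by (simp add: walk_def)
  next
    case (Suc k)
    have q: "0 \<le> real k * \<delta>" "real k * \<delta> \<le> real (Suc k) * \<delta>" using \<delta> by (auto intro!: mult_right_mono)
    interpret Fk: subalgebra_prob M "F (real k * \<delta>)" by (rule subalgebra_prob_F[OF q(1)])
    have wm[measurable]: "walk W \<delta> f k \<in> borel_measurable (F (real k * \<delta>))" by (rule walk_measurable[OF W \<delta>(1)]) simp
    have fm[measurable]: "(\<lambda>w. f (Z (real k * \<delta>) w)) \<in> borel_measurable (F (real k * \<delta>))" by (rule Z_measurable) (use q in auto)
    have [measurable]: "walk W \<delta> f k \<in> borel_measurable M" "(\<lambda>w. f (Z (real k * \<delta>) w)) \<in> borel_measurable M"
      by (rule Fk.measurable_G, measurable)+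
    have N: "indep_gauss M (F (real k * \<delta>)) (\<lambda>w. W (real (Suc k) * \<delta>) w - W (real k * \<delta>) w) \<delta>"
      using bm_increment[OF W q] by (simp add: distrib_right)
    have "(\<integral>\<^sup>+w. ennreal (\<bar>walk W \<delta> f (Suc k) w\<bar> powr p) \<partial>M)
      = (\<integral>\<^sup>+w. ennreal (\<bar>walk W \<delta> f k w + f (Z (real k * \<delta>) w) * (W (real (Suc k) * \<delta>) w - W (real k * \<delta>) w)\<bar> powr p) \<partial>M)"
      by (simp add: walk_def)
    also have "\<dots> = (\<integral>\<^sup>+w. \<integral>\<^sup>+x. ennreal (\<bar>walk W \<delta> f k w + f (Z (real k * \<delta>) w) * x\<bar> powr p) \<partial>gauss \<delta> \<partial>M)"
      by (rule Fk.indep_gauss_nn_integral[where H="\<lambda>w x. ennreal (\<bar>walk W \<delta> f k w + f (Z (real k * \<delta>) w) * x\<bar> powr p)", OF N]) measurable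
    also have "\<dots> \<le> (\<integral>\<^sup>+w. ennreal (1 + A * \<delta>) * ennreal (\<bar>walk W \<delta> f k w\<bar> powr p)
        + ennreal (A * (1 + gauss_moment p) * \<delta>) * ennreal (\<bar>f (Z (real k * \<delta>) w)\<bar> powr p) \<partial>M)"
      unfolding A_def by (intro nn_integral_mono gauss_power_step p \<delta>)
    also have "\<dots> = ennreal (1 + A * \<delta>) * (\<integral>\<^sup>+w. ennreal (\<bar>walk W \<delta> f k w\<bar> powr p) \<partial>M)
        + ennreal (A * (1 + gauss_moment p) * \<delta>) * (\<integral>\<^sup>+w. ennreal (\<bar>f (Z (real k * \<delta>) w)\<bar> powr p) \<partial>M)"
      by (simp add: nn_integral_add nn_integral_cmult)
    also have "\<dots> \<le> ennreal (1 + A * \<delta>) * ennreal (exp (A * (real k * \<delta>)) * (K * (real k * \<delta>)))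
        + ennreal (A * (1 + gauss_moment p) * \<delta>) * ennreal \<beta>"
      using Suc f[of k] by (intro add_mono mult_left_mono) auto
    also have "\<dots> = ennreal ((1 + A * \<delta>) * (exp (A * (real k * \<delta>)) * (K * (real k * \<delta>))) + K * \<delta>)"
      using A0 \<delta> gm \<beta> K0 by (simp add: ennreal_mult K_def mult_ac)
    also have "\<dots> \<le> ennreal (exp (A * (real (Suc k) * \<delta>)) * (K * (real (Suc k) * \<delta>)))"
    proof (rule ennreal_leI)
      have "(1 + A * \<delta>) * exp (A * (real k * \<delta>)) \<le> exp (A * \<delta>) * exp (A * (real k * \<delta>))"
        by (intro mult_right_mono) auto
      also have "\<dots> = exp (A * (real (Suc k) * \<delta>))" by (simp add: exp_add[symmetric] algebra_simps)
      finally have "(1 + A * \<delta>) * exp (A * (real k * \<delta>)) * (K * (real k * \<delta>)) \<le> exp (A * (real (Suc k) * \<delta>)) * (K * (real k * \<delta>))"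
        using K0 \<delta> by (intro mult_right_mono) auto
      moreover have "1 * (K * \<delta>) \<le> exp (A * (real (Suc k) * \<delta>)) * (K * \<delta>)"
        using K0 \<delta> A0 by (intro mult_right_mono) auto
      ultimately show "(1 + A * \<delta>) * (exp (A * (real k * \<delta>)) * (K * (real k * \<delta>))) + K * \<delta> \<le> exp (A * (real (Suc k) * \<delta>)) * (K * (real (Suc k) * \<delta>))"
        by (simp add: algebra_simps)
    qed
    finally show ?case .
  qed
  from this[of n] show ?thesis by (simp add: K_def)
qed

text \<open>By the Feller property at time 0 the chain is found at its starting point after a short time with
  probability at least one half; \<open>n\<close> such steps in succession reach any time in \<open>[0, T]\<close>.\<close>

lemma return_probability:
  assumes T: "0 < T"
  shows "\<exists>d>0. \<forall>u. 0 \<le> u \<longrightarrow> u \<le> T \<longrightarrow> d \<le> pmf (P u z0) z0"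
proof -
  let ?f = "indicator {z0} :: real ^ 'd \<Rightarrow> real"
  have "?f \<in> C0_on E"
    unfolding C0_on_def
  proof (intro CollectI conjI allI impI)
    show "continuous_on E ?f" by (rule continuous_on_discrete[OF discrete_E])
    fix \<epsilon> :: real assume "0 < \<epsilon>"
    then show "\<exists>K\<subseteq>E. compact K \<and> (\<forall>z\<in>E - K. \<bar>?f z\<bar> < \<epsilon>)"
      using z0_E by (intro exI[of _ "{z0}"]) auto
  qed
  then have ul: "uniform_limit E (\<lambda>t. semigroup_op P t ?f) ?f (at_right 0)" using feller by (auto simp: feller_def)
  have "\<forall>\<^sub>F t in at_right 0. \<forall>z\<in>E. dist (semigroup_op P t ?f z) (?f z) < 1/2"
    using uniform_limitD[OF ul, of "1/2"] by simp
  then obtain b where b: "0 < b" "\<And>t z. 0 < t \<Longrightarrow> t < b \<Longrightarrow> z \<in> E \<Longrightarrow> dist (semigroup_op P t ?f z) (?f z) < 1/2"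
    by (auto simp: eventually_at_right_field)
  have op: "semigroup_op P t ?f z0 = pmf (P t z0) z0" for t by (simp add: semigroup_op_def pmf.rep_eq)
  have small: "1/2 \<le> pmf (P t z0) z0" if "0 \<le> t" "t < b" for t
  proof (cases "t = 0")
    case True
    then show ?thesis using transition z0_E by (simp add: transition_function_def)
  next
    case False
    then have "dist (semigroup_op P t ?f z0) (?f z0) < 1/2" using that z0_E by (intro b) auto
    then show ?thesis unfolding op by (simp add: dist_real_def abs_if split: if_splits)
  qed
  have mult: "pmf (P s z0) z0 * pmf (P t z0) z0 \<le> pmf (P (s + t) z0) z0" if "0 \<le> s" "0 \<le> t" for s t
  proof -
    have "P (s + t) z0 = bind_pmf (P s z0) (P t)" using transition z0_E that by (simp add: transition_function_def)
    then have "pmf (P (s + t) z0) z0 = measure_pmf.expectation (P s z0) (\<lambda>y. pmf (P t y) z0)" by (simp add: pmf_bind)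
    also have "\<dots> \<ge> measure_pmf.expectation (P s z0) (\<lambda>y. indicator {z0} y * pmf (P t z0) z0)"
      by (rule integral_mono) (auto intro!: measure_pmf.integrable_const_bound[of _ 1] simp: pmf_le_1 split: split_indicator)
    also have "measure_pmf.expectation (P s z0) (\<lambda>y. indicator {z0} y * pmf (P t z0) z0) = pmf (P s z0) z0 * pmf (P t z0) z0"
      by (simp add: pmf.rep_eq)
    finally show ?thesis .
  qed
  obtain n :: nat where n: "T / b < real n" using reals_Archimedean2 by blast
  then have n0: "0 < n" using T b(1) by (cases n) (auto simp: divide_less_0_iff)
  have "(1/2) ^ n \<le> pmf (P u z0) z0" if u: "0 \<le> u" "u \<le> T" for u
  proof -
    define v where "v = u / real n"
    have v: "0 \<le> v" using u by (simp add: v_def)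
    have "u < b * real n" using n u b(1) by (simp add: pos_divide_less_eq mult.commute)
    then have vb: "v < b" using n0 by (simp add: v_def pos_divide_less_eq)
    have "(1/2) ^ k \<le> pmf (P (real k * v) z0) z0" for k
    proof (induction k)
      case 0 then show ?case using transition z0_E by (simp add: transition_function_def)
    next
      case (Suc k)
      have "(1/2) * (1/2) ^ k \<le> pmf (P v z0) z0 * pmf (P (real k * v) z0) z0"
        using Suc small[OF v vb] by (intro mult_mono) auto
      also have "\<dots> \<le> pmf (P (v + real k * v) z0) z0" using v by (intro mult) auto
      finally show ?case by (simp add: distrib_right)
    qed
    from this[of n] show ?thesis using n0 by (simp add: v_def)
  qed
  then show ?thesis by (intro exI[of _ "(1/2) ^ n"]) simp
qed

text \<open>Being at \<open>z0\<close> at time \<open>T - s\<close> and running for time \<open>s\<close> is one way to reach time \<open>T\<close>.\<close>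

lemma moments_before:
  assumes T: "0 < T" and fin: "semigroup_op_nn P T h z0 < \<infinity>"
  shows "\<exists>\<beta>\<ge>0. \<forall>s. 0 \<le> s \<longrightarrow> s \<le> T \<longrightarrow> semigroup_op_nn P s h z0 \<le> ennreal \<beta>"
proof -
  obtain d where d: "0 < d" "\<And>u. 0 \<le> u \<Longrightarrow> u \<le> T \<Longrightarrow> d \<le> pmf (P u z0) z0" using return_probability[OF T] by blast
  define \<beta> where "\<beta> = enn2real (semigroup_op_nn P T h z0) / d"
  have "semigroup_op_nn P s h z0 \<le> ennreal \<beta>" if s: "0 \<le> s" "s \<le> T" for s
  proof -
    have "\<forall>s\<ge>0. \<forall>t\<ge>0. \<forall>z\<in>E. P (s + t) z = bind_pmf (P s z) (P t)"
      using transition by (simp add: transition_function_def)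
    from this[rule_format, of "T - s" s z0] have "P ((T - s) + s) z0 = bind_pmf (P (T - s) z0) (P s)"
      using z0_E s by simp
    then have "semigroup_op_nn P T h z0 = (\<integral>\<^sup>+y. semigroup_op_nn P s h y \<partial>measure_pmf (P (T - s) z0))"
      by (simp add: semigroup_op_nn_def)
    also have "\<dots> \<ge> (\<integral>\<^sup>+y. semigroup_op_nn P s h z0 * indicator {z0} y \<partial>measure_pmf (P (T - s) z0))"
      by (intro nn_integral_mono) (auto split: split_indicator)
    also have "(\<integral>\<^sup>+y. semigroup_op_nn P s h z0 * indicator {z0} y \<partial>measure_pmf (P (T - s) z0))
       = semigroup_op_nn P s h z0 * ennreal (pmf (P (T - s) z0) z0)"
      by (simp add: nn_integral_cmult_indicator emeasure_pmf_single)
    finally have le: "semigroup_op_nn P s h z0 * ennreal (pmf (P (T - s) z0) z0) \<le> semigroup_op_nn P T h z0" .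
    have "semigroup_op_nn P s h z0 * ennreal d \<le> semigroup_op_nn P s h z0 * ennreal (pmf (P (T - s) z0) z0)"
      using d(2)[of "T - s"] s by (intro mult_left_mono ennreal_leI) auto
    also note le
    also have "semigroup_op_nn P T h z0 = ennreal (\<beta> * d)" using fin d(1) by (simp add: \<beta>_def less_top)
    also have "\<dots> = ennreal \<beta> * ennreal d" by (rule ennreal_mult) (use d(1) in \<open>auto simp: \<beta>_def\<close>)
    finally show ?thesis using d(1) by (simp add: ennreal_mult_le_mult_iff[of "ennreal d"] mult.commute[of _ "ennreal d"])
  qed
  moreover have "0 \<le> \<beta>" using d(1) by (simp add: \<beta>_def)
  ultimately show ?thesis by blast
qed

text \<open>The moment bound for walks is uniform in the grid and in the truncation; Fatou's lemma along an almost surely convergent subsequence carries it to the integral.\<close>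

lemma ito_moment:
  assumes T: "0 < T" and W: "brownian_motion M F W" and I: "is_ito_integral M F W (\<lambda>s w. \<sigma> (Z s w)) I"
    and p: "2 \<le> p" and fin: "semigroup_op_nn P T (\<lambda>z. \<bar>\<sigma> z\<bar> powr p) z0 < \<infinity>"
  shows "integrable M (\<lambda>w. \<bar>I T w\<bar> powr p)"
proof -
  obtain \<beta> where \<beta>: "0 \<le> \<beta>" "\<And>s. 0 \<le> s \<Longrightarrow> s \<le> T \<Longrightarrow> semigroup_op_nn P s (\<lambda>z. \<bar>\<sigma> z\<bar> powr p) z0 \<le> ennreal \<beta>"
    using moments_before[OF T fin] by blast
  define A where "A = exp (p\<^sup>2) + 2 powr p"
  define bnd where "bnd = exp (A * T) * (A * (1 + gauss_moment p) * \<beta> * T)"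
  have fin2: "mean_int_square M (\<lambda>s w. \<sigma> (Z s w)) T < \<infinity>" using I T by (auto simp: is_ito_integral_def)
  have ex: "\<exists>U. integrable M U \<and> (\<integral>w. \<bar>I T w - U w\<bar> \<partial>M) \<le> 4 * \<epsilon> \<and> integrable M (\<lambda>w. I T w - U w) \<and> (\<integral>\<^sup>+w. ennreal (\<bar>U w\<bar> powr p) \<partial>M) \<le> ennreal bnd"
    if \<epsilon>: "0 < \<epsilon>" for \<epsilon>
  proof -
    have \<eta>: "0 < \<epsilon>\<^sup>2" using \<epsilon> by simp
    have "\<forall>\<^sub>F m in sequentially. mean_int_square M (\<lambda>s w. \<sigma> (Z s w) - \<sigma> (Z s w) * indicator (initial_states m) (Z s w)) T < ennreal (\<epsilon>\<^sup>2)"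
      using order_tendstoD(2)[OF truncation_tendsto[OF fin2], of "ennreal (\<epsilon>\<^sup>2)"] \<eta> by simp
    then obtain j where j: "mean_int_square M (\<lambda>s w. \<sigma> (Z s w) - \<sigma> (Z s w) * indicator (initial_states j) (Z s w)) T < ennreal (\<epsilon>\<^sup>2)"
      by (auto simp: eventually_sequentially)
    define f where "f z = \<sigma> z * indicator (initial_states j) z" for z
    obtain C where f: "\<And>z. \<bar>f z\<bar> \<le> C" using finite_support_bounded[OF finite_initial_states, of j f f] by (auto simp: f_def)
    have cf: "mean_int_square M (\<lambda>s w. \<sigma> (Z s w) - f (Z s w)) T \<le> ennreal (\<epsilon>\<^sup>2)" using j by (simp add: f_def)
    obtain N where N: "T < real N" using reals_Archimedean2 by blast
    have "\<forall>\<^sub>F m in sequentially. (\<integral>\<^sup>+w. ennreal ((I T w - walk W (T / real (Suc m)) f (Suc m) w)\<^sup>2) \<partial>M) \<le> ennreal (16 * \<epsilon>\<^sup>2) \<and> N \<le> m"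
      by (intro eventually_conj walk_approx[OF T W I f \<eta> cf] eventually_ge_at_top)
    then obtain m where m: "(\<integral>\<^sup>+w. ennreal ((I T w - walk W (T / real (Suc m)) f (Suc m) w)\<^sup>2) \<partial>M) \<le> ennreal (16 * \<epsilon>\<^sup>2)" "N \<le> m"
      by (auto simp only: eventually_sequentially)
    define \<delta> where "\<delta> = T / real (Suc m)"
    have \<delta>: "0 \<le> \<delta>" "\<delta> \<le> 1" using T N m(2) by (auto simp: \<delta>_def)
    have n\<delta>: "real (Suc m) * \<delta> = T" by (simp add: \<delta>_def)
    define U where "U = walk W \<delta> f (Suc m)"
    have Ui: "integrable M U" unfolding U_def by (rule walk_integrable[OF W \<delta>(1) f])
    have meas: "(\<lambda>w. I T w - U w) \<in> borel_measurable M" using ito_measurable[OF I, of T] T Ui by auto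
    have le: "(\<integral>\<^sup>+w. ennreal ((I T w - U w)\<^sup>2) \<partial>M) \<le> ennreal (16 * \<epsilon>\<^sup>2)" using m(1) by (simp add: U_def \<delta>_def)
    have s: "sqrt (16 * \<epsilon>\<^sup>2) = 4 * \<epsilon>" using \<epsilon> by (simp add: real_sqrt_mult)
    have fb: "(\<integral>\<^sup>+w. ennreal (\<bar>f (Z (real k * \<delta>) w)\<bar> powr p) \<partial>M) \<le> ennreal \<beta>" if "k < Suc m" for k
    proof -
      have k: "0 \<le> real k * \<delta>" "real k * \<delta> \<le> T"
        using mult_right_mono[of "real k" "real (Suc m)" \<delta>] that \<delta> n\<delta> by auto
      have "(\<integral>\<^sup>+w. ennreal (\<bar>f (Z (real k * \<delta>) w)\<bar> powr p) \<partial>M) \<le> (\<integral>\<^sup>+w. ennreal (\<bar>\<sigma> (Z (real k * \<delta>) w)\<bar> powr p) \<partial>M)"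
        using p by (intro nn_integral_mono ennreal_leI powr_mono2) (auto simp: f_def split: split_indicator)
      also have "\<dots> = semigroup_op_nn P (real k * \<delta>) (\<lambda>z. \<bar>\<sigma> z\<bar> powr p) z0" by (rule Z_nn_integral[OF k(1)])
      also have "\<dots> \<le> ennreal \<beta>" by (rule \<beta>(2)[OF k])
      finally show ?thesis .
    qed
    have "(\<integral>\<^sup>+w. ennreal (\<bar>U w\<bar> powr p) \<partial>M) \<le> ennreal bnd"
      using walk_moment[where n="Suc m" and f=f, OF W p \<delta> \<beta>(1) fb] unfolding U_def bnd_def A_def n\<delta> .
    then show ?thesis
      using Ui L1_from_L2[OF meas le] s by (intro exI[of _ U]) auto
  qed
  have "\<forall>n::nat. \<exists>U. integrable M U \<and> (\<integral>w. \<bar>I T w - U w\<bar> \<partial>M) \<le> 4 * (1 / real (Suc n)) \<and> integrable M (\<lambda>w. I T w - U w) \<and> (\<integral>\<^sup>+w. ennreal (\<bar>U w\<bar> powr p) \<partial>M) \<le> ennreal bnd"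
    by (intro allI ex) simp
  from choice[OF this] obtain U where U: "\<And>n. integrable M (U n)" "\<And>n. (\<integral>w. \<bar>I T w - U n w\<bar> \<partial>M) \<le> 4 * (1 / real (Suc n))"
    "\<And>n. integrable M (\<lambda>w. I T w - U n w)" "\<And>n. (\<integral>\<^sup>+w. ennreal (\<bar>U n w\<bar> powr p) \<partial>M) \<le> ennreal bnd"
    by blast
  have "(\<lambda>n. \<integral>w. norm (I T w - U n w) \<partial>M) \<longlonglongrightarrow> 0"
  proof (rule tendsto_sandwich[of "\<lambda>_. 0" _ _ "\<lambda>n. 4 * (1 / real (Suc n))"])
    have "(\<lambda>n. 4 * inverse (real (Suc n))) \<longlonglongrightarrow> 4 * 0" by (intro tendsto_intros LIMSEQ_inverse_real_of_nat)
    then show "(\<lambda>n. 4 * (1 / real (Suc n))) \<longlonglongrightarrow> 0" by (simp add: inverse_eq_divide)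
  qed (use U(2) in auto)
  from tendsto_L1_AE_subseq[OF U(3) this] obtain r where r: "strict_mono r" "AE w in M. (\<lambda>n. I T w - U (r n) w) \<longlonglongrightarrow> 0" by blast
  have Im: "I T \<in> borel_measurable M" using ito_measurable[OF I, of T] T by simp
  have [measurable]: "U n \<in> borel_measurable M" for n using U(1) by auto
  have "(\<integral>\<^sup>+w. ennreal (\<bar>I T w\<bar> powr p) \<partial>M) = (\<integral>\<^sup>+w. liminf (\<lambda>n. ennreal (\<bar>U (r n) w\<bar> powr p)) \<partial>M)"
  proof (rule nn_integral_cong_AE)
    show "AE w in M. ennreal (\<bar>I T w\<bar> powr p) = liminf (\<lambda>n. ennreal (\<bar>U (r n) w\<bar> powr p))"
      using r(2)
    proof eventually_elim
      case (elim w)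
      have "(\<lambda>n. I T w - (I T w - U (r n) w)) \<longlonglongrightarrow> I T w - 0" by (intro tendsto_intros elim)
      then have "(\<lambda>n. U (r n) w) \<longlonglongrightarrow> I T w" by simp
      then have "(\<lambda>n. ennreal (\<bar>U (r n) w\<bar> powr p)) \<longlonglongrightarrow> ennreal (\<bar>I T w\<bar> powr p)"
        using p by (intro tendsto_ennrealI tendsto_powr2 tendsto_rabs tendsto_const) auto
      then show ?case by (intro lim_imp_Liminf[symmetric]) auto
    qed
  qed
  also have "\<dots> \<le> liminf (\<lambda>n. \<integral>\<^sup>+w. ennreal (\<bar>U (r n) w\<bar> powr p) \<partial>M)" by (rule nn_integral_liminf) simp
  also have "\<dots> \<le> liminf (\<lambda>n. ennreal bnd)" by (intro Liminf_mono always_eventually allI U(4))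
  also have "\<dots> = ennreal bnd" by (simp add: Liminf_const)
  finally have "(\<integral>\<^sup>+w. ennreal (\<bar>I T w\<bar> powr p) \<partial>M) < \<infinity>" by (rule le_less_trans) simp
  then show ?thesis using Im by (intro integrableI_bounded) auto
qed

end

section \<open>Approximation of convex functions by Lipschitz convex functions\<close>

text \<open>The supremum of the tangents touching at points of \<open>[-m, m]\<close>. It is convex, Lipschitz because the slopes
  are monotone, agrees with \<open>\<phi>\<close> on \<open>[-m, m]\<close>, and lies between the tangent at 0 and \<open>\<phi>\<close>.\<close>

lemma convex_lipschitz_approximation:
  fixes \<phi> :: "real \<Rightarrow> real"
  assumes "convex_on UNIV \<phi>"
  obtains \<psi> :: "nat \<Rightarrow> real \<Rightarrow> real" and L c where
    "\<And>m. lipschitz_convex (\<psi> m) (L m)"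
    "\<And>m x. \<bar>x\<bar> \<le> real m \<Longrightarrow> \<psi> m x = \<phi> x"
    "\<And>m x. \<bar>\<psi> m x\<bar> \<le> \<bar>\<phi> x\<bar> + \<bar>\<phi> 0\<bar> + \<bar>c\<bar> * \<bar>x\<bar>"
proof -
  define d where "d y = Inf ((\<lambda>t. (\<phi> y - \<phi> t) / (y - t)) ` ({y<..} \<inter> UNIV))" for y
  have tan: "\<phi> y + d y * (x - y) \<le> \<phi> x" for x y
    using convex_le_Inf_differential[OF assms, of y x] by (simp add: d_def)
  have d_mono: "d x \<le> d y" if "x < y" for x y
  proof -
    have "d x * (y - x) \<le> d y * (y - x)" using tan[of x y] tan[of y x] by (simp add: algebra_simps)
    then show ?thesis using that by simp
  qed
  define \<psi> where "\<psi> m x = (SUP y\<in>{- real m..real m}. \<phi> y + d y * (x - y))" for m x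
  define L where "L m = \<bar>d (- real m)\<bar> + \<bar>d (real m)\<bar>" for m
  have ne: "{- real m..real m} \<noteq> {}" for m by simp
  have bdd: "bdd_above ((\<lambda>y. \<phi> y + d y * (x - y)) ` {- real m..real m})" for m x
    using tan by (intro bdd_aboveI2[of _ _ "\<phi> x"])
  have ge: "\<phi> y + d y * (x - y) \<le> \<psi> m x" if "y \<in> {- real m..real m}" for m x y
    unfolding \<psi>_def by (rule cSUP_upper[OF that bdd])
  have le: "\<psi> m x \<le> a" if "\<And>y. y \<in> {- real m..real m} \<Longrightarrow> \<phi> y + d y * (x - y) \<le> a" for m x a
    unfolding \<psi>_def using that by (intro cSUP_least ne)
  have dL: "\<bar>d y\<bar> \<le> L m" if "y \<in> {- real m..real m}" for y m
  proof -
    have "d (- real m) \<le> d y" using that d_mono[of "- real m" y] by (cases "y = - real m") auto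
    moreover have "d y \<le> d (real m)" using that d_mono[of y "real m"] by (cases "y = real m") auto
    ultimately show ?thesis unfolding L_def by linarith
  qed
  show ?thesis
  proof (rule that)
    show "lipschitz_convex (\<psi> m) (L m)" for m
    proof
      show "convex_on UNIV (\<psi> m)"
      proof (rule convex_onI)
        fix t x y :: real assume t: "0 < t" "t < 1"
        show "\<psi> m ((1 - t) *\<^sub>R x + t *\<^sub>R y) \<le> (1 - t) * \<psi> m x + t * \<psi> m y"
        proof (rule le)
          fix z assume z: "z \<in> {- real m..real m}"
          have "\<phi> z + d z * ((1 - t) *\<^sub>R x + t *\<^sub>R y - z) = (1 - t) * (\<phi> z + d z * (x - z)) + t * (\<phi> z + d z * (y - z))"
            by (simp add: algebra_simps)
          also have "\<dots> \<le> (1 - t) * \<psi> m x + t * \<psi> m y"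
            using t by (intro add_mono mult_left_mono ge z) auto
          finally show "\<phi> z + d z * ((1 - t) *\<^sub>R x + t *\<^sub>R y - z) \<le> (1 - t) * \<psi> m x + t * \<psi> m y" .
        qed
      qed simp
      have one: "\<psi> m x \<le> \<psi> m y + L m * \<bar>x - y\<bar>" for x y
      proof (rule le)
        fix z assume z: "z \<in> {- real m..real m}"
        have "\<phi> z + d z * (x - z) = (\<phi> z + d z * (y - z)) + d z * (x - y)" by (simp add: algebra_simps)
        also have "\<dots> \<le> \<psi> m y + L m * \<bar>x - y\<bar>"
        proof (rule add_mono[OF ge[OF z]])
          have "d z * (x - y) \<le> \<bar>d z\<bar> * \<bar>x - y\<bar>" by (simp add: abs_mult[symmetric])
          also have "\<dots> \<le> L m * \<bar>x - y\<bar>" using dL[OF z] by (intro mult_right_mono) auto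
          finally show "d z * (x - y) \<le> L m * \<bar>x - y\<bar>" .
        qed
        finally show "\<phi> z + d z * (x - z) \<le> \<psi> m y + L m * \<bar>x - y\<bar>" .
      qed
      show "\<bar>\<psi> m x - \<psi> m y\<bar> \<le> L m * \<bar>x - y\<bar>" for x y
        using one[of x y] one[of y x] by (simp add: abs_le_iff abs_minus_commute)
    qed
    have up: "\<psi> m x \<le> \<phi> x" for m x by (rule le) (rule tan)
    show "\<psi> m x = \<phi> x" if "\<bar>x\<bar> \<le> real m" for m x
      using up[of m x] ge[of x m x] that by (simp add: abs_le_iff)
    show "\<bar>\<psi> m x\<bar> \<le> \<bar>\<phi> x\<bar> + \<bar>\<phi> 0\<bar> + \<bar>d 0\<bar> * \<bar>x\<bar>" for m x
    proof -
      have "- (\<bar>d 0\<bar> * \<bar>x\<bar>) \<le> d 0 * x" by (simp add: abs_mult[symmetric] abs_ge_minus_self) 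
      moreover have "\<phi> 0 + d 0 * x \<le> \<psi> m x" using ge[of 0 m x] by simp
      moreover have "0 \<le> \<bar>d 0\<bar> * \<bar>x\<bar>" by simp
      ultimately show ?thesis using up[of m x] by linarith
    qed
  qed
qed

lemma (in prob_space) integral_convex_approximation:
  fixes U :: "'a \<Rightarrow> real"
  assumes lc: "\<And>m. lipschitz_convex (\<psi> m) (L m)"
    and eq: "\<And>m x. \<bar>x\<bar> \<le> real m \<Longrightarrow> \<psi> m x = \<phi> x"
    and bd: "\<And>m x. \<bar>\<psi> m x\<bar> \<le> \<bar>\<phi> x\<bar> + \<bar>\<phi> 0\<bar> + \<bar>c\<bar> * \<bar>x\<bar>"
    and U: "integrable M U" and \<phi>U: "integrable M (\<lambda>w. \<phi> (U w))"
  shows "(\<lambda>m. \<integral>w. \<psi> m (U w) \<partial>M) \<longlonglongrightarrow> (\<integral>w. \<phi> (U w) \<partial>M)"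
proof (rule integral_dominated_convergence[where w="\<lambda>w. \<bar>\<phi> (U w)\<bar> + \<bar>\<phi> 0\<bar> + \<bar>c\<bar> * \<bar>U w\<bar>"])
  show "(\<lambda>w. \<phi> (U w)) \<in> borel_measurable M" using \<phi>U by auto
  show "(\<lambda>w. \<psi> m (U w)) \<in> borel_measurable M" for m
    using U by (intro measurable_compose[OF _ lipschitz_convex.measurable_\<phi>[OF lc]]) auto
  show "integrable M (\<lambda>w. \<bar>\<phi> (U w)\<bar> + \<bar>\<phi> 0\<bar> + \<bar>c\<bar> * \<bar>U w\<bar>)" using U \<phi>U by auto
  show "AE w in M. norm (\<psi> m (U w)) \<le> \<bar>\<phi> (U w)\<bar> + \<bar>\<phi> 0\<bar> + \<bar>c\<bar> * \<bar>U w\<bar>" for m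
    using bd by (intro AE_I2) simp
  show "AE w in M. (\<lambda>m. \<psi> m (U w)) \<longlonglongrightarrow> \<phi> (U w)"
  proof (rule AE_I2)
    fix w
    obtain N where N: "\<bar>U w\<bar> \<le> real N" using real_arch_simple by blast
    have "\<psi> m (U w) = \<phi> (U w)" if "N \<le> m" for m using N that by (intro eq) simp
    then show "(\<lambda>m. \<psi> m (U w)) \<longlonglongrightarrow> \<phi> (U w)"
      by (intro tendsto_eventually) (auto simp: eventually_sequentially)
  qed
qed

section \<open>The comparison theorem\<close>

lemma powr_add_le:
  fixes x y z p :: real
  assumes "0 \<le> p"
  shows "\<bar>x + y - z\<bar> powr p \<le> 3 powr p * (\<bar>x\<bar> powr p + \<bar>y\<bar> powr p + \<bar>z\<bar> powr p)"
proof -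
  define m where "m = max \<bar>x\<bar> (max \<bar>y\<bar> \<bar>z\<bar>)"
  have "\<bar>x + y - z\<bar> \<le> 3 * m" unfolding m_def by linarith
  then have "\<bar>x + y - z\<bar> powr p \<le> (3 * m) powr p" using assms by (intro powr_mono2) auto
  also have "\<dots> = 3 powr p * m powr p" by (simp add: powr_mult m_def)
  also have "m powr p \<le> \<bar>x\<bar> powr p + \<bar>y\<bar> powr p + \<bar>z\<bar> powr p" by (auto simp: m_def max_def)
  finally show ?thesis by simp
qed

theorem theorem1p1:
  fixes M :: "'w measure" and F :: "real \<Rightarrow> 'w measure"
    and B VI X :: "('w, real) process"
    and Y :: "('w, real) process \<Rightarrow> ('w, real) process"
    and E :: "(real ^ 'd) set" and P :: "real \<Rightarrow> real ^ 'd \<Rightarrow> (real ^ 'd) pmf"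
    and z0 :: "real ^ 'd" and Z :: "('w, real ^ 'd) process"
    and \<sigma>1 \<sigma>2 :: "real ^ 'd \<Rightarrow> real" and \<phi> :: "real \<Rightarrow> real"
    and a b p T x y c :: real
  assumes "filtered_prob_space M F"
    and "B \<in> brownian_motions M F"
    and "markov_chain_from M F E P z0 Z"
    and "\<forall>z\<in>E. \<bar>\<sigma>1 z\<bar> + \<bar>\<sigma>2 z\<bar> > 0"
    and "\<forall>t>0. (\<integral>\<^sup>+w. (\<integral>\<^sup>+s\<in>{0..t}. ennreal ((\<sigma>1 (Z s w))\<^sup>2) \<partial>lborel) \<partial>M) < \<infinity>"
    and "\<forall>t>0. (\<integral>\<^sup>+w. (\<integral>\<^sup>+s\<in>{0..t}. ennreal ((\<sigma>2 (Z s w))\<^sup>2) \<partial>lborel) \<partial>M) < \<infinity>"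
    and "convex_on UNIV \<phi>"
    and "a > 0" and "b > 0" and "p \<ge> 2"
    and "\<forall>r. \<bar>\<phi> r\<bar> \<le> a * \<bar>r\<bar> powr p + b"
    and "T > 0"
    and "\<forall>z\<in>E. semigroup_op_nn P T (\<lambda>u. \<bar>\<sigma>1 u\<bar> powr p + \<bar>\<sigma>2 u\<bar> powr p) z < \<infinity>"
    and "is_ito_integral M F B (\<lambda>s w. \<sigma>1 (Z s w)) (\<lambda>t w. X t w - x)"
    and "\<forall>V\<in>brownian_motions M F.
           is_ito_integral M F V (\<lambda>s w. \<sigma>2 (Z s w)) (\<lambda>t w. Y V t w - y)"
    and "c \<in> {1, -1}"
    and "is_ito_integral M F B (\<lambda>s w. sgn_at0 c (\<sigma>1 (Z s w) * \<sigma>2 (Z s w))) VI"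
  shows "VI \<in> brownian_motions M F \<and>
    (\<lambda>t w. - VI t w) \<in> brownian_motions M F \<and>
    (\<forall>V\<in>brownian_motions M F.
       integrable M (\<lambda>w. \<phi> (X T w - Y V T w)) \<and>
       (\<integral>w. \<phi> (X T w - Y VI T w) \<partial>M) \<le> (\<integral>w. \<phi> (X T w - Y V T w) \<partial>M) \<and>
       (\<integral>w. \<phi> (X T w - Y V T w) \<partial>M) \<le> (\<integral>w. \<phi> (X T w - Y (\<lambda>t w. - VI t w) T w) \<partial>M))"
proof -
  note fp = assms(1) and B = assms(2) and chain = assms(3) and convex = assms(7) and p = assms(10)
    and growth = assms(11) and T = assms(12) and moments = assms(13) and X = assms(14) and Y = assms(15)
    and c = assms(16) and VI = assms(17)
  interpret prob_space M using fp by (simp add: filtered_prob_space_def)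
  interpret markov_chain M F E P z0 Z by unfold_locales (rule fp, rule chain)
  define \<kappa> where "\<kappa> z = sgn_at0 c (\<sigma>1 z * \<sigma>2 z)" for z
  have \<kappa>: "(\<kappa> z)\<^sup>2 = 1" "\<kappa> z * (\<sigma>1 z * \<sigma>2 z) = \<bar>\<sigma>1 z * \<sigma>2 z\<bar>" for z
    using c by (auto simp: \<kappa>_def sgn_at0_def)
  have B': "brownian_motion M F B" using B by (simp add: brownian_motions_def)
  have K: "is_ito_integral M F B (\<lambda>s w. \<kappa> (Z s w)) VI" using VI by (simp add: \<kappa>_def)
  have VI': "brownian_motion M F VI" by (rule sign_integral_brownian[OF B' \<kappa>(1) K])
  have VII': "brownian_motion M F (\<lambda>t w. - VI t w)" by (rule brownian_minus[OF VI'])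
  have fin1: "semigroup_op_nn P T (\<lambda>u. \<bar>\<sigma>1 u\<bar> powr p) z0 < \<infinity>" and fin2: "semigroup_op_nn P T (\<lambda>u. \<bar>\<sigma>2 u\<bar> powr p) z0 < \<infinity>"
  proof -
    have "semigroup_op_nn P T (\<lambda>u. \<bar>\<sigma>1 u\<bar> powr p) z0 \<le> semigroup_op_nn P T (\<lambda>u. \<bar>\<sigma>1 u\<bar> powr p + \<bar>\<sigma>2 u\<bar> powr p) z0"
      "semigroup_op_nn P T (\<lambda>u. \<bar>\<sigma>2 u\<bar> powr p) z0 \<le> semigroup_op_nn P T (\<lambda>u. \<bar>\<sigma>1 u\<bar> powr p + \<bar>\<sigma>2 u\<bar> powr p) z0"
      unfolding semigroup_op_nn_def by (auto intro!: nn_integral_mono ennreal_leI)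
    then show "semigroup_op_nn P T (\<lambda>u. \<bar>\<sigma>1 u\<bar> powr p) z0 < \<infinity>" "semigroup_op_nn P T (\<lambda>u. \<bar>\<sigma>2 u\<bar> powr p) z0 < \<infinity>"
      using moments z0_E by (auto intro: le_less_trans)
  qed
  define I1 where "I1 t w = X t w - x" for t w
  define I2 where "I2 V t w = Y V t w - y" for V t w
  define r where "r = x - y"
  have eq: "X T w - Y V T w = r + I1 T w - I2 V T w" for V w by (simp add: r_def I1_def I2_def)
  have I1: "is_ito_integral M F B (\<lambda>s w. \<sigma>1 (Z s w)) I1" using X by (simp add: I1_def[abs_def])
  have I2: "is_ito_integral M F V (\<lambda>s w. \<sigma>2 (Z s w)) (I2 V)" if "brownian_motion M F V" for V
    using Y that by (simp add: brownian_motions_def I2_def[abs_def])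
  have T0: "0 \<le> T" using T by simp
  have pw1: "integrable M (\<lambda>w. \<bar>I1 T w\<bar> powr p)" by (rule ito_moment[OF T B' I1 p fin1])
  have pw2: "integrable M (\<lambda>w. \<bar>I2 V T w\<bar> powr p)" if "brownian_motion M F V" for V
    by (rule ito_moment[OF T that I2[OF that] p fin2])
  have m1[measurable]: "I1 T \<in> borel_measurable M" by (rule ito_measurable[OF I1 T0])
  have m2: "I2 V T \<in> borel_measurable M" if "brownian_motion M F V" for V by (rule ito_measurable[OF I2[OF that] T0])
  have \<phi>m[measurable]: "\<phi> \<in> borel_measurable borel"
    using convex_on_continuous[OF open_UNIV convex] by (rule borel_measurable_continuous_onI)
  have absint: "integrable M U" if [measurable]: "U \<in> borel_measurable M" and "integrable M (\<lambda>w. \<bar>U w\<bar> powr p)" for U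
  proof (rule Bochner_Integration.integrable_bound)
    show "integrable M (\<lambda>w. 1 + \<bar>U w\<bar> powr p)" using that by auto
    show "AE w in M. norm (U w) \<le> norm (1 + \<bar>U w\<bar> powr p)"
    proof (rule AE_I2)
      fix w
      have "\<bar>U w\<bar> \<le> 1 + \<bar>U w\<bar> powr p"
      proof (cases "\<bar>U w\<bar> \<le> 1")
        case False
        then have "\<bar>U w\<bar> powr 1 \<le> \<bar>U w\<bar> powr p" using p by (intro powr_mono) auto
        then show ?thesis using False by simp
      qed (simp add: add_increasing2)
      then show "norm (U w) \<le> norm (1 + \<bar>U w\<bar> powr p)" by simp
    qed
  qed simp
  have Ui: "integrable M (\<lambda>w. r + I1 T w - I2 V T w)" if V: "brownian_motion M F V" for V
    using absint[OF m1 pw1] absint[OF m2[OF V] pw2[OF V]] by auto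
  have \<phi>i: "integrable M (\<lambda>w. \<phi> (r + I1 T w - I2 V T w))" if V: "brownian_motion M F V" for V
  proof (rule Bochner_Integration.integrable_bound)
    show "integrable M (\<lambda>w. a * (3 powr p * (\<bar>r\<bar> powr p + \<bar>I1 T w\<bar> powr p + \<bar>I2 V T w\<bar> powr p)) + b)"
      using pw1 pw2[OF V] by auto
    show "(\<lambda>w. \<phi> (r + I1 T w - I2 V T w)) \<in> borel_measurable M" using m2[OF V] by measurable
    show "AE w in M. norm (\<phi> (r + I1 T w - I2 V T w)) \<le> norm (a * (3 powr p * (\<bar>r\<bar> powr p + \<bar>I1 T w\<bar> powr p + \<bar>I2 V T w\<bar> powr p)) + b)"
    proof (rule AE_I2)
      fix w
      have "\<bar>\<phi> (r + I1 T w - I2 V T w)\<bar> \<le> a * \<bar>r + I1 T w - I2 V T w\<bar> powr p + b" using growth by blast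
      also have "\<dots> \<le> a * (3 powr p * (\<bar>r\<bar> powr p + \<bar>I1 T w\<bar> powr p + \<bar>I2 V T w\<bar> powr p)) + b"
        using p assms(8) by (intro add_right_mono mult_left_mono powr_add_le) auto
      finally show "norm (\<phi> (r + I1 T w - I2 V T w)) \<le> norm (a * (3 powr p * (\<bar>r\<bar> powr p + \<bar>I1 T w\<bar> powr p + \<bar>I2 V T w\<bar> powr p)) + b)"
        by simp
    qed
  qed
  obtain \<psi> :: "nat \<Rightarrow> real \<Rightarrow> real" and L d where \<psi>: "\<And>m. lipschitz_convex (\<psi> m) (L m)"
    "\<And>m x. \<bar>x\<bar> \<le> real m \<Longrightarrow> \<psi> m x = \<phi> x" "\<And>m x. \<bar>\<psi> m x\<bar> \<le> \<bar>\<phi> x\<bar> + \<bar>\<phi> 0\<bar> + \<bar>d\<bar> * \<bar>x\<bar>"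
    by (rule convex_lipschitz_approximation[OF convex]) blast
  have lim: "(\<lambda>m. \<integral>w. \<psi> m (r + I1 T w - I2 V T w) \<partial>M) \<longlonglongrightarrow> (\<integral>w. \<phi> (r + I1 T w - I2 V T w) \<partial>M)"
    if V: "brownian_motion M F V" for V
    by (rule integral_convex_approximation[OF \<psi> Ui[OF V] \<phi>i[OF V]])
  have cmp: "(\<integral>w. \<phi> (r + I1 T w - I2 VI T w) \<partial>M) \<le> (\<integral>w. \<phi> (r + I1 T w - I2 V T w) \<partial>M)"
    "(\<integral>w. \<phi> (r + I1 T w - I2 V T w) \<partial>M) \<le> (\<integral>w. \<phi> (r + I1 T w - I2 (\<lambda>t w. - VI t w) T w) \<partial>M)"
    if V: "brownian_motion M F V" for V
  proof -
    note lip = lipschitz_comparison[OF \<psi>(1) T B' V \<kappa> K I1 I2[OF V] I2[OF VI'] I2[OF VII'], where ?r0.0=r]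
    show "(\<integral>w. \<phi> (r + I1 T w - I2 VI T w) \<partial>M) \<le> (\<integral>w. \<phi> (r + I1 T w - I2 V T w) \<partial>M)"
      by (rule LIMSEQ_le[OF lim[OF VI'] lim[OF V]]) (use lip(1) in blast)
    show "(\<integral>w. \<phi> (r + I1 T w - I2 V T w) \<partial>M) \<le> (\<integral>w. \<phi> (r + I1 T w - I2 (\<lambda>t w. - VI t w) T w) \<partial>M)"
      by (rule LIMSEQ_le[OF lim[OF V] lim[OF VII']]) (use lip(2) in blast)
  qed
  show ?thesis
    unfolding eq using VI' VII' \<phi>i cmp by (auto simp: brownian_motions_def)
qed

end
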